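(* Let $I\subseteq\mathbb{C}[x_1,\dots,x_n]$ be a (not necessarily homogeneous) ideal and let $I^h\subseteq\mathbb{C}[x_0,\dots,x_n]$ be its homogenization with respect to $x_0$. Let $\tilde{G}=\{g\in\mathrm{GL}_{n+1}(\mathbb{C}): g.I^h\subseteq I^h\}$ with Lie algebra $\tilde{\mathfrak{g}}\subseteq M_{n+1}(\mathbb{C})$, and let $\mathfrak{g}\subseteq\tilde{\mathfrak{g}}$ be the set of all $A\in\tilde{\mathfrak{g}}$ such that $e_0=(1,0,\dots,0)^T\in\mathbb{C}^{n+1}$ is an eigenvector of $A^T$. Then $\mathfrak{g}$ is a Lie subalgebra of $\tilde{\mathfrak{g}}$, and the following procedure correctly decides whether $I$ can be made a prime binomial ideal by an affine-linear change of coordinates. (1) Compute $\mathfrak{g}$. (2) Pick $x\in\mathfrak{g}$ at random and compute $\mathfrak{c}=\ker\big((\mathrm{ad}(x))^{\dim\mathfrak{g}}\big)$, where $\mathrm{ad}(x):\mathfrak g\to\mathfrak g$; repeat until $\mathfrak{c}$ is a Cartan subalgebra of $\mathfrak{g}$. (3) Decompose $\mathfrak{c}=\mathfrak{t}\oplus\mathfrak{n}$, where $\mathfrak{t}$ consists of all diagonalizable elements of $\mathfrak{c}$ and $\mathfrak{n}$ of all nilpotent elements of $\mathfrak{c}$. (4) Compute $S\in H$ such that $S\mathfrak{t}S^{-1}$ consists of diagonal matrices. (5) Return $S$ if $S.I$ is a binomial ideal and prime; otherwise return $\texttt{False}$. That is, if there exists $S'\in H$ such that $S'.I$ is prime and generated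 by binomials, then the procedure returns some $S\in H$ such that $S.I$ is prime and generated by binomials; if no such $S'$ exists, it returns $\texttt{False}$.
   Context: A binomial is a polynomial of the form $x^a-\lambda x^b$ with $\lambda\in\mathbb{C}$ and $a,b$ exponent vectors with nonnegative integer entries (so monomials are binomials). A binomial ideal is an ideal that can be generated by binomials. The group $\mathrm{GL}_{n+1}(\mathbb{C})$ acts on $\mathbb{C}[x_0,\dots,x_n]$ via $(g.f)(x)=f(g^{-1}x)$. For $f\in\mathbb{C}[x_1,\dots,x_n]$, $f^h$ denotes its homogenization with respect to $x_0$, and for $F\in\mathbb{C}[x_0,\dots,x_n]$, $F^d$ denotes its dehomogenization, obtained by setting $x_0=1$. Let $H=\{S\in\mathrm{GL}_{n+1}(\mathbb{C}) : (1,0,\dots,0)\,S=(1,0,\dots,0)\}$, i.e. the invertible matrices with first row $(1,0,\dots,0)$. The group $H$ acts on $\mathbb{C}[x_1,\dots,x_n]$ by $S.f=(S.f^h)^d$; these are exactly the affine-linear changes of coordinates. For an ideal $I$, $S.I=\{S.f:f\in I\}$. The Lie bracket on matrices is $[X,Y]=XY-YX$ and $\mathrm{ad}(x)(y)=[x,y]$. A subalgebra $\mathfrak{c}\subseteq\mathfrak{g}$ is a Cartan subalgebra if (i) there is $m\in\mathbb{N}$ such that for every $x\in\mathfrak{c}$ the map $\mathrm{ad}(x)^m$ on $\mathfrak{c}$ is zero, and (ii) $\mathfrak{c}=\{x\in\mathfrak{g}:[x,\mathfrak{c}]\subseteq\mathfrak{c}\}$. For the Lie algebra of a linear algebraic group,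 a Cartan subalgebra decomposes as in step (3), and $\mathfrak{t}$ is simultaneously diagonalizable. "Diagonalizable" and "nilpotent" refer to elements as matrices. "At random" means drawn, independently at each repetition, from a probability distribution on $\mathfrak{g}$ for which every proper Zariski closed subset has probability zero; the loop in step (2) then ends with probability $1$. Each individual step is assumed to be carried out exactly. *)

theory Defs
  imports
    "HOL-Probability.Probability"
    "HOL-Library.Poly_Mapping"
    "HOL-Algebra.Algebraic_Closure_Type"
begin

section \<open>Polynomial rings over the complex numbers\<close>

text \<open>
  The variables of a polynomial ring are indexed by a type.  With \<open>'n\<close> a finite type of
  cardinality \<open>n\<close>, the ring in \<open>x\<^sub>1, \<dots>, x\<^sub>n\<close> is \<^typ>\<open>(('n \<Rightarrow>\<^sub>0 nat) \<Rightarrow>\<^sub>0 complex)\<close>; the ring in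
  \<open>x\<^sub>0, \<dots>, x\<^sub>n\<close> has variables indexed by \<^typ>\<open>'n option\<close>, where \<^term>\<open>None\<close> is the index \<open>0\<close>.
  Accordingly \<open>(n+1) \<times> (n+1)\<close> matrices have rows and columns indexed by \<^typ>\<open>'n option\<close>.
\<close>

type_synonym 'v cpoly = "('v \<Rightarrow>\<^sub>0 nat) \<Rightarrow>\<^sub>0 complex"

type_synonym 'm cmatrix = "complex ^ 'm ^ 'm"

abbreviation cpoly_ring :: "'v cpoly ring"
  where "cpoly_ring \<equiv> ring_of_type_algebra"

definition pconst :: "complex \<Rightarrow> 'v cpoly"
  where "pconst c = Poly_Mapping.single 0 c"

definition pvar :: "'v \<Rightarrow> 'v cpoly"
  where "pvar i = Poly_Mapping.single (Poly_Mapping.single i 1) 1"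

definition peval :: "(complex \<Rightarrow> 'b) \<Rightarrow> ('v \<Rightarrow> 'b) \<Rightarrow> 'v cpoly \<Rightarrow> 'b::comm_ring_1"
  where "peval \<phi> \<sigma> f =
    (\<Sum>a\<in>Poly_Mapping.keys f. \<phi> (Poly_Mapping.lookup f a) *
      (\<Prod>i\<in>Poly_Mapping.keys a. \<sigma> i ^ Poly_Mapping.lookup a i))"

definition psubst :: "('v \<Rightarrow> 'w cpoly) \<Rightarrow> 'v cpoly \<Rightarrow> 'w cpoly"
  where "psubst = peval pconst"

definition binomials :: "'v cpoly set"
  where "binomials = {Poly_Mapping.single a 1 - Poly_Mapping.single b c | a b c. True}"

definition binomial_ideal :: "'v cpoly set \<Rightarrow> bool"
  where "binomial_ideal J \<longleftrightarrow> (\<exists>B \<subseteq> binomials. J = genideal cpoly_ring B)"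

definition exp_degree :: "('v \<Rightarrow>\<^sub>0 nat) \<Rightarrow> nat"
  where "exp_degree a = (\<Sum>i\<in>Poly_Mapping.keys a. Poly_Mapping.lookup a i)"

definition total_degree :: "'v cpoly \<Rightarrow> nat"
  where "total_degree f = Max (insert 0 (exp_degree ` Poly_Mapping.keys f))"

definition homogenize :: "'n cpoly \<Rightarrow> 'n option cpoly"
  where "homogenize f =
    (\<Sum>a\<in>Poly_Mapping.keys f. pconst (Poly_Mapping.lookup f a) *
      pvar None ^ (total_degree f - exp_degree a) *
      (\<Prod>i\<in>Poly_Mapping.keys a. pvar (Some i) ^ Poly_Mapping.lookup a i))"

definition dehomogenize :: "'n option cpoly \<Rightarrow> 'n cpoly"
  where "dehomogenize = psubst (case_option 1 pvar)"

definition homogenized_ideal :: "'n cpoly set \<Rightarrow> 'n option cpoly set"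
  where "homogenized_ideal I = genideal cpoly_ring (homogenize ` I)"


section \<open>Group actions on polynomials\<close>

definition gl_act :: "'m::finite cmatrix \<Rightarrow> 'm cpoly \<Rightarrow> 'm cpoly"
  where "gl_act g = psubst (\<lambda>i. \<Sum>j\<in>UNIV. pconst (matrix_inv g $ i $ j) * pvar j)"

definition affine_group :: "'n::finite option cmatrix set"
  where "affine_group = {S. invertible S \<and> axis None 1 v* S = axis None 1}"

definition affine_act :: "'n::finite option cmatrix \<Rightarrow> 'n cpoly \<Rightarrow> 'n cpoly"
  where "affine_act S f = dehomogenize (gl_act S (homogenize f))"

definition stabilizer :: "'m::finite cpoly set \<Rightarrow> 'm cmatrix set"
  where "stabilizer J = {g. invertible g \<and> gl_act g ` J \<subseteq> J}"


section \<open>Matrix Lie algebras\<close>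

definition cscale :: "complex \<Rightarrow> 'm::finite cmatrix \<Rightarrow> 'm cmatrix"
  where "cscale c A = (\<chi> i j. c * A $ i $ j)"

interpretation cmat: vector_space cscale
  by unfold_locales (simp_all add: cscale_def vec_eq_iff algebra_simps)

definition bracket :: "'m::finite cmatrix \<Rightarrow> 'm cmatrix \<Rightarrow> 'm cmatrix"
  where "bracket A B = A ** B - B ** A"

definition lie_algebra :: "'m::finite cmatrix set \<Rightarrow> bool"
  where "lie_algebra L \<longleftrightarrow> cmat.subspace L \<and> (\<forall>A\<in>L. \<forall>B\<in>L. bracket A B \<in> L)"

definition lie_subalgebra :: "'m::finite cmatrix set \<Rightarrow> 'm cmatrix set \<Rightarrow> bool"
  where "lie_subalgebra K L \<longleftrightarrow> lie_algebra L \<and> lie_algebra K \<and> K \<subseteq> L"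

definition cartan_subalgebra :: "'m::finite cmatrix set \<Rightarrow> 'm cmatrix set \<Rightarrow> bool"
  where "cartan_subalgebra C L \<longleftrightarrow> lie_subalgebra C L \<and>
    (\<exists>m. \<forall>A\<in>C. \<forall>B\<in>C. (bracket A ^^ m) B = 0) \<and>
    C = {A \<in> L. \<forall>B\<in>C. bracket A B \<in> C}"

text \<open>A polynomial function on matrices is a polynomial in the matrix entries.\<close>

definition mat_eval :: "('m \<times> 'm) cpoly \<Rightarrow> 'm::finite cmatrix \<Rightarrow> complex"
  where "mat_eval p A = peval (\<lambda>c. c) (\<lambda>(i, j). A $ i $ j) p"

text \<open>
  The Lie algebra of a linear algebraic group is its tangent space at the identity: the matrices
  in whose direction the differential at the identity of every polynomial vanishing on the group
  is zero.
\<close>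

definition lie_algebra_of :: "'m::finite cmatrix set \<Rightarrow> 'm cmatrix set"
  where "lie_algebra_of G = {A. \<forall>p. (\<forall>g\<in>G. mat_eval p g = 0) \<longrightarrow>
    ((\<lambda>t. mat_eval p (mat 1 + cscale t A)) has_field_derivative 0) (at 0)}"

definition diagonal_matrix :: "'m::finite cmatrix \<Rightarrow> bool"
  where "diagonal_matrix A \<longleftrightarrow> (\<forall>i j. i \<noteq> j \<longrightarrow> A $ i $ j = 0)"

definition diagonalizable :: "'m::finite cmatrix \<Rightarrow> bool"
  where "diagonalizable A \<longleftrightarrow>
    (\<exists>P :: 'm cmatrix. invertible P \<and> diagonal_matrix (P ** A ** matrix_inv P))"

definition nilpotent :: "'m::finite cmatrix \<Rightarrow> bool"
  where "nilpotent A \<longleftrightarrow> (\<exists>k. ((**) A ^^ k) (mat 1) = 0)"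

definition direct_sum :: "'m::finite cmatrix set \<Rightarrow> 'm cmatrix set \<Rightarrow> 'm cmatrix set \<Rightarrow> bool"
  where "direct_sum C T N \<longleftrightarrow> cmat.subspace T \<and> cmat.subspace N \<and>
    C = {A + B | A B. A \<in> T \<and> B \<in> N} \<and> T \<inter> N = {0}"


section \<open>The procedure\<close>

definition full_lie_algebra :: "'n::finite cpoly set \<Rightarrow> 'n option cmatrix set"
  where "full_lie_algebra I = lie_algebra_of (stabilizer (homogenized_ideal I))"

definition affine_lie_algebra :: "'n::finite cpoly set \<Rightarrow> 'n option cmatrix set"
  where "affine_lie_algebra I =
    {A \<in> full_lie_algebra I. \<exists>c. transpose A *v axis None 1 = c *s axis None 1}"

definition ad_kernel :: "'m::finite cmatrix set \<Rightarrow> 'm cmatrix \<Rightarrow> 'm cmatrix set"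
  where "ad_kernel L A = {B \<in> L. (bracket A ^^ cmat.dim L) B = 0}"

definition prime_binomial_after :: "'n::finite cpoly set \<Rightarrow> 'n option cmatrix \<Rightarrow> bool"
  where "prime_binomial_after I S \<longleftrightarrow>
    primeideal (affine_act S ` I) cpoly_ring \<and> binomial_ideal (affine_act S ` I)"

text \<open>
  \<open>xs\<close> is the sequence of successive random choices \<open>x\<close>; the loop that repeats the choice until
  \<^term>\<open>ad_kernel L x\<close> is a Cartan subalgebra ends at the \<open>k\<close>-th of them.
\<close>

definition loop_ends_at ::
    "'n::finite cpoly set \<Rightarrow> (nat \<Rightarrow> 'n option cmatrix) \<Rightarrow> nat \<Rightarrow> bool"
  where "loop_ends_at I xs k \<longleftrightarrow> (let L = affine_lie_algebra I in
    cartan_subalgebra (ad_kernel L (xs k)) L \<and>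
    (\<forall>j<k. \<not> cartan_subalgebra (ad_kernel L (xs j)) L))"

text \<open>
  After the loop has produced the Cartan subalgebra \<open>C\<close>, the rest of the procedure can return \<open>r\<close>,
  where \<^term>\<open>None\<close> stands for the answer \<open>False\<close>.  This is a relation because any \<open>S\<close> in the
  affine group that diagonalizes \<open>T\<close> may be chosen.
\<close>

definition can_output ::
    "'n::finite cpoly set \<Rightarrow> 'n option cmatrix set \<Rightarrow> 'n option cmatrix option \<Rightarrow> bool"
  where "can_output I C r \<longleftrightarrow> (\<exists>T N S.
    T = {A \<in> C. diagonalizable A} \<and> N = {A \<in> C. nilpotent A} \<and> direct_sum C T N \<and>
    S \<in> affine_group \<and> (\<forall>A\<in>T. diagonal_matrix (S ** A ** matrix_inv S)) \<and>
    r = (if prime_binomial_after I S then Some S else None))"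

definition correct_output :: "'n::finite cpoly set \<Rightarrow> 'n option cmatrix option \<Rightarrow> bool"
  where "correct_output I r \<longleftrightarrow>
    ((\<exists>S'\<in>affine_group. prime_binomial_after I S') \<longrightarrow>
      (\<exists>S\<in>affine_group. r = Some S \<and> prime_binomial_after I S)) \<and>
    ((\<nexists>S'. S' \<in> affine_group \<and> prime_binomial_after I S') \<longrightarrow> r = None)"

definition zariski_closed_in :: "'m::finite cmatrix set \<Rightarrow> 'm cmatrix set \<Rightarrow> bool"
  where "zariski_closed_in L Z \<longleftrightarrow> (\<exists>F. Z = {A \<in> L. \<forall>p\<in>F. mat_eval p A = 0})"

definition generic_distribution :: "'m::finite cmatrix set \<Rightarrow> 'm cmatrix measure \<Rightarrow> bool"
  where "generic_distribution L D \<longleftrightarrow> prob_space D \<and> space D = L \<and>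
    (\<forall>Z. zariski_closed_in L Z \<and> Z \<noteq> L \<longrightarrow> Z \<in> null_sets D)"

end

(* Let J be the homogenization of I and C = ker (ad x)^N the Cartan subalgebra found, with torus T
   of diagonalizable elements, diagonalized by S.  The transform of I by S is binomial as soon as no
   two monomials of equal T-weight are linearly independent modulo the transform of J: its weight
   components are then combinations of binomials.  If S' makes I prime and binomial, the diagonal
   matrices stabilizing the transform of J by S' separate monomials in this sense, because the
   exponent vectors of the binomials span, over the rationals, all differences of exponents of
   proportional monomials (primeness lets one extract roots).  It remains to compare T with this
   torus without conjugacy theorems for Cartan subalgebras.  The differential of the conjugation
   map is onto at x, so all elements near x on the line from x to a generic element a of the
   second torus are conjugate into C.  The number of eigenvalues on J-classes of polynomials of
   bounded degree is detected by a Hankel matrix of traces of powers, which is invariant under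
   conjugation and polynomial in the coordinates; hence C acts with as many eigenvalues as a.
   That ker (ad x)^N is a Cartan subalgebra for generic x follows from the same kind of polynomial
   dependence. *)


theory Submission
  imports Defs "HOL-Complex_Analysis.Complex_Analysis"
begin

section \<open>Locally finite operators: generalized eigenvectors, semisimple parts, generic
  independence, traces on quotients\<close>

section \<open>Linear operators on complex vector spaces\<close>

text \<open>The polynomial ring is infinite dimensional, so the linear algebra is set up for locally
  finite operators. Finite dimension is recovered by truncating at the larger degree of the two
  monomials compared and passing to the quotient by J, which is represented by a
  \<open>frame\<close> of representatives with dual functionals. Traces enter because the number of
  eigenvalues is not itself polynomial in the matrix, whereas singularity of a Hankel matrix of
  power traces is a polynomial condition. Determinants are avoided: \<open>generic_lin_indep\<close>
  supplies the polynomial whose nonvanishing guarantees independence. Any x for which C passes the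
  Cartan test will do, since Fitting's decomposition L = C + [L, x] holds for every x in L and makes
  the differential onto. Two facts about L carry the argument: it contains the semisimple parts of
  its elements, and their exponentials preserve J and the shape of the first row. Both rest on
  describing L by derivations that map J into itself. The identity matrix is among these, so
  monomials of equal weight have equal degree.\<close>

locale complex_space = vector_space scale
  for scale :: "complex \<Rightarrow> 'b::ab_group_add \<Rightarrow> 'b" (infixr \<open>\<triangleright>\<close> 75)
begin

definition linop :: "('b \<Rightarrow> 'b) \<Rightarrow> bool"
  where "linop Z \<longleftrightarrow> (\<forall>u v. Z (u + v) = Z u + Z v) \<and> (\<forall>c u. Z (c \<triangleright> u) = c \<triangleright> Z u)"

definition linfun :: "('b \<Rightarrow> complex) \<Rightarrow> bool"
  where "linfun l \<longleftrightarrow> (\<forall>u v. l (u + v) = l u + l v) \<and> (\<forall>c u. l (c \<triangleright> u) = c * l u)"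

definition shift :: "('b \<Rightarrow> 'b) \<Rightarrow> complex \<Rightarrow> 'b \<Rightarrow> 'b"
  where "shift Z \<mu> v = Z v - \<mu> \<triangleright> v"

definition stable :: "('b \<Rightarrow> 'b) \<Rightarrow> 'b set \<Rightarrow> bool"
  where "stable Z U \<longleftrightarrow> subspace U \<and> (\<forall>u\<in>U. Z u \<in> U)"

definition lin_indep :: "'i set \<Rightarrow> ('i \<Rightarrow> 'b) \<Rightarrow> bool"
  where "lin_indep K u \<longleftrightarrow> (\<forall>c. (\<Sum>i\<in>K. c i \<triangleright> u i) = 0 \<longrightarrow> (\<forall>i\<in>K. c i = 0))"

lemma linop_add: "linop Z \<Longrightarrow> Z (u + v) = Z u + Z v"
  and linop_scale: "linop Z \<Longrightarrow> Z (c \<triangleright> u) = c \<triangleright> Z u"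
  by (auto simp: linop_def)

lemma linfun_add: "linfun l \<Longrightarrow> l (u + v) = l u + l v"
  and linfun_scale: "linfun l \<Longrightarrow> l (c \<triangleright> u) = c * l u"
  by (auto simp: linfun_def)

lemma linop_zero: "linop Z \<Longrightarrow> Z 0 = 0"
  using linop_scale[of Z 0 0] by simp

lemma linfun_zero: "linfun l \<Longrightarrow> l 0 = 0"
  using linfun_scale[of l 0 0] by simp

lemma linop_minus: "linop Z \<Longrightarrow> Z (- u) = - Z u"
  using linop_scale[of Z "-1" u] by simp

lemma linfun_minus: "linfun l \<Longrightarrow> l (- u) = - l u"
  using linfun_scale[of l "-1" u] by simp

lemma linop_diff: "linop Z \<Longrightarrow> Z (u - v) = Z u - Z v"
  using linop_add[of Z u "- v"] linop_minus[of Z v] by simp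

lemma linfun_diff: "linfun l \<Longrightarrow> l (u - v) = l u - l v"
  using linfun_add[of l u "- v"] linfun_minus[of l v] by simp

lemma linop_sum: "linop Z \<Longrightarrow> Z (\<Sum>i\<in>K. u i) = (\<Sum>i\<in>K. Z (u i))"
  by (induction K rule: infinite_finite_induct) (auto simp: linop_zero linop_add)

lemma linfun_sum: "linfun l \<Longrightarrow> l (\<Sum>i\<in>K. u i) = (\<Sum>i\<in>K. l (u i))"
  by (induction K rule: infinite_finite_induct) (auto simp: linfun_zero linfun_add)

lemma linop_id: "linop (\<lambda>v. v)"
  by (simp add: linop_def)

lemma linop_comp: "linop Z \<Longrightarrow> linop Y \<Longrightarrow> linop (\<lambda>v. Z (Y v))"
  by (simp add: linop_def)

lemma linfun_comp: "linfun l \<Longrightarrow> linop Y \<Longrightarrow> linfun (\<lambda>v. l (Y v))"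
  by (simp add: linop_def linfun_def)

lemma linop_funpow: "linop Z \<Longrightarrow> linop (Z ^^ k)"
  by (induction k) (auto simp: linop_def)

lemma linop_plus: "linop Z \<Longrightarrow> linop Y \<Longrightarrow> linop (\<lambda>v. Z v + Y v)"
  by (simp add: linop_def scale_right_distrib algebra_simps)

lemma linop_scaled: "linop Z \<Longrightarrow> linop (\<lambda>v. c \<triangleright> Z v)"
  by (simp add: linop_def scale_right_distrib scale_left_commute)

lemma linop_shift: "linop Z \<Longrightarrow> linop (shift Z \<mu>)"
  by (simp add: linop_def shift_def scale_right_distrib scale_right_diff_distrib
      scale_left_commute algebra_simps)

lemma linop_linear: "linop Z \<longleftrightarrow> Vector_Spaces.linear (\<triangleright>) (\<triangleright>) Z"
  by (simp add: linop_def Vector_Spaces.linear_iff vector_space_axioms)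

lemma linfun_linear: "linfun l \<longleftrightarrow> Vector_Spaces.linear (\<triangleright>) (*) l"
proof -
  have "vector_space ((*) :: complex \<Rightarrow> complex \<Rightarrow> complex)"
    by unfold_locales (auto simp: algebra_simps)
  then show ?thesis
    by (simp add: linfun_def Vector_Spaces.linear_iff vector_space_axioms)
qed

lemma linop_eq_on_span:
  assumes "linop Z" "linop Y" "\<And>b. b \<in> B \<Longrightarrow> Z b = Y b" "v \<in> span B"
  shows "Z v = Y v"
  using assms(4)
  by (induction rule: span_induct_alt)
    (use assms(1-3) in \<open>auto simp: linop_zero linop_add linop_scale\<close>)

lemma linfun_eq_on_span:
  assumes "linfun Z" "linfun Y" "\<And>b. b \<in> B \<Longrightarrow> Z b = Y b" "v \<in> span B"
  shows "Z v = Y v"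
  using assms(4)
  by (induction rule: span_induct_alt)
    (use assms(1-3) in \<open>auto simp: linfun_zero linfun_add linfun_scale\<close>)

lemma stable_shift: "stable Z U \<Longrightarrow> stable (shift Z \<mu>) U"
  by (auto simp: stable_def shift_def intro!: subspace_diff subspace_scale)

lemma stable_funpow: "stable Z U \<Longrightarrow> stable (Z ^^ k) U"
  by (induction k) (auto simp: stable_def)

lemma stable_in: "stable Z U \<Longrightarrow> u \<in> U \<Longrightarrow> Z u \<in> U"
  by (auto simp: stable_def)

lemma stable_zero: "linop Z \<Longrightarrow> stable Z {0}"
  by (auto simp: stable_def linop_zero)

lemma stable_UNIV: "stable Z UNIV"
  by (auto simp: stable_def)

lemma funpow_zero: "linop Z \<Longrightarrow> (Z ^^ k) 0 = 0"
  by (rule linop_zero[OF linop_funpow])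

lemma funpow_eq_zero_mono:
  assumes "linop Z" "(Z ^^ k) v = 0" "k \<le> n"
  shows "(Z ^^ n) v = 0"
proof -
  have "(Z ^^ n) v = (Z ^^ (n - k)) ((Z ^^ k) v)"
    using assms(3) by (metis funpow_add le_add_diff_inverse2 comp_apply)
  then show ?thesis using assms by (simp add: funpow_zero)
qed

lemma commute_funpow:
  assumes "\<And>v. Z (Y v) = Y (Z v)"
  shows "Z ((Y ^^ k) v) = (Y ^^ k) (Z v)"
  by (induction k) (auto simp: assms)

lemma shift_commute:
  assumes "linop Z" "linop Y" "\<And>v. Z (Y v) = Y (Z v)"
  shows "shift Z \<mu> (shift Y \<nu> v) = shift Y \<nu> (shift Z \<mu> v)"
  using assms
  by (simp add: shift_def linop_diff linop_scale scale_right_diff_distrib algebra_simps)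

lemma commute_shift:
  assumes "linop Y" "\<And>v. Z (Y v) = Y (Z v)"
  shows "shift Z \<mu> (Y v) = Y (shift Z \<mu> v)"
  using assms by (simp add: shift_def linop_diff linop_scale)

subsection \<open>Generalized eigenvectors\<close>

text \<open>Modulo U the operator Z - \<nu> is injective on generalized eigenvectors for \<mu>:
  induction puts (Z - \<mu>) w into U, and the two shifts of w differ by (\<mu> - \<nu>) w.\<close>

lemma gen_eigen_cancel_shift:
  assumes Z: "linop Z" and U: "stable Z U" and "\<mu> \<noteq> \<nu>"
    and "(shift Z \<mu> ^^ k) w = 0" "shift Z \<nu> w \<in> U"
  shows "w \<in> U"
  using assms(4,5)
proof (induction k arbitrary: w)
  case 0
  then show ?case using U by (simp add: stable_def subspace_0)
next
  case (Suc k)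
  let ?w = "shift Z \<mu> w"
  have "shift Z \<nu> ?w = shift Z \<mu> (shift Z \<nu> w)"
    by (rule shift_commute[OF Z Z]) simp
  also have "\<dots> \<in> U" by (rule stable_in[OF stable_shift[OF U] Suc.prems(2)])
  finally have "?w \<in> U"
    using Suc.IH[of ?w] Suc.prems(1) by (metis comp_apply funpow_Suc_right)
  then have "shift Z \<nu> w - ?w \<in> U"
    using U Suc.prems(2) by (simp add: stable_def subspace_diff)
  then have "(\<mu> - \<nu>) \<triangleright> w \<in> U" by (simp add: shift_def scale_left_diff_distrib)
  then have "(1 / (\<mu> - \<nu>)) \<triangleright> ((\<mu> - \<nu>) \<triangleright> w) \<in> U"
    using U unfolding stable_def by (blast intro: subspace_scale)
  then show ?case using \<open>\<mu> \<noteq> \<nu>\<close> by simp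
qed

lemma gen_eigen_funpow_shift:
  assumes Z: "linop Z" and "(shift Z \<mu> ^^ k) w = 0"
  shows "(shift Z \<mu> ^^ k) ((shift Z \<nu> ^^ j) w) = 0"
proof -
  have "(shift Z \<mu> ^^ k) ((shift Z \<nu> ^^ j) w) = (shift Z \<nu> ^^ j) ((shift Z \<mu> ^^ k) w)"
    by (intro commute_funpow commute_funpow[symmetric] shift_commute Z) simp
  then show ?thesis using assms by (simp add: funpow_zero linop_shift)
qed

lemma gen_eigen_cancel:
  assumes Z: "linop Z" and U: "stable Z U" and "\<mu> \<noteq> \<nu>"
    and "(shift Z \<mu> ^^ k) w = 0" "(shift Z \<nu> ^^ j) w \<in> U"
  shows "w \<in> U"
  using assms(5)
proof (induction j)
  case (Suc j)
  have "(shift Z \<mu> ^^ k) ((shift Z \<nu> ^^ j) w) = 0"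
    by (rule gen_eigen_funpow_shift[OF Z assms(4)])
  then have "(shift Z \<nu> ^^ j) w \<in> U"
    using gen_eigen_cancel_shift[OF Z U \<open>\<mu> \<noteq> \<nu>\<close>, of k "(shift Z \<nu> ^^ j) w"] Suc.prems by simp
  then show ?case by (rule Suc.IH)
qed simp

text \<open>A power of Z - \<nu> removes one component and keeps the sum in U; the induction
  hypothesis then applies to the remaining shifted components, and \<open>gen_eigen_cancel\<close>
  undoes the shift. With U = {0} this is the independence of generalized eigenspaces.\<close>

lemma gen_eigen_components:
  assumes Z: "linop Z" and U: "stable Z U" and "finite M"
    and "\<And>\<mu>. \<mu> \<in> M \<Longrightarrow> \<exists>k. (shift Z \<mu> ^^ k) (u \<mu>) = 0"
    and "(\<Sum>\<mu>\<in>M. u \<mu>) \<in> U" "\<mu> \<in> M"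
  shows "u \<mu> \<in> U"
  using assms(3-6)
proof (induction M arbitrary: u \<mu> rule: finite_induct)
  case (insert \<nu> M)
  obtain j where j: "(shift Z \<nu> ^^ j) (u \<nu>) = 0" using insert.prems by blast
  have lY: "linop (shift Z \<nu> ^^ j)" by (intro linop_funpow linop_shift Z)
  have "(shift Z \<nu> ^^ j) (\<Sum>\<mu>\<in>insert \<nu> M. u \<mu>) \<in> U"
    by (rule stable_in[OF stable_funpow[OF stable_shift[OF U]] insert.prems(2)])
  then have sum: "(\<Sum>\<mu>\<in>M. (shift Z \<nu> ^^ j) (u \<mu>)) \<in> U"
    using insert.hyps j by (simp add: linop_add[OF lY] linop_sum[OF lY])
  have killed: "\<exists>k. (shift Z \<mu> ^^ k) ((shift Z \<nu> ^^ j) (u \<mu>)) = 0" if "\<mu> \<in> M" for \<mu>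
    using insert.prems(1)[of \<mu>] that gen_eigen_funpow_shift[OF Z] by (metis insertI2)
  have other: "u \<mu> \<in> U" if "\<mu> \<in> M" for \<mu>
  proof -
    have jU: "(shift Z \<nu> ^^ j) (u \<mu>) \<in> U"
      by (rule insert.IH[of "\<lambda>\<mu>. (shift Z \<nu> ^^ j) (u \<mu>)", OF killed sum that])
    have "\<exists>k. (shift Z \<mu> ^^ k) (u \<mu>) = 0"
      by (rule insert.prems(1)[OF insertI2[OF that]])
    then obtain k where k: "(shift Z \<mu> ^^ k) (u \<mu>) = 0" by blast
    have "\<mu> \<noteq> \<nu>" using that insert.hyps by blast
    then show ?thesis using jU k gen_eigen_cancel[OF Z U, of \<mu> \<nu> k "u \<mu>" j] by simp
  qed
  have "(\<Sum>\<mu>\<in>insert \<nu> M. u \<mu>) - (\<Sum>\<mu>\<in>M. u \<mu>) \<in> U"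
    using U insert.prems(2) other by (auto simp: stable_def intro!: subspace_diff subspace_sum)
  then have "u \<nu> \<in> U" using insert.hyps by simp
  then show ?case using other insert.prems by blast
qed simp

text \<open>Z - \<mu> is invertible on generalized eigenvectors for \<nu>, even inside U: if w
  solves the equation for (Z - \<nu>) u, then u - w, rescaled by 1 / (\<nu> - \<mu>), solves it for
  u.\<close>

lemma gen_eigen_solve:
  assumes Z: "linop Z" and U: "stable Z U" and "\<mu> \<noteq> \<nu>"
    and "(shift Z \<nu> ^^ k) u = 0" "u \<in> U"
  shows "\<exists>w\<in>U. shift Z \<mu> w = u"
  using assms(4,5)
proof (induction k arbitrary: u)
  case 0
  then show ?case by (auto intro!: bexI[of _ 0] simp: shift_def linop_zero[OF Z])
next
  case (Suc k)
  have "shift Z \<nu> u \<in> U" by (rule stable_in[OF stable_shift[OF U] Suc.prems(2)])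
  then obtain w where w: "w \<in> U" "shift Z \<mu> w = shift Z \<nu> u"
    using Suc.IH[of "shift Z \<nu> u"] Suc.prems(1) by (metis comp_apply funpow_Suc_right)
  let ?w = "(1 / (\<nu> - \<mu>)) \<triangleright> (u - w)"
  have "?w \<in> U" using U w Suc.prems by (auto simp: stable_def intro!: subspace_scale subspace_diff)
  moreover have "shift Z \<mu> ?w = (1 / (\<nu> - \<mu>)) \<triangleright> (shift Z \<mu> u - shift Z \<mu> w)"
    using linop_shift[OF Z] by (simp add: linop_scale linop_diff)
  moreover have "shift Z \<mu> u - shift Z \<mu> w = (\<nu> - \<mu>) \<triangleright> u"
    unfolding w(2) by (simp add: shift_def scale_left_diff_distrib)
  ultimately show ?case using \<open>\<mu> \<noteq> \<nu>\<close> by (intro bexI[of _ ?w]) auto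
qed

text \<open>A condition on single vectors, in place of finite dimension of the space.\<close>

definition gen_eigen_decomposable :: "('b \<Rightarrow> 'b) \<Rightarrow> 'b \<Rightarrow> bool"
  where "gen_eigen_decomposable Z v \<longleftrightarrow>
    (\<exists>M u. finite M \<and> (\<forall>\<mu>\<in>M. \<exists>k. (shift Z \<mu> ^^ k) (u \<mu>) = 0) \<and> v = (\<Sum>\<mu>\<in>M. u \<mu>))"

text \<open>Decompositions can only be added over a common index set, so a given finite set N is
  adjoined and the missing components become 0.\<close>

lemma gen_eigen_decomposable_extend:
  assumes "gen_eigen_decomposable Z v" and N: "finite N"
  obtains M u where "finite M" "N \<subseteq> M" "\<And>\<mu>. \<exists>k. (shift Z \<mu> ^^ k) (u \<mu>) = 0"
    "\<And>\<mu>. \<mu> \<notin> M \<Longrightarrow> u \<mu> = 0" "v = (\<Sum>\<mu>\<in>M. u \<mu>)"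
proof -
  obtain M u where M: "finite M" "\<forall>\<mu>\<in>M. \<exists>k. (shift Z \<mu> ^^ k) (u \<mu>) = 0" "v = (\<Sum>\<mu>\<in>M. u \<mu>)"
    using assms(1) unfolding gen_eigen_decomposable_def by blast
  let ?u = "\<lambda>\<mu>. if \<mu> \<in> M then u \<mu> else 0"
  have "(shift Z \<mu> ^^ 0) 0 = 0" for \<mu> by simp
  then have "\<exists>k. (shift Z \<mu> ^^ k) 0 = 0" for \<mu> by blast
  then have k: "\<exists>k. (shift Z \<mu> ^^ k) (?u \<mu>) = 0" for \<mu> using M(2) by (cases "\<mu> \<in> M") auto
  have "v = (\<Sum>\<mu>\<in>M \<union> N. ?u \<mu>)"
    unfolding M(3) using M(1) N by (intro sum.mono_neutral_cong_left) auto
  then show thesis using that[of "M \<union> N" ?u] M(1) N k by auto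
qed

lemma gen_eigen_decomposable_add:
  assumes Z: "linop Z" and "gen_eigen_decomposable Z v" "gen_eigen_decomposable Z w"
  shows "gen_eigen_decomposable Z (v + w)"
proof -
  obtain M u where M: "finite M" "\<And>\<mu>. \<exists>k. (shift Z \<mu> ^^ k) (u \<mu>) = 0"
    "\<And>\<mu>. \<mu> \<notin> M \<Longrightarrow> u \<mu> = 0" "v = (\<Sum>\<mu>\<in>M. u \<mu>)"
    using gen_eigen_decomposable_extend[OF assms(2), of "{}"] by auto
  obtain M' u' where M': "finite M'" "M \<subseteq> M'" "\<And>\<mu>. \<exists>k. (shift Z \<mu> ^^ k) (u' \<mu>) = 0"
    "w = (\<Sum>\<mu>\<in>M'. u' \<mu>)"
    using gen_eigen_decomposable_extend[OF assms(3) M(1)] by metis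
  have v: "v = (\<Sum>\<mu>\<in>M'. u \<mu>)"
    unfolding M(4) using M' M by (intro sum.mono_neutral_left) auto
  have "\<exists>k. (shift Z \<mu> ^^ k) (u \<mu> + u' \<mu>) = 0" for \<mu>
  proof -
    obtain i j where "(shift Z \<mu> ^^ i) (u \<mu>) = 0" "(shift Z \<mu> ^^ j) (u' \<mu>) = 0"
      using M(2) M'(3) by meson
    then have "(shift Z \<mu> ^^ (max i j)) (u \<mu> + u' \<mu>) = 0"
      using funpow_eq_zero_mono[OF linop_shift[OF Z]] linop_add[OF linop_funpow[OF linop_shift[OF Z]]]
      by simp
    then show ?thesis by blast
  qed
  then show ?thesis unfolding gen_eigen_decomposable_def
    using M'(1) v M'(4) by (intro exI[of _ M'] exI[of _ "\<lambda>\<mu>. u \<mu> + u' \<mu>"]) (auto simp: sum.distrib)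
qed

lemma gen_eigen_decomposable_gen_eigen:
  "(shift Z \<mu> ^^ k) v = 0 \<Longrightarrow> gen_eigen_decomposable Z v"
  unfolding gen_eigen_decomposable_def by (intro exI[of _ "{\<mu>}"] exI[of _ "\<lambda>_. v"]) auto

lemma gen_eigen_decomposable_sum:
  assumes Z: "linop Z" and "finite K" "\<And>i. i \<in> K \<Longrightarrow> gen_eigen_decomposable Z (w i)"
  shows "gen_eigen_decomposable Z (\<Sum>i\<in>K. w i)"
  using assms(2,3)
proof (induction K rule: finite_induct)
  case empty
  then show ?case using gen_eigen_decomposable_gen_eigen[where k = 0 and v = 0] by simp
next
  case (insert x F)
  then show ?case by (auto intro: gen_eigen_decomposable_add[OF Z])
qed

text \<open>The components of (Z - \<mu>) v for \<nu> \<noteq> \<mu> have preimages under Z - \<mu>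
  of the same kind. Subtracting them from v leaves a vector whose shift is the \<mu>-component,
  hence one that a further power of Z - \<mu> kills.\<close>

lemma gen_eigen_decomposable_shiftD:
  assumes Z: "linop Z" and "gen_eigen_decomposable Z (shift Z \<mu> v)"
  shows "gen_eigen_decomposable Z v"
proof -
  obtain M u where M: "finite M" "{\<mu>} \<subseteq> M" "\<And>\<nu>. \<exists>k. (shift Z \<nu> ^^ k) (u \<nu>) = 0"
    "shift Z \<mu> v = (\<Sum>\<nu>\<in>M. u \<nu>)"
    by (rule gen_eigen_decomposable_extend[OF assms(2), of "{\<mu>}"]) auto
  have "\<exists>w. (\<exists>k. (shift Z \<nu> ^^ k) w = 0) \<and> shift Z \<mu> w = u \<nu>" if "\<nu> \<noteq> \<mu>" for \<nu>
  proof -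
    obtain k where k: "(shift Z \<nu> ^^ k) (u \<nu>) = 0" using M(3) by blast
    let ?U = "{w. (shift Z \<nu> ^^ k) w = 0}"
    have lk: "linop (shift Z \<nu> ^^ k)" by (intro linop_funpow linop_shift Z)
    have "(shift Z \<nu> ^^ k) (Z w) = Z ((shift Z \<nu> ^^ k) w)" for w
      by (rule commute_funpow[symmetric]) (simp add: shift_def linop_diff[OF Z] linop_scale[OF Z])
    then have "stable Z ?U"
      by (auto simp: stable_def subspace_def linop_add[OF lk] linop_scale[OF lk] linop_zero[OF lk]
          linop_zero[OF Z])
    then show ?thesis using gen_eigen_solve[OF Z, of ?U \<mu> \<nu> k "u \<nu>"] that k by auto
  qed
  then obtain w where w: "\<And>\<nu>. \<nu> \<noteq> \<mu> \<Longrightarrow> \<exists>k. (shift Z \<nu> ^^ k) (w \<nu>) = 0"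
    "\<And>\<nu>. \<nu> \<noteq> \<mu> \<Longrightarrow> shift Z \<mu> (w \<nu>) = u \<nu>" by metis
  let ?w = "\<Sum>\<nu>\<in>M - {\<mu>}. w \<nu>"
  have "shift Z \<mu> (v - ?w) = u \<mu>"
    using M(1,2,4) w(2)
    by (simp add: linop_diff[OF linop_shift[OF Z]] linop_sum[OF linop_shift[OF Z]]
        sum.remove[of M \<mu>])
  moreover obtain k where "(shift Z \<mu> ^^ k) (u \<mu>) = 0" using M(3) by blast
  ultimately have "(shift Z \<mu> ^^ Suc k) (v - ?w) = 0" by (metis comp_apply funpow_Suc_right)
  then have "gen_eigen_decomposable Z (v - ?w)" by (rule gen_eigen_decomposable_gen_eigen)
  moreover have "gen_eigen_decomposable Z ?w"
    using M(1) w(1) by (intro gen_eigen_decomposable_sum[OF Z])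
      (auto intro: gen_eigen_decomposable_gen_eigen)
  ultimately have "gen_eigen_decomposable Z (v - ?w + ?w)" by (rule gen_eigen_decomposable_add[OF Z])
  then show ?thesis by simp
qed

subsection \<open>Polynomials in an operator\<close>

definition op_poly :: "complex poly \<Rightarrow> ('b \<Rightarrow> 'b) \<Rightarrow> 'b \<Rightarrow> 'b"
  where "op_poly p Z v = (\<Sum>i\<le>Polynomial.degree p. Polynomial.coeff p i \<triangleright> (Z ^^ i) v)"

lemma op_poly_bound:
  "Polynomial.degree p \<le> n \<Longrightarrow> op_poly p Z v = (\<Sum>i\<le>n. Polynomial.coeff p i \<triangleright> (Z ^^ i) v)"
  unfolding op_poly_def by (intro sum.mono_neutral_left) (auto simp: coeff_eq_0)

lemma op_poly_0 [simp]: "op_poly 0 Z v = 0"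
  by (simp add: op_poly_def)

lemma op_poly_pCons:
  assumes Z: "linop Z"
  shows "op_poly (pCons a p) Z v = a \<triangleright> v + Z (op_poly p Z v)"
proof -
  have "op_poly (pCons a p) Z v = (\<Sum>i\<le>Suc (Polynomial.degree p). Polynomial.coeff (pCons a p) i \<triangleright> (Z ^^ i) v)"
    by (rule op_poly_bound) (simp add: degree_pCons_le)
  also have "\<dots> = a \<triangleright> v + (\<Sum>i\<le>Polynomial.degree p. Polynomial.coeff p i \<triangleright> (Z ^^ Suc i) v)"
    by (subst sum.atMost_Suc_shift) simp
  also have "(\<Sum>i\<le>Polynomial.degree p. Polynomial.coeff p i \<triangleright> (Z ^^ Suc i) v) = Z (op_poly p Z v)"
    by (simp add: op_poly_def linop_sum[OF Z] linop_scale[OF Z])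
  finally show ?thesis .
qed

lemma op_poly_add: "op_poly (p + q) Z v = op_poly p Z v + op_poly q Z v"
proof -
  let ?n = "max (Polynomial.degree p) (Polynomial.degree q)"
  have "Polynomial.degree (p + q) \<le> ?n" by (rule degree_add_le) auto
  then show ?thesis
    using op_poly_bound[of "p + q" ?n] op_poly_bound[of p ?n] op_poly_bound[of q ?n]
    by (simp add: sum.distrib scale_left_distrib)
qed

lemma op_poly_smult: "op_poly (Polynomial.smult c p) Z v = c \<triangleright> op_poly p Z v"
proof -
  have "Polynomial.degree (Polynomial.smult c p) \<le> Polynomial.degree p" by (rule degree_smult_le)
  then show ?thesis
    using op_poly_bound[of "Polynomial.smult c p" "Polynomial.degree p"] by (simp add: op_poly_def scale_sum_right)
qed

lemma linop_op_poly: "linop Z \<Longrightarrow> linop (op_poly p Z)"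
  by (induction p) (auto simp: op_poly_pCons linop_def scale_right_distrib algebra_simps scale_left_commute)

lemma op_poly_mult:
  assumes Z: "linop Z"
  shows "op_poly (p * q) Z v = op_poly p Z (op_poly q Z v)"
proof (induction p)
  case 0
  then show ?case by simp
next
  case (pCons a p)
  have "op_poly (pCons 0 (p * q)) Z v = Z (op_poly (p * q) Z v)"
    by (simp add: op_poly_pCons[OF Z])
  then show ?case using pCons by (simp add: op_poly_add op_poly_smult op_poly_pCons[OF Z])
qed

lemma op_poly_linear_factor:
  assumes Z: "linop Z" shows "op_poly [:- \<mu>, 1:] Z v = shift Z \<mu> v"
  by (simp add: op_poly_pCons[OF Z] shift_def linop_add[OF Z] linop_zero[OF Z])

text \<open>Each root \<mu> of p splits off a factor Z - \<mu>, and
  \<open>gen_eigen_decomposable_shiftD\<close> lifts the decomposition back through it.\<close>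

lemma gen_eigen_decomposable_poly:
  assumes Z: "linop Z" and "p \<noteq> 0" "op_poly p Z v = 0"
  shows "gen_eigen_decomposable Z v"
  using assms(2,3)
proof (induction "Polynomial.degree p" arbitrary: p v)
  case 0
  then obtain c where "p = [:c:]" "c \<noteq> 0" by (metis degree_eq_zeroE pCons_0_0)
  then have "v = 0" using 0 by (simp add: op_poly_pCons[OF Z] linop_zero[OF Z])
  then show ?case using gen_eigen_decomposable_gen_eigen[where k = 0 and v = v] by simp
next
  case (Suc n)
  have "\<not> constant (poly p)" using Suc.hyps(2) by (simp add: constant_degree)
  then obtain \<mu> where \<mu>: "poly p \<mu> = 0" using Fundamental_Theorem_Algebra.fundamental_theorem_of_algebra[of p] by auto
  have "[:- \<mu>, 1:] dvd p" using \<mu> by (simp add: poly_eq_0_iff_dvd)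
  then obtain q where q: "p = [:- \<mu>, 1:] * q" by (rule dvdE)
  then have q0: "q \<noteq> 0" using Suc.prems by auto
  then have "Polynomial.degree p = Suc (Polynomial.degree q)" by (simp add: q degree_mult_eq del: mult_pCons_left)
  moreover have "op_poly q Z (shift Z \<mu> v) = 0"
    using Suc.prems(2) op_poly_mult[OF Z, of q "[:- \<mu>, 1:]" v]
    unfolding q by (simp add: mult.commute op_poly_linear_factor[OF Z])
  ultimately have "gen_eigen_decomposable Z (shift Z \<mu> v)" using Suc.hyps q0 by auto
  then show ?case by (rule gen_eigen_decomposable_shiftD[OF Z])
qed

text \<open>The iterates number one more than a spanning set has elements. The degree bound is kept
  because it later yields the exponent \<open>cmat.dim L\<close>.\<close>

lemma krylov_dependent:
  assumes Z: "linop Z" and "finite B" "\<And>i. (Z ^^ i) v \<in> span B"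
  shows "\<exists>p. p \<noteq> 0 \<and> Polynomial.degree p \<le> card B \<and> op_poly p Z v = 0"
proof (rule ccontr)
  assume no: "\<not> ?thesis"
  let ?f = "\<lambda>i. (Z ^^ i) v"
  have *: "c i = 0" if "(\<Sum>i\<le>card B. c i \<triangleright> ?f i) = 0" "i \<le> card B" for c i
  proof -
    define q where "q = Poly (map c [0..<Suc (card B)])"
    have co: "Polynomial.coeff q j = (if j \<le> card B then c j else 0)" for j
      by (auto simp: q_def coeff_Poly_eq nth_default_def less_Suc_eq_le simp del: upt_Suc)
    then have deg: "Polynomial.degree q \<le> card B" by (intro degree_le) auto
    have "op_poly q Z v = 0"
      using that(1) by (subst op_poly_bound[OF deg]) (simp add: co)
    then have "q = 0" using no deg by blast
    then show ?thesis using co[of i] that(2) by simp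
  qed
  \<comment> \<open>Independence is a property of the set of iterates, so repetitions have to be
    excluded before counting; a repetition would itself be a relation.\<close>
  have inj: "inj_on ?f {..card B}"
  proof (rule inj_onI, rule ccontr)
    fix i j assume ij: "i \<in> {..card B}" "j \<in> {..card B}" "?f i = ?f j" "i \<noteq> j"
    let ?c = "\<lambda>k. if k = i then 1 else if k = j then - 1 else (0::complex)"
    have "(\<Sum>k\<le>card B. ?c k \<triangleright> ?f k) = (\<Sum>k\<in>{i, j}. ?c k \<triangleright> ?f k)"
      using ij by (intro sum.mono_neutral_right) auto
    also have "\<dots> = 0" using ij by simp
    finally show False using *[of ?c i] ij by simp
  qed
  have "independent (?f ` {..card B})"
  proof (rule independent_if_scalars_zero)
    fix c w assume "(\<Sum>x\<in>?f ` {..card B}. c x \<triangleright> x) = 0" and w: "w \<in> ?f ` {..card B}"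
    then have "(\<Sum>i\<le>card B. c (?f i) \<triangleright> ?f i) = 0" by (simp add: sum.reindex[OF inj])
    from *[OF this] w show "c w = 0" by auto
  qed simp
  then have "card (?f ` {..card B}) \<le> card B"
    using independent_span_bound[OF assms(2), of "?f ` {..card B}"] assms(3) by blast
  then show False using inj by (simp add: card_image)
qed

lemma gen_eigen_decomposable_finite_span:
  assumes "linop Z" "finite B" "\<And>i. (Z ^^ i) v \<in> span B"
  shows "gen_eigen_decomposable Z v"
  using krylov_dependent[OF assms] gen_eigen_decomposable_poly[OF assms(1)] by blast

text \<open>Let n be the lowest index with a nonzero coefficient of an annihilating polynomial, and
  m the least exponent killing v. If n < m, applying Z^(m-1-n) to the relation leaves a nonzero
  multiple of Z^(m-1) v, which is not 0.\<close>

lemma funpow_nilpotent_bound: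
  assumes Z: "linop Z" and B: "finite B" "\<And>i. (Z ^^ i) v \<in> span B" and k: "(Z ^^ k) v = 0"
  shows "(Z ^^ card B) v = 0"
proof -
  obtain p where p: "p \<noteq> 0" "Polynomial.degree p \<le> card B" "op_poly p Z v = 0"
    using krylov_dependent[OF Z B] by blast
  have "\<exists>n. Polynomial.coeff p n \<noteq> 0" using p(1) leading_coeff_neq_0 by blast
  define n where "n = (LEAST n. Polynomial.coeff p n \<noteq> 0)"
  have n: "Polynomial.coeff p n \<noteq> 0" and nl: "\<And>i. i < n \<Longrightarrow> Polynomial.coeff p i = 0"
    unfolding n_def using \<open>\<exists>n. Polynomial.coeff p n \<noteq> 0\<close> by (metis (mono_tags, lifting) LeastI_ex, metis not_less_Least)
  have nB: "n \<le> card B" using n p(2) le_degree by fastforce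
  have "(Z ^^ n) v = 0"
  proof (rule ccontr)
    assume "(Z ^^ n) v \<noteq> 0"
    define m where "m = (LEAST m. (Z ^^ m) v = 0)"
    have m: "(Z ^^ m) v = 0" and ml: "\<And>i. i < m \<Longrightarrow> (Z ^^ i) v \<noteq> 0"
      unfolding m_def using k by (auto intro: LeastI dest: not_less_Least)
    have nm: "n < m" using \<open>(Z ^^ n) v \<noteq> 0\<close> funpow_eq_zero_mono[OF Z m, of n] by (meson not_le)
    have "0 = (Z ^^ (m - 1 - n)) (op_poly p Z v)" using p(3) Z by (simp add: funpow_zero)
    also have "\<dots> = (\<Sum>i\<le>Polynomial.degree p. Polynomial.coeff p i \<triangleright> (Z ^^ (m - 1 - n + i)) v)"
      unfolding op_poly_def using linop_funpow[OF Z]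
      by (simp add: linop_sum linop_scale funpow_add)
    also have "\<dots> = (\<Sum>i\<in>{n}. Polynomial.coeff p i \<triangleright> (Z ^^ (m - 1 - n + i)) v)"
    proof (rule sum.mono_neutral_right)
      show "\<forall>i\<in>{..Polynomial.degree p} - {n}. Polynomial.coeff p i \<triangleright> (Z ^^ (m - 1 - n + i)) v = 0"
      proof
        fix i assume "i \<in> {..Polynomial.degree p} - {n}"
        then consider "i < n" | "i > n" by fastforce
        then show "Polynomial.coeff p i \<triangleright> (Z ^^ (m - 1 - n + i)) v = 0"
          by cases (use nl nm funpow_eq_zero_mono[OF Z m] in auto)
      qed
    qed (use n le_degree in auto)
    finally show False using ml[of "m - 1"] n nm by simp
  qed
  then show ?thesis by (rule funpow_eq_zero_mono[OF Z _ nB])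
qed

end

context complex_space
begin

subsection \<open>The semisimple part of a locally finite operator\<close>

text \<open>On an eigenvector of S the operator Z - \<mu> is just N, so for locally nilpotent N
  eigenvectors of S are generalized eigenvectors of Z.\<close>

lemma shift_funpow_eigen:
  assumes S: "linop S" and N: "linop N" and comm: "\<And>v. S (N v) = N (S v)"
    and Z: "\<And>v. Z v = S v + N v" and "S v = \<mu> \<triangleright> v"
  shows "(shift Z \<mu> ^^ k) v = (N ^^ k) v"
proof (induction k)
  case (Suc k)
  have "S ((N ^^ k) v) = \<mu> \<triangleright> (N ^^ k) v"
    using commute_funpow[of S N k v, OF comm] assms(5) by (simp add: linop_scale[OF linop_funpow[OF N]])
  then show ?case using Suc by (simp add: shift_def Z)
qed simp

lemma semisimple_components:
  assumes S: "linop S" and N: "linop N" and comm: "\<And>v. S (N v) = N (S v)"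
    and Z: "\<And>v. Z v = S v + N v" and U: "stable Z U" and M: "finite M"
    and eig: "\<And>\<mu>. \<mu> \<in> M \<Longrightarrow> S (u \<mu>) = \<mu> \<triangleright> u \<mu>"
    and nil: "\<And>\<mu>. \<mu> \<in> M \<Longrightarrow> \<exists>k. (N ^^ k) (u \<mu>) = 0"
    and "(\<Sum>\<mu>\<in>M. u \<mu>) \<in> U" "\<mu> \<in> M"
  shows "u \<mu> \<in> U"
proof (rule gen_eigen_components[OF _ U M _ assms(9,10)])
  have "Z = (\<lambda>v. S v + N v)" using Z by auto
  then show "linop Z" using linop_plus[OF S N] by simp
  show "\<exists>k. (shift Z \<mu> ^^ k) (u \<mu>) = 0" if "\<mu> \<in> M" for \<mu>
    using nil[OF that] shift_funpow_eigen[OF S N comm Z eig[OF that]] by simp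
qed

lemma semisimple_stable:
  assumes S: "linop S" and N: "linop N" and comm: "\<And>v. S (N v) = N (S v)"
    and Z: "\<And>v. Z v = S v + N v" and U: "stable Z U" and M: "finite M"
    and eig: "\<And>\<mu>. \<mu> \<in> M \<Longrightarrow> S (u \<mu>) = \<mu> \<triangleright> u \<mu>"
    and nil: "\<And>\<mu>. \<mu> \<in> M \<Longrightarrow> \<exists>k. (N ^^ k) (u \<mu>) = 0"
    and "(\<Sum>\<mu>\<in>M. u \<mu>) \<in> U"
  shows "S (\<Sum>\<mu>\<in>M. u \<mu>) \<in> U"
proof -
  have "S (\<Sum>\<mu>\<in>M. u \<mu>) = (\<Sum>\<mu>\<in>M. \<mu> \<triangleright> u \<mu>)" using eig by (simp add: linop_sum[OF S])
  also have "\<dots> \<in> U"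
    using U semisimple_components[OF assms] by (auto simp: stable_def intro!: subspace_sum subspace_scale)
  finally show ?thesis .
qed

text \<open>S multiplies each generalized eigencomponent by its eigenvalue. A vector has many
  decompositions, differing in their zero components, so S is read off from a relation R; R is
  linear, and R 0 s forces s = 0 because the components of 0 vanish.\<close>

lemma semisimple_part_exists:
  assumes Z: "linop Z" and dec: "\<And>v. gen_eigen_decomposable Z v"
  obtains S where "linop S" "\<And>\<mu> k v. (shift Z \<mu> ^^ k) v = 0 \<Longrightarrow> S v = \<mu> \<triangleright> v"
proof -
  define R where "R v s \<longleftrightarrow> (\<exists>M u. finite M \<and> (\<forall>\<mu>. \<exists>k. (shift Z \<mu> ^^ k) (u \<mu>) = 0) \<and>
    v = (\<Sum>\<mu>\<in>M. u \<mu>) \<and> s = (\<Sum>\<mu>\<in>M. \<mu> \<triangleright> u \<mu>))" for v s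
  have RI: "R v s" if "finite M" "\<And>\<mu>. \<exists>k. (shift Z \<mu> ^^ k) (u \<mu>) = 0"
    "v = (\<Sum>\<mu>\<in>M. u \<mu>)" "s = (\<Sum>\<mu>\<in>M. \<mu> \<triangleright> u \<mu>)" for v s M u
    unfolding R_def using that by blast
  have ex: "\<exists>s. R v s" for v
    by (rule gen_eigen_decomposable_extend[OF dec[of v], of "{}"]) (simp, rule exI, rule RI[OF _ _ _ refl])
  have lin: "linop (shift Z \<mu> ^^ k)" for \<mu> k by (intro linop_funpow linop_shift Z)
  have zero0: "(shift Z \<mu> ^^ k) 0 = 0" for \<mu> k by (rule linop_zero[OF lin])
  have Rscale: "R (c \<triangleright> v) (c \<triangleright> s)" if Rv: "R v s" for c v s
  proof -
    obtain M u where M: "finite M" "\<forall>\<mu>. \<exists>k. (shift Z \<mu> ^^ k) (u \<mu>) = 0"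
      "v = (\<Sum>\<mu>\<in>M. u \<mu>)" "s = (\<Sum>\<mu>\<in>M. \<mu> \<triangleright> u \<mu>)" using Rv unfolding R_def by blast
    have "\<exists>k. (shift Z \<mu> ^^ k) (c \<triangleright> u \<mu>) = 0" for \<mu>
    proof -
      obtain k where "(shift Z \<mu> ^^ k) (u \<mu>) = 0" using M(2) by blast
      then have "(shift Z \<mu> ^^ k) (c \<triangleright> u \<mu>) = 0" by (simp add: linop_scale[OF lin])
      then show ?thesis by blast
    qed
    then show ?thesis
      using M(1,3,4) by (intro RI[of M "\<lambda>\<mu>. c \<triangleright> u \<mu>"])
        (auto simp: scale_sum_right mult.commute)
  qed
  have Radd: "R (v + w) (s + t)" if Rv: "R v s" and Rw: "R w t" for v w s t
  proof -
    obtain M u where M: "finite M" "\<forall>\<mu>. \<exists>k. (shift Z \<mu> ^^ k) (u \<mu>) = 0"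
      "v = (\<Sum>\<mu>\<in>M. u \<mu>)" "s = (\<Sum>\<mu>\<in>M. \<mu> \<triangleright> u \<mu>)" using Rv unfolding R_def by blast
    obtain M' u' where M': "finite M'" "\<forall>\<mu>. \<exists>k. (shift Z \<mu> ^^ k) (u' \<mu>) = 0"
      "w = (\<Sum>\<mu>\<in>M'. u' \<mu>)" "t = (\<Sum>\<mu>\<in>M'. \<mu> \<triangleright> u' \<mu>)" using Rw unfolding R_def by blast
    let ?u = "\<lambda>\<mu>. if \<mu> \<in> M then u \<mu> else 0" and ?u' = "\<lambda>\<mu>. if \<mu> \<in> M' then u' \<mu> else 0"
    have "\<exists>k. (shift Z \<mu> ^^ k) (?u \<mu> + ?u' \<mu>) = 0" for \<mu>
    proof -
      obtain i j where ij: "(shift Z \<mu> ^^ i) (u \<mu>) = 0" "(shift Z \<mu> ^^ j) (u' \<mu>) = 0"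
        using M(2) M'(2) by meson
      have "(shift Z \<mu> ^^ max i j) (u \<mu>) = 0" "(shift Z \<mu> ^^ max i j) (u' \<mu>) = 0"
        using ij funpow_eq_zero_mono[OF linop_shift[OF Z]] by auto
      then have "(shift Z \<mu> ^^ max i j) (?u \<mu> + ?u' \<mu>) = 0" by (simp add: linop_add[OF lin] zero0)
      then show ?thesis by blast
    qed
    moreover have "v = (\<Sum>\<mu>\<in>M \<union> M'. ?u \<mu>)" "w = (\<Sum>\<mu>\<in>M \<union> M'. ?u' \<mu>)"
      "s = (\<Sum>\<mu>\<in>M \<union> M'. \<mu> \<triangleright> ?u \<mu>)" "t = (\<Sum>\<mu>\<in>M \<union> M'. \<mu> \<triangleright> ?u' \<mu>)"
      unfolding M(3,4) M'(3,4) using M(1) M'(1) by (intro sum.mono_neutral_cong_left; auto)+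
    ultimately show ?thesis using M(1) M'(1)
      by (intro RI[of "M \<union> M'" "\<lambda>\<mu>. ?u \<mu> + ?u' \<mu>"]) (auto simp only: sum.distrib scale_right_distrib finite_UnI)
  qed
  have R0: "s = 0" if R0s: "R 0 s" for s
  proof -
    obtain M u where M: "finite M" "\<forall>\<mu>. \<exists>k. (shift Z \<mu> ^^ k) (u \<mu>) = 0"
      "0 = (\<Sum>\<mu>\<in>M. u \<mu>)" "s = (\<Sum>\<mu>\<in>M. \<mu> \<triangleright> u \<mu>)" using R0s unfolding R_def by blast
    have "u \<mu> \<in> {0}" if "\<mu> \<in> M" for \<mu>
      using M that by (intro gen_eigen_components[OF Z stable_zero[OF Z], of M u]) auto
    then show ?thesis using M(4) by simp
  qed
  have uniq: "s = t" if "R v s" "R v t" for v s t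
    using R0[of "s + (- 1) \<triangleright> t"] Radd[OF that(1) Rscale[OF that(2), of "- 1"]] by simp
  define S where "S v = (THE s. R v s)" for v
  have RS: "R v (S v)" for v
    unfolding S_def using ex[of v] uniq[of v] by (metis theI)
  have SI: "S v = s" if "R v s" for v s using uniq[OF RS that] .
  show thesis
  proof (rule that)
    show "linop S" unfolding linop_def using SI Radd Rscale RS by blast
    fix \<mu> k v assume kv: "(shift Z \<mu> ^^ k) v = 0"
    have "\<exists>k. (shift Z \<nu> ^^ k) (if \<nu> = \<mu> then v else 0) = 0" for \<nu>
      using kv zero0 by (cases "\<nu> = \<mu>") auto
    then show "S v = \<mu> \<triangleright> v"
      by (intro SI RI[of "{\<mu>}" "\<lambda>\<nu>. if \<nu> = \<mu> then v else 0"]) auto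
  qed
qed

text \<open>Y preserves every generalized eigenspace of Z, and there S is a scalar.\<close>

lemma semisimple_part_commute:
  assumes Z: "linop Z" and v: "gen_eigen_decomposable Z v" and S: "linop S"
    and eig: "\<And>\<mu> k v. (shift Z \<mu> ^^ k) v = 0 \<Longrightarrow> S v = \<mu> \<triangleright> v"
    and Y: "linop Y" and comm: "\<And>v. Z (Y v) = Y (Z v)"
  shows "S (Y v) = Y (S v)"
proof -
  obtain M u where M: "finite M" "\<forall>\<mu>\<in>M. \<exists>k. (shift Z \<mu> ^^ k) (u \<mu>) = 0" "v = (\<Sum>\<mu>\<in>M. u \<mu>)"
    using v unfolding gen_eigen_decomposable_def by blast
  have "S (Y (u \<mu>)) = Y (S (u \<mu>))" if "\<mu> \<in> M" for \<mu>
  proof -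
    obtain k where k: "(shift Z \<mu> ^^ k) (u \<mu>) = 0" using M(2) \<open>\<mu> \<in> M\<close> by blast
    have "(shift Z \<mu> ^^ k) (Y (u \<mu>)) = Y ((shift Z \<mu> ^^ k) (u \<mu>))"
      by (rule commute_funpow[symmetric], rule commute_shift[OF Y, symmetric], rule comm)
    then have "(shift Z \<mu> ^^ k) (Y (u \<mu>)) = 0" using k by (simp add: linop_zero[OF Y])
    from eig[OF this] eig[OF k] show ?thesis by (simp add: linop_scale[OF Y])
  qed
  then show ?thesis unfolding M(3) by (simp add: linop_sum[OF S] linop_sum[OF Y])
qed

lemma nilpotent_part_locally_nilpotent:
  assumes Z: "linop Z" and v: "gen_eigen_decomposable Z v" and S: "linop S"
    and eig: "\<And>\<mu> k v. (shift Z \<mu> ^^ k) v = 0 \<Longrightarrow> S v = \<mu> \<triangleright> v"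
  shows "\<exists>k. ((\<lambda>v. Z v - S v) ^^ k) v = 0"
proof -
  let ?N = "\<lambda>v. Z v - S v"
  have N: "linop ?N"
    using linop_plus[OF Z linop_scaled[OF S, of "- 1"]] by simp
  obtain M u where M: "finite M" "\<forall>\<mu>\<in>M. \<exists>k. (shift Z \<mu> ^^ k) (u \<mu>) = 0" "v = (\<Sum>\<mu>\<in>M. u \<mu>)"
    using v unfolding gen_eigen_decomposable_def by blast
  have pow: "(?N ^^ j) v = (shift Z \<mu> ^^ j) v" if "(shift Z \<mu> ^^ k) v = 0" for \<mu> k j v
  proof (induction j)
    case (Suc j)
    have kill: "(shift Z \<mu> ^^ k) ((shift Z \<mu> ^^ j) v) = 0" by (rule gen_eigen_funpow_shift[OF Z that])
    have "Z x - S x = shift Z \<mu> x" if "x = (shift Z \<mu> ^^ j) v" for x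
      using eig[OF kill] that by (simp add: shift_def)
    then show ?case using Suc by simp
  qed simp
  obtain k where k: "\<And>\<mu>. \<mu> \<in> M \<Longrightarrow> (shift Z \<mu> ^^ k \<mu>) (u \<mu>) = 0" using M(2) by metis
  have "(?N ^^ (\<Sum>\<mu>\<in>M. k \<mu>)) (u \<mu>) = 0" if "\<mu> \<in> M" for \<mu>
  proof (rule funpow_eq_zero_mono[OF N])
    show "(?N ^^ k \<mu>) (u \<mu>) = 0" using pow[OF k[OF that], of "k \<mu>"] k[OF that] by simp
    show "k \<mu> \<le> (\<Sum>\<mu>\<in>M. k \<mu>)" using M(1) that by (intro member_le_sum) auto
  qed
  then have "(?N ^^ (\<Sum>\<mu>\<in>M. k \<mu>)) v = 0"
    unfolding M(3) by (simp add: linop_sum[OF linop_funpow[OF N]])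
  then show ?thesis by blast
qed

subsection \<open>Functionals and projections\<close>

text \<open>Functionals that kill U turn membership in U into the vanishing of scalar functions, to
  which derivatives and identity theorems apply.\<close>

lemma linfun_separating:
  assumes U: "subspace U" and f: "f \<notin> U"
  obtains l where "linfun l" "\<And>u. u \<in> U \<Longrightarrow> l u = 0" "l f = 1"
proof -
  interpret c: vector_space "(*) :: complex \<Rightarrow> complex \<Rightarrow> complex"
    by unfold_locales (auto simp: algebra_simps)
  interpret vp: vector_space_pair scale "(*) :: complex \<Rightarrow> complex \<Rightarrow> complex" ..
  obtain B where B: "B \<subseteq> U" "independent B" "U \<subseteq> span B"
    using maximal_independent_subset[of U] by blast
  have "f \<notin> span B" using f B(1) U span_minimal by blast
  then have "independent (insert f B)" using B(2) by (rule independent_insertI)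
  from vp.linear_independent_extend[OF this, of "\<lambda>x. if x = f then 1 else 0"]
  obtain l where l: "Vector_Spaces.linear scale (*) l" "\<forall>x\<in>insert f B. l x = (if x = f then 1 else 0)"
    by blast
  have lin: "linfun l" using l(1) by (simp add: linfun_linear)
  have "l u = 0" if "u \<in> U" for u
  proof -
    have "linfun (\<lambda>_. 0)" by (simp add: linfun_def)
    moreover have "l b = 0" if "b \<in> B" for b using l(2) that B(1) f by auto
    moreover have "u \<in> span B" using that B(3) by blast
    ultimately show ?thesis by (rule linfun_eq_on_span[OF lin])
  qed
  moreover have "l f = 1" using l(2) by simp
  ultimately show thesis by (rule that[OF lin])
qed

lemma subspace_projection:
  assumes U: "subspace U"
  obtains pr where "linop pr" "\<And>v. pr v \<in> U" "\<And>u. u \<in> U \<Longrightarrow> pr u = u"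
proof -
  interpret vp: vector_space_pair scale scale ..
  obtain B where B: "B \<subseteq> U" "independent B" "U \<subseteq> span B"
    using maximal_independent_subset[of U] by blast
  from vp.linear_independent_extend_subspace[OF B(2), of "\<lambda>x. x"]
  obtain pr where pr: "Vector_Spaces.linear scale scale pr" "\<forall>x\<in>B. pr x = x" "range pr = span B"
    by auto
  have lin: "linop pr" using pr(1) by (simp add: linop_linear)
  have sp: "span B = U" using B(1,3) U span_minimal by blast
  show thesis
  proof (rule that[OF lin])
    show "pr v \<in> U" for v using pr(3) sp by blast
    show "pr u = u" if "u \<in> U" for u
      using linop_eq_on_span[OF lin linop_id, of B u] pr(2) sp that by blast
  qed
qed

subsection \<open>Generic linear independence\<close>

text \<open>Models the polynomial functions of a parameter x. The instances are polynomials in one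
  variable, for lines, and polynomials in the entries of a matrix.\<close>

definition fun_algebra :: "('x \<Rightarrow> complex) set \<Rightarrow> bool"
  where "fun_algebra \<Phi> \<longleftrightarrow> (\<forall>c. (\<lambda>_. c) \<in> \<Phi>) \<and>
    (\<forall>f\<in>\<Phi>. \<forall>g\<in>\<Phi>. (\<lambda>x. f x + g x) \<in> \<Phi> \<and> (\<lambda>x. f x * g x) \<in> \<Phi>)"

text \<open>A vector depending polynomially on x, expressed without choosing a basis.\<close>

definition fun_vector :: "('x \<Rightarrow> complex) set \<Rightarrow> ('x \<Rightarrow> 'b) \<Rightarrow> bool"
  where "fun_vector \<Phi> u \<longleftrightarrow> (\<forall>l. linfun l \<longrightarrow> (\<lambda>x. l (u x)) \<in> \<Phi>)"

lemma lin_indepD: "lin_indep K u \<Longrightarrow> (\<Sum>i\<in>K. c i \<triangleright> u i) = 0 \<Longrightarrow> i \<in> K \<Longrightarrow> c i = 0"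
  by (auto simp: lin_indep_def)

lemma lin_indep_nonzero:
  assumes "lin_indep K u" "i \<in> K" shows "u i \<noteq> 0"
proof
  assume "u i = 0"
  then have "(\<Sum>j\<in>K. (if j = i then 1 else 0) \<triangleright> u j) = 0" by (intro sum.neutral) auto
  from lin_indepD[OF assms(1) this assms(2)] show False by simp
qed

text \<open>Fraction-free Gaussian elimination in place of a nonvanishing minor: a functional l with
  l (u j x0) = 1 gives the pivot g, the other vectors are replaced by combinations that l kills, and
  p is the product of the pivots.\<close>

lemma generic_lin_indep:
  assumes \<Phi>: "fun_algebra \<Phi>" and "finite K" and "\<And>i. i \<in> K \<Longrightarrow> fun_vector \<Phi> (u i)"
    and "lin_indep K (\<lambda>i. u i x0)"
  shows "\<exists>p\<in>\<Phi>. p x0 \<noteq> 0 \<and> (\<forall>x. p x \<noteq> 0 \<longrightarrow> lin_indep K (\<lambda>i. u i x))"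
  using assms(2-4)
proof (induction K arbitrary: u rule: finite_induct)
  case empty
  have "(\<lambda>_. 1) \<in> \<Phi>" using \<Phi> by (simp add: fun_algebra_def)
  then show ?case by (intro bexI[of _ "\<lambda>_. 1"]) (auto simp: lin_indep_def)
next
  case (insert j K)
  have "u j x0 \<noteq> 0" using lin_indep_nonzero[OF insert.prems(2)] by simp
  then have "u j x0 \<notin> {0}" by simp
  then obtain l where l: "linfun l" "l (u j x0) = 1"
    by (rule linfun_separating[OF subspace_single_0]) blast
  define g where "g x = l (u j x)" for x
  define w where "w i x = g x \<triangleright> u i x - l (u i x) \<triangleright> u j x" for i x
  have gx0: "g x0 = 1" by (simp add: g_def l)
  have g: "g \<in> \<Phi>" using insert.prems(1)[of j] l(1) unfolding g_def fun_vector_def by simp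
  have mult: "(\<lambda>x. f x * h x) \<in> \<Phi>" and add: "(\<lambda>x. f x + h x) \<in> \<Phi>" if "f \<in> \<Phi>" "h \<in> \<Phi>" for f h
    using \<Phi> that by (auto simp: fun_algebra_def)
  have const: "(\<lambda>_. c) \<in> \<Phi>" for c using \<Phi> by (auto simp: fun_algebra_def)
  have "fun_vector \<Phi> (w i)" if "i \<in> K" for i
    unfolding fun_vector_def
  proof (intro allI impI)
    fix m assume m: "linfun m"
    have "(\<lambda>x. l (u i x)) \<in> \<Phi>" "(\<lambda>x. m (u i x)) \<in> \<Phi>" "(\<lambda>x. m (u j x)) \<in> \<Phi>"
      using insert.prems(1) l(1) m that unfolding fun_vector_def by auto
    then have "(\<lambda>x. g x * m (u i x) + (- 1) * (l (u i x) * m (u j x))) \<in> \<Phi>"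
      by (intro add mult g const)
    then show "(\<lambda>x. m (w i x)) \<in> \<Phi>" by (simp add: w_def linfun_diff[OF m] linfun_scale[OF m])
  qed
  moreover have "lin_indep K (\<lambda>i. w i x0)" unfolding lin_indep_def
  proof (intro allI impI)
    fix c assume "(\<Sum>i\<in>K. c i \<triangleright> w i x0) = 0"
    then have eq: "(\<Sum>i\<in>K. c i \<triangleright> u i x0) - (\<Sum>i\<in>K. c i * l (u i x0)) \<triangleright> u j x0 = 0"
      by (simp add: w_def gx0 scale_right_diff_distrib sum_subtractf scale_sum_left)
    let ?c = "\<lambda>i. if i = j then - (\<Sum>i\<in>K. c i * l (u i x0)) else c i"
    have "(\<Sum>i\<in>K. ?c i \<triangleright> u i x0) = (\<Sum>i\<in>K. c i \<triangleright> u i x0)"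
      using insert.hyps by (intro sum.cong) auto
    then have "(\<Sum>i\<in>insert j K. ?c i \<triangleright> u i x0) = 0" using insert.hyps eq by (simp add: algebra_simps)
    from lin_indepD[OF insert.prems(2) this] have "?c i = 0" if "i \<in> K" for i using that by blast
    then show "\<forall>i\<in>K. c i = 0" using insert.hyps by (metis (full_types))
  qed
  ultimately obtain p where p: "p \<in> \<Phi>" "p x0 \<noteq> 0"
    "\<And>x. p x \<noteq> 0 \<Longrightarrow> lin_indep K (\<lambda>i. w i x)" using insert.IH[of w] by blast
  show ?case
  proof (intro bexI[of _ "\<lambda>x. p x * g x"] conjI allI impI)
    show "(\<lambda>x. p x * g x) \<in> \<Phi>" by (intro mult p g)
    show "p x0 * g x0 \<noteq> 0" using p(2) gx0 by simp
    fix x assume "p x * g x \<noteq> 0"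
    then have px: "p x \<noteq> 0" and gx: "g x \<noteq> 0" by auto
    show "lin_indep (insert j K) (\<lambda>i. u i x)" unfolding lin_indep_def
    proof (intro allI impI)
      fix c assume c: "(\<Sum>i\<in>insert j K. c i \<triangleright> u i x) = 0"
      then have c': "c j \<triangleright> u j x + (\<Sum>i\<in>K. c i \<triangleright> u i x) = 0" using insert.hyps by simp
      then have "l (c j \<triangleright> u j x + (\<Sum>i\<in>K. c i \<triangleright> u i x)) = 0" using linfun_zero[OF l(1)] by simp
      then have lc: "c j * g x + (\<Sum>i\<in>K. c i * l (u i x)) = 0"
        by (simp add: g_def linfun_add[OF l(1)] linfun_sum[OF l(1)] linfun_scale[OF l(1)])
      have "(\<Sum>i\<in>K. c i \<triangleright> w i x) = g x \<triangleright> (\<Sum>i\<in>K. c i \<triangleright> u i x) - (\<Sum>i\<in>K. c i * l (u i x)) \<triangleright> u j x"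
        by (simp add: w_def scale_right_diff_distrib sum_subtractf scale_sum_left scale_sum_right mult.commute)
      also have "(\<Sum>i\<in>K. c i * l (u i x)) = - (c j * g x)"
        using lc by (simp add: add_eq_0_iff)
      also have "g x \<triangleright> (\<Sum>i\<in>K. c i \<triangleright> u i x) - (- (c j * g x)) \<triangleright> u j x
        = g x \<triangleright> (c j \<triangleright> u j x + (\<Sum>i\<in>K. c i \<triangleright> u i x))"
        by (simp add: scale_right_distrib mult.commute)
      finally have "(\<Sum>i\<in>K. c i \<triangleright> w i x) = 0" using c' by simp
      then have cK: "\<forall>i\<in>K. c i = 0" using lin_indepD[OF p(3)[OF px]] by blast
      then have "c j * g x = 0" using lc by simp
      then show "\<forall>i\<in>insert j K. c i = 0" using cK gx by simp
    qed
  qed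
qed

subsection \<open>Traces on finite-dimensional subquotients\<close>

text \<open>A basis of W / U given by representatives K together with the dual basis, as functionals
  on the whole space that vanish on U.\<close>

definition frame :: "'b set \<Rightarrow> 'b set \<Rightarrow> 'b set \<Rightarrow> ('b \<Rightarrow> 'b \<Rightarrow> complex) \<Rightarrow> bool"
  where "frame U W K l \<longleftrightarrow> subspace U \<and> subspace W \<and> U \<subseteq> W \<and> finite K \<and> K \<subseteq> W \<and>
    (\<forall>r\<in>K. linfun (l r) \<and> (\<forall>u\<in>U. l r u = 0) \<and> (\<forall>s\<in>K. l r s = (if s = r then 1 else 0))) \<and>
    (\<forall>w\<in>W. w - (\<Sum>r\<in>K. l r w \<triangleright> r) \<in> U)"

definition frame_trace :: "'b set \<Rightarrow> ('b \<Rightarrow> 'b \<Rightarrow> complex) \<Rightarrow> ('b \<Rightarrow> 'b) \<Rightarrow> complex"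
  where "frame_trace K l Z = (\<Sum>r\<in>K. l r (Z r))"

definition indep_mod :: "'b set \<Rightarrow> 'b set \<Rightarrow> bool"
  where "indep_mod U K \<longleftrightarrow> (\<forall>c. (\<Sum>r\<in>K. c r \<triangleright> r) \<in> U \<longrightarrow> (\<forall>r\<in>K. c r = 0))"

lemma indep_modD: "indep_mod U K \<Longrightarrow> (\<Sum>r\<in>K. c r \<triangleright> r) \<in> U \<Longrightarrow> r \<in> K \<Longrightarrow> c r = 0"
  by (auto simp: indep_mod_def)

lemma span_Un_finite:
  assumes U: "subspace U" and K: "finite K" and v: "v \<in> span (U \<union> K)"
  obtains u c where "u \<in> U" "v = u + (\<Sum>r\<in>K. c r \<triangleright> r)"
proof -
  have "v \<in> {x + y |x y. x \<in> span U \<and> y \<in> span K}" using v by (simp add: span_Un)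
  then obtain x y where "x \<in> U" "y \<in> span K" "v = x + y"
    using span_eq_iff[THEN iffD2, OF U] by auto
  moreover obtain c where "y = (\<Sum>r\<in>K. c r \<triangleright> r)" using \<open>y \<in> span K\<close> span_finite[OF K] by auto
  ultimately show thesis using that by blast
qed

text \<open>K is a maximal subset of E that contains E0 and is independent modulo U; the functional
  of r separates r from U and the other representatives. E0 allows chosen representatives to be
  forced into the frame.\<close>

lemma frame_exists:
  assumes U: "subspace U" and W: "subspace W" "U \<subseteq> W" and E: "finite E" "E \<subseteq> W" "W \<subseteq> span (U \<union> E)"
    and E0: "E0 \<subseteq> E" "indep_mod U E0"
  obtains K l where "E0 \<subseteq> K" "K \<subseteq> E" "indep_mod U K" "frame U W K l"
proof -
  define A where "A = {K. E0 \<subseteq> K \<and> K \<subseteq> E \<and> indep_mod U K}"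
  have "finite A" unfolding A_def using E(1) by (auto intro: finite_subset[of _ "Pow E"])
  moreover have "E0 \<in> A" using E0 by (auto simp: A_def)
  ultimately have "\<exists>K\<in>A. \<forall>K'\<in>A. K \<subseteq> K' \<longrightarrow> K = K'" by (intro finite_has_maximal) auto
  then obtain K where KA: "K \<in> A" and max: "\<forall>K'\<in>A. K \<subseteq> K' \<longrightarrow> K = K'" by (rule bexE)
  have K: "E0 \<subseteq> K" "K \<subseteq> E" "indep_mod U K" using KA by (auto simp: A_def)
  have fK: "finite K" by (rule finite_subset[OF K(2) E(1)])
  have EK: "E \<subseteq> span (U \<union> K)"
  proof (rule subsetI, rule ccontr)
    fix e assume e: "e \<in> E" "e \<notin> span (U \<union> K)"
    then have eK: "e \<notin> K" by (metis UnI2 span_base)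
    have "indep_mod U (insert e K)" unfolding indep_mod_def
    proof (intro allI impI)
      fix c assume c: "(\<Sum>r\<in>insert e K. c r \<triangleright> r) \<in> U"
      have ce: "c e = 0"
      proof (rule ccontr)
        assume "c e \<noteq> 0"
        have "e = (1 / c e) \<triangleright> ((\<Sum>r\<in>insert e K. c r \<triangleright> r) - (\<Sum>r\<in>K. c r \<triangleright> r))"
          using fK eK \<open>c e \<noteq> 0\<close> by simp
        also have "\<dots> \<in> span (U \<union> K)"
          by (rule span_scale[OF span_diff[OF span_base[OF UnI1[OF c]] span_sum[OF span_scale[OF span_base[OF UnI2]]]]])
        finally show False using e by simp
      qed
      then have "(\<Sum>r\<in>K. c r \<triangleright> r) \<in> U" using c fK eK by simp
      then show "\<forall>r\<in>insert e K. c r = 0" using indep_modD[OF K(3)] ce by blast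
    qed
    then have "insert e K \<in> A" using K e by (auto simp: A_def)
    from max[rule_format, OF this] eK show False by blast
  qed
  have "\<exists>l. linfun l \<and> (\<forall>u\<in>U. l u = 0) \<and> (\<forall>s\<in>K. l s = (if s = r then 1 else 0))" if r: "r \<in> K" for r
  proof -
    have "r \<notin> span (U \<union> (K - {r}))"
    proof
      assume "r \<in> span (U \<union> (K - {r}))"
      from span_Un_finite[OF U _ this] fK obtain u c
        where uc: "u \<in> U" "r = u + (\<Sum>s\<in>K - {r}. c s \<triangleright> s)" by auto
      let ?c = "\<lambda>s. if s = r then 1 else - c s"
      have "(\<Sum>s\<in>K. ?c s \<triangleright> s) = r + (\<Sum>s\<in>K - {r}. ?c s \<triangleright> s)" using fK r by (simp add: sum.remove)
      also have "(\<Sum>s\<in>K - {r}. ?c s \<triangleright> s) = - (\<Sum>s\<in>K - {r}. c s \<triangleright> s)"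
        unfolding sum_negf[symmetric] by (intro sum.cong) auto
      also have "r + - (\<Sum>s\<in>K - {r}. c s \<triangleright> s) = u" by (subst uc(2)) simp
      finally have "(\<Sum>s\<in>K. ?c s \<triangleright> s) \<in> U" using uc(1) by (rule ssubst)
      from indep_modD[OF K(3) this r] show False by simp
    qed
    then obtain l where l: "linfun l" "\<And>u. u \<in> span (U \<union> (K - {r})) \<Longrightarrow> l u = 0" "l r = 1"
      using linfun_separating[OF subspace_span] by blast
    have "l s = 0" if "s \<in> U \<union> (K - {r})" for s using l(2)[OF span_base[OF that]] .
    then show ?thesis using l(1,3) by (intro exI[of _ l] conjI ballI) simp_all
  qed
  then obtain l where l: "\<And>r. r \<in> K \<Longrightarrow> linfun (l r) \<and> (\<forall>u\<in>U. l r u = 0) \<and>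
    (\<forall>s\<in>K. l r s = (if s = r then 1 else 0))" by metis
  have "w - (\<Sum>r\<in>K. l r w \<triangleright> r) \<in> U" if w: "w \<in> W" for w
  proof -
    have "span (U \<union> E) \<subseteq> span (U \<union> K)"
      using EK by (intro span_minimal subspace_span) (auto intro: span_base)
    then have "w \<in> span (U \<union> K)" using w E(3) by blast
    then obtain u c where uc: "u \<in> U" "w = u + (\<Sum>s\<in>K. c s \<triangleright> s)"
      using span_Un_finite[OF U fK] by blast
    have "l r w = c r" if r: "r \<in> K" for r
    proof -
      have "l r w = (\<Sum>s\<in>K. c s * l r s)"
        using l[OF r] uc(1) by (simp add: uc(2) linfun_add linfun_sum linfun_scale)
      also have "\<dots> = (\<Sum>s\<in>K. if s = r then c s else 0)" using l[OF r] by (intro sum.cong) auto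
      finally show ?thesis using fK r by simp
    qed
    then have "(\<Sum>r\<in>K. l r w \<triangleright> r) = (\<Sum>s\<in>K. c s \<triangleright> s)" by simp
    then show ?thesis using uc by simp
  qed
  then have "frame U W K l"
    unfolding frame_def using U W fK K E(2) l by (intro conjI) auto
  with K show thesis by (rule that)
qed

lemma frame_functional:
  assumes F: "frame U W K l" and m: "linfun m" "\<And>u. u \<in> U \<Longrightarrow> m u = 0" and w: "w \<in> W"
  shows "m w = (\<Sum>r\<in>K. l r w * m r)"
proof -
  have "m (w - (\<Sum>r\<in>K. l r w \<triangleright> r)) = 0" using F w m(2) unfolding frame_def by blast
  then show ?thesis by (simp add: linfun_diff linfun_sum linfun_scale m(1))
qed

text \<open>The usual exchange of two finite sums of products of matrix entries. Stability of U
  makes the entries well defined on the quotient.\<close>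

lemma frame_trace_commute:
  assumes F: "frame U W K l" and Z: "linop Z" "stable Z U" "stable Z W"
    and Y: "linop Y" "stable Y U" "stable Y W"
  shows "frame_trace K l (\<lambda>v. Z (Y v)) = frame_trace K l (\<lambda>v. Y (Z v))"
proof -
  have *: "l r (Z (Y r)) = (\<Sum>s\<in>K. l s (Y r) * l r (Z s))"
    if "linop Z" "stable Z U" "stable Y W" "r \<in> K" for Z Y r
  proof (rule frame_functional[OF F])
    show "linfun (\<lambda>v. l r (Z v))" using F that by (auto simp: frame_def intro: linfun_comp)
    show "l r (Z u) = 0" if "u \<in> U" for u
      using F \<open>r \<in> K\<close> stable_in[OF \<open>stable Z U\<close> that] unfolding frame_def by blast
    show "Y r \<in> W" using F that stable_in unfolding frame_def by blast
  qed
  have "frame_trace K l (\<lambda>v. Z (Y v)) = (\<Sum>r\<in>K. \<Sum>s\<in>K. l s (Y r) * l r (Z s))"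
    unfolding frame_trace_def using *[OF Z(1,2) Y(3)] by simp
  also have "\<dots> = (\<Sum>s\<in>K. \<Sum>r\<in>K. l r (Z s) * l s (Y r))" by (subst sum.swap) (simp add: mult.commute)
  also have "\<dots> = frame_trace K l (\<lambda>v. Y (Z v))"
    unfolding frame_trace_def using *[OF Y(1,2) Z(3)] by simp
  finally show ?thesis .
qed

text \<open>Applied to the identity, this shows that two frames of W / U have equally many
  representatives.\<close>

lemma frame_trace_unique:
  assumes F: "frame U W K l" and F': "frame U W K' l'" and Z: "linop Z" "stable Z U" "stable Z W"
  shows "frame_trace K l Z = frame_trace K' l' Z"
proof -
  have "l r (Z r) = (\<Sum>s\<in>K'. l' s r * l r (Z s))" if "r \<in> K" for r
  proof (rule frame_functional[OF F'])
    show "linfun (\<lambda>v. l r (Z v))" using F Z that by (auto simp: frame_def intro: linfun_comp)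
    show "l r (Z u) = 0" if "u \<in> U" for u
      using F \<open>r \<in> K\<close> stable_in[OF Z(2) that] unfolding frame_def by blast
    show "r \<in> W" using F that unfolding frame_def by blast
  qed
  then have "frame_trace K l Z = (\<Sum>r\<in>K. \<Sum>s\<in>K'. l' s r * l r (Z s))" by (simp add: frame_trace_def)
  also have "\<dots> = (\<Sum>s\<in>K'. \<Sum>r\<in>K. l r (Z s) * l' s r)" by (subst sum.swap) (simp add: mult.commute)
  also have "\<dots> = (\<Sum>s\<in>K'. l' s (Z s))"
  proof (rule sum.cong)
    fix s assume s: "s \<in> K'"
    show "(\<Sum>r\<in>K. l r (Z s) * l' s r) = l' s (Z s)"
      using F' s Z(3) by (intro frame_functional[OF F, symmetric]) (auto simp: frame_def stable_def)
  qed simp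
  finally show ?thesis by (simp add: frame_trace_def)
qed

text \<open>Induction on the exponent. With V = Z W + U and a projection pr onto V, the trace of Z =
  pr Z equals that of Z pr. The latter is nilpotent one step sooner, because pr already maps into
  V.\<close>

lemma frame_trace_nilpotent:
  assumes F: "frame U W K l" and "linop Z" "stable Z U" "stable Z W" and "\<And>w. w \<in> W \<Longrightarrow> (Z ^^ k) w \<in> U"
  shows "frame_trace K l Z = 0"
proof -
  have W: "subspace W" and U: "subspace U" and UW: "U \<subseteq> W" and KW: "K \<subseteq> W"
    using F by (auto simp: frame_def)
  have "frame_trace K l Z = 0"
    if "linop Z" "stable Z U" "stable Z W" "\<And>w. w \<in> W \<Longrightarrow> (Z ^^ Suc k) w \<in> U" for Z
    using that
  proof (induction k arbitrary: Z)
    case 0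
    then have "l r (Z r) = 0" if "r \<in> K" for r using F that by (auto simp: frame_def)
    then show ?case by (simp add: frame_trace_def)
  next
    case (Suc k)
    define V where "V = {Z w + u | w u. w \<in> W \<and> u \<in> U}"
    have VI: "Z w + u \<in> V" if "w \<in> W" "u \<in> U" for w u using that unfolding V_def by blast
    have VE: "\<exists>w u. w \<in> W \<and> u \<in> U \<and> v = Z w + u" if "v \<in> V" for v using that unfolding V_def by blast
    have UV: "U \<subseteq> V" using VI[of 0] W linop_zero[OF Suc.prems(1)] by (auto simp: subspace_0)
    have ZV: "Z w \<in> V" if "w \<in> W" for w using VI[OF that, of 0] U by (simp add: subspace_0)
    have VW: "V \<subseteq> W"
      using VE Suc.prems(3) UW W by (metis (no_types, lifting) stable_in subsetD subsetI subspace_add)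
    have sub: "subspace V"
      unfolding subspace_def
    proof (intro conjI ballI allI)
      show "0 \<in> V" using UV U by (auto simp: subspace_0)
      fix x assume "x \<in> V"
      then obtain w u where x: "x = Z w + u" "w \<in> W" "u \<in> U" using VE by blast
      show "c \<triangleright> x \<in> V" for c
        using VI[of "c \<triangleright> w" "c \<triangleright> u"] x U W
        by (simp add: scale_right_distrib linop_scale[OF Suc.prems(1)] subspace_scale)
      fix y assume "y \<in> V"
      then obtain w' u' where y: "y = Z w' + u'" "w' \<in> W" "u' \<in> U" using VE by blast
      show "x + y \<in> V"
        using VI[of "w + w'" "u + u'"] x y U W
        by (simp add: linop_add[OF Suc.prems(1)] subspace_add algebra_simps)
    qed
    obtain pr where pr: "linop pr" "\<And>v. pr v \<in> V" "\<And>v. v \<in> V \<Longrightarrow> pr v = v"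
      using subspace_projection[OF sub] by blast
    have prU: "stable pr U" using pr(3) UV U by (auto simp: stable_def)
    have prW: "stable pr W" using pr(2) VW W by (auto simp: stable_def)
    let ?Y = "\<lambda>v. Z (pr v)"
    have Y: "linop ?Y" "stable ?Y U" "stable ?Y W"
      using linop_comp[OF Suc.prems(1) pr(1)] prU prW Suc.prems(2,3) by (auto simp: stable_def)
    have "frame_trace K l Z = frame_trace K l (\<lambda>v. pr (Z v))"
      unfolding frame_trace_def using KW ZV pr(3) by (intro sum.cong) auto
    also have "\<dots> = frame_trace K l ?Y"
      by (rule frame_trace_commute[OF F pr(1) prU prW Suc.prems(1-3)])
    also have "\<dots> = 0"
    proof (rule Suc.IH[OF Y])
      fix w assume w: "w \<in> W"
      have pow: "(?Y ^^ Suc j) w = (Z ^^ Suc j) (pr w) \<and> (Z ^^ Suc j) (pr w) \<in> V" for j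
      proof (induction j)
        case 0
        show ?case using ZV[of "pr w"] pr(2)[of w] VW by auto
      next
        case (Suc j)
        then show ?case using ZV[of "(Z ^^ Suc j) (pr w)"] VW pr(3)[of "(Z ^^ Suc j) (pr w)"] by auto
      qed
      obtain w' u where wu: "pr w = Z w' + u" "w' \<in> W" "u \<in> U" using pr(2)[of w] VE by blast
      have "(Z ^^ Suc k) (pr w) = (Z ^^ Suc k) (Z w') + (Z ^^ Suc k) u"
        unfolding wu(1) by (rule linop_add[OF linop_funpow[OF Suc.prems(1)]])
      also have "(Z ^^ Suc k) (Z w') = (Z ^^ Suc (Suc k)) w'" by (simp only: funpow_Suc_right comp_apply)
      also have "\<dots> + (Z ^^ Suc k) u \<in> U"
        using Suc.prems(4)[OF wu(2)] stable_in[OF stable_funpow[OF Suc.prems(2)] wu(3)] U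
        by (rule_tac subspace_add)
      finally show "(?Y ^^ Suc k) w \<in> U" using pow by simp
    qed
    finally show ?case .
  qed
  moreover have "(Z ^^ Suc k) w \<in> U" if "w \<in> W" for w
    using assms(3,5) that by (auto simp: stable_def)
  ultimately show ?thesis using assms(2-4) by blast
qed

lemma frame_trace_id: "frame U W K l \<Longrightarrow> frame_trace K l (\<lambda>v. v) = of_nat (card K)"
  by (auto simp: frame_trace_def frame_def)

end

section \<open>Polynomials as a complex vector space; substitutions, ideals, derivations and
  polynomial families\<close>

section \<open>Polynomial rings\<close>

definition pmon :: "('v \<Rightarrow>\<^sub>0 nat) \<Rightarrow> 'v cpoly"
  where "pmon a = Poly_Mapping.single a 1"

definition pscale :: "complex \<Rightarrow> 'v cpoly \<Rightarrow> 'v cpoly"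
  where "pscale c f = pconst c * f"

definition mon_eval :: "('v \<Rightarrow> 'b::comm_ring_1) \<Rightarrow> ('v \<Rightarrow>\<^sub>0 nat) \<Rightarrow> 'b"
  where "mon_eval \<sigma> a = (\<Prod>i\<in>Poly_Mapping.keys a. \<sigma> i ^ Poly_Mapping.lookup a i)"

lemma pconst_add: "pconst (c + d) = pconst c + pconst d"
  by (simp add: pconst_def single_add)

lemma pconst_mult: "pconst (c * d) = pconst c * pconst d"
  by (simp add: pconst_def mult_single)

lemma pconst_0 [simp]: "pconst 0 = 0" and pconst_1 [simp]: "pconst 1 = 1"
  by (simp_all add: pconst_def)

lemma lookup_pscale [simp]: "Poly_Mapping.lookup (pscale c f) a = c * Poly_Mapping.lookup f a"
  unfolding pscale_def pconst_def mult_map_scale_conv_mult[symmetric]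
  by (simp add: Poly_Mapping.map.rep_eq when_def)

interpretation P: complex_space "pscale :: complex \<Rightarrow> 'v cpoly \<Rightarrow> 'v cpoly"
  by unfold_locales (simp_all add: pscale_def pconst_add pconst_mult algebra_simps)

lemma pscale_mult_left: "pscale c f * g = pscale c (f * g)"
  by (simp add: pscale_def mult.assoc)

lemma pscale_mult_right: "f * pscale c g = pscale c (f * g)"
  by (simp add: pscale_def mult.left_commute)

lemma pmon_add: "pmon (a + b) = pmon a * pmon b"
  by (simp add: pmon_def mult_single)

lemma pmon_0 [simp]: "pmon 0 = 1"
  by (simp add: pmon_def)

lemma lookup_pmon: "Poly_Mapping.lookup (pmon a) b = (if a = b then 1 else 0)"
  by (simp add: pmon_def lookup_single when_def)

lemma single_eq_pscale: "Poly_Mapping.single a c = pscale c (pmon a)"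
  by (simp add: pscale_def pmon_def pconst_def mult_single)

lemma pvar_eq_pmon: "pvar i = pmon (Poly_Mapping.single i 1)"
  by (simp add: pvar_def pmon_def)

lemma keys_pmon [simp]: "Poly_Mapping.keys (pmon a) = {a}"
  by (simp add: pmon_def)

lemma cpoly_expand_superset:
  assumes "finite S" "Poly_Mapping.keys f \<subseteq> S"
  shows "f = (\<Sum>a\<in>S. pscale (Poly_Mapping.lookup f a) (pmon a))"
proof (rule poly_mapping_eqI)
  fix b
  have "Poly_Mapping.lookup (\<Sum>a\<in>S. pscale (Poly_Mapping.lookup f a) (pmon a)) b
    = (\<Sum>a\<in>S. if a = b then Poly_Mapping.lookup f b else 0)"
    by (simp add: lookup_sum lookup_pmon if_distrib cong: if_cong)
  also have "\<dots> = Poly_Mapping.lookup f b" using assms by (auto simp: in_keys_iff)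
  finally show "Poly_Mapping.lookup f b =
    Poly_Mapping.lookup (\<Sum>a\<in>S. pscale (Poly_Mapping.lookup f a) (pmon a)) b" by simp
qed

lemma cpoly_expand: "f = (\<Sum>a\<in>Poly_Mapping.keys f. pscale (Poly_Mapping.lookup f a) (pmon a))"
  by (rule cpoly_expand_superset) auto

lemma cpoly_in_span_pmon: "Poly_Mapping.keys f \<subseteq> S \<Longrightarrow> f \<in> P.span (pmon ` S)"
  by (subst cpoly_expand, rule P.span_sum, rule P.span_scale, rule P.span_base) auto

lemma expo_induct [case_names zero step]:
  assumes "Q 0" "\<And>a i. Q a \<Longrightarrow> Q (a + Poly_Mapping.single i (1::nat))"
  shows "Q a"
proof (induction "\<Sum>i\<in>Poly_Mapping.keys a. Poly_Mapping.lookup a i" arbitrary: a)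
  case 0
  then have "Poly_Mapping.lookup a i = 0" for i
    by (cases "i \<in> Poly_Mapping.keys a") (auto simp: in_keys_iff)
  then have "a = 0" by (intro poly_mapping_eqI) simp
  then show ?case using assms(1) by simp
next
  case (Suc n)
  then have "\<exists>i. Poly_Mapping.lookup a i \<noteq> 0" by (metis Zero_neq_Suc sum.neutral)
  then obtain i where i: "Poly_Mapping.lookup a i \<noteq> 0" by blast
  let ?b = "a - Poly_Mapping.single i 1"
  have a: "a = ?b + Poly_Mapping.single i 1"
    using i by (intro poly_mapping_eqI) (auto simp: lookup_add lookup_minus lookup_single when_def)
  have "Poly_Mapping.keys ?b \<subseteq> Poly_Mapping.keys a" by (auto simp: in_keys_iff lookup_minus)
  then have "(\<Sum>j\<in>Poly_Mapping.keys ?b. Poly_Mapping.lookup ?b j) =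
    (\<Sum>j\<in>Poly_Mapping.keys a. Poly_Mapping.lookup ?b j)"
    by (intro sum.mono_neutral_left) (auto simp: in_keys_iff)
  moreover have "(\<Sum>j\<in>Poly_Mapping.keys a. Poly_Mapping.lookup a j) =
    (\<Sum>j\<in>Poly_Mapping.keys a. Poly_Mapping.lookup ?b j) + 1"
  proof -
    have "(\<Sum>j\<in>Poly_Mapping.keys a. Poly_Mapping.lookup a j) =
      (\<Sum>j\<in>Poly_Mapping.keys a. Poly_Mapping.lookup ?b j + Poly_Mapping.lookup (Poly_Mapping.single i (1::nat)) j)"
      by (intro sum.cong refl) (subst a, simp only: lookup_add)
    also have "\<dots> = (\<Sum>j\<in>Poly_Mapping.keys a. Poly_Mapping.lookup ?b j) + 1"
      using i by (simp add: sum.distrib lookup_single when_def in_keys_iff)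
    finally show ?thesis .
  qed
  ultimately have "Q ?b" using Suc by simp
  then show ?case using assms(2) a by metis
qed

text \<open>Substitutions and derivations are determined by their behaviour on constants, variables,
  sums and products.\<close>

lemma cpoly_induct [case_names const var add mult]:
  assumes const: "\<And>c. Q (pconst c)" and var: "\<And>i. Q (pvar i)"
    and add: "\<And>f g. Q f \<Longrightarrow> Q g \<Longrightarrow> Q (f + g)" and mult: "\<And>f g. Q f \<Longrightarrow> Q g \<Longrightarrow> Q (f * g)"
  shows "Q f"
proof -
  have one: "Q 1" using const[of 1] by simp
  have zero: "Q 0" using const[of 0] by simp
  have mon: "Q (pmon a)" for a
    by (induction a rule: expo_induct) (simp_all only: pmon_0 one pmon_add pvar_eq_pmon[symmetric] mult var)
  have "Q (\<Sum>a\<in>S. pscale (c a) (pmon a))" if "finite S" for S c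
    using that by (induction S rule: finite_induct)
      (auto simp: zero pscale_def intro!: add mult[OF const mon])
  from this[OF finite_keys, of "Poly_Mapping.lookup f" f] show ?thesis by (simp flip: cpoly_expand)
qed

subsection \<open>Evaluation\<close>

definition scalar_hom :: "(complex \<Rightarrow> 'b::comm_ring_1) \<Rightarrow> bool"
  where "scalar_hom \<phi> \<longleftrightarrow> \<phi> 1 = 1 \<and> (\<forall>x y. \<phi> (x + y) = \<phi> x + \<phi> y) \<and> (\<forall>x y. \<phi> (x * y) = \<phi> x * \<phi> y)"

lemma scalar_hom_0: "scalar_hom \<phi> \<Longrightarrow> \<phi> 0 = 0"
  unfolding scalar_hom_def by (metis add_cancel_right_right)

lemma scalar_hom_pconst: "scalar_hom pconst"
  by (simp add: scalar_hom_def pconst_add pconst_mult)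

lemma mon_eval_superset:
  assumes "finite S" "Poly_Mapping.keys a \<subseteq> S"
  shows "mon_eval \<sigma> a = (\<Prod>i\<in>S. \<sigma> i ^ Poly_Mapping.lookup a i)"
  unfolding mon_eval_def using assms by (intro prod.mono_neutral_left) (auto simp: in_keys_iff)

lemma mon_eval_add: "mon_eval \<sigma> (a + b) = mon_eval \<sigma> a * mon_eval \<sigma> b"
proof -
  let ?S = "Poly_Mapping.keys a \<union> Poly_Mapping.keys b"
  have "Poly_Mapping.keys (a + b) \<subseteq> ?S" by (rule keys_add)
  then show ?thesis
    using mon_eval_superset[of ?S "a + b" \<sigma>] mon_eval_superset[of ?S a \<sigma>] mon_eval_superset[of ?S b \<sigma>]
    by (simp add: lookup_add power_add prod.distrib)
qed

lemma mon_eval_single: "mon_eval \<sigma> (Poly_Mapping.single i k) = \<sigma> i ^ k"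
  using mon_eval_superset[of "{i}" "Poly_Mapping.single i k" \<sigma>] by simp

lemma mon_eval_0 [simp]: "mon_eval \<sigma> 0 = 1"
  by (simp add: mon_eval_def)

lemma peval_mon_eval:
  "peval \<phi> \<sigma> f = (\<Sum>a\<in>Poly_Mapping.keys f. \<phi> (Poly_Mapping.lookup f a) * mon_eval \<sigma> a)"
  by (simp add: peval_def mon_eval_def)

lemma peval_superset:
  assumes "scalar_hom \<phi>" "finite S" "Poly_Mapping.keys f \<subseteq> S"
  shows "peval \<phi> \<sigma> f = (\<Sum>a\<in>S. \<phi> (Poly_Mapping.lookup f a) * mon_eval \<sigma> a)"
  unfolding peval_mon_eval using assms
  by (intro sum.mono_neutral_left) (auto simp: in_keys_iff scalar_hom_0)

lemma peval_add:
  assumes \<phi>: "scalar_hom \<phi>"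
  shows "peval \<phi> \<sigma> (f + g) = peval \<phi> \<sigma> f + peval \<phi> \<sigma> g"
proof -
  let ?S = "Poly_Mapping.keys f \<union> Poly_Mapping.keys g"
  have "Poly_Mapping.keys (f + g) \<subseteq> ?S" by (rule keys_add)
  then show ?thesis
    using peval_superset[OF \<phi>, of ?S "f + g" \<sigma>] peval_superset[OF \<phi>, of ?S f \<sigma>]
      peval_superset[OF \<phi>, of ?S g \<sigma>] \<phi>
    by (simp add: lookup_add sum.distrib scalar_hom_def algebra_simps)
qed

lemma peval_0 [simp]: "peval \<phi> \<sigma> 0 = 0"
  by (simp add: peval_def)

lemma peval_sum: "scalar_hom \<phi> \<Longrightarrow> peval \<phi> \<sigma> (\<Sum>i\<in>K. f i) = (\<Sum>i\<in>K. peval \<phi> \<sigma> (f i))"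
  by (induction K rule: infinite_finite_induct) (auto simp: peval_add)

lemma peval_single:
  assumes "scalar_hom \<phi>" shows "peval \<phi> \<sigma> (Poly_Mapping.single a c) = \<phi> c * mon_eval \<sigma> a"
  using peval_superset[OF assms, of "{a}" "Poly_Mapping.single a c" \<sigma>] by simp

lemma peval_pmon: "scalar_hom \<phi> \<Longrightarrow> peval \<phi> \<sigma> (pmon a) = mon_eval \<sigma> a"
  by (simp add: pmon_def peval_single) (simp add: scalar_hom_def)

lemma peval_pconst: "scalar_hom \<phi> \<Longrightarrow> peval \<phi> \<sigma> (pconst c) = \<phi> c"
  by (simp add: pconst_def peval_single)

lemma peval_pvar: "scalar_hom \<phi> \<Longrightarrow> peval \<phi> \<sigma> (pvar i) = \<sigma> i"
  by (simp add: pvar_eq_pmon peval_pmon mon_eval_single)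

lemma peval_mult:
  assumes \<phi>: "scalar_hom \<phi>"
  shows "peval \<phi> \<sigma> (f * g) = peval \<phi> \<sigma> f * peval \<phi> \<sigma> g"
proof -
  have "f * g = (\<Sum>a\<in>Poly_Mapping.keys f. pscale (Poly_Mapping.lookup f a) (pmon a)) *
    (\<Sum>b\<in>Poly_Mapping.keys g. pscale (Poly_Mapping.lookup g b) (pmon b))"
    by (simp flip: cpoly_expand)
  also have "\<dots> = (\<Sum>a\<in>Poly_Mapping.keys f. \<Sum>b\<in>Poly_Mapping.keys g.
    Poly_Mapping.single (a + b) (Poly_Mapping.lookup f a * Poly_Mapping.lookup g b))"
    by (simp add: sum_product single_eq_pscale[symmetric] mult_single)
  finally have "peval \<phi> \<sigma> (f * g) = (\<Sum>a\<in>Poly_Mapping.keys f. \<Sum>b\<in>Poly_Mapping.keys g.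
    \<phi> (Poly_Mapping.lookup f a * Poly_Mapping.lookup g b) * mon_eval \<sigma> (a + b))"
    by (simp add: peval_sum[OF \<phi>] peval_single[OF \<phi>])
  also have "\<dots> = peval \<phi> \<sigma> f * peval \<phi> \<sigma> g"
    using \<phi> by (simp add: peval_mon_eval sum_product mon_eval_add scalar_hom_def mult_ac)
  finally show ?thesis .
qed

lemma cpoly_hom_unique:
  assumes "\<And>f g. h (f + g) = h f + h g" "\<And>f g. h (f * g) = h f * h g"
    and "\<And>f g. k (f + g) = k f + k g" "\<And>f g. k (f * g) = k f * k g"
    and "\<And>c. h (pconst c) = k (pconst c)" "\<And>i. h (pvar i) = k (pvar i)"
  shows "h (f :: 'v cpoly) = (k f :: 'b::comm_ring_1)"
  by (induction f rule: cpoly_induct) (auto simp: assms)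

lemmas psubst_simps = peval_add[OF scalar_hom_pconst] peval_mult[OF scalar_hom_pconst]
  peval_pconst[OF scalar_hom_pconst] peval_pvar[OF scalar_hom_pconst]
  peval_pmon[OF scalar_hom_pconst] peval_sum[OF scalar_hom_pconst]

lemma psubst_add: "psubst \<sigma> (f + g) = psubst \<sigma> f + psubst \<sigma> g"
  and psubst_mult: "psubst \<sigma> (f * g) = psubst \<sigma> f * psubst \<sigma> g"
  and psubst_pconst: "psubst \<sigma> (pconst c) = pconst c"
  and psubst_pvar: "psubst \<sigma> (pvar i) = \<sigma> i"
  and psubst_pmon: "psubst \<sigma> (pmon a) = mon_eval \<sigma> a"
  and psubst_sum: "psubst \<sigma> (\<Sum>k\<in>K. F k) = (\<Sum>k\<in>K. psubst \<sigma> (F k))"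
  by (simp_all add: psubst_def psubst_simps)

lemma psubst_pscale: "psubst \<sigma> (pscale c f) = pscale c (psubst \<sigma> f)"
  by (simp add: pscale_def psubst_mult psubst_pconst)

lemma psubst_0 [simp]: "psubst \<sigma> 0 = 0"
  by (simp add: psubst_def)

lemma psubst_1 [simp]: "psubst \<sigma> 1 = 1"
  using psubst_pconst[of \<sigma> 1] by simp

lemma psubst_diff: "psubst \<sigma> (f - g) = psubst \<sigma> f - psubst \<sigma> g"
  using psubst_add[of \<sigma> "f - g" g] by simp

lemma psubst_psubst: "psubst \<sigma> (psubst \<tau> f) = psubst (\<lambda>i. psubst \<sigma> (\<tau> i)) f"
  by (rule cpoly_hom_unique) (simp_all add: psubst_add psubst_mult psubst_pconst psubst_pvar)

lemma psubst_pvar_id: "psubst pvar f = f"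
  by (rule cpoly_hom_unique[where k = "\<lambda>f. f"]) (simp_all add: psubst_add psubst_mult psubst_pconst psubst_pvar)

lemma linop_psubst: "P.linop (psubst \<sigma>)"
  by (simp add: P.linop_def psubst_add psubst_pscale)

subsection \<open>Ideals\<close>

definition is_ideal :: "'v cpoly set \<Rightarrow> bool"
  where "is_ideal J \<longleftrightarrow> 0 \<in> J \<and> (\<forall>f\<in>J. \<forall>g\<in>J. f + g \<in> J) \<and> (\<forall>f\<in>J. \<forall>h. h * f \<in> J)"

lemma is_idealD:
  assumes "is_ideal J"
  shows "0 \<in> J" "f \<in> J \<Longrightarrow> g \<in> J \<Longrightarrow> f + g \<in> J" "f \<in> J \<Longrightarrow> h * f \<in> J"
    "f \<in> J \<Longrightarrow> f * h \<in> J" "f \<in> J \<Longrightarrow> pscale c f \<in> J" "f \<in> J \<Longrightarrow> - f \<in> J"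
    "f \<in> J \<Longrightarrow> g \<in> J \<Longrightarrow> f - g \<in> J"
proof -
  show 1: "0 \<in> J" "f \<in> J \<Longrightarrow> g \<in> J \<Longrightarrow> f + g \<in> J" and 2: "f \<in> J \<Longrightarrow> h * f \<in> J" for f g h
    using assms by (auto simp: is_ideal_def)
  show "f \<in> J \<Longrightarrow> f * h \<in> J" for f h using 2[of f h] by (simp add: mult.commute)
  show "f \<in> J \<Longrightarrow> pscale c f \<in> J" for f c using 2 by (simp add: pscale_def)
  show 3: "f \<in> J \<Longrightarrow> - f \<in> J" for f using 2[of f "- 1"] by simp
  show "f \<in> J \<Longrightarrow> g \<in> J \<Longrightarrow> f - g \<in> J" for f g using 1(2)[of f "- g"] 3 by simp
qed

lemma is_ideal_subspace: "is_ideal J \<Longrightarrow> P.subspace J"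
  by (auto simp: P.subspace_def is_idealD)

lemma cring_cpoly_ring: "cring (cpoly_ring :: 'v cpoly ring)"
  by (rule cring_from_type_algebra)

lemma cpoly_ring_sel:
  "carrier (cpoly_ring :: 'v cpoly ring) = UNIV"
  "x \<otimes>\<^bsub>(cpoly_ring :: 'v cpoly ring)\<^esub> y = x * y"
  "x \<oplus>\<^bsub>(cpoly_ring :: 'v cpoly ring)\<^esub> y = x + y"
  "\<zero>\<^bsub>(cpoly_ring :: 'v cpoly ring)\<^esub> = 0"
  by (simp_all add: ring_of_type_algebra_def)

lemma ideal_cpoly_ring: "ideal J (cpoly_ring :: 'v cpoly ring) \<longleftrightarrow> is_ideal J"
proof
  assume "ideal J (cpoly_ring :: 'v cpoly ring)"
  then interpret ideal J "cpoly_ring :: 'v cpoly ring" .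
  show "is_ideal J"
    using additive_subgroup.zero_closed[OF additive_subgroup_axioms]
      additive_subgroup.a_closed[OF additive_subgroup_axioms] I_l_closed
    by (auto simp: is_ideal_def cpoly_ring_sel)
next
  assume J: "is_ideal J"
  interpret R: cring "cpoly_ring :: 'v cpoly ring" by (rule cring_cpoly_ring)
  have inv: "\<ominus>\<^bsub>(cpoly_ring :: 'v cpoly ring)\<^esub> x = - x" for x
    using R.minus_equality[of "- x" x] by (simp add: cpoly_ring_sel)
  show "ideal J (cpoly_ring :: 'v cpoly ring)"
  proof (rule idealI)
    show "ring (cpoly_ring :: 'v cpoly ring)" by (rule R.ring_axioms)
    show "subgroup J (add_monoid (cpoly_ring :: 'v cpoly ring))"
      using is_idealD[OF J] inv[unfolded a_inv_def]
      by (intro subgroup.intro) (auto simp: cpoly_ring_sel)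
  qed (use is_idealD[OF J] in \<open>auto simp: cpoly_ring_sel\<close>)
qed

lemma genideal_cpoly_ring:
  "genideal (cpoly_ring :: 'v cpoly ring) B = \<Inter>{J. is_ideal J \<and> B \<subseteq> J}"
  by (simp add: genideal_def ideal_cpoly_ring)

lemma is_ideal_genideal: "is_ideal (genideal (cpoly_ring :: 'v cpoly ring) B)"
  unfolding genideal_cpoly_ring is_ideal_def by auto

lemma genideal_subset: "B \<subseteq> genideal (cpoly_ring :: 'v cpoly ring) B"
  unfolding genideal_cpoly_ring by auto

lemma genideal_least: "is_ideal J \<Longrightarrow> B \<subseteq> J \<Longrightarrow> genideal (cpoly_ring :: 'v cpoly ring) B \<subseteq> J"
  unfolding genideal_cpoly_ring by auto

lemma primeideal_cpoly_ring:
  "primeideal J (cpoly_ring :: 'v cpoly ring) \<longleftrightarrow>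
    is_ideal J \<and> J \<noteq> UNIV \<and> (\<forall>f g. f * g \<in> J \<longrightarrow> f \<in> J \<or> g \<in> J)"
proof
  assume p: "primeideal J (cpoly_ring :: 'v cpoly ring)"
  then interpret primeideal J "cpoly_ring :: 'v cpoly ring" .
  show "is_ideal J \<and> J \<noteq> UNIV \<and> (\<forall>f g. f * g \<in> J \<longrightarrow> f \<in> J \<or> g \<in> J)"
    using I_notcarr I_prime is_ideal ideal_cpoly_ring by (auto simp: cpoly_ring_sel)
next
  assume "is_ideal J \<and> J \<noteq> UNIV \<and> (\<forall>f g. f * g \<in> J \<longrightarrow> f \<in> J \<or> g \<in> J)"
  then show "primeideal J (cpoly_ring :: 'v cpoly ring)"
    by (intro primeidealI cring_cpoly_ring) (auto simp: ideal_cpoly_ring cpoly_ring_sel)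
qed

subsection \<open>Derivations\<close>

text \<open>The linear coefficient in an auxiliary variable \<epsilon> of f(x + \<epsilon>
  \<sigma>): polynomials in \<epsilon> serve as dual numbers, and the product rule is that for
  coefficients 0 and 1.\<close>

definition derivation :: "('v \<Rightarrow> 'v cpoly) \<Rightarrow> 'v cpoly \<Rightarrow> 'v cpoly"
  where "derivation \<sigma> f = Polynomial.coeff (peval (\<lambda>c. [:pconst c:]) (\<lambda>i. [:pvar i, \<sigma> i:]) f) 1"

lemma scalar_hom_dual: "scalar_hom (\<lambda>c. [:pconst c:])"
  by (simp add: scalar_hom_def pconst_add pconst_mult one_pCons)

lemma dual_coeff_0: "Polynomial.coeff (peval (\<lambda>c. [:pconst c:]) (\<lambda>i. [:pvar i, \<sigma> i:]) f) 0 = f"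
  by (rule cpoly_hom_unique[where k = "\<lambda>f. f"])
    (simp_all add: peval_add peval_mult peval_pconst peval_pvar scalar_hom_dual coeff_mult)

lemma derivation_add: "derivation \<sigma> (f + g) = derivation \<sigma> f + derivation \<sigma> g"
  by (simp add: derivation_def peval_add scalar_hom_dual)

lemma derivation_mult: "derivation \<sigma> (f * g) = f * derivation \<sigma> g + derivation \<sigma> f * g"
  using dual_coeff_0[of \<sigma> f] dual_coeff_0[of \<sigma> g]
  by (simp add: derivation_def peval_mult scalar_hom_dual coeff_mult)

lemma derivation_pconst: "derivation \<sigma> (pconst c) = 0"
  by (simp add: derivation_def peval_pconst scalar_hom_dual)

lemma derivation_pvar: "derivation \<sigma> (pvar i) = \<sigma> i"
  by (simp add: derivation_def peval_pvar scalar_hom_dual)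

lemma linop_derivation: "P.linop (derivation \<sigma>)"
  by (simp add: P.linop_def derivation_add pscale_def derivation_mult derivation_pconst)

subsection \<open>Polynomial curves\<close>

text \<open>The common finite support makes any functional of the family a finite combination of its
  coefficient functions (\<open>pcurve_linfun\<close>).\<close>

definition pcurve :: "('x \<Rightarrow> complex) set \<Rightarrow> ('x \<Rightarrow> 'v cpoly) \<Rightarrow> bool"
  where "pcurve \<Phi> u \<longleftrightarrow> (\<exists>B. finite B \<and> (\<forall>x. Poly_Mapping.keys (u x) \<subseteq> B) \<and>
    (\<forall>b. (\<lambda>x. Poly_Mapping.lookup (u x) b) \<in> \<Phi>))"

definition has_pderiv :: "(complex \<Rightarrow> 'v cpoly) \<Rightarrow> 'v cpoly \<Rightarrow> complex \<Rightarrow> bool"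
  where "has_pderiv u u' t \<longleftrightarrow> (\<exists>B. finite B \<and> (\<forall>x. Poly_Mapping.keys (u x) \<subseteq> B) \<and>
    (\<forall>b. ((\<lambda>x. Poly_Mapping.lookup (u x) b) has_field_derivative Poly_Mapping.lookup u' b) (at t)))"

lemma lookup_mult_superset:
  assumes "finite A" "Poly_Mapping.keys f \<subseteq> A" "finite B" "Poly_Mapping.keys g \<subseteq> B"
  shows "Poly_Mapping.lookup (f * g :: 'v cpoly) e =
    (\<Sum>a\<in>A. \<Sum>b\<in>B. if a + b = e then Poly_Mapping.lookup f a * Poly_Mapping.lookup g b else 0)"
proof -
  have "f * g = (\<Sum>a\<in>A. pscale (Poly_Mapping.lookup f a) (pmon a)) *
    (\<Sum>b\<in>B. pscale (Poly_Mapping.lookup g b) (pmon b))"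
    using cpoly_expand_superset[OF assms(1,2)] cpoly_expand_superset[OF assms(3,4)] by simp
  also have "\<dots> = (\<Sum>a\<in>A. \<Sum>b\<in>B. pscale (Poly_Mapping.lookup f a * Poly_Mapping.lookup g b) (pmon (a + b)))"
    by (simp add: sum_product pmon_add pscale_mult_left pscale_mult_right mult.commute)
  finally show ?thesis
    by (simp add: lookup_sum lookup_pmon if_distrib cong: if_cong)
qed

lemma fun_algebraD:
  assumes "P.fun_algebra \<Phi>"
  shows "(\<lambda>_. c) \<in> \<Phi>" "f \<in> \<Phi> \<Longrightarrow> g \<in> \<Phi> \<Longrightarrow> (\<lambda>x. f x + g x) \<in> \<Phi>"
    "f \<in> \<Phi> \<Longrightarrow> g \<in> \<Phi> \<Longrightarrow> (\<lambda>x. f x * g x) \<in> \<Phi>"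
  using assms by (auto simp: P.fun_algebra_def)

lemma fun_algebra_sum:
  assumes "P.fun_algebra \<Phi>" "\<And>i. i \<in> K \<Longrightarrow> f i \<in> \<Phi>"
  shows "(\<lambda>x. \<Sum>i\<in>K. f i x) \<in> \<Phi>"
  using assms(2) by (induction K rule: infinite_finite_induct) (auto intro: fun_algebraD[OF assms(1)])

lemma pcurve_const: "P.fun_algebra \<Phi> \<Longrightarrow> pcurve \<Phi> (\<lambda>_. f)"
  unfolding pcurve_def by (intro exI[of _ "Poly_Mapping.keys f"]) (auto intro: fun_algebraD)

lemma pcurve_add:
  assumes \<Phi>: "P.fun_algebra \<Phi>" and "pcurve \<Phi> u" "pcurve \<Phi> v"
  shows "pcurve \<Phi> (\<lambda>x. u x + v x)"
proof -
  obtain A B where A: "finite A" "\<And>x. Poly_Mapping.keys (u x) \<subseteq> A" "\<And>b. (\<lambda>x. Poly_Mapping.lookup (u x) b) \<in> \<Phi>"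
    and B: "finite B" "\<And>x. Poly_Mapping.keys (v x) \<subseteq> B" "\<And>b. (\<lambda>x. Poly_Mapping.lookup (v x) b) \<in> \<Phi>"
    using assms(2,3) unfolding pcurve_def by meson
  have "Poly_Mapping.keys (u x + v x) \<subseteq> A \<union> B" for x
    using keys_add[of "u x" "v x"] A(2)[of x] B(2)[of x] by blast
  then show ?thesis unfolding pcurve_def
    using A B by (intro exI[of _ "A \<union> B"]) (auto simp: lookup_add intro!: fun_algebraD[OF \<Phi>])
qed

lemma pcurve_mult:
  assumes \<Phi>: "P.fun_algebra \<Phi>" and "pcurve \<Phi> u" "pcurve \<Phi> v"
  shows "pcurve \<Phi> (\<lambda>x. u x * v x)"
proof -
  obtain A B where A: "finite A" "\<And>x. Poly_Mapping.keys (u x) \<subseteq> A" "\<And>b. (\<lambda>x. Poly_Mapping.lookup (u x) b) \<in> \<Phi>"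
    and B: "finite B" "\<And>x. Poly_Mapping.keys (v x) \<subseteq> B" "\<And>b. (\<lambda>x. Poly_Mapping.lookup (v x) b) \<in> \<Phi>"
    using assms(2,3) unfolding pcurve_def by meson
  have "Poly_Mapping.keys (u x * v x) \<subseteq> (\<lambda>(a, b). a + b) ` (A \<times> B)" for x
  proof
    fix e assume "e \<in> Poly_Mapping.keys (u x * v x)"
    then obtain a b where "e = a + b" "a \<in> Poly_Mapping.keys (u x)" "b \<in> Poly_Mapping.keys (v x)"
      using keys_mult[of "u x" "v x"] by auto
    then show "e \<in> (\<lambda>(a, b). a + b) ` (A \<times> B)" using A(2)[of x] B(2)[of x] by auto
  qed
  moreover have "(\<lambda>x. Poly_Mapping.lookup (u x * v x) e) \<in> \<Phi>" for e
  proof -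
    have "(\<lambda>x. if a + b = e then Poly_Mapping.lookup (u x) a * Poly_Mapping.lookup (v x) b else 0) \<in> \<Phi>" for a b
      by (cases "a + b = e") (auto intro: fun_algebraD[OF \<Phi>] A(3) B(3))
    then show ?thesis
      unfolding lookup_mult_superset[OF A(1,2) B(1,2)] by (intro fun_algebra_sum[OF \<Phi>])
  qed
  ultimately show ?thesis
    unfolding pcurve_def using A(1) B(1) by (intro exI[of _ "(\<lambda>(a, b). a + b) ` (A \<times> B)"]) auto
qed

lemma pcurve_sum:
  assumes "P.fun_algebra \<Phi>" "\<And>i. i \<in> K \<Longrightarrow> pcurve \<Phi> (u i)"
  shows "pcurve \<Phi> (\<lambda>x. \<Sum>i\<in>K. u i x)"
  using assms(2)
  by (induction K rule: infinite_finite_induct) (auto intro: pcurve_add[OF assms(1)] pcurve_const[OF assms(1)])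

lemma pcurve_pscale:
  assumes \<Phi>: "P.fun_algebra \<Phi>" and "g \<in> \<Phi>"
  shows "pcurve \<Phi> (\<lambda>x. pscale (g x) f)"
  unfolding pcurve_def using assms(2)
  by (intro exI[of _ "Poly_Mapping.keys f"]) (auto simp: in_keys_iff intro!: fun_algebraD[OF \<Phi>])

lemma pcurve_linop:
  assumes \<Phi>: "P.fun_algebra \<Phi>" and u: "pcurve \<Phi> u" and Z: "P.linop Z"
  shows "pcurve \<Phi> (\<lambda>x. Z (u x))"
proof -
  obtain A where A: "finite A" "\<And>x. Poly_Mapping.keys (u x) \<subseteq> A" "\<And>b. (\<lambda>x. Poly_Mapping.lookup (u x) b) \<in> \<Phi>"
    using u unfolding pcurve_def by blast
  have "Z (u x) = (\<Sum>a\<in>A. pscale (Poly_Mapping.lookup (u x) a) (Z (pmon a)))" for x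
    by (subst cpoly_expand_superset[OF A(1,2)]) (simp add: P.linop_sum[OF Z] P.linop_scale[OF Z])
  then show ?thesis by (simp add: pcurve_sum[OF \<Phi>] pcurve_pscale[OF \<Phi>] A(3))
qed

lemma pcurve_linfun:
  assumes \<Phi>: "P.fun_algebra \<Phi>" and u: "pcurve \<Phi> u" and l: "P.linfun l"
  shows "(\<lambda>x. l (u x)) \<in> \<Phi>"
proof -
  obtain A where A: "finite A" "\<And>x. Poly_Mapping.keys (u x) \<subseteq> A" "\<And>b. (\<lambda>x. Poly_Mapping.lookup (u x) b) \<in> \<Phi>"
    using u unfolding pcurve_def by blast
  have "l (u x) = (\<Sum>a\<in>A. Poly_Mapping.lookup (u x) a * l (pmon a))" for x
    by (subst cpoly_expand_superset[OF A(1,2)]) (simp add: P.linfun_sum[OF l] P.linfun_scale[OF l])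
  then show ?thesis by (auto intro!: fun_algebra_sum[OF \<Phi>] fun_algebraD[OF \<Phi>] A(3))
qed

lemma has_pderiv_const: "has_pderiv (\<lambda>_. f) 0 t"
  unfolding has_pderiv_def by (intro exI[of _ "Poly_Mapping.keys f"]) auto

lemma has_pderiv_add:
  assumes "has_pderiv u u' t" "has_pderiv v v' t"
  shows "has_pderiv (\<lambda>x. u x + v x) (u' + v') t"
proof -
  obtain A B where A: "finite A" "\<And>x. Poly_Mapping.keys (u x) \<subseteq> A"
    "\<And>b. ((\<lambda>x. Poly_Mapping.lookup (u x) b) has_field_derivative Poly_Mapping.lookup u' b) (at t)"
    and B: "finite B" "\<And>x. Poly_Mapping.keys (v x) \<subseteq> B"
    "\<And>b. ((\<lambda>x. Poly_Mapping.lookup (v x) b) has_field_derivative Poly_Mapping.lookup v' b) (at t)"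
    using assms unfolding has_pderiv_def by meson
  have "Poly_Mapping.keys (u x + v x) \<subseteq> A \<union> B" for x
    using keys_add[of "u x" "v x"] A(2)[of x] B(2)[of x] by blast
  then show ?thesis unfolding has_pderiv_def
    using A B by (intro exI[of _ "A \<union> B"]) (auto simp: lookup_add intro!: derivative_eq_intros)
qed

lemma has_pderiv_keys:
  assumes "finite A" "\<And>x. Poly_Mapping.keys (u x) \<subseteq> A"
    and "\<And>b. ((\<lambda>x. Poly_Mapping.lookup (u x) b) has_field_derivative Poly_Mapping.lookup u' b) (at t)"
  shows "Poly_Mapping.keys u' \<subseteq> A"
proof
  fix b assume b: "b \<in> Poly_Mapping.keys u'"
  show "b \<in> A"
  proof (rule ccontr)
    assume "b \<notin> A"
    then have "Poly_Mapping.lookup (u x) b = 0" for x using assms(2)[of x] by (auto simp: in_keys_iff)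
    then have "((\<lambda>_. 0) has_field_derivative Poly_Mapping.lookup u' b) (at t)" using assms(3)[of b] by simp
    then have "Poly_Mapping.lookup u' b = 0" using DERIV_const DERIV_unique by blast
    then show False using b by (simp add: in_keys_iff)
  qed
qed

lemma has_pderiv_mult:
  assumes "has_pderiv u u' t" "has_pderiv v v' t"
  shows "has_pderiv (\<lambda>x. u x * v x) (u t * v' + u' * v t) t"
proof -
  obtain A B where A: "finite A" "\<And>x. Poly_Mapping.keys (u x) \<subseteq> A"
    "\<And>b. ((\<lambda>x. Poly_Mapping.lookup (u x) b) has_field_derivative Poly_Mapping.lookup u' b) (at t)"
    and B: "finite B" "\<And>x. Poly_Mapping.keys (v x) \<subseteq> B"
    "\<And>b. ((\<lambda>x. Poly_Mapping.lookup (v x) b) has_field_derivative Poly_Mapping.lookup v' b) (at t)"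
    using assms unfolding has_pderiv_def by meson
  have u': "Poly_Mapping.keys u' \<subseteq> A" by (rule has_pderiv_keys[OF A])
  have v': "Poly_Mapping.keys v' \<subseteq> B" by (rule has_pderiv_keys[OF B])
  have "Poly_Mapping.keys (u x * v x) \<subseteq> (\<lambda>(a, b). a + b) ` (A \<times> B)" for x
  proof
    fix e assume "e \<in> Poly_Mapping.keys (u x * v x)"
    then obtain a b where "e = a + b" "a \<in> Poly_Mapping.keys (u x)" "b \<in> Poly_Mapping.keys (v x)"
      using keys_mult[of "u x" "v x"] by auto
    then show "e \<in> (\<lambda>(a, b). a + b) ` (A \<times> B)" using A(2)[of x] B(2)[of x] by auto
  qed
  moreover have "((\<lambda>x. Poly_Mapping.lookup (u x * v x) e) has_field_derivative
    Poly_Mapping.lookup (u t * v' + u' * v t) e) (at t)" for e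
  proof -
    have *: "((\<lambda>x. if a + b = e then Poly_Mapping.lookup (u x) a * Poly_Mapping.lookup (v x) b else 0)
      has_field_derivative (if a + b = e then Poly_Mapping.lookup (u t) a * Poly_Mapping.lookup v' b else 0) +
      (if a + b = e then Poly_Mapping.lookup u' a * Poly_Mapping.lookup (v t) b else 0)) (at t)" for a b
      by (cases "a + b = e") (auto intro!: derivative_eq_intros A(3) B(3))
    show ?thesis
      unfolding lookup_mult_superset[OF A(1,2) B(1,2)] lookup_add
        lookup_mult_superset[OF A(1,2) B(1) v'] lookup_mult_superset[OF A(1) u' B(1,2)]
        sum.distrib[symmetric]
      by (intro DERIV_sum *)
  qed
  ultimately show ?thesis
    unfolding has_pderiv_def using A(1) B(1) by (intro exI[of _ "(\<lambda>(a, b). a + b) ` (A \<times> B)"]) auto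
qed

lemma has_pderiv_sum:
  assumes "\<And>i. i \<in> K \<Longrightarrow> has_pderiv (u i) (u' i) t"
  shows "has_pderiv (\<lambda>x. \<Sum>i\<in>K. u i x) (\<Sum>i\<in>K. u' i) t"
  using assms by (induction K rule: infinite_finite_induct) (auto intro: has_pderiv_add has_pderiv_const)

lemma has_pderiv_pscale:
  assumes "(g has_field_derivative g') (at t)"
  shows "has_pderiv (\<lambda>x. pscale (g x) f) (pscale g' f) t"
  unfolding has_pderiv_def
  by (intro exI[of _ "Poly_Mapping.keys f"]) (auto simp: in_keys_iff intro!: derivative_eq_intros assms)

lemma has_pderiv_linfun:
  assumes u: "has_pderiv u u' t" and l: "P.linfun l"
  shows "((\<lambda>x. l (u x)) has_field_derivative l u') (at t)"
proof -
  obtain A where A: "finite A" "\<And>x. Poly_Mapping.keys (u x) \<subseteq> A"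
    "\<And>b. ((\<lambda>x. Poly_Mapping.lookup (u x) b) has_field_derivative Poly_Mapping.lookup u' b) (at t)"
    using u unfolding has_pderiv_def by blast
  have *: "l f = (\<Sum>a\<in>A. Poly_Mapping.lookup f a * l (pmon a))" if "Poly_Mapping.keys f \<subseteq> A" for f
    by (subst cpoly_expand_superset[OF A(1) that]) (simp add: P.linfun_sum[OF l] P.linfun_scale[OF l])
  have "((\<lambda>x. \<Sum>a\<in>A. Poly_Mapping.lookup (u x) a * l (pmon a)) has_field_derivative
    (\<Sum>a\<in>A. Poly_Mapping.lookup u' a * l (pmon a))) (at t)"
    by (intro DERIV_sum DERIV_cmult_right A(3))
  then show ?thesis using *[OF A(2)] *[OF has_pderiv_keys[OF A]] by simp
qed

section \<open>Linear substitutions and their infinitesimal versions; weights and degrees\<close>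

section \<open>Linear substitutions and the derivations attached to matrices\<close>

definition linform :: "'m::finite cmatrix \<Rightarrow> 'm \<Rightarrow> 'm cpoly"
  where "linform M i = (\<Sum>j\<in>UNIV. pscale (M $ i $ j) (pvar j))"

text \<open>Substitution by M itself, whereas \<open>gl_act\<close> substitutes by the inverse. It
  reverses products (\<open>psub_psub\<close>) and is defined for singular M as well, which is what
  makes it polynomial in M.\<close>

definition psub :: "'m::finite cmatrix \<Rightarrow> 'm cpoly \<Rightarrow> 'm cpoly"
  where "psub M = psubst (linform M)"

definition pder :: "'m::finite cmatrix \<Rightarrow> 'm cpoly \<Rightarrow> 'm cpoly"
  where "pder A = derivation (linform A)"

lemma gl_act_psub: "gl_act g = psub (matrix_inv g)"
  by (simp add: gl_act_def psub_def linform_def[abs_def] pscale_def)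

lemma linop_psub: "P.linop (psub M)"
  by (simp add: psub_def linop_psubst)

lemma linop_pder: "P.linop (pder A)"
  by (simp add: pder_def linop_derivation)

lemma psub_linform: "psub M (linform N i) = linform (N ** M) i"
proof -
  have "psub M (linform N i) = (\<Sum>j\<in>UNIV. \<Sum>k\<in>UNIV. pscale (N $ i $ j * M $ j $ k) (pvar k))"
    by (simp add: psub_def linform_def[of N] psubst_sum psubst_pscale psubst_pvar)
      (simp add: linform_def P.scale_sum_right)
  also have "\<dots> = linform (N ** M) i"
    by (subst sum.swap) (simp add: linform_def matrix_matrix_mult_def P.scale_sum_left)
  finally show ?thesis .
qed

lemma psub_psub: "psub M (psub N f) = psub (N ** M) f"
proof -
  have "psub M (psub N f) = psubst (\<lambda>i. psubst (linform M) (linform N i)) f"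
    by (simp add: psub_def psubst_psubst)
  also have "(\<lambda>i. psubst (linform M) (linform N i)) = linform (N ** M)"
    using psub_linform[of M N] by (auto simp: psub_def)
  finally show ?thesis by (simp add: psub_def)
qed

lemma linform_mat_1: "linform (mat 1 :: 'm::finite cmatrix) = pvar"
proof
  fix i :: "'m::finite"
  have "linform (mat 1) i = (\<Sum>j\<in>UNIV. if i = j then pvar j else (0 :: 'm cpoly))"
    unfolding linform_def mat_def by (intro sum.cong) auto
  then show "linform (mat 1) i = pvar i" by simp
qed

lemma psub_mat_1: "psub (mat 1) f = f"
  by (simp add: psub_def linform_mat_1 psubst_pvar_id)

lemma matrix_inv_cmatrix:
  assumes "invertible (g :: 'm::finite cmatrix)"
  shows "g ** matrix_inv g = mat 1" "matrix_inv g ** g = mat 1"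
  using someI_ex[OF assms[unfolded invertible_def]] by (simp_all add: matrix_inv_def)

lemma psub_matrix_inv:
  assumes "invertible g"
  shows "psub g (psub (matrix_inv g) f) = f" "psub (matrix_inv g) (psub g f) = f"
  using matrix_inv_cmatrix[OF assms] by (simp_all add: psub_psub psub_mat_1)

definition partial :: "'m \<Rightarrow> 'm cpoly \<Rightarrow> 'm cpoly"
  where "partial i = derivation (\<lambda>k. if k = i then 1 else 0)"

lemma linop_partial: "P.linop (partial i)"
  by (simp add: partial_def linop_derivation)

lemma derivation_eq_partial: "derivation \<sigma> (f :: 'm::finite cpoly) = (\<Sum>i\<in>UNIV. \<sigma> i * partial i f)"
proof (induction f rule: cpoly_induct)
  case (var i)
  have "(\<Sum>k\<in>UNIV. \<sigma> k * partial k (pvar i)) = (\<Sum>k\<in>UNIV. if k = i then \<sigma> k else 0)"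
    by (intro sum.cong) (auto simp: partial_def derivation_pvar)
  then show ?case by (simp add: derivation_pvar)
qed (simp_all add: partial_def derivation_pconst derivation_add derivation_mult algebra_simps
      sum.distrib sum_distrib_left sum_distrib_right)

lemma pder_eq_partial:
  "pder A f = (\<Sum>i\<in>UNIV. \<Sum>j\<in>UNIV. pscale (A $ i $ j) (pvar j * partial i f))"
  by (simp add: pder_def derivation_eq_partial linform_def sum_distrib_right pscale_mult_left)

lemma pder_mult: "pder A (f * g) = f * pder A g + pder A f * g"
  by (simp add: pder_def derivation_mult)

lemma pder_pvar: "pder A (pvar i) = linform A i"
  by (simp add: pder_def derivation_pvar)

lemma pder_pconst: "pder A (pconst c) = 0"
  by (simp add: pder_def derivation_pconst)

lemma pder_plus: "pder A (f + g) = pder A f + pder A g"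
  by (simp add: pder_def derivation_add)

lemma pder_mat_add: "pder (A + B) f = pder A f + pder B f"
  by (simp add: pder_eq_partial P.scale_left_distrib sum.distrib)

lemma pder_mat_cscale: "pder (cscale c A) f = pscale c (pder A f)"
  by (simp add: pder_eq_partial cscale_def P.scale_sum_right)

lemma pder_mat_0: "pder 0 f = 0"
  by (simp add: pder_eq_partial)

lemma pder_linform: "pder A (linform B i) = linform (B ** A) i"
proof -
  have "pder A (linform B i) = (\<Sum>j\<in>UNIV. \<Sum>k\<in>UNIV. pscale (B $ i $ j * A $ j $ k) (pvar k))"
    unfolding linform_def[of B] P.linop_sum[OF linop_pder] P.linop_scale[OF linop_pder] pder_pvar
    by (simp add: linform_def P.scale_sum_right)
  also have "\<dots> = linform (B ** A) i"
    by (subst sum.swap) (simp add: linform_def matrix_matrix_mult_def P.scale_sum_left)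
  finally show ?thesis .
qed

lemma linform_diff: "linform (A - B) i = linform A i - linform B i"
  by (simp add: linform_def P.scale_left_diff_distrib sum_subtractf)

text \<open>The bracket appears reversed because \<open>psub\<close> reverses products. Both sides
  are derivations, so the variables decide.\<close>

lemma pder_bracket: "pder A (pder B f) - pder B (pder A f) = pder (bracket B A) f"
proof (induction f rule: cpoly_induct)
  case (var i)
  then show ?case by (simp add: pder_pvar pder_linform bracket_def linform_diff)
qed (simp_all add: pder_pconst pder_plus pder_mult algebra_simps P.linop_zero[OF linop_pder])

lemma psub_mult: "psub M (f * g) = psub M f * psub M g"
  by (simp add: psub_def psubst_mult)

text \<open>The chain rule for a linear change of variables. Its main use is to carry weight vectors
  of a diagonal matrix to eigenvectors of a conjugate one.\<close>

lemma psub_pder: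
  assumes "N ** A' = A ** N"
  shows "psub N (pder A f) = pder A' (psub N f)"
proof (induction f rule: cpoly_induct)
  case (const c)
  then show ?case by (simp add: psub_def psubst_pconst pder_pconst)
next
  case (var i)
  then show ?case using assms by (simp add: pder_pvar psub_linform)
      (simp add: psub_def psubst_pvar flip: pder_linform assms)
qed (simp_all add: pder_plus pder_mult psub_mult P.linop_add[OF linop_psub])

subsection \<open>Diagonal matrices\<close>

text \<open>For diagonal A, the eigenvalue of \<open>pder A\<close> on the monomial with exponent a
  (\<open>pder_diagonal\<close>).\<close>

definition weight :: "'m::finite cmatrix \<Rightarrow> ('m \<Rightarrow>\<^sub>0 nat) \<Rightarrow> complex"
  where "weight A a = (\<Sum>i\<in>UNIV. A $ i $ i * of_nat (Poly_Mapping.lookup a i))"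

lemma weight_add: "weight A (a + b) = weight A a + weight A b"
  by (simp add: weight_def lookup_add algebra_simps sum.distrib)

lemma weight_single: "weight A (Poly_Mapping.single i 1) = A $ i $ i"
proof -
  have "weight A (Poly_Mapping.single i 1) = (\<Sum>j\<in>UNIV. if i = j then A $ j $ j else 0)"
    unfolding weight_def by (intro sum.cong) (auto simp: lookup_single when_def)
  then show ?thesis by simp
qed

lemma weight_0 [simp]: "weight A 0 = 0"
  by (simp add: weight_def)

lemma linform_diagonal: "diagonal_matrix A \<Longrightarrow> linform A i = pscale (A $ i $ i) (pvar i)"
proof -
  assume "diagonal_matrix A"
  then have "linform A i = (\<Sum>j\<in>UNIV. if i = j then pscale (A $ j $ j) (pvar j) else 0)"
    unfolding linform_def diagonal_matrix_def by (intro sum.cong) auto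
  then show ?thesis by simp
qed

lemma pder_diagonal:
  assumes "diagonal_matrix A"
  shows "pder A (pmon a) = pscale (weight A a) (pmon a)"
proof (induction a rule: expo_induct)
  case zero
  then show ?case using pder_pconst[of A 1] by simp
next
  case (step a i)
  have "pder A (pmon (a + Poly_Mapping.single i 1)) =
    pmon a * pscale (A $ i $ i) (pvar i) + pscale (weight A a) (pmon a) * pvar i"
    by (simp only: pmon_add pder_mult step pvar_eq_pmon[symmetric] pder_pvar linform_diagonal[OF assms])
  also have "\<dots> = pscale (weight A (a + Poly_Mapping.single i 1)) (pmon a * pvar i)"
    by (simp add: pscale_mult_left pscale_mult_right weight_add weight_single[simplified]
        P.scale_left_distrib add.commute)
  finally show ?case by (simp add: pmon_add pvar_eq_pmon)
qed

subsection \<open>Degrees\<close>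

lemma exp_degree_UNIV: "exp_degree (a :: 'm::finite \<Rightarrow>\<^sub>0 nat) = (\<Sum>i\<in>UNIV. Poly_Mapping.lookup a i)"
  unfolding exp_degree_def by (intro sum.mono_neutral_left) (auto simp: in_keys_iff)

lemma exp_degree_add: "exp_degree (a + b :: 'm::finite \<Rightarrow>\<^sub>0 nat) = exp_degree a + exp_degree b"
  by (simp add: exp_degree_UNIV lookup_add sum.distrib)

lemma exp_degree_single: "exp_degree (Poly_Mapping.single i k) = k"
  by (cases "k = 0") (simp_all add: exp_degree_def)

lemma finite_exp_degree_le: "finite {a :: 'm::finite \<Rightarrow>\<^sub>0 nat. exp_degree a \<le> d}"
proof (rule finite_imageD)
  have "Poly_Mapping.lookup a i \<le> d" if "exp_degree a \<le> d" for a :: "'m \<Rightarrow>\<^sub>0 nat" and i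
    using member_le_sum[of i UNIV "Poly_Mapping.lookup a"] that by (simp add: exp_degree_UNIV)
  then have "Poly_Mapping.lookup ` {a :: 'm \<Rightarrow>\<^sub>0 nat. exp_degree a \<le> d} \<subseteq> (UNIV \<rightarrow>\<^sub>E {..d})"
    by (auto simp: PiE_def extensional_def)
  then show "finite (Poly_Mapping.lookup ` {a :: 'm \<Rightarrow>\<^sub>0 nat. exp_degree a \<le> d})"
    by (rule finite_subset) (auto intro: finite_PiE)
  show "inj_on Poly_Mapping.lookup {a :: 'm \<Rightarrow>\<^sub>0 nat. exp_degree a \<le> d}"
    by (auto intro: inj_onI poly_mapping_eqI)
qed

text \<open>The finite-dimensional pieces of the polynomial ring that all \<open>psub M\<close> and
  \<open>pder A\<close> preserve.\<close>

definition pdeg_le :: "nat \<Rightarrow> 'm cpoly set"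
  where "pdeg_le d = {f. \<forall>a\<in>Poly_Mapping.keys f. exp_degree a \<le> d}"

lemma pdeg_le_span: "pdeg_le d = P.span (pmon ` {a. exp_degree a \<le> d})"
proof (intro equalityI subsetI)
  fix f :: "'m cpoly" assume "f \<in> pdeg_le d"
  then show "f \<in> P.span (pmon ` {a. exp_degree a \<le> d})"
    by (intro cpoly_in_span_pmon) (auto simp: pdeg_le_def)
next
  have "P.subspace (pdeg_le d :: 'm cpoly set)"
    unfolding P.subspace_def pdeg_le_def
    by (auto dest!: subsetD[OF keys_add]) (auto simp: in_keys_iff)
  then have "P.span (pmon ` {a. exp_degree a \<le> d}) \<subseteq> (pdeg_le d :: 'm cpoly set)"
    by (intro P.span_minimal) (auto simp: pdeg_le_def)
  then show "f \<in> P.span (pmon ` {a. exp_degree a \<le> d}) \<Longrightarrow> f \<in> pdeg_le d" for f :: "'m cpoly" by blast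
qed

lemma subspace_pdeg_le: "P.subspace (pdeg_le d)"
  by (simp add: pdeg_le_span)

lemma pdeg_le_ex: "\<exists>d. f \<in> pdeg_le d"
proof -
  have "exp_degree a \<le> (\<Sum>b\<in>Poly_Mapping.keys f. exp_degree b)" if "a \<in> Poly_Mapping.keys f" for a
    using that by (intro member_le_sum) auto
  then show ?thesis by (auto simp: pdeg_le_def)
qed

lemma pdeg_le_mult:
  assumes "f \<in> pdeg_le d" "g \<in> (pdeg_le e :: 'm::finite cpoly set)"
  shows "f * g \<in> pdeg_le (d + e)"
proof -
  have "exp_degree c \<le> d + e" if "c \<in> Poly_Mapping.keys (f * g)" for c
  proof -
    from that obtain a b where "c = a + b" "a \<in> Poly_Mapping.keys f" "b \<in> Poly_Mapping.keys g"
      using keys_mult[of f g] by auto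
    then show ?thesis using assms by (auto simp: pdeg_le_def exp_degree_add intro!: add_mono)
  qed
  then show ?thesis by (simp add: pdeg_le_def)
qed

lemma pmon_pdeg_le: "pmon a \<in> pdeg_le d \<longleftrightarrow> exp_degree a \<le> d"
  by (simp add: pdeg_le_def)

lemma linform_pdeg_le: "linform M i \<in> pdeg_le 1"
  unfolding linform_def
  by (intro P.subspace_sum P.subspace_scale subspace_pdeg_le)
    (simp add: pvar_eq_pmon pmon_pdeg_le exp_degree_single)

lemma linop_stable_pdeg_le:
  assumes Z: "P.linop Z" and mon: "\<And>a. Z (pmon a) \<in> pdeg_le (exp_degree a)"
  shows "P.stable Z (pdeg_le d :: 'm::finite cpoly set)"
  unfolding P.stable_def
proof (intro conjI ballI subspace_pdeg_le)
  have mono: "f \<in> pdeg_le e \<Longrightarrow> e \<le> d \<Longrightarrow> f \<in> pdeg_le d" for f :: "'m cpoly" and e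
    by (auto simp: pdeg_le_def)
  fix f :: "'m cpoly" assume f: "f \<in> pdeg_le d"
  have "Z f = (\<Sum>a\<in>Poly_Mapping.keys f. pscale (Poly_Mapping.lookup f a) (Z (pmon a)))"
    by (subst cpoly_expand) (simp add: P.linop_sum[OF Z] P.linop_scale[OF Z])
  also have "\<dots> \<in> pdeg_le d"
    using f by (intro P.subspace_sum P.subspace_scale subspace_pdeg_le mono[OF mon]) (auto simp: pdeg_le_def)
  finally show "Z f \<in> pdeg_le d" .
qed

lemma pder_stable_pdeg_le: "P.stable (pder A) (pdeg_le d)"
proof (rule linop_stable_pdeg_le[OF linop_pder])
  fix a :: "'a \<Rightarrow>\<^sub>0 nat"
  show "pder A (pmon a) \<in> pdeg_le (exp_degree a)"
  proof (induction a rule: expo_induct)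
    case zero
    then show ?case using pder_pconst[of A 1] by (simp add: pdeg_le_def)
  next
    case (step a i)
    have "pmon a * linform A i + pder A (pmon a) * pvar i \<in> pdeg_le (exp_degree a + 1)"
      using step by (intro P.subspace_add subspace_pdeg_le pdeg_le_mult linform_pdeg_le)
        (auto simp: pmon_pdeg_le pvar_eq_pmon exp_degree_single[of _ "Suc 0"])
    then show ?case
      by (simp only: pmon_add pder_mult pvar_eq_pmon[symmetric] pder_pvar exp_degree_add exp_degree_single)
  qed
qed

lemma psub_stable_pdeg_le: "P.stable (psub M) (pdeg_le d)"
proof (rule linop_stable_pdeg_le[OF linop_psub])
  fix a :: "'a \<Rightarrow>\<^sub>0 nat"
  show "psub M (pmon a) \<in> pdeg_le (exp_degree a)"
  proof (induction a rule: expo_induct)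
    case zero
    then show ?case by (simp add: psub_def pdeg_le_def)
  next
    case (step a i)
    have "psub M (pmon a) * linform M i \<in> pdeg_le (exp_degree a + 1)"
      using step by (intro pdeg_le_mult linform_pdeg_le)
    moreover have "psub M (pvar i) = linform M i" by (simp add: psub_def psubst_pvar)
    ultimately show ?case
      by (simp only: pmon_add psub_mult pvar_eq_pmon[symmetric] exp_degree_add exp_degree_single)
  qed
qed

subsection \<open>Dependence on the matrix\<close>

lemma pcurve_linform:
  fixes M :: "'x \<Rightarrow> 'm::finite cmatrix"
  assumes "P.fun_algebra \<Phi>" "\<And>i j. (\<lambda>x. M x $ i $ j) \<in> \<Phi>"
  shows "pcurve \<Phi> (\<lambda>x. linform (M x) i)"
  unfolding linform_def by (intro pcurve_sum pcurve_pscale assms)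

lemma pcurve_psub:
  fixes M :: "'x \<Rightarrow> 'm::finite cmatrix"
  assumes "P.fun_algebra \<Phi>" "\<And>i j. (\<lambda>x. M x $ i $ j) \<in> \<Phi>"
  shows "pcurve \<Phi> (\<lambda>x. psub (M x) f)"
proof (induction f rule: cpoly_induct)
  case (var i)
  show ?case using pcurve_linform[OF assms, of i] by (simp add: psub_def psubst_pvar)
qed (simp_all add: psub_def psubst_pconst psubst_add psubst_mult pcurve_const pcurve_add pcurve_mult assms)

lemma pcurve_pder:
  fixes A :: "'x \<Rightarrow> 'm::finite cmatrix"
  assumes \<Phi>: "P.fun_algebra \<Phi>" "\<And>i j. (\<lambda>x. A x $ i $ j) \<in> \<Phi>" and u: "pcurve \<Phi> u"
  shows "pcurve \<Phi> (\<lambda>x. pder (A x) (u x))"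
proof -
  have "pder (A x) (u x) = (\<Sum>i\<in>UNIV. linform (A x) i * partial i (u x))" for x
    by (simp add: pder_def derivation_eq_partial)
  then show ?thesis
    by (auto intro!: pcurve_sum[OF \<Phi>(1)] pcurve_mult[OF \<Phi>(1)] pcurve_linform[OF \<Phi>] pcurve_linop[OF \<Phi>(1) u] linop_partial)
qed

text \<open>The equation E' = A E is demanded only at the point t, so that the lemma covers the
  exponential for all t and also the straight path 1 + t A at t = 0.\<close>

lemma has_pderiv_psub:
  fixes E :: "complex \<Rightarrow> 'm::finite cmatrix"
  assumes "\<And>i j. ((\<lambda>t. E t $ i $ j) has_field_derivative (A ** E t) $ i $ j) (at t)"
  shows "has_pderiv (\<lambda>t. psub (E t) f) (psub (E t) (pder A f)) t"
proof (induction f rule: cpoly_induct)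
  case (const c)
  show ?case using has_pderiv_const[of "pconst c" t] by (simp add: psub_def psubst_pconst pder_pconst)
next
  case (var i)
  have "has_pderiv (\<lambda>t. linform (E t) i) (linform (A ** E t) i) t"
    unfolding linform_def by (intro has_pderiv_sum has_pderiv_pscale assms)
  then show ?case by (simp add: pder_pvar psub_linform) (simp add: psub_def psubst_pvar)
next
  case (add f g)
  from has_pderiv_add[OF add] show ?case by (simp add: pder_plus P.linop_add[OF linop_psub])
next
  case (mult f g)
  from has_pderiv_mult[OF mult] show ?case by (simp add: pder_mult psub_mult P.linop_add[OF linop_psub])
qed

lemma fun_algebra_range:
  fixes val :: "'p \<Rightarrow> 'x \<Rightarrow> complex"
  assumes "\<And>c. \<exists>p. \<forall>x. val p x = c" "\<And>p q. \<exists>r. \<forall>x. val r x = val p x + val q x"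
    "\<And>p q. \<exists>r. \<forall>x. val r x = val p x * val q x"
  shows "P.fun_algebra (range val)"
  unfolding P.fun_algebra_def
proof (intro conjI allI ballI)
  have mem: "f \<in> range val" if "\<exists>p. \<forall>x. val p x = f x" for f using that by (metis ext rangeI)
  show "(\<lambda>_. c) \<in> range val" for c by (rule mem) (rule assms(1))
  fix f g assume "f \<in> range val" "g \<in> range val"
  then show "(\<lambda>x. f x + g x) \<in> range val" "(\<lambda>x. f x * g x) \<in> range val"
    using assms(2,3) by (auto intro!: mem)
qed

lemma fun_algebra_mat_eval: "P.fun_algebra (range mat_eval)"
proof -
  have sh: "scalar_hom (\<lambda>c. c)" by (simp add: scalar_hom_def)
  show ?thesis
    by (rule fun_algebra_range)
      (simp_all add: mat_eval_def, (metis peval_pconst[OF sh] peval_add[OF sh] peval_mult[OF sh])+)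
qed

lemma entry_in_mat_eval: "(\<lambda>A :: 'm::finite cmatrix. A $ i $ j) \<in> range mat_eval"
proof -
  have sh: "scalar_hom (\<lambda>c. c)" by (simp add: scalar_hom_def)
  have "(\<lambda>A :: 'm cmatrix. A $ i $ j) = mat_eval (pvar (i, j))" by (auto simp: mat_eval_def peval_pvar[OF sh])
  then show ?thesis by blast
qed

lemma fun_algebra_poly: "P.fun_algebra (range poly)"
proof (rule fun_algebra_range)
  show "\<exists>p. \<forall>x. poly p x = c" for c :: complex by (rule exI[of _ "[:c:]"]) simp
  show "\<exists>r. \<forall>x. poly r x = poly p x + poly q x" for p q :: "complex poly" by (rule exI[of _ "p + q"]) simp
  show "\<exists>r. \<forall>x. poly r x = poly p x * poly q x" for p q :: "complex poly" by (rule exI[of _ "p * q"]) simp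
qed

lemma line_in_poly: "(\<lambda>t. (A + cscale t B :: 'm::finite cmatrix) $ i $ j) \<in> range poly"
proof -
  have "(\<lambda>t. (A + cscale t B) $ i $ j) = poly [:A $ i $ j, B $ i $ j:]" by (auto simp: cscale_def)
  then show ?thesis by blast
qed

section \<open>One-parameter groups of matrices and their action on a stable subspace of
  polynomials\<close>

section \<open>Matrix exponentials\<close>

definition mat_pow :: "'m::finite cmatrix \<Rightarrow> nat \<Rightarrow> 'm cmatrix"
  where "mat_pow A k = ((**) A ^^ k) (mat 1)"

definition mexp :: "'m::finite cmatrix \<Rightarrow> complex \<Rightarrow> 'm cmatrix"
  where "mexp A t = (\<chi> i j. (suminf (\<lambda>k. (mat_pow A k $ i $ j / fact k) * t ^ k)))"

lemma mat_pow_0: "mat_pow A 0 = mat 1" and mat_pow_Suc: "mat_pow A (Suc k) = A ** mat_pow A k"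
  by (simp_all add: mat_pow_def)

lemma mat_pow_Suc2: "mat_pow A (Suc k) = mat_pow A k ** A"
proof (induction k)
  case (Suc k)
  have "mat_pow A (Suc (Suc k)) = A ** (mat_pow A k ** A)" using Suc by (simp add: mat_pow_Suc)
  then show ?case by (simp add: matrix_mul_assoc mat_pow_Suc)
qed (simp add: mat_pow_Suc mat_pow_0)

lemma mat_pow_bound:
  fixes A :: "'m::finite cmatrix"
  shows "norm (mat_pow A k $ i $ j) \<le> (\<Sum>i\<in>UNIV. \<Sum>j\<in>UNIV. norm (A $ i $ j)) ^ k"
proof (induction k arbitrary: i j)
  case 0
  then show ?case by (simp add: mat_pow_0 mat_def)
next
  case (Suc k)
  let ?B = "\<Sum>i\<in>UNIV. \<Sum>j\<in>UNIV. norm (A $ i $ j)"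
  have B: "?B \<ge> 0" by (intro sum_nonneg) auto
  have "norm (mat_pow A (Suc k) $ i $ j) \<le> (\<Sum>l\<in>UNIV. norm (A $ i $ l) * norm (mat_pow A k $ l $ j))"
    unfolding mat_pow_Suc matrix_matrix_mult_def by (simp add: sum_norm_le norm_mult)
  also have "\<dots> \<le> (\<Sum>l\<in>UNIV. norm (A $ i $ l) * ?B ^ k)"
    by (intro sum_mono mult_left_mono Suc) auto
  also have "\<dots> = (\<Sum>l\<in>UNIV. norm (A $ i $ l)) * ?B ^ k" by (simp add: sum_distrib_right)
  also have "\<dots> \<le> ?B * ?B ^ k"
    using B by (intro mult_right_mono member_le_sum) (auto intro: sum_nonneg)
  finally show ?case by simp
qed

lemma summable_mexp:
  fixes A :: "'m::finite cmatrix"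
  shows "summable (\<lambda>k. (mat_pow A k $ i $ j / fact k) * t ^ k)"
proof (rule summable_comparison_test')
  let ?B = "\<Sum>i\<in>UNIV. \<Sum>j\<in>UNIV. norm (A $ i $ j)"
  show "summable (\<lambda>k. inverse (fact k) * (?B * norm t) ^ k)" by (rule summable_exp)
  fix k
  have "norm (mat_pow A k $ i $ j / fact k * t ^ k) = norm (mat_pow A k $ i $ j) * (norm t ^ k / fact k)"
    by (simp add: norm_mult norm_divide norm_power)
  also have "\<dots> \<le> ?B ^ k * (norm t ^ k / fact k)"
    by (intro mult_right_mono mat_pow_bound) auto
  finally show "norm (mat_pow A k $ i $ j / fact k * t ^ k) \<le> inverse (fact k) * (?B * norm t) ^ k"
    by (simp add: power_mult_distrib field_simps)
qed

lemma mexp_has_derivative: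
  fixes A :: "'m::finite cmatrix"
  shows "((\<lambda>t. mexp A t $ i $ j) has_field_derivative (A ** mexp A t) $ i $ j) (at t)" (is ?L)
    and "((\<lambda>t. mexp A t $ i $ j) has_field_derivative (mexp A t ** A) $ i $ j) (at t)" (is ?R)
proof -
  let ?c = "\<lambda>i j k. mat_pow A k $ i $ j / fact k"
  have "((\<lambda>t. (suminf (\<lambda>k. ?c i j k * t ^ k))) has_field_derivative (suminf (\<lambda>k. diffs (?c i j) k * t ^ k))) (at t)"
    by (rule termdiffs_strong_converges_everywhere) (rule summable_mexp)
  moreover have diffs: "diffs (?c i j) k = mat_pow A (Suc k) $ i $ j / fact k" for k
    by (simp add: diffs_def del: of_nat_Suc)
  ultimately have D: "((\<lambda>t. mexp A t $ i $ j) has_field_derivative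
    (suminf (\<lambda>k. mat_pow A (Suc k) $ i $ j / fact k * t ^ k))) (at t)"
    by (simp add: mexp_def)
  have "(suminf (\<lambda>k. mat_pow A (Suc k) $ i $ j / fact k * t ^ k)) = (suminf (\<lambda>k. \<Sum>l\<in>UNIV. A $ i $ l * (?c l j k * t ^ k)))"
    by (simp add: mat_pow_Suc matrix_matrix_mult_def sum_divide_distrib sum_distrib_right mult.assoc)
  also have "\<dots> = (\<Sum>l\<in>UNIV. (suminf (\<lambda>k. A $ i $ l * (?c l j k * t ^ k))))"
    by (intro suminf_sum summable_mult summable_mexp)
  also have "\<dots> = (\<Sum>l\<in>UNIV. A $ i $ l * (suminf (\<lambda>k. ?c l j k * t ^ k)))"
    by (intro sum.cong suminf_mult summable_mexp) auto
  also have "\<dots> = (A ** mexp A t) $ i $ j" by (simp add: mexp_def matrix_matrix_mult_def)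
  finally show ?L using D by simp
  have "(suminf (\<lambda>k. mat_pow A (Suc k) $ i $ j / fact k * t ^ k)) = (suminf (\<lambda>k. \<Sum>l\<in>UNIV. (?c i l k * t ^ k) * A $ l $ j))"
    by (intro suminf_cong) (simp add: mat_pow_Suc2 matrix_matrix_mult_def sum_divide_distrib sum_distrib_left mult_ac)
  also have "\<dots> = (\<Sum>l\<in>UNIV. (suminf (\<lambda>k. (?c i l k * t ^ k) * A $ l $ j)))"
    by (intro suminf_sum summable_mult2 summable_mexp)
  also have "\<dots> = (\<Sum>l\<in>UNIV. (suminf (\<lambda>k. ?c i l k * t ^ k)) * A $ l $ j)"
    by (intro sum.cong suminf_mult2[symmetric] summable_mexp) auto
  also have "\<dots> = (mexp A t ** A) $ i $ j" by (simp add: mexp_def matrix_matrix_mult_def)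
  finally show ?R using D by simp
qed

lemma mexp_0: "mexp A 0 = mat 1"
proof -
  have "(suminf (\<lambda>k. (mat_pow A k $ i $ j / fact k) * 0 ^ k)) = mat 1 $ i $ j" for i j
    using powser_zero[of "\<lambda>k. mat_pow A k $ i $ j / fact k"] by (simp add: mat_pow_0)
  then show ?thesis by (simp add: mexp_def vec_eq_iff)
qed

text \<open>The product has derivative 0: A is taken to the right of the first factor and to the
  left of the second, which is why \<open>mexp_has_derivative\<close> gives both forms.\<close>

lemma mexp_mult_minus:
  fixes A :: "'m::finite cmatrix"
  shows "mexp A t ** mexp A (- t) = mat 1"
proof -
  have "(mexp A t ** mexp A (- t)) $ i $ j = mat 1 $ i $ j" for i j
  proof -
    let ?f = "\<lambda>t. (mexp A t ** mexp A (- t)) $ i $ j"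
    have "(?f has_field_derivative 0) (at t within UNIV)" for t
    proof -
      have neg: "((\<lambda>t. mexp A (- t) $ l $ j) has_field_derivative - (A ** mexp A (- t)) $ l $ j) (at t)" for l
      proof -
        have "(uminus has_field_derivative - 1) (at t)" by (auto intro!: derivative_eq_intros)
        from DERIV_chain2[where f = "\<lambda>t. mexp A t $ l $ j" and g = uminus, OF mexp_has_derivative(1) this]
        show ?thesis by simp
      qed
      have "(?f has_field_derivative (\<Sum>l\<in>UNIV. mexp A t $ i $ l * - (A ** mexp A (- t)) $ l $ j +
        (mexp A t ** A) $ i $ l * mexp A (- t) $ l $ j)) (at t)"
        unfolding matrix_matrix_mult_def[of "mexp A _" "mexp A (- _)"]
        by (simp only: vec_lambda_beta, intro DERIV_sum DERIV_mult'[OF mexp_has_derivative(2) neg])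
      also have "(\<Sum>l\<in>UNIV. mexp A t $ i $ l * - (A ** mexp A (- t)) $ l $ j +
        (mexp A t ** A) $ i $ l * mexp A (- t) $ l $ j) =
        ((mexp A t ** A) ** mexp A (- t)) $ i $ j - (mexp A t ** (A ** mexp A (- t))) $ i $ j"
        by (simp add: matrix_matrix_mult_def[of "mexp A t" "A ** mexp A (- t)"]
            matrix_matrix_mult_def[of "mexp A t ** A"] sum_subtractf)
      also have "\<dots> = 0" by (simp add: matrix_mul_assoc)
      finally show ?thesis by simp
    qed
    then obtain c where "\<And>t. ?f t = c"
      using has_field_derivative_zero_constant[of UNIV ?f] by auto
    from this[of t] this[of 0] show ?thesis by (simp add: mexp_0)
  qed
  then show ?thesis by (simp add: vec_eq_iff)
qed

lemma matrix_inv_unique_cmatrix: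
  fixes g h :: "'m::finite cmatrix"
  assumes "g ** h = mat 1" "h ** g = mat 1"
  shows "invertible g" "matrix_inv g = h"
proof -
  show g: "invertible g" using assms by (auto simp: invertible_def)
  have "matrix_inv g = matrix_inv g ** (g ** h)" by (simp add: assms)
  also have "\<dots> = h" by (simp add: matrix_mul_assoc matrix_inv_cmatrix(2)[OF g])
  finally show "matrix_inv g = h" .
qed

lemma mexp_inv: "invertible (mexp A t)" "matrix_inv (mexp A t) = mexp A (- t)"
  using matrix_inv_unique_cmatrix[OF mexp_mult_minus[of A t]] mexp_mult_minus[of A "- t"] by auto

text \<open>The identity theorem; h k is the k-th derivative of the entire function h 0.\<close>

lemma entire_all_derivs_zero:
  fixes h :: "nat \<Rightarrow> complex \<Rightarrow> complex"
  assumes "\<And>k t. (h k has_field_derivative h (Suc k) t) (at t)" "\<And>k. h k 0 = 0"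
  shows "h 0 t = 0"
proof -
  have d: "(deriv ^^ k) (h 0) = h k" for k
  proof (induction k)
    case (Suc k)
    then show ?case using DERIV_imp_deriv[OF assms(1)] by auto
  qed simp
  have "h 0 holomorphic_on UNIV"
    unfolding holomorphic_on_def using assms(1) field_differentiable_at_within field_differentiable_def
    by blast
  then show ?thesis
    by (rule holomorphic_fun_eq_0_on_connected[where z = 0]) (auto simp: d assms(2))
qed

text \<open>A linear functional killing \<open>J\<close> is, along the one-parameter group, an entire function of
  \<open>t\<close> all of whose derivatives at \<open>0\<close> vanish.\<close>

lemma psub_mexp_stable:
  assumes J: "P.subspace J" and A: "\<And>f. f \<in> J \<Longrightarrow> pder A f \<in> J" and f: "f \<in> J"
  shows "psub (mexp A t) f \<in> J"
proof (rule ccontr)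
  assume "psub (mexp A t) f \<notin> J"
  then obtain l where l: "P.linfun l" "\<And>u. u \<in> J \<Longrightarrow> l u = 0" "l (psub (mexp A t) f) = 1"
    using P.linfun_separating[OF J] by metis
  define h where "h k t = l (psub (mexp A t) ((pder A ^^ k) f))" for k t
  have "(h k has_field_derivative h (Suc k) t) (at t)" for k t
    unfolding h_def using has_pderiv_linfun[OF has_pderiv_psub[OF mexp_has_derivative(1)] l(1)]
    by simp
  moreover have "h k 0 = 0" for k
  proof -
    have "(pder A ^^ k) f \<in> J" by (induction k) (auto simp: f A)
    then show ?thesis by (simp add: h_def mexp_0 psub_mat_1 l(2))
  qed
  ultimately have "h 0 t = 0" by (rule entire_all_derivs_zero)
  then show False using l(3) by (simp add: h_def)
qed

section \<open>The Lie algebra of a stabilizer as the matrices whose derivation preserves J\<close>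

section \<open>The Lie algebra of a stabilizer\<close>

definition stab_lie :: "'m::finite cpoly set \<Rightarrow> 'm cmatrix set"
  where "stab_lie J = {A. \<forall>f\<in>J. pder A f \<in> J}"

text \<open>The stabilizer only asks for an inclusion under the inverse substitution Z; here it is
  reversed. The iterates of f stay in bounded degree, so a polynomial in Z annihilates f. Cancelling
  powers of the injective Z makes its constant term nonzero, and then f is Z applied to an element
  of J.\<close>

lemma stabilizer_psub:
  assumes J: "P.subspace J" and g: "g \<in> stabilizer J" and f: "f \<in> J"
  shows "psub g f \<in> J"
proof -
  let ?Z = "psub (matrix_inv g)"
  have inv: "invertible g" and ZJ: "\<And>f. f \<in> J \<Longrightarrow> ?Z f \<in> J"
    using g by (auto simp: stabilizer_def gl_act_psub)
  have inj: "u = 0" if "?Z u = 0" for u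
    using psub_matrix_inv(1)[OF inv, of u] that P.linop_zero[OF linop_psub] by metis
  have stab: "P.stable ?Z J" using J ZJ by (simp add: P.stable_def)
  have opJ: "P.op_poly p ?Z f \<in> J" for p
    unfolding P.op_poly_def
    by (intro P.subspace_sum P.subspace_scale J P.stable_in[OF P.stable_funpow[OF stab]] f)
  obtain d where d: "f \<in> pdeg_le d" using pdeg_le_ex by blast
  have "finite (pmon ` {a :: 'a \<Rightarrow>\<^sub>0 nat. exp_degree a \<le> d})" by (simp add: finite_exp_degree_le)
  moreover have "(?Z ^^ i) f \<in> P.span (pmon ` {a. exp_degree a \<le> d})" for i
    using P.stable_in[OF P.stable_funpow[OF psub_stable_pdeg_le] d] by (simp add: pdeg_le_span)
  ultimately obtain p where p: "p \<noteq> 0" "P.op_poly p ?Z f = 0"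
    using P.krylov_dependent[OF linop_psub] by blast
  have "\<exists>w\<in>J. ?Z w = f"
    using p
  proof (induction p)
    case (pCons c r)
    have eq: "pscale c f + ?Z (P.op_poly r ?Z f) = 0"
      using pCons.prems by (simp add: P.op_poly_pCons[OF linop_psub])
    show ?case
    proof (cases "c = 0")
      case True
      then have "P.op_poly r ?Z f = 0" "r \<noteq> 0" using eq inj pCons.prems by auto
      then show ?thesis using pCons.IH by blast
    next
      case False
      let ?w = "pscale (- (1 / c)) (P.op_poly r ?Z f)"
      have e: "?Z (P.op_poly r ?Z f) = - pscale c f" using eq by (simp add: add_eq_0_iff)
      have "?Z ?w = pscale (- (1 / c)) (?Z (P.op_poly r ?Z f))" by (rule P.linop_scale[OF linop_psub])
      also have "\<dots> = f" unfolding e using False by simp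
      finally have "?Z ?w = f" .
      then show ?thesis using P.subspace_scale[OF J opJ] by blast
    qed
  qed simp
  then obtain w where "w \<in> J" "?Z w = f" by blast
  then show ?thesis using psub_matrix_inv(1)[OF inv, of w] by simp
qed

text \<open>D is chosen before the curve M: the derivative depends only on position and velocity at
  t, so it is the same along 1 + t A and along the exponential.\<close>

lemma mat_eval_deriv_exists:
  fixes X0 Y :: "'m::finite cmatrix"
  shows "\<exists>D. \<forall>M. M t = X0 \<and> (\<forall>i j. ((\<lambda>t. M t $ i $ j) has_field_derivative Y $ i $ j) (at t)) \<longrightarrow>
    ((\<lambda>t. mat_eval p (M t)) has_field_derivative D) (at t)"
proof -
  have sh: "scalar_hom (\<lambda>c. c)" by (simp add: scalar_hom_def)
  show ?thesis
  proof (induction p rule: cpoly_induct)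
    case (const c)
    show ?case by (intro exI[of _ 0]) (auto simp: mat_eval_def peval_pconst[OF sh])
  next
    case (var ij)
    show ?case
      by (cases ij, intro exI[of _ "Y $ fst ij $ snd ij"]) (auto simp: mat_eval_def peval_pvar[OF sh])
  next
    case (add f g)
    then obtain D E where D: "\<forall>M. M t = X0 \<and> (\<forall>i j. ((\<lambda>t. M t $ i $ j) has_field_derivative Y $ i $ j) (at t)) \<longrightarrow>
      ((\<lambda>t. mat_eval f (M t)) has_field_derivative D) (at t)"
      "\<forall>M. M t = X0 \<and> (\<forall>i j. ((\<lambda>t. M t $ i $ j) has_field_derivative Y $ i $ j) (at t)) \<longrightarrow>
      ((\<lambda>t. mat_eval g (M t)) has_field_derivative E) (at t)" by blast
    have eq: "mat_eval (f + g) A = mat_eval f A + mat_eval g A" for A :: "'m cmatrix"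
      by (simp add: mat_eval_def peval_add[OF sh])
    show ?case unfolding eq
      by (intro exI[of _ "D + E"] allI impI DERIV_add D[rule_format])
  next
    case (mult f g)
    then obtain D E where D: "\<forall>M. M t = X0 \<and> (\<forall>i j. ((\<lambda>t. M t $ i $ j) has_field_derivative Y $ i $ j) (at t)) \<longrightarrow>
      ((\<lambda>t. mat_eval f (M t)) has_field_derivative D) (at t)"
      "\<forall>M. M t = X0 \<and> (\<forall>i j. ((\<lambda>t. M t $ i $ j) has_field_derivative Y $ i $ j) (at t)) \<longrightarrow>
      ((\<lambda>t. mat_eval g (M t)) has_field_derivative E) (at t)" by blast
    have eq: "mat_eval (f * g) A = mat_eval f A * mat_eval g A" for A :: "'m cmatrix"
      by (simp add: mat_eval_def peval_mult[OF sh])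
    show ?case unfolding eq
    proof (intro exI[of _ "mat_eval f X0 * E + D * mat_eval g X0"] allI impI)
      fix M assume M: "M t = X0 \<and> (\<forall>i j. ((\<lambda>t. M t $ i $ j) has_field_derivative Y $ i $ j) (at t))"
      from DERIV_mult'[OF D(1)[rule_format, OF M] D(2)[rule_format, OF M]] M
      show "((\<lambda>t. mat_eval f (M t) * mat_eval g (M t)) has_field_derivative mat_eval f X0 * E + D * mat_eval g X0) (at t)"
        by simp
    qed
  qed
qed

lemma line_has_derivative:
  "((\<lambda>t. (mat 1 + cscale t A) $ i $ j) has_field_derivative A $ i $ j) (at t)"
  unfolding cscale_def by (auto intro!: derivative_eq_intros)

text \<open>A functional l killing J makes g \<mapsto> l (psub g f) a polynomial function vanishing
  on the group, with derivative l (pder A f) in direction A. Conversely the exponentials of A lie in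
  the group and have the same velocity at 0 as 1 + t A.\<close>

lemma lie_algebra_of_stabilizer:
  assumes J: "P.subspace J"
  shows "lie_algebra_of (stabilizer J) = stab_lie J"
proof (intro equalityI subsetI)
  fix A assume A: "A \<in> lie_algebra_of (stabilizer J)"
  have "pder A f \<in> J" if f: "f \<in> J" for f
  proof (rule ccontr)
    assume "pder A f \<notin> J"
    then obtain l where l: "P.linfun l" "\<And>u. u \<in> J \<Longrightarrow> l u = 0" "l (pder A f) = 1"
      using P.linfun_separating[OF J] by metis
    have "(\<lambda>g. l (psub g f)) \<in> range mat_eval"
      by (intro pcurve_linfun[OF fun_algebra_mat_eval _ l(1)] pcurve_psub[OF fun_algebra_mat_eval]
          entry_in_mat_eval)
    then obtain p where p: "\<And>g. mat_eval p g = l (psub g f)" by (metis rangeE)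
    have "\<forall>g\<in>stabilizer J. mat_eval p g = 0" by (simp add: p l(2) stabilizer_psub[OF J _ f])
    then have "((\<lambda>t. mat_eval p (mat 1 + cscale t A)) has_field_derivative 0) (at 0)"
      using A by (simp add: lie_algebra_of_def)
    moreover have "((\<lambda>t. l (psub (mat 1 + cscale t A) f)) has_field_derivative
      l (psub (mat 1 + cscale 0 A) (pder A f))) (at 0)"
    proof (rule has_pderiv_linfun[OF has_pderiv_psub l(1)])
      have "mat 1 + cscale 0 A = mat 1" by (simp add: cscale_def vec_eq_iff)
      then show "((\<lambda>t. (mat 1 + cscale t A) $ i $ j) has_field_derivative (A ** (mat 1 + cscale 0 A)) $ i $ j) (at 0)"
        for i j using line_has_derivative[of A i j 0] by simp
    qed
    ultimately have "l (psub (mat 1 + cscale 0 A) (pder A f)) = 0" unfolding p by (metis DERIV_unique)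
    then show False using l(3) by (simp add: psub_mat_1)
  qed
  then show "A \<in> stab_lie J" by (simp add: stab_lie_def)
next
  fix A assume A: "A \<in> stab_lie J"
  have stab: "mexp A t \<in> stabilizer J" for t
    using A psub_mexp_stable[OF J, of A] by (auto simp: stab_lie_def stabilizer_def gl_act_psub mexp_inv)
  have "((\<lambda>t. mat_eval p (mat 1 + cscale t A)) has_field_derivative 0) (at 0)"
    if p: "\<forall>g\<in>stabilizer J. mat_eval p g = 0" for p
  proof -
    obtain D where D: "\<And>M. M 0 = mat 1 \<Longrightarrow> (\<And>i j. ((\<lambda>t. M t $ i $ j) has_field_derivative A $ i $ j) (at 0)) \<Longrightarrow>
      ((\<lambda>t. mat_eval p (M t)) has_field_derivative D) (at 0)"
      using mat_eval_deriv_exists[of 0 "mat 1" A p] by blast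
    have "((\<lambda>t. mexp A t $ i $ j) has_field_derivative A $ i $ j) (at 0)" for i j
      using mexp_has_derivative(1)[of A i j 0] by (simp add: mexp_0)
    from D[of "mexp A", OF mexp_0 this] have "((\<lambda>t. 0) has_field_derivative D) (at 0)"
      using p stab by simp
    then have "D = 0" using DERIV_const DERIV_unique by blast
    moreover have "((\<lambda>t. mat_eval p (mat 1 + cscale t A)) has_field_derivative D) (at 0)"
      by (intro D line_has_derivative) simp
    ultimately show ?thesis by simp
  qed
  then show "A \<in> lie_algebra_of (stabilizer J)" by (simp add: lie_algebra_of_def)
qed

lemma lie_algebra_stab_lie: "P.subspace J \<Longrightarrow> lie_algebra (stab_lie J)"
  unfolding lie_algebra_def stab_lie_def cmat.subspace_def
  by (auto simp: pder_mat_0 pder_mat_add pder_mat_cscale pder_bracket[symmetric] P.subspace_0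
      intro!: P.subspace_add P.subspace_scale P.subspace_diff)

text \<open>The eigenvector condition on the transpose in terms of entries
  (\<open>row_fixing_eigen\<close>). In contrast to \<open>affine_group\<close> the corner entry is
  free, so this is closed under sums and multiples as well as products.\<close>

definition row_fixing :: "'n::finite option cmatrix set"
  where "row_fixing = {A. \<forall>j. A $ None $ Some j = 0}"

lemma row_fixing_mult_row: "A \<in> row_fixing \<Longrightarrow> (A ** B) $ None $ j = A $ None $ None * B $ None $ j"
proof -
  assume A: "A \<in> row_fixing"
  have "(A ** B) $ None $ j = (\<Sum>k\<in>UNIV. if k = None then A $ None $ k * B $ k $ j else 0)"
    unfolding matrix_matrix_mult_def vec_lambda_beta
  proof (rule sum.cong)
    show "A $ None $ k * B $ k $ j = (if k = None then A $ None $ k * B $ k $ j else 0)" for k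
      using A by (cases k) (auto simp: row_fixing_def)
  qed simp
  then show ?thesis by simp
qed

lemma row_fixing_mult: "A \<in> row_fixing \<Longrightarrow> B \<in> row_fixing \<Longrightarrow> A ** B \<in> row_fixing"
proof -
  assume A: "A \<in> row_fixing" and B: "B \<in> row_fixing"
  show ?thesis using B by (simp add: row_fixing_def[where 'n = 'a] row_fixing_mult_row[OF A])
qed

lemma row_fixing_eigen:
  "A \<in> row_fixing \<longleftrightarrow> (\<exists>c. transpose A *v axis None 1 = c *s axis None 1)"
proof -
  have "(transpose A *v axis None 1) $ j = A $ None $ j" for j
    by (simp add: matrix_vector_mult_def transpose_def axis_def if_distrib cong: if_cong)
  then show ?thesis
    unfolding row_fixing_def vec_eq_iff split_option_all by (simp add: axis_def)
qed

lemma full_lie_algebra_eq: "full_lie_algebra I = stab_lie (homogenized_ideal I)"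
  unfolding full_lie_algebra_def homogenized_ideal_def
  by (intro lie_algebra_of_stabilizer is_ideal_subspace is_ideal_genideal)

lemma affine_lie_algebra_eq: "affine_lie_algebra I = stab_lie (homogenized_ideal I) \<inter> row_fixing"
  unfolding affine_lie_algebra_def full_lie_algebra_eq row_fixing_eigen[symmetric] by auto

lemma lie_algebra_affine: "P.subspace J \<Longrightarrow> lie_algebra (stab_lie J \<inter> row_fixing)"
proof -
  assume J: "P.subspace J"
  have "A - B \<in> row_fixing" if "A \<in> row_fixing" "B \<in> row_fixing" for A B :: "'a option cmatrix"
    using that by (auto simp: row_fixing_def)
  then have "bracket A B \<in> row_fixing" if "A \<in> row_fixing" "B \<in> row_fixing" for A B :: "'a option cmatrix"
    using row_fixing_mult that by (auto simp: bracket_def)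
  moreover have "cmat.subspace row_fixing" by (auto simp: cmat.subspace_def row_fixing_def cscale_def)
  ultimately show ?thesis
    using lie_algebra_stab_lie[OF J] unfolding lie_algebra_def by (auto intro: cmat.subspace_inter)
qed

lemma affine_lie_subalgebra: "lie_subalgebra (affine_lie_algebra I) (full_lie_algebra I)"
  unfolding lie_subalgebra_def affine_lie_algebra_eq full_lie_algebra_eq homogenized_ideal_def
  by (auto intro!: lie_algebra_stab_lie lie_algebra_affine is_ideal_subspace is_ideal_genideal)

section \<open>Jordan decomposition and simultaneous diagonalization of matrices\<close>

section \<open>Jordan decomposition of matrices\<close>

context complex_space
begin

definition eigenvectors :: "('b \<Rightarrow> 'b) \<Rightarrow> 'b set"
  where "eigenvectors Z = {v. \<exists>c. Z v = c \<triangleright> v}"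

text \<open>Terms with the same eigenvalue are merged, so the pieces can be indexed by eigenvalues
  as \<open>gen_eigen_components\<close> requires.\<close>

lemma eigen_span_decompose:
  assumes Z: "linop Z" and v: "v \<in> span (eigenvectors Z)"
  shows "\<exists>M u. finite M \<and> (\<forall>\<mu>. Z (u \<mu>) = \<mu> \<triangleright> u \<mu>) \<and> v = (\<Sum>\<mu>\<in>M. u \<mu>) \<and> (\<forall>\<mu>. \<mu> \<notin> M \<longrightarrow> u \<mu> = 0)"
  using v
proof (induction rule: span_induct_alt)
  case base
  show ?case by (intro exI[of _ "{}"] exI[of _ "\<lambda>_. 0"]) (simp add: linop_zero[OF Z])
next
  case (step c x y)
  obtain M u where M: "finite M" "\<forall>\<mu>. Z (u \<mu>) = \<mu> \<triangleright> u \<mu>" "y = (\<Sum>\<mu>\<in>M. u \<mu>)"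
    "\<forall>\<mu>. \<mu> \<notin> M \<longrightarrow> u \<mu> = 0" using step by blast
  obtain \<nu> where \<nu>: "Z x = \<nu> \<triangleright> x" using step by (auto simp: eigenvectors_def)
  let ?d = "\<lambda>\<mu>. if \<mu> = \<nu> then c \<triangleright> x else 0"
  have "y = (\<Sum>\<mu>\<in>insert \<nu> M. u \<mu>)" unfolding M(3) using M(1,4) by (intro sum.mono_neutral_left) auto
  moreover have "(\<Sum>\<mu>\<in>insert \<nu> M. ?d \<mu>) = c \<triangleright> x" using M(1) by simp
  ultimately have "c \<triangleright> x + y = (\<Sum>\<mu>\<in>insert \<nu> M. u \<mu> + ?d \<mu>)" by (simp add: sum.distrib)
  moreover have "Z (u \<mu> + ?d \<mu>) = \<mu> \<triangleright> (u \<mu> + ?d \<mu>)" for \<mu>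
    using M(2) \<nu> by (simp add: linop_add[OF Z] linop_scale[OF Z] linop_zero[OF Z] scale_right_distrib mult.commute)
  ultimately show ?case using M(1,4)
    by (intro exI[of _ "insert \<nu> M"] exI[of _ "\<lambda>\<mu>. u \<mu> + ?d \<mu>"]) auto
qed

text \<open>The S-eigencomponents of w are generalized eigenvectors of Z and hence lie in U. This is
  applied to the ideal J and to the hyperplane that encodes the shape of the first row.\<close>

lemma semisimple_part_stable:
  assumes S: "linop S" and N: "linop N" and comm: "\<And>v. S (N v) = N (S v)"
    and Z: "\<And>v. Z v = S v + N v" and eig: "\<And>v. v \<in> span (eigenvectors S)"
    and nil: "\<And>v. \<exists>k. (N ^^ k) v = 0" and U: "stable Z U"
  shows "stable S U"
  unfolding stable_def
proof (intro conjI ballI)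
  show "subspace U" using U by (simp add: stable_def)
  fix w assume w: "w \<in> U"
  obtain M u where M: "finite M" "\<forall>\<mu>. S (u \<mu>) = \<mu> \<triangleright> u \<mu>" "w = (\<Sum>\<mu>\<in>M. u \<mu>)"
    using eigen_span_decompose[OF S eig] by blast
  show "S w \<in> U"
    unfolding M(3) using semisimple_stable[OF S N comm Z U M(1) _ nil] M(2) w[unfolded M(3)] by blast
qed

lemma linop_zero_on_span:
  assumes Z: "linop Z" and "\<And>b. b \<in> B \<Longrightarrow> Z b = 0" "v \<in> span B"
  shows "Z v = 0"
  using assms(3)
  by (induction rule: span_induct_alt)
    (use assms(2) in \<open>auto simp: linop_zero[OF Z] linop_add[OF Z] linop_scale[OF Z]\<close>)

lemma eigenspace_nonneg_funpow: "linop Z \<Longrightarrow> Z v = c \<triangleright> v \<Longrightarrow> (Z ^^ k) v = c ^ k \<triangleright> v"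
  by (induction k) (auto simp: linop_scale mult.commute)

end

interpretation V: complex_space "(*s) :: complex \<Rightarrow> complex ^ 'm \<Rightarrow> complex ^ 'm::finite"
  by unfold_locales (simp_all add: vec_eq_iff algebra_simps)

interpretation M: complex_space "cscale :: complex \<Rightarrow> 'm cmatrix \<Rightarrow> 'm::finite cmatrix"
  by unfold_locales

lemma linop_mv: "V.linop ((*v) A)"
  by (simp add: V.linop_linear matrix_vector_mul_linear_gen)

lemma vec_in_span_axes: "v \<in> vec.span (range (\<lambda>i. axis i 1))"
  by (subst basis_expansion[symmetric]) (intro vec.span_sum vec.span_scale vec.span_base rangeI)

lemma mv_decomposable: "V.gen_eigen_decomposable ((*v) A) v"
  by (rule V.gen_eigen_decomposable_finite_span[OF linop_mv _ vec_in_span_axes]) simp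

lemma mat_pow_mv: "mat_pow A k *v v = ((*v) A ^^ k) v"
  by (induction k) (simp_all add: mat_pow_0 mat_pow_Suc flip: matrix_vector_mul_assoc)

text \<open>A uniform exponent is obtained by adding up the exponents for the coordinate
  vectors.\<close>

lemma nilpotent_iff: "nilpotent A \<longleftrightarrow> (\<forall>v. \<exists>k. ((*v) A ^^ k) v = 0)"
proof
  assume "nilpotent A"
  then obtain k where "mat_pow A k = 0" by (auto simp: nilpotent_def mat_pow_def)
  then have "((*v) A ^^ k) v = 0" for v using mat_pow_mv[of A k v] by simp
  then show "\<forall>v. \<exists>k. ((*v) A ^^ k) v = 0" by blast
next
  assume "\<forall>v. \<exists>k. ((*v) A ^^ k) v = 0"
  then have "\<forall>i. \<exists>k. ((*v) A ^^ k) (axis i 1) = 0" by blast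
  then obtain k where k: "\<And>i. ((*v) A ^^ k i) (axis i 1) = 0" by metis
  let ?n = "\<Sum>i\<in>UNIV. k i"
  have axes: "((*v) A ^^ ?n) (axis i 1) = 0" for i
    by (rule V.funpow_eq_zero_mono[OF linop_mv k], rule member_le_sum) simp_all
  have "((*v) A ^^ ?n) v = 0" for v
    by (rule V.linop_zero_on_span[OF V.linop_funpow[OF linop_mv] _ vec_in_span_axes]) (use axes in auto)
  then have "mat_pow A ?n = 0" by (auto simp only: matrix_eq mat_pow_mv matrix_vector_mult_0)
  then show "nilpotent A" by (auto simp: nilpotent_def mat_pow_def)
qed

lemma linop_matrix: "V.linop f \<Longrightarrow> matrix f *v v = f v"
  unfolding V.linop_linear by (rule matrix_works)

text \<open>The last clause pins S down on all generalized eigenvectors; it is what later shows that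
  a diagonalizable matrix is its own semisimple part.\<close>

lemma jordan_decomposition:
  fixes A :: "'m::finite cmatrix"
  obtains S N where "A = S + N" "\<And>v. v \<in> vec.span (V.eigenvectors ((*v) S))" "nilpotent N"
    "\<And>B. A ** B = B ** A \<Longrightarrow> S ** B = B ** S"
    "\<And>\<mu> k v. (V.shift ((*v) A) \<mu> ^^ k) v = 0 \<Longrightarrow> S *v v = \<mu> *s v"
proof -
  obtain f where f: "V.linop f" "\<And>\<mu> k v. (V.shift ((*v) A) \<mu> ^^ k) v = 0 \<Longrightarrow> f v = \<mu> *s v"
    by (rule V.semisimple_part_exists[OF linop_mv mv_decomposable]) blast
  define S where "S = matrix f"
  have S: "S *v v = f v" for v unfolding S_def by (rule linop_matrix[OF f(1)])
  have Sf: "(*v) S = f" using S by auto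
  show thesis
  proof (rule that[of S "A - S"])
    show "A = S + (A - S)" by simp
    show "v \<in> vec.span (V.eigenvectors ((*v) S))" for v
    proof -
      obtain M u where M: "finite M" "\<forall>\<mu>\<in>M. \<exists>k. (V.shift ((*v) A) \<mu> ^^ k) (u \<mu>) = 0" "v = (\<Sum>\<mu>\<in>M. u \<mu>)"
        using mv_decomposable[of A v] unfolding V.gen_eigen_decomposable_def by blast
      have "u \<mu> \<in> V.eigenvectors ((*v) S)" if "\<mu> \<in> M" for \<mu>
        using M(2) that f(2) unfolding V.eigenvectors_def Sf by blast
      then show ?thesis unfolding M(3) by (intro vec.span_sum vec.span_base)
    qed
    have "(*v) (A - S) = (\<lambda>v. A *v v - f v)" using S by (auto simp: matrix_vector_mult_diff_rdistrib)
    then show "nilpotent (A - S)"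
      using V.nilpotent_part_locally_nilpotent[OF linop_mv mv_decomposable f] by (simp add: nilpotent_iff)
    show "S ** B = B ** S" if "A ** B = B ** A" for B
    proof -
      have "(A ** B) *v v = (B ** A) *v v" for v using that by simp
      then have AB: "A *v (B *v v) = B *v (A *v v)" for v by (simp only: matrix_vector_mul_assoc)
      have "f (B *v v) = B *v f v" for v
        by (rule V.semisimple_part_commute[where Z = "(*v) A" and Y = "(*v) B",
            OF linop_mv mv_decomposable f linop_mv AB])
      then have "(S ** B) *v v = (B ** S) *v v" for v
        by (simp only: matrix_vector_mul_assoc[symmetric] S)
      then show ?thesis by (subst matrix_eq) blast
    qed
    show "(V.shift ((*v) A) \<mu> ^^ k) v = 0 \<Longrightarrow> S *v v = \<mu> *s v" for \<mu> k v
      unfolding S by (rule f(2))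
  qed
qed

lemma matrix_mult_axis_column: "(Q *v axis i 1) $ j = (Q :: complex ^ 'm::finite ^ 'm) $ j $ i"
  by (simp add: matrix_vector_mult_def axis_def if_distrib cong: if_cong)

text \<open>A given joint eigenvector e is extended to a basis of joint eigenvectors and placed at
  position i0. With e = e_0 this keeps the diagonalizing matrix inside the affine group.\<close>

lemma joint_eigenbasis:
  fixes T :: "'m::finite cmatrix set" and e :: "complex ^ 'm" and i0 :: 'm
  defines "E \<equiv> {v. \<forall>A\<in>T. \<exists>c. A *v v = c *s v}"
  assumes E: "vec.span E = UNIV" and e: "e \<in> E" "e \<noteq> 0"
  obtains Q where "invertible Q" "Q *v axis i0 1 = e"
    "\<And>A. A \<in> T \<Longrightarrow> diagonal_matrix (matrix_inv Q ** A ** Q)"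
proof -
  have "vec.independent {e}" using e by simp
  then obtain B where B: "{e} \<subseteq> B" "B \<subseteq> E" "vec.independent B" "E \<subseteq> vec.span B"
    using vec.maximal_independent_subset_extend[of "{e}" E] e by auto
  have "vec.span E \<subseteq> vec.span B" by (rule vec.span_minimal[OF B(4) vec.subspace_span])
  then have spB: "vec.span B = UNIV" using E by auto
  have fB: "finite B" using vec.finiteI_independent B(3) by blast
  have "card B = vec.dim (UNIV :: (complex ^ 'm) set)"
    using vec.basis_card_eq_dim[of B UNIV] B(3) spB by simp
  then have "card B = card (UNIV :: 'm set)" by (simp add: vec.dim_UNIV card_cart_basis vec.dimension_def)
  then have "card (B - {e}) = card (UNIV - {i0})" using fB B(1) by simp
  then obtain g where g: "bij_betw g (UNIV - {i0}) (B - {e})"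
    using fB by (metis finite_Diff finite_class.finite_UNIV finite_same_card_bij)
  define f where "f = g(i0 := e)"
  have fB2: "f ` UNIV = B"
    using g B(1) by (auto simp: f_def bij_betw_def)
  define Q where "Q = (\<chi> i j. f j $ i)"
  have col: "Q *v axis j 1 = f j" for j by (simp add: vec_eq_iff matrix_mult_axis_column Q_def)
  have "columns Q = B" using fB2 by (auto simp: columns_def column_def Q_def vec_lambda_eta)
  then have "\<exists>R. Q ** R = mat 1" using spB by (simp add: matrix_right_invertible_span_columns)
  then obtain R where R: "Q ** R = mat 1" by blast
  then have R': "R ** Q = mat 1" by (simp add: matrix_left_right_inverse)
  have inv: "invertible Q" "matrix_inv Q = R" using matrix_inv_unique_cmatrix[OF R R'] by auto
  show thesis
  proof (rule that[OF inv(1)])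
    show "Q *v axis i0 1 = e" by (simp add: col f_def)
    fix A assume A: "A \<in> T"
    have "(matrix_inv Q ** A ** Q) $ i $ j = 0" if "i \<noteq> j" for i j
    proof -
      have "f j \<in> E" using fB2 B(2) by blast
      then obtain c where c: "A *v f j = c *s f j" using A by (auto simp: E_def)
      have "(matrix_inv Q ** A ** Q) *v axis j 1 = matrix_inv Q *v (A *v f j)"
        by (simp add: col flip: matrix_vector_mul_assoc)
      also have "\<dots> = c *s ((R ** Q) *v axis j 1)"
        by (simp add: c inv(2) V.linop_scale[OF linop_mv] col flip: matrix_vector_mul_assoc)
      finally have "(matrix_inv Q ** A ** Q) $ i $ j = (c *s axis j 1) $ i"
        by (simp add: R' flip: matrix_mult_axis_column)
      then show ?thesis using that by (simp add: axis_def)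
    qed
    then show "diagonal_matrix (matrix_inv Q ** A ** Q)" by (simp add: diagonal_matrix_def)
  qed
qed

lemma diagonal_matrix_mv_axis: "diagonal_matrix D \<Longrightarrow> D *v axis j 1 = D $ j $ j *s axis j 1"
  by (simp add: vec_eq_iff matrix_mult_axis_column diagonal_matrix_def) (simp add: axis_def)

lemma diagonalizable_iff: "diagonalizable (A :: 'm::finite cmatrix) \<longleftrightarrow> vec.span (V.eigenvectors ((*v) A)) = UNIV"
proof
  assume "diagonalizable A"
  then obtain P :: "'m cmatrix" where P: "invertible P" "diagonal_matrix (P ** A ** matrix_inv P)"
    unfolding diagonalizable_def by blast
  let ?R = "matrix_inv P" and ?D = "P ** A ** matrix_inv P"
  have "?R *v axis j 1 \<in> V.eigenvectors ((*v) A)" for j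
  proof -
    have "A *v (?R *v axis j 1) = ?R *v (?D *v axis j 1)"
      using matrix_inv_cmatrix[OF P(1)] by (simp add: matrix_vector_mul_assoc matrix_mul_assoc)
    also have "\<dots> = ?D $ j $ j *s (?R *v axis j 1)"
      by (simp only: diagonal_matrix_mv_axis[OF P(2)] V.linop_scale[OF linop_mv])
    finally show ?thesis by (auto simp: V.eigenvectors_def)
  qed
  then have "?R *v (\<Sum>j\<in>UNIV. (P *v v) $ j *s axis j 1) \<in> vec.span (V.eigenvectors ((*v) A))" for v
    unfolding V.linop_sum[OF linop_mv] V.linop_scale[OF linop_mv]
    by (intro vec.span_sum vec.span_scale vec.span_base)
  then show "vec.span (V.eigenvectors ((*v) A)) = UNIV"
    using matrix_inv_cmatrix[OF P(1)] by (auto simp: basis_expansion matrix_vector_mul_assoc)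
next
  assume sp: "vec.span (V.eigenvectors ((*v) A)) = UNIV"
  \<comment> \<open>\<open>joint_eigenbasis\<close> wants a starting vector; here any nonzero
    eigenvector serves.\<close>
  have "\<exists>e\<in>V.eigenvectors ((*v) A). e \<noteq> 0"
  proof (rule ccontr)
    assume "\<not> ?thesis"
    then have "V.eigenvectors ((*v) A) \<subseteq> {0}" by blast
    then have "vec.span (V.eigenvectors ((*v) A)) \<subseteq> {0}" by (intro vec.span_minimal) auto
    then have "(axis undefined 1 :: complex ^ 'm) = 0" using sp by blast
    then show False by (simp add: axis_eq_0_iff)
  qed
  then obtain e where e: "e \<in> V.eigenvectors ((*v) A)" "e \<noteq> 0" by blast
  have eq: "V.eigenvectors ((*v) A) = {v. \<forall>B\<in>{A}. \<exists>c. B *v v = c *s v}" by (auto simp: V.eigenvectors_def)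
  obtain Q :: "'m cmatrix" where Q: "invertible Q" "diagonal_matrix (matrix_inv Q ** A ** Q)"
    by (rule joint_eigenbasis[of "{A}" e undefined, folded eq, OF sp e]) blast
  have "invertible (matrix_inv Q)" "matrix_inv (matrix_inv Q) = Q"
    using matrix_inv_unique_cmatrix[of "matrix_inv Q" Q] matrix_inv_cmatrix[OF Q(1)] by auto
  then show "diagonalizable A" using Q(2) by (auto simp: diagonalizable_def)
qed

text \<open>For a new matrix A, a joint eigenvector v of F is split into eigenvectors of A. The
  eigenspaces of the members of F are stable under A, because the matrices commute, so they contain
  the pieces of v.\<close>

lemma joint_eigenvectors_span_finite:
  fixes F :: "'m::finite cmatrix set"
  assumes "finite F" "\<And>A. A \<in> F \<Longrightarrow> diagonalizable A" "\<And>A B. A \<in> F \<Longrightarrow> B \<in> F \<Longrightarrow> A ** B = B ** A"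
  shows "vec.span {v. \<forall>A\<in>F. \<exists>c. A *v v = c *s v} = UNIV"
  using assms
proof (induction F rule: finite_induct)
  case empty
  show ?case by (simp add: vec.span_UNIV)
next
  case (insert A F)
  let ?E = "\<lambda>F :: 'm cmatrix set. {v. \<forall>A\<in>F. \<exists>c. A *v v = c *s v}"
  have IH: "vec.span (?E F) = UNIV" using insert by auto
  have "v \<in> vec.span (?E (insert A F))" if v: "v \<in> ?E F" for v
  proof -
    have "v \<in> vec.span (V.eigenvectors ((*v) A))" using insert.prems(1) diagonalizable_iff by blast
    then obtain M u where M: "finite M" "\<forall>\<mu>. A *v u \<mu> = \<mu> *s u \<mu>" "v = (\<Sum>\<mu>\<in>M. u \<mu>)"
      using V.eigen_span_decompose[OF linop_mv] by blast
    have "u \<mu> \<in> ?E (insert A F)" if \<mu>: "\<mu> \<in> M" for \<mu>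
    proof -
      have "\<exists>c. B *v u \<mu> = c *s u \<mu>" if B: "B \<in> F" for B
      proof -
        obtain c where c: "B *v v = c *s v" using v B by blast
        have "V.stable ((*v) A) {w. B *v w = c *s w}"
        proof -
          have "B *v (A *v w) = A *v (B *v w)" for w
            using insert.prems(2)[of A B] B by (simp add: matrix_vector_mul_assoc)
          then show ?thesis
            by (auto simp: V.stable_def vec.subspace_def V.linop_zero[OF linop_mv] V.linop_add[OF linop_mv]
                V.linop_scale[OF linop_mv] vec.scale_right_distrib mult.commute)
        qed
        moreover have "(V.shift ((*v) A) \<mu> ^^ 1) (u \<mu>) = 0" for \<mu> using M(2) by (simp add: V.shift_def)
        moreover have "(\<Sum>\<mu>\<in>M. u \<mu>) \<in> {w. B *v w = c *s w}" using c M(3) by simp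
        ultimately have "u \<mu> \<in> {w. B *v w = c *s w}"
          using V.gen_eigen_components[OF linop_mv _ M(1) _ _ \<mu>] by metis
        then show ?thesis by blast
      qed
      then show ?thesis using M(2) by auto
    qed
    then show ?thesis unfolding M(3) by (intro vec.span_sum vec.span_base)
  qed
  then have "vec.span (?E F) \<subseteq> vec.span (?E (insert A F))" by (intro vec.span_minimal vec.subspace_span) auto
  then show ?case using IH by auto
qed

definition mat_unit :: "'m \<Rightarrow> 'm \<Rightarrow> 'm::finite cmatrix"
  where "mat_unit i j = (\<chi> k l. if k = i \<and> l = j then 1 else 0)"

lemma cmat_in_span_units: "(A :: 'm::finite cmatrix) \<in> cmat.span (range (\<lambda>(i, j). mat_unit i j))"
proof -
  have "A = (\<Sum>ij\<in>UNIV. cscale (A $ fst ij $ snd ij) (mat_unit (fst ij) (snd ij)))"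
  proof -
    have "cscale (A $ fst ij $ snd ij) (mat_unit (fst ij) (snd ij)) $ k $ l =
      (if ij = (k, l) then A $ k $ l else 0)" for ij k l
      by (cases ij) (auto simp: cscale_def mat_unit_def)
    then show ?thesis by (simp add: vec_eq_iff sum_component)
  qed
  also have "\<dots> \<in> cmat.span (range (\<lambda>(i, j). mat_unit i j))"
    by (intro cmat.span_sum cmat.span_scale cmat.span_base) auto
  finally show ?thesis .
qed

lemma cmat_independent_finite: "cmat.independent B \<Longrightarrow> finite (B :: 'm::finite cmatrix set)"
  using cmat.independent_span_bound[of "range (\<lambda>(i, j). mat_unit i j)" B] cmat_in_span_units by auto

lemma cmat_finite_spanning:
  obtains B where "B \<subseteq> T" "finite (B :: 'm::finite cmatrix set)" "T \<subseteq> cmat.span B" "cmat.independent B"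
  using cmat.maximal_independent_subset[of T] cmat_independent_finite by metis

text \<open>A joint eigenvector of a finite subset spanning T linearly is one for all of T.\<close>

lemma joint_eigenvectors_span:
  fixes T :: "'m::finite cmatrix set"
  assumes "\<And>A. A \<in> T \<Longrightarrow> diagonalizable A" "\<And>A B. A \<in> T \<Longrightarrow> B \<in> T \<Longrightarrow> A ** B = B ** A"
  shows "vec.span {v. \<forall>A\<in>T. \<exists>c. A *v v = c *s v} = UNIV"
proof -
  obtain B where B: "B \<subseteq> T" "finite B" "T \<subseteq> cmat.span B" by (rule cmat_finite_spanning)
  have "{v. \<forall>A\<in>B. \<exists>c. A *v v = c *s v} \<subseteq> {v. \<forall>A\<in>T. \<exists>c. A *v v = c *s v}"
  proof (intro subsetI CollectI ballI)
    fix v A assume v: "v \<in> {v. \<forall>A\<in>B. \<exists>c. A *v v = c *s v}" and "A \<in> T"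
    then have "A \<in> cmat.span B" using B(3) by blast
    then show "\<exists>c. A *v v = c *s v"
    proof (induction rule: cmat.span_induct_alt)
      case base
      show ?case by (intro exI[of _ 0]) simp
    next
      case (step c x y)
      then obtain a b where "x *v v = a *s v" "y *v v = b *s v" using v by blast
      moreover have "cscale c x *v v = c *s (x *v v)"
        by (simp add: vec_eq_iff matrix_vector_mult_def cscale_def sum_distrib_left mult.assoc)
      ultimately show ?case
        by (intro exI[of _ "c * a + b"]) (simp add: matrix_vector_mult_add_rdistrib vec.scale_left_distrib)
    qed
  qed
  then have "vec.span {v. \<forall>A\<in>B. \<exists>c. A *v v = c *s v} \<subseteq> vec.span {v. \<forall>A\<in>T. \<exists>c. A *v v = c *s v}"
    by (rule vec.span_mono)
  moreover have "vec.span {v. \<forall>A\<in>B. \<exists>c. A *v v = c *s v} = UNIV"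
    by (rule joint_eigenvectors_span_finite[OF B(2)]) (use assms B(1) in blast)+
  ultimately show ?thesis by blast
qed

lemma cscale_mv: "cscale c A *v v = c *s (A *v v)"
  by (simp add: vec_eq_iff matrix_vector_mult_def cscale_def sum_distrib_left mult.assoc)

lemma diagonalizable_add:
  assumes "diagonalizable A" "diagonalizable B" "A ** B = B ** A"
  shows "diagonalizable (A + B)"
proof -
  have "vec.span {v. \<forall>C\<in>{A, B}. \<exists>c. C *v v = c *s v} = UNIV"
    using assms by (intro joint_eigenvectors_span) auto
  moreover have "{v. \<forall>C\<in>{A, B}. \<exists>c. C *v v = c *s v} \<subseteq> V.eigenvectors ((*v) (A + B))"
  proof
    fix v assume "v \<in> {v. \<forall>C\<in>{A, B}. \<exists>c. C *v v = c *s v}"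
    then obtain a b where "A *v v = a *s v" "B *v v = b *s v" by auto
    then have "(A + B) *v v = (a + b) *s v"
      by (simp only: matrix_vector_mult_add_rdistrib vec.scale_left_distrib)
    then show "v \<in> V.eigenvectors ((*v) (A + B))" unfolding V.eigenvectors_def by blast
  qed
  ultimately show ?thesis unfolding diagonalizable_iff using vec.span_mono by blast
qed

lemma diagonalizable_cscale:
  assumes "diagonalizable A" shows "diagonalizable (cscale c A)"
proof -
  have "V.eigenvectors ((*v) A) \<subseteq> V.eigenvectors ((*v) (cscale c A))"
  proof
    fix v assume "v \<in> V.eigenvectors ((*v) A)"
    then obtain a where "A *v v = a *s v" by (auto simp: V.eigenvectors_def)
    then have "cscale c A *v v = (c * a) *s v" by (simp add: cscale_mv)
    then show "v \<in> V.eigenvectors ((*v) (cscale c A))" unfolding V.eigenvectors_def by blast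
  qed
  then show ?thesis using assms vec.span_mono unfolding diagonalizable_iff by blast
qed

lemma diagonalizable_0: "diagonalizable (0 :: 'm::finite cmatrix)"
proof -
  have "V.eigenvectors ((*v) (0 :: 'm cmatrix)) = UNIV" by (auto simp: V.eigenvectors_def intro!: exI[of _ 0])
  then show ?thesis unfolding diagonalizable_iff by (simp only: vec.span_UNIV)
qed

lemma diagonalizable_nilpotent_0:
  assumes "diagonalizable A" "nilpotent A" shows "A = 0"
proof -
  have "A *v v = 0" if v: "v \<in> V.eigenvectors ((*v) A)" for v
  proof -
    obtain c where c: "A *v v = c *s v" using v by (auto simp: V.eigenvectors_def)
    obtain k where "((*v) A ^^ k) v = 0" using assms(2) nilpotent_iff by blast
    then have "c ^ k *s v = 0" using V.eigenspace_nonneg_funpow[OF linop_mv c] by simp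
    then show ?thesis using c by auto
  qed
  then have "A *v v = 0" for v
    using assms(1) V.linop_zero_on_span[OF linop_mv, of "V.eigenvectors ((*v) A)" A v]
    by (simp add: diagonalizable_iff)
  then show ?thesis by (subst matrix_eq) simp
qed

lemma diagonalizable_eq_semisimple_part:
  assumes "diagonalizable A" "\<And>\<mu> k v. (V.shift ((*v) A) \<mu> ^^ k) v = 0 \<Longrightarrow> S *v v = \<mu> *s v"
  shows "S = A"
proof -
  have "S *v v = A *v v" if v: "v \<in> V.eigenvectors ((*v) A)" for v
  proof -
    obtain c where c: "A *v v = c *s v" using v by (auto simp: V.eigenvectors_def)
    then have "(V.shift ((*v) A) c ^^ 1) v = 0" by (simp add: V.shift_def)
    from assms(2)[OF this] c show ?thesis by simp
  qed
  then have "S *v v = A *v v" for v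
    using assms(1) V.linop_eq_on_span[OF linop_mv linop_mv, of "V.eigenvectors ((*v) A)" S A v]
    by (simp add: diagonalizable_iff)
  then show ?thesis by (subst matrix_eq) simp
qed

section \<open>Fitting null components of ad x, and why they are Cartan subalgebras for generic
  x\<close>

section \<open>Regular elements and Cartan subalgebras\<close>

lemma matrix_diff_ldistrib: "A ** (B - C) = A ** B - A ** (C :: 'm::finite cmatrix)"
  by (simp add: matrix_matrix_mult_def vec_eq_iff algebra_simps sum_subtractf)

lemma matrix_diff_rdistrib: "(A - B) ** C = A ** C - B ** (C :: 'm::finite cmatrix)"
  by (simp add: matrix_matrix_mult_def vec_eq_iff algebra_simps sum_subtractf)

lemma matrix_add_rdistrib_cmatrix: "(A + B) ** C = A ** C + B ** (C :: 'm::finite cmatrix)"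
  by (simp add: matrix_matrix_mult_def vec_eq_iff algebra_simps sum.distrib)

lemma cscale_mult_left: "cscale c A ** B = cscale c (A ** B)"
  by (simp add: matrix_matrix_mult_def vec_eq_iff cscale_def sum_distrib_left mult_ac)

lemma cscale_mult_right: "A ** cscale c B = cscale c (A ** B)"
  by (simp add: matrix_matrix_mult_def vec_eq_iff cscale_def sum_distrib_left mult_ac)

lemma linop_bracket: "M.linop (bracket A)"
  by (simp add: M.linop_def bracket_def matrix_add_ldistrib matrix_add_rdistrib_cmatrix cscale_mult_left
      cscale_mult_right cmat.scale_right_diff_distrib)

lemma bracket_anti: "bracket A B = - bracket B A"
  by (simp add: bracket_def)

lemma bracket_self: "bracket A A = 0"
  by (simp add: bracket_def)

lemma jacobi: "bracket A (bracket B C) = bracket (bracket A B) C + bracket B (bracket A C)"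
  by (simp add: bracket_def matrix_diff_ldistrib matrix_diff_rdistrib matrix_mul_assoc)

lemma lie_algebraD:
  assumes "lie_algebra L"
  shows "cmat.subspace L" "A \<in> L \<Longrightarrow> B \<in> L \<Longrightarrow> bracket A B \<in> L" "A \<in> L \<Longrightarrow> M.stable (bracket A) L"
  using assms by (auto simp: lie_algebra_def M.stable_def)

lemma subspace_basis:
  assumes L: "cmat.subspace (L :: 'm::finite cmatrix set)"
  obtains B where "finite B" "cmat.span B = L" "card B = cmat.dim L" "cmat.independent B"
proof -
  obtain B where B: "B \<subseteq> L" "finite B" "L \<subseteq> cmat.span B" "cmat.independent B"
    by (rule cmat_finite_spanning)
  have "cmat.span B = L" using B L cmat.span_minimal by blast
  with B that cmat.basis_card_eq_dim show thesis by metis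
qed

text \<open>An arbitrary basis, fixed so that the dimension formulas for finite-dimensional spaces
  apply.\<close>

definition cmat_basis :: "'m::finite cmatrix set"
  where "cmat_basis = (SOME B. finite B \<and> cmat.independent B \<and> cmat.span B = UNIV)"

interpretation FD: finite_dimensional_vector_space cscale "cmat_basis :: 'm::finite cmatrix set"
proof -
  obtain B :: "'m cmatrix set" where "finite B" "cmat.span B = UNIV" "cmat.independent B"
    using subspace_basis[OF cmat.subspace_UNIV] by metis
  then have "\<exists>B :: 'm cmatrix set. finite B \<and> cmat.independent B \<and> cmat.span B = UNIV" by blast
  from someI_ex[OF this] show "finite_dimensional_vector_space cscale (cmat_basis :: 'm cmatrix set)"
    unfolding cmat_basis_def by unfold_locales auto
qed

text \<open>The exponent dim L of the procedure captures the whole generalized 0-eigenspace of ad x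
  on L, since the iterates of v never leave L.\<close>

lemma ad_nilpotent_bound:
  assumes L: "lie_algebra L" and x: "x \<in> L" and v: "v \<in> L" and k: "(bracket x ^^ k) v = 0"
  shows "(bracket x ^^ cmat.dim L) v = 0"
proof -
  obtain B where B: "finite B" "cmat.span B = L" "card B = cmat.dim L"
    using subspace_basis[OF lie_algebraD(1)[OF L]] by metis
  have "(bracket x ^^ i) v \<in> cmat.span B" for i
    using M.stable_in[OF M.stable_funpow[OF lie_algebraD(3)[OF L x]] v] B(2) by simp
  from M.funpow_nilpotent_bound[OF linop_bracket B(1) this k] show ?thesis by (simp add: B(3))
qed

lemma ad_kernel_iff:
  assumes "lie_algebra L" "x \<in> L"
  shows "B \<in> ad_kernel L x \<longleftrightarrow> B \<in> L \<and> (\<exists>k. (bracket x ^^ k) B = 0)"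
  using ad_nilpotent_bound[OF assms] by (auto simp: ad_kernel_def)

text \<open>Each application of the derivation Z lowers the exponent of one of the two factors. It
  serves for brackets, by the Jacobi identity, and for products of polynomials.\<close>

lemma leibniz_nilpotent:
  assumes "\<And>a b. Z (m a b) = m (Z a) b + m a (Z b :: 'b::ab_group_add)"
    and "\<And>u v. Z (u + v) = Z u + Z v" "\<And>b. m 0 b = 0" "\<And>a. m a 0 = 0" "Z 0 = (0::'b)"
    and "(Z ^^ i) a = 0" "(Z ^^ j) b = 0"
  shows "(Z ^^ (i + j)) (m a b) = 0"
  using assms(6,7)
proof (induction "i + j" arbitrary: i j a b)
  case 0
  then show ?case using assms(3) by simp
next
  case (Suc n)
  have add: "(Z ^^ k) (u + v) = (Z ^^ k) u + (Z ^^ k) v" for k u v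
    by (induction k) (simp_all add: assms(2))
  have z: "(Z ^^ k) 0 = 0" for k by (induction k) (simp_all add: assms(5))
  have "(Z ^^ n) (m (Z a) b) = 0"
  proof (cases i)
    case 0
    then have "a = 0" using Suc.prems(1) by simp
    then show ?thesis by (simp add: assms(3,5) z)
  next
    case (Suc i')
    then have "(Z ^^ i') (Z a) = 0" using Suc.prems(1) by (simp add: funpow_swap1)
    with Suc.hyps(1)[of i' j "Z a" b] Suc \<open>Suc n = i + j\<close> Suc.prems(2) show ?thesis by simp
  qed
  moreover have "(Z ^^ n) (m a (Z b)) = 0"
  proof (cases j)
    case 0
    then have "b = 0" using Suc.prems(2) by simp
    then show ?thesis by (simp add: assms(4,5) z)
  next
    case (Suc j')
    then have "(Z ^^ j') (Z b) = 0" using Suc.prems(2) by (simp add: funpow_swap1)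
    with Suc.hyps(1)[of i j' a "Z b"] Suc \<open>Suc n = i + j\<close> Suc.prems(1) show ?thesis by simp
  qed
  ultimately have "(Z ^^ Suc n) (m a b) = 0"
    by (simp only: funpow_Suc_right comp_apply assms(1) add) simp
  then show ?case using Suc.hyps(2) by simp
qed

lemma lie_algebra_ad_kernel:
  assumes L: "lie_algebra L" and x: "x \<in> L"
  shows "lie_algebra (ad_kernel L x)"
  unfolding lie_algebra_def
proof (intro conjI ballI)
  note lin = M.linop_funpow[OF linop_bracket]
  show "cmat.subspace (ad_kernel L x)"
    using lie_algebraD(1)[OF L] unfolding cmat.subspace_def ad_kernel_def
    by (auto simp: M.linop_zero[OF lin] M.linop_add[OF lin] M.linop_scale[OF lin])
  fix A B assume "A \<in> ad_kernel L x" "B \<in> ad_kernel L x"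
  then have A: "A \<in> L" "(bracket x ^^ cmat.dim L) A = 0" and B: "B \<in> L" "(bracket x ^^ cmat.dim L) B = 0"
    by (auto simp: ad_kernel_def)
  have "(bracket x ^^ (cmat.dim L + cmat.dim L)) (bracket A B) = 0"
    by (rule leibniz_nilpotent[where Z = "bracket x" and m = bracket])
      (rule jacobi M.linop_add[OF linop_bracket] A(2) B(2) | simp add: bracket_def)+
  then show "bracket A B \<in> ad_kernel L x"
    using ad_kernel_iff[OF L x] lie_algebraD(2)[OF L A(1) B(1)] by blast
qed

lemma self_in_ad_kernel: "lie_algebra L \<Longrightarrow> x \<in> L \<Longrightarrow> x \<in> ad_kernel L x"
  by (subst ad_kernel_iff) (auto intro!: exI[of _ 1] simp: bracket_self)

text \<open>If A normalizes the kernel then [x, A] lies in it, as x does, and one more application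
  of ad x kills A. So nilpotency is the only part of the Cartan condition that can fail.\<close>

lemma ad_kernel_self_normalizing:
  assumes L: "lie_algebra L" and x: "x \<in> L"
  shows "ad_kernel L x = {A \<in> L. \<forall>B\<in>ad_kernel L x. bracket A B \<in> ad_kernel L x}"
proof (intro equalityI subsetI)
  fix A assume A: "A \<in> ad_kernel L x"
  then show "A \<in> {A \<in> L. \<forall>B\<in>ad_kernel L x. bracket A B \<in> ad_kernel L x}"
    using lie_algebraD(2)[OF lie_algebra_ad_kernel[OF L x]] by (auto simp: ad_kernel_def)
next
  fix A assume A: "A \<in> {A \<in> L. \<forall>B\<in>ad_kernel L x. bracket A B \<in> ad_kernel L x}"
  then have "bracket A x \<in> ad_kernel L x" using self_in_ad_kernel[OF L x] by blast
  then have "- bracket A x \<in> ad_kernel L x"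
    using lie_algebraD(1)[OF lie_algebra_ad_kernel[OF L x]] by (rule_tac cmat.subspace_neg)
  then have "bracket x A \<in> ad_kernel L x" by (simp add: bracket_anti[of x A])
  then obtain k where "(bracket x ^^ k) (bracket x A) = 0" using ad_kernel_iff[OF L x] by blast
  then have "(bracket x ^^ Suc k) A = 0" by (simp add: funpow_swap1)
  then show "A \<in> ad_kernel L x" using A ad_kernel_iff[OF L x] by blast
qed

subsection \<open>Polynomial dependence\<close>

lemma fun_algebra_diff:
  assumes \<Phi>: "P.fun_algebra \<Phi>" and "f \<in> \<Phi>" "g \<in> \<Phi>"
  shows "(\<lambda>x. f x - g x) \<in> \<Phi>"
proof -
  have "(\<lambda>x. f x + (- 1) * g x) \<in> \<Phi>" using assms by (intro fun_algebraD[OF \<Phi>])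
  then show ?thesis by simp
qed

lemma fun_algebra_bracket:
  fixes A B :: "'x \<Rightarrow> 'm::finite cmatrix"
  assumes \<Phi>: "P.fun_algebra \<Phi>" and "\<And>i j. (\<lambda>x. A x $ i $ j) \<in> \<Phi>" "\<And>i j. (\<lambda>x. B x $ i $ j) \<in> \<Phi>"
  shows "(\<lambda>x. bracket (A x) (B x) $ i $ j) \<in> \<Phi>"
  unfolding bracket_def matrix_matrix_mult_def vector_minus_component vec_lambda_beta
  by (intro fun_algebra_diff[OF \<Phi>] fun_algebra_sum[OF \<Phi>] fun_algebraD(3)[OF \<Phi>] assms)

lemma fun_algebra_ad_pow:
  fixes A :: "'x \<Rightarrow> 'm::finite cmatrix"
  assumes \<Phi>: "P.fun_algebra \<Phi>" and A: "\<And>i j. (\<lambda>x. A x $ i $ j) \<in> \<Phi>"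
  shows "(\<lambda>x. (bracket (A x) ^^ k) B $ i $ j) \<in> \<Phi>"
proof (induction k arbitrary: i j)
  case 0
  show ?case using fun_algebraD(1)[OF \<Phi>] by simp
next
  case (Suc k)
  then show ?case using fun_algebra_bracket[OF \<Phi> A] by simp
qed

lemma fun_vector_entries:
  fixes u :: "'x \<Rightarrow> 'm::finite cmatrix"
  assumes \<Phi>: "P.fun_algebra \<Phi>" and u: "\<And>i j. (\<lambda>x. u x $ i $ j) \<in> \<Phi>"
  shows "M.fun_vector \<Phi> u"
  unfolding M.fun_vector_def
proof (intro allI impI)
  fix l :: "'m cmatrix \<Rightarrow> complex" assume l: "M.linfun l"
  have "A = (\<Sum>i\<in>UNIV. \<Sum>j\<in>UNIV. cscale (A $ i $ j) (mat_unit i j))" for A :: "'m cmatrix"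
  proof -
    have "(\<Sum>i\<in>UNIV. \<Sum>j\<in>UNIV. cscale (A $ i $ j) (mat_unit i j)) $ k $ l = A $ k $ l" for k l
    proof -
      have "(\<Sum>i\<in>UNIV. \<Sum>j\<in>UNIV. cscale (A $ i $ j) (mat_unit i j)) $ k $ l =
        (\<Sum>i\<in>UNIV. \<Sum>j\<in>UNIV. if j = l then (if i = k then A $ k $ l else 0) else 0)"
        unfolding sum_component by (intro sum.cong) (auto simp: cscale_def mat_unit_def)
      then show ?thesis by simp
    qed
    then show ?thesis by (simp add: vec_eq_iff)
  qed
  then have "l (u x) = (\<Sum>i\<in>UNIV. \<Sum>j\<in>UNIV. u x $ i $ j * l (mat_unit i j))" for x
    by (metis (no_types, lifting) M.linfun_scale[OF l] M.linfun_sum[OF l] sum.cong)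
  then show "(\<lambda>x. l (u x)) \<in> \<Phi>"
    by (auto intro!: fun_algebra_sum[OF \<Phi>] fun_algebraD[OF \<Phi>] u)
qed

lemma M_fun_algebra: "M.fun_algebra \<Phi> \<longleftrightarrow> P.fun_algebra \<Phi>"
  by (simp add: M.fun_algebra_def P.fun_algebra_def)

text \<open>R represents L / K. The vectors are the coordinates modulo K of (ad (A x))^N applied to
  R; they are independent at x0 and therefore wherever p does not vanish. It is used along a line
  and for a matrix with free entries.\<close>

lemma generic_ad_kernel_frame:
  fixes L :: "'m::finite cmatrix set" and A :: "'x \<Rightarrow> 'm cmatrix"
  assumes L: "lie_algebra L" and x: "A x0 \<in> L" and \<Phi>: "P.fun_algebra \<Phi>"
    and A: "\<And>i j. (\<lambda>x. A x $ i $ j) \<in> \<Phi>"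
  defines "K \<equiv> ad_kernel L (A x0)"
  shows "\<exists>R l. M.frame K L R l \<and> M.indep_mod K R \<and> (\<exists>p\<in>\<Phi>. p x0 \<noteq> 0 \<and> (\<forall>x. p x \<noteq> 0 \<longrightarrow>
    M.lin_indep R (\<lambda>r. \<Sum>s\<in>R. cscale (l s ((bracket (A x) ^^ cmat.dim L) r)) s)))"
proof -
  have K: "lie_algebra K" unfolding K_def by (rule lie_algebra_ad_kernel[OF L x])
  have KL: "K \<subseteq> L" by (auto simp: K_def ad_kernel_def)
  obtain B where B: "finite B" "cmat.span B = L"
    using subspace_basis[OF lie_algebraD(1)[OF L]] by metis
  have "B \<subseteq> L" using B(2) cmat.span_superset by blast
  moreover have "L \<subseteq> cmat.span (K \<union> B)" using B(2) cmat.span_mono[of B "K \<union> B"] by blast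
  moreover have "M.indep_mod K {}" by (simp add: M.indep_mod_def)
  ultimately obtain R l where R: "M.indep_mod K R" "M.frame K L R l"
    using M.frame_exists[OF lie_algebraD(1)[OF K] lie_algebraD(1)[OF L] KL B(1)] by (metis empty_subsetI)
  let ?N = "cmat.dim L"
  let ?u = "\<lambda>r x. \<Sum>s\<in>R. cscale (l s ((bracket (A x) ^^ ?N) r)) s"
  have l: "M.linfun (l s)" if "s \<in> R" for s using R(2) that by (auto simp: M.frame_def)
  have fR: "finite R" "R \<subseteq> L" using R(2) by (auto simp: M.frame_def)
  have vecs: "M.fun_vector \<Phi> (?u r)" for r
    unfolding M.fun_vector_def
  proof (intro allI impI)
    fix m :: "'m cmatrix \<Rightarrow> complex" assume m: "M.linfun m"
    have "(\<lambda>x. l s ((bracket (A x) ^^ ?N) r)) \<in> \<Phi>" if "s \<in> R" for s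
      using fun_vector_entries[OF \<Phi> fun_algebra_ad_pow[OF \<Phi> A]] l[OF that] unfolding M.fun_vector_def by blast
    then show "(\<lambda>x. m (?u r x)) \<in> \<Phi>"
      unfolding M.linfun_sum[OF m] M.linfun_scale[OF m]
      by (intro fun_algebra_sum[OF \<Phi>] fun_algebraD(3)[OF \<Phi>] fun_algebraD(1)[OF \<Phi>])
  qed
  \<comment> \<open>If (ad x0)^N maps a combination of R into K, a higher power kills it, so it lies
    in K and is trivial. Here x0 is short for \<open>A x0\<close>.\<close>
  have indep0: "M.lin_indep R (\<lambda>r. ?u r x0)"
    unfolding M.lin_indep_def
  proof (intro allI impI)
    fix c assume c: "(\<Sum>r\<in>R. cscale (c r) (?u r x0)) = 0"
    let ?w = "\<Sum>r\<in>R. cscale (c r) r"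
    let ?v = "(bracket (A x0) ^^ ?N) ?w"
    have lin: "M.linop (bracket (A x0) ^^ ?N)" by (rule M.linop_funpow[OF linop_bracket])
    have w: "?w \<in> L" using fR by (intro cmat.subspace_sum cmat.subspace_scale lie_algebraD(1)[OF L]) auto
    have v: "?v \<in> L" by (rule M.stable_in[OF M.stable_funpow[OF lie_algebraD(3)[OF L x]] w])
    have "(\<Sum>s\<in>R. cscale (l s ?v) s) = (\<Sum>s\<in>R. \<Sum>r\<in>R. cscale (c r * l s ((bracket (A x0) ^^ ?N) r)) s)"
      by (intro sum.cong) (simp_all add: M.linop_sum[OF lin] M.linop_scale[OF lin] M.linfun_sum[OF l]
          M.linfun_scale[OF l] cmat.scale_sum_left)
    also have "\<dots> = (\<Sum>r\<in>R. cscale (c r) (?u r x0))"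
      by (subst sum.swap) (simp add: cmat.scale_sum_right)
    finally have "(\<Sum>s\<in>R. cscale (l s ?v) s) = 0" using c by simp
    moreover have "?v - (\<Sum>s\<in>R. cscale (l s ?v) s) \<in> K" using R(2) v by (auto simp: M.frame_def)
    ultimately have "?v \<in> K" by simp
    then obtain k where "(bracket (A x0) ^^ k) ?v = 0" unfolding K_def using ad_kernel_iff[OF L x] by blast
    then have "(bracket (A x0) ^^ (k + ?N)) ?w = 0" by (simp add: funpow_add)
    then have "?w \<in> K" unfolding K_def using ad_kernel_iff[OF L x] w by blast
    then show "\<forall>r\<in>R. c r = 0" using M.indep_modD[OF R(1)] by blast
  qed
  have "\<exists>p\<in>\<Phi>. p x0 \<noteq> 0 \<and> (\<forall>x. p x \<noteq> 0 \<longrightarrow> M.lin_indep R (\<lambda>r. ?u r x))"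
    by (rule M.generic_lin_indep[where u = ?u, OF M_fun_algebra[THEN iffD2, OF \<Phi>] fR(1) vecs indep0])
  with R show ?thesis by (intro exI conjI)
qed

definition regular_in :: "'m::finite cmatrix set \<Rightarrow> 'm cmatrix \<Rightarrow> bool"
  where "regular_in L x \<longleftrightarrow> x \<in> L \<and> (\<forall>y\<in>L. cmat.dim (ad_kernel L x) \<le> cmat.dim (ad_kernel L y))"

lemma poly_zero_infinite:
  fixes p q :: "complex poly"
  assumes "q \<noteq> 0" "\<And>t. poly q t \<noteq> 0 \<Longrightarrow> poly p t = 0"
  shows "p = 0"
proof (rule ccontr)
  assume "p \<noteq> 0"
  then have "finite {t. poly (p * q) t = 0}" using assms(1) by (intro poly_roots_finite) simp
  moreover have "{t. poly (p * q) t = 0} = UNIV" using assms(2) by auto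
  ultimately show False using infinite_UNIV_char_0 by metis
qed

text \<open>Move from x to y on a line inside K. For generic t the operator ad (A t) is invertible
  on L / K, so its Fitting null component lies in K and equals K by minimality of the dimension.
  Thus (ad (A t))^N B vanishes for generic t, hence identically in t, and t = 1 gives y.\<close>

lemma regular_ad_kernel_nilpotent:
  assumes L: "lie_algebra (L :: 'm::finite cmatrix set)" and reg: "regular_in L x"
    and y: "y \<in> ad_kernel L x" and k: "B \<in> ad_kernel L x"
  shows "(bracket y ^^ cmat.dim L) B = 0"
proof -
  let ?N = "cmat.dim L" and ?K = "ad_kernel L x"
  define A where "A t = x + cscale t (y - x)" for t
  have x: "x \<in> L" using reg by (simp add: regular_in_def)
  have KL: "?K \<subseteq> L" by (auto simp: ad_kernel_def)
  have K: "lie_algebra ?K" by (rule lie_algebra_ad_kernel[OF L x])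
  have AK: "A t \<in> ?K" for t
    unfolding A_def using lie_algebraD(1)[OF K] self_in_ad_kernel[OF L x] y
    by (intro cmat.subspace_add cmat.subspace_scale cmat.subspace_diff)
  have A0: "A 0 = x" by (simp add: A_def)
  have entries: "(\<lambda>t. A t $ i $ j) \<in> range poly" for i j unfolding A_def by (rule line_in_poly)
  have A0L: "A 0 \<in> L" using A0 x by simp
  from generic_ad_kernel_frame[where A = A and ?x0.0 = 0 and \<Phi> = "range poly" and L = L,
      OF L A0L fun_algebra_poly entries]
  obtain R l p where R: "M.frame ?K L R l" "M.indep_mod ?K R"
    and pm: "p \<in> range poly" and p2: "p 0 \<noteq> 0 \<and> (\<forall>t. p t \<noteq> 0 \<longrightarrow>
      M.lin_indep R (\<lambda>r. \<Sum>s\<in>R. cscale (l s ((bracket (A t) ^^ ?N) r)) s))"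
    unfolding A0 by (elim exE conjE bexE) blast
  note p = pm conjunct1[OF p2] conjunct2[OF p2, rule_format]
  obtain q where q: "p = poly q" using p(1) by blast
  have small: "ad_kernel L (A t) \<subseteq> ?K" if t: "p t \<noteq> 0" for t
  proof
    fix v assume "v \<in> ad_kernel L (A t)"
    then have v: "v \<in> L" "(bracket (A t) ^^ ?N) v = 0" by (auto simp: ad_kernel_def)
    let ?Z = "bracket (A t) ^^ ?N"
    have Z: "M.linop ?Z" by (rule M.linop_funpow[OF linop_bracket])
    \<comment> \<open>The part of v in K stays in K under ad (A t), so only the coordinates of v
      along R matter modulo K.\<close>
    let ?k = "v - (\<Sum>r\<in>R. cscale (l r v) r)"
    have k: "?k \<in> ?K" using R(1) v(1) by (auto simp: M.frame_def)
    have "?Z ?k \<in> ?K" by (rule M.stable_in[OF M.stable_funpow[OF lie_algebraD(3)[OF K AK]] k])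
    then have "l s (?Z ?k) = 0" if "s \<in> R" for s using R(1) that by (auto simp: M.frame_def)
    moreover have "?Z ?k = - (\<Sum>r\<in>R. cscale (l r v) (?Z r))"
      by (simp add: M.linop_diff[OF Z] v(2) M.linop_sum[OF Z] M.linop_scale[OF Z])
    ultimately have ls: "(\<Sum>r\<in>R. l r v * l s (?Z r)) = 0" if "s \<in> R" for s
      using that R(1) by (auto simp: M.frame_def M.linfun_minus M.linfun_sum M.linfun_scale)
    have "(\<Sum>r\<in>R. cscale (l r v) (\<Sum>s\<in>R. cscale (l s (?Z r)) s)) =
      (\<Sum>s\<in>R. cscale (\<Sum>r\<in>R. l r v * l s (?Z r)) s)"
      by (simp add: cmat.scale_sum_right cmat.scale_sum_left) (rule sum.swap)
    also have "\<dots> = 0" using ls by (intro sum.neutral) simp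
    finally have "l r v = 0" if "r \<in> R" for r
      using M.lin_indepD[OF p(3)[OF t], of "\<lambda>r. l r v"] that by blast
    then show "v \<in> ?K" using k by simp
  qed
  have kill: "(bracket (A t) ^^ ?N) B = 0" if t: "p t \<noteq> 0" for t
  proof -
    have At: "A t \<in> L" using AK KL by blast
    have "ad_kernel L (A t) = ?K"
    proof (rule FD.subspace_dim_equal)
      show "cmat.subspace (ad_kernel L (A t))" by (rule lie_algebraD(1)[OF lie_algebra_ad_kernel[OF L At]])
      show "cmat.subspace ?K" by (rule lie_algebraD(1)[OF K])
      show "cmat.dim ?K \<le> cmat.dim (ad_kernel L (A t))" using reg At by (simp add: regular_in_def)
    qed (rule small[OF t])
    then show ?thesis using k by (auto simp: ad_kernel_def)
  qed
  have "(bracket (A 1) ^^ ?N) B $ i $ j = 0" for i j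
  proof -
    obtain f where f: "(\<lambda>t. (bracket (A t) ^^ ?N) B $ i $ j) = poly f"
      using fun_algebra_ad_pow[OF fun_algebra_poly entries] by blast
    have "poly f t = 0" if "poly q t \<noteq> 0" for t
      using kill[of t] that q fun_cong[OF f, of t] by simp
    then have "f = 0" using p(2) q by (intro poly_zero_infinite[of q]) auto
    then show ?thesis using fun_cong[OF f, of 1] by simp
  qed
  moreover have "A 1 = y" by (simp add: A_def)
  ultimately show ?thesis by (simp add: vec_eq_iff)
qed

lemma regular_cartan:
  assumes L: "lie_algebra L" and reg: "regular_in L x"
  shows "cartan_subalgebra (ad_kernel L x) L"
proof -
  have x: "x \<in> L" using reg by (simp add: regular_in_def)
  have "ad_kernel L x \<subseteq> L" by (auto simp: ad_kernel_def)
  then have "lie_subalgebra (ad_kernel L x) L"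
    using L lie_algebra_ad_kernel[OF L x] by (simp add: lie_subalgebra_def)
  moreover have "\<exists>m. \<forall>A\<in>ad_kernel L x. \<forall>B\<in>ad_kernel L x. (bracket A ^^ m) B = 0"
    using regular_ad_kernel_nilpotent[OF L reg] by blast
  ultimately show ?thesis unfolding cartan_subalgebra_def
    using ad_kernel_self_normalizing[OF L x] by blast
qed

text \<open>Take x0 with null component K of least dimension. Where p does not vanish, the null
  component of x meets the span of R only in 0, so its dimension is at most dim L - card R, hence at
  most dim K. Thus x is regular too.\<close>

lemma generic_cartan:
  assumes L: "lie_algebra (L :: 'm::finite cmatrix set)"
  obtains p x0 where "x0 \<in> L" "mat_eval p x0 \<noteq> 0"
    "\<And>x. x \<in> L \<Longrightarrow> mat_eval p x \<noteq> 0 \<Longrightarrow> cartan_subalgebra (ad_kernel L x) L"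
proof -
  have "0 \<in> L" using lie_algebraD(1)[OF L] by (simp add: cmat.subspace_0)
  then obtain x0 where reg: "regular_in L x0"
    using ex_has_least_nat[of "\<lambda>x. x \<in> L" 0 "\<lambda>x. cmat.dim (ad_kernel L x)"] unfolding regular_in_def by blast
  then have x0: "x0 \<in> L" by (simp add: regular_in_def)
  let ?N = "cmat.dim L" and ?K = "ad_kernel L x0"
  from generic_ad_kernel_frame[where A = "\<lambda>x. x" and ?x0.0 = x0 and \<Phi> = "range mat_eval" and L = L,
      OF L x0 fun_algebra_mat_eval entry_in_mat_eval]
  obtain R l p where R: "M.frame ?K L R l" "M.indep_mod ?K R"
    and pm: "p \<in> range mat_eval" and p2: "p x0 \<noteq> 0 \<and> (\<forall>x. p x \<noteq> 0 \<longrightarrow>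
      M.lin_indep R (\<lambda>r. \<Sum>s\<in>R. cscale (l s ((bracket x ^^ ?N) r)) s))"
    by (elim exE conjE bexE) blast
  note p = pm conjunct1[OF p2] conjunct2[OF p2, rule_format]
  have K: "lie_algebra ?K" by (rule lie_algebra_ad_kernel[OF L x0])
  have fR: "finite R" "R \<subseteq> L" using R(1) by (auto simp: M.frame_def)
  have indR: "cmat.independent R"
    using M.indep_modD[OF R(2)] cmat.subspace_0[OF lie_algebraD(1)[OF K]]
    by (intro cmat.independent_if_scalars_zero fR(1)) auto
  have dimN: "?N \<le> cmat.dim ?K + card R"
  proof -
    obtain BK where BK: "finite BK" "cmat.span BK = ?K" "card BK = cmat.dim ?K"
      using subspace_basis[OF lie_algebraD(1)[OF K]] by metis
    have "L \<subseteq> cmat.span (BK \<union> R)"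
    proof
      fix v assume v: "v \<in> L"
      have "v - (\<Sum>r\<in>R. cscale (l r v) r) \<in> cmat.span BK" using R(1) v BK(2) by (auto simp: M.frame_def)
      then have "v - (\<Sum>r\<in>R. cscale (l r v) r) \<in> cmat.span (BK \<union> R)"
        using cmat.span_mono[of BK "BK \<union> R"] by blast
      moreover have "(\<Sum>r\<in>R. cscale (l r v) r) \<in> cmat.span (BK \<union> R)"
        by (intro cmat.span_sum cmat.span_scale cmat.span_base) auto
      ultimately have "v - (\<Sum>r\<in>R. cscale (l r v) r) + (\<Sum>r\<in>R. cscale (l r v) r) \<in> cmat.span (BK \<union> R)"
        by (rule cmat.span_add)
      then show "v \<in> cmat.span (BK \<union> R)" by simp
    qed
    then have "?N \<le> card (BK \<union> R)" using BK(1) fR(1) by (intro cmat.dim_le_card) auto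
    also have "\<dots> \<le> card BK + card R" by (rule card_Un_le)
    finally show ?thesis by (simp add: BK(3))
  qed
  have "cartan_subalgebra (ad_kernel L x) L" if x: "x \<in> L" and px: "p x \<noteq> 0" for x
  proof (rule regular_cartan[OF L])
    let ?Z = "bracket x ^^ ?N" and ?S = "ad_kernel L x" and ?T = "cmat.span R"
    have Z: "M.linop ?Z" by (rule M.linop_funpow[OF linop_bracket])
    have S: "cmat.subspace ?S" by (rule lie_algebraD(1)[OF lie_algebra_ad_kernel[OF L x]])
    have "v = 0" if v: "v \<in> ?S" "v \<in> ?T" for v
    proof -
      obtain c where c: "v = (\<Sum>r\<in>R. cscale (c r) r)" using v(2) cmat.span_finite[OF fR(1)] by auto
      have "0 = ?Z v" using v(1) by (simp add: ad_kernel_def)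
      also have "\<dots> = (\<Sum>r\<in>R. cscale (c r) (?Z r))" by (simp add: c M.linop_sum[OF Z] M.linop_scale[OF Z])
      finally have zero: "(\<Sum>r\<in>R. cscale (c r) (?Z r)) = 0" by simp
      have "(\<Sum>r\<in>R. c r * l s (?Z r)) = 0" if "s \<in> R" for s
      proof -
        have "M.linfun (l s)" using R(1) that by (auto simp: M.frame_def)
        then show ?thesis using arg_cong[OF zero, of "l s"] by (simp add: M.linfun_sum M.linfun_scale M.linfun_zero)
      qed
      then have "(\<Sum>s\<in>R. cscale (\<Sum>r\<in>R. c r * l s (?Z r)) s) = 0" by (intro sum.neutral) simp
      moreover have "(\<Sum>r\<in>R. cscale (c r) (\<Sum>s\<in>R. cscale (l s (?Z r)) s)) =
        (\<Sum>s\<in>R. cscale (\<Sum>r\<in>R. c r * l s (?Z r)) s)"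
        by (simp add: cmat.scale_sum_right cmat.scale_sum_left) (rule sum.swap)
      ultimately have "c r = 0" if "r \<in> R" for r using M.lin_indepD[OF p(3)[OF px], of c] that by simp
      then show ?thesis by (simp add: c)
    qed
    then have "?S \<inter> ?T = {0}" using S cmat.span_zero by (auto simp: cmat.subspace_0)
    then have "cmat.dim {a + b |a b. a \<in> ?S \<and> b \<in> ?T} = cmat.dim ?S + cmat.dim ?T"
      using FD.dim_sums_Int[OF S cmat.subspace_span, of R] by simp
    moreover have "{a + b |a b. a \<in> ?S \<and> b \<in> ?T} \<subseteq> L"
    proof -
      have "?T \<subseteq> L" by (rule cmat.span_minimal[OF fR(2) lie_algebraD(1)[OF L]])
      moreover have "?S \<subseteq> L" by (auto simp: ad_kernel_def)
      ultimately show ?thesis using lie_algebraD(1)[OF L] by (auto intro: cmat.subspace_add)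
    qed
    then have "cmat.dim {a + b |a b. a \<in> ?S \<and> b \<in> ?T} \<le> ?N" by (rule FD.dim_subset)
    ultimately have "cmat.dim ?S \<le> cmat.dim ?K"
      using dimN by (simp add: cmat.dim_eq_card_independent[OF indR])
    then show "regular_in L x" using reg x unfolding regular_in_def by fastforce
  qed
  then show thesis using that[OF x0] p(1,2) by blast
qed

section \<open>Stabilizer Lie algebras are closed under taking semisimple parts\<close>

section \<open>Semisimple parts in Lie algebras of stabilizers\<close>

definition semisimple_part_of :: "'m::finite cmatrix \<Rightarrow> 'm cmatrix \<Rightarrow> bool"
  where "semisimple_part_of A S \<longleftrightarrow> diagonalizable S \<and> nilpotent (A - S) \<and>
    (\<forall>B. A ** B = B ** A \<longrightarrow> S ** B = B ** S) \<and>
    (\<forall>\<mu> k v. (V.shift ((*v) A) \<mu> ^^ k) v = 0 \<longrightarrow> S *v v = \<mu> *s v)"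

definition ss :: "'m::finite cmatrix \<Rightarrow> 'm cmatrix"
  where "ss A = (SOME S. semisimple_part_of A S)"

lemma ss_semisimple_part: "semisimple_part_of A (ss A)"
proof -
  obtain S N where J: "A = S + N" "\<And>v. v \<in> vec.span (V.eigenvectors ((*v) S))" "nilpotent N"
    "\<And>B. A ** B = B ** A \<Longrightarrow> S ** B = B ** S"
    "\<And>\<mu> k v. (V.shift ((*v) A) \<mu> ^^ k) v = 0 \<Longrightarrow> S *v v = \<mu> *s v"
    by (rule jordan_decomposition[of A]) (rule that)
  have "vec.span (V.eigenvectors ((*v) S)) = UNIV" using J(2) by blast
  then have "diagonalizable S" by (simp add: diagonalizable_iff)
  moreover have "A - S = N" using J(1) by simp
  ultimately have "semisimple_part_of A S" unfolding semisimple_part_of_def using J(3-5) by blast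
  then show ?thesis unfolding ss_def by (rule someI)
qed

lemma ss_diagonalizable: "diagonalizable (ss A)" and ss_nilpotent: "nilpotent (A - ss A)"
  and ss_commute: "A ** B = B ** A \<Longrightarrow> ss A ** B = B ** ss A"
  using ss_semisimple_part[of A] by (auto simp: semisimple_part_of_def)

lemma ss_of_diagonalizable: "diagonalizable A \<Longrightarrow> ss A = A"
  using ss_semisimple_part[of A] diagonalizable_eq_semisimple_part[of A "ss A"]
  unfolding semisimple_part_of_def by blast

lemma bracket_eq_0_iff: "bracket A B = 0 \<longleftrightarrow> A ** B = B ** A"
  by (simp add: bracket_def)

lemma bracket_ss_nilpotent_part: "bracket (ss A) (A - ss A) = 0"
proof -
  have "ss A ** A = A ** ss A" by (rule ss_commute) simp
  then show ?thesis by (simp add: bracket_def matrix_diff_ldistrib matrix_diff_rdistrib)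
qed

lemma bracket_split: "bracket A B = bracket (ss A) B + bracket (A - ss A) B"
  by (simp add: bracket_def matrix_diff_ldistrib matrix_diff_rdistrib)

lemma bracket_comm: "bracket A B = 0 \<Longrightarrow> bracket A (bracket B C) = bracket B (bracket A C)"
  using jacobi[of A B C] M.linop_zero[OF linop_bracket] by (simp add: bracket_def)

lemma diagonalizableE:
  fixes D :: "'m::finite cmatrix"
  assumes "diagonalizable D"
  obtains P R \<Lambda> :: "'m cmatrix" where "P ** R = mat 1" "R ** P = mat 1" "diagonal_matrix \<Lambda>" "P ** D = \<Lambda> ** P"
    "D ** R = R ** \<Lambda>" "D = R ** \<Lambda> ** P"
proof -
  obtain P :: "'m cmatrix" where P: "invertible P" "diagonal_matrix (P ** D ** matrix_inv P)"
    using assms unfolding diagonalizable_def by blast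
  note i = matrix_inv_cmatrix[OF P(1)]
  have r: "A ** matrix_inv P ** P = A" for A by (metis i(2) matrix_mul_assoc matrix_mul_rid)
  have l: "matrix_inv P ** (P ** A) = A" for A by (metis i(2) matrix_mul_assoc matrix_mul_lid)
  show thesis
    by (rule that[OF i P(2)]) (metis r l matrix_mul_assoc)+
qed

text \<open>In an eigenbasis of D the matrix units are eigenvectors of ad D, with differences of
  eigenvalues of D as eigenvalues.\<close>

lemma ad_eigenvectors_span:
  assumes "diagonalizable (D :: 'm::finite cmatrix)"
  shows "cmat.span (M.eigenvectors (bracket D)) = UNIV"
proof -
  obtain P R \<Lambda> :: "'m cmatrix" where PR: "P ** R = mat 1" "R ** P = mat 1" and \<Lambda>: "diagonal_matrix \<Lambda>"
    and D: "P ** D = \<Lambda> ** P" "D ** R = R ** \<Lambda>" "D = R ** \<Lambda> ** P"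
    by (rule diagonalizableE[OF assms]) (rule that)
  have u1: "\<Lambda> ** mat_unit i j = cscale (\<Lambda> $ i $ i) (mat_unit i j)" for i j
    using \<Lambda> by (auto simp: vec_eq_iff matrix_matrix_mult_def mat_unit_def cscale_def diagonal_matrix_def if_distrib cong: if_cong)
  have u2: "mat_unit i j ** \<Lambda> = cscale (\<Lambda> $ j $ j) (mat_unit i j)" for i j
  proof -
    have "(\<Sum>k\<in>UNIV. mat_unit i j $ a $ k * \<Lambda> $ k $ b) = \<Lambda> $ j $ j * mat_unit i j $ a $ b" for a b
    proof -
      have "(\<Sum>k\<in>UNIV. mat_unit i j $ a $ k * \<Lambda> $ k $ b) = (\<Sum>k\<in>UNIV. if k = j then mat_unit i j $ a $ j * \<Lambda> $ j $ b else 0)"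
        by (intro sum.cong) (auto simp: mat_unit_def)
      then show ?thesis using \<Lambda> by (auto simp: mat_unit_def diagonal_matrix_def)
    qed
    then show ?thesis by (simp add: vec_eq_iff matrix_matrix_mult_def cscale_def)
  qed
  let ?f = "\<lambda>B. R ** B ** P"
  have f: "M.linop ?f"
    by (simp add: M.linop_def matrix_add_ldistrib matrix_add_rdistrib_cmatrix cscale_mult_left cscale_mult_right)
  have eig: "?f (mat_unit i j) \<in> M.eigenvectors (bracket D)" for i j
  proof -
    have "D ** ?f (mat_unit i j) = ?f (\<Lambda> ** mat_unit i j)" by (simp add: matrix_mul_assoc D(2))
    moreover have "?f (mat_unit i j) ** D = ?f (mat_unit i j ** \<Lambda>)"
      by (simp add: matrix_mul_assoc[symmetric] D(1))
    ultimately have "bracket D (?f (mat_unit i j)) = cscale (\<Lambda> $ i $ i - \<Lambda> $ j $ j) (?f (mat_unit i j))"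
      by (simp add: bracket_def u1 u2 M.linop_scale[OF f] cmat.scale_left_diff_distrib)
    then show ?thesis unfolding M.eigenvectors_def by blast
  qed
  have "B \<in> cmat.span (M.eigenvectors (bracket D))" for B
  proof -
    have "?f A \<in> cmat.span (M.eigenvectors (bracket D))" for A
      using cmat_in_span_units[of A]
    proof (induction rule: cmat.span_induct_alt)
      case base
      then show ?case by (simp add: M.linop_zero[OF f] cmat.span_zero)
    next
      case (step c x y)
      then obtain i j where "x = mat_unit i j" by auto
      then show ?case
        using step eig[of i j]
        by (auto simp only: M.linop_add[OF f] M.linop_scale[OF f] intro!: cmat.span_add cmat.span_scale
            intro: cmat.span_base)
    qed
    then have "?f (P ** B ** R) \<in> cmat.span (M.eigenvectors (bracket D))" .
    moreover have "?f (P ** B ** R) = (R ** P) ** B ** (R ** P)" by (simp add: matrix_mul_assoc)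
    ultimately show ?thesis by (simp add: PR)
  qed
  then show ?thesis by blast
qed

lemma nilpotentE:
  assumes "nilpotent N" obtains k where "mat_pow N k = 0"
  using assms by (auto simp: nilpotent_def mat_pow_def)

lemma mat_pow_zero_mono: "mat_pow N k = 0 \<Longrightarrow> k \<le> n \<Longrightarrow> mat_pow N n = 0"
  by (induction n) (auto simp: le_Suc_eq mat_pow_Suc)

text \<open>Every application of ad N adds one factor N on the left or on the right of B; among 2k
  factors one side collects at least k.\<close>

lemma ad_nilpotent:
  assumes "nilpotent N" shows "\<exists>k. (bracket N ^^ k) B = 0"
proof -
  obtain k where k: "mat_pow N k = 0" using assms by (rule nilpotentE)
  have "(bracket N ^^ n) (mat_pow N i ** B ** mat_pow N j) = 0" if "2 * k \<le> n + i + j" for n i j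
    using that
  proof (induction n arbitrary: i j)
    case 0
    then have "k \<le> i \<or> k \<le> j" by auto
    then have "mat_pow N i = 0 \<or> mat_pow N j = 0" using mat_pow_zero_mono[OF k] by blast
    then show ?case by auto
  next
    case (Suc n)
    have "bracket N (mat_pow N i ** B ** mat_pow N j) =
      (N ** mat_pow N i) ** B ** mat_pow N j - mat_pow N i ** B ** (mat_pow N j ** N)"
      by (simp add: bracket_def matrix_mul_assoc)
    then have "bracket N (mat_pow N i ** B ** mat_pow N j) =
      mat_pow N (Suc i) ** B ** mat_pow N j - mat_pow N i ** B ** mat_pow N (Suc j)"
      by (simp only: mat_pow_Suc[of N i] mat_pow_Suc2[of N j])
    then have "(bracket N ^^ Suc n) (mat_pow N i ** B ** mat_pow N j) =
      (bracket N ^^ n) (mat_pow N (Suc i) ** B ** mat_pow N j) -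
      (bracket N ^^ n) (mat_pow N i ** B ** mat_pow N (Suc j))"
      by (simp only: funpow_Suc_right comp_apply M.linop_diff[OF M.linop_funpow[OF linop_bracket]])
    also have "\<dots> = 0" using Suc.IH[of "Suc i" j] Suc.IH[of i "Suc j"] Suc.prems by simp
    finally show ?case .
  qed
  from this[of "2 * k" 0 0] show ?thesis by (auto simp: mat_pow_0)
qed

text \<open>On variables the iterates are linear forms of powers of N; the Leibniz rule handles
  products. The exponent depends on f, so the nilpotency is only local.\<close>

lemma pder_nilpotent:
  assumes "nilpotent N" shows "\<exists>k. (pder N ^^ k) f = 0"
proof (induction f rule: cpoly_induct)
  case (const c)
  then show ?case by (intro exI[of _ 1]) (simp add: pder_pconst)
next
  case (var i)
  obtain k where k: "mat_pow N k = 0" using assms by (rule nilpotentE)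
  have "(pder N ^^ j) (pvar i) = linform (mat_pow N j) i" for j
    by (induction j) (simp_all add: mat_pow_0 linform_mat_1 pder_linform mat_pow_Suc2)
  then have "(pder N ^^ k) (pvar i) = 0" by (simp add: k linform_def)
  then show ?case by blast
next
  case (add f g)
  then obtain i j where ij: "(pder N ^^ i) f = 0" "(pder N ^^ j) g = 0" by blast
  have "(pder N ^^ (i + j)) f = 0" "(pder N ^^ (i + j)) g = 0"
    using P.funpow_eq_zero_mono[OF linop_pder ij(1)] P.funpow_eq_zero_mono[OF linop_pder ij(2)] by auto
  then have "(pder N ^^ (i + j)) (f + g) = 0" by (simp add: P.linop_add[OF P.linop_funpow[OF linop_pder]])
  then show ?case by blast
next
  case (mult f g)
  then obtain i j where ij: "(pder N ^^ i) f = 0" "(pder N ^^ j) g = 0" by blast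
  have "(pder N ^^ (i + j)) (f * g) = 0"
    by (rule leibniz_nilpotent[where m = "(*)", OF _ _ _ _ _ ij])
      (simp_all add: pder_mult pder_plus P.linop_zero[OF linop_pder] add.commute)
  then show ?case by blast
qed

text \<open>The eigenvectors are the monomials in coordinates that diagonalize D.\<close>

lemma pder_eigenvectors_span:
  assumes "diagonalizable (D :: 'm::finite cmatrix)"
  shows "P.span (P.eigenvectors (pder D)) = UNIV"
proof -
  obtain P' R \<Lambda> :: "'m cmatrix" where PR: "P' ** R = mat 1" "R ** P' = mat 1" and \<Lambda>: "diagonal_matrix \<Lambda>"
    and D: "P' ** D = \<Lambda> ** P'" by (rule diagonalizableE[OF assms]) (rule that)
  have "psub P' (pmon a) \<in> P.eigenvectors (pder D)" for a
  proof -
    have "pder D (psub P' (pmon a)) = psub P' (pder \<Lambda> (pmon a))" by (rule psub_pder[OF D, symmetric])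
    then have "pder D (psub P' (pmon a)) = pscale (weight \<Lambda> a) (psub P' (pmon a))"
      by (simp add: pder_diagonal[OF \<Lambda>] P.linop_scale[OF linop_psub])
    then show ?thesis unfolding P.eigenvectors_def by blast
  qed
  then have "psub P' g \<in> P.span (P.eigenvectors (pder D))" for g
    by (subst cpoly_expand) (simp only: P.linop_sum[OF linop_psub] P.linop_scale[OF linop_psub],
      intro P.span_sum P.span_scale P.span_base)
  moreover have "psub P' (psub R f) = f" for f by (simp add: psub_psub PR psub_mat_1)
  ultimately show ?thesis by (metis UNIV_eq_I)
qed

lemma pder_split: "pder A f = pder (ss A) f + pder (A - ss A) f"
  by (simp flip: pder_mat_add)

lemma pder_comm: "bracket A B = 0 \<Longrightarrow> pder A (pder B f) = pder B (pder A f)"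
  using pder_bracket[of A B f] bracket_anti[of B A] by (simp add: pder_mat_0)

text \<open>The Jordan decomposition of A induces that of its derivation, and a subspace stable
  under an operator is stable under its semisimple part.\<close>

lemma stab_lie_ss:
  assumes J: "P.subspace J" and A: "A \<in> stab_lie J"
  shows "ss A \<in> stab_lie J"
proof -
  have "P.stable (pder (ss A)) J"
  proof (rule P.semisimple_part_stable[OF linop_pder linop_pder])
    show "pder (ss A) (pder (A - ss A) f) = pder (A - ss A) (pder (ss A) f)" for f
      by (rule pder_comm[OF bracket_ss_nilpotent_part])
    show "pder A f = pder (ss A) f + pder (A - ss A) f" for f by (rule pder_split)
    show "f \<in> P.span (P.eigenvectors (pder (ss A)))" for f
      using pder_eigenvectors_span[OF ss_diagonalizable] by blast
    show "\<exists>k. (pder (A - ss A) ^^ k) f = 0" for f by (rule pder_nilpotent[OF ss_nilpotent])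
    show "P.stable (pder A) J" using A J by (auto simp: P.stable_def stab_lie_def)
  qed
  then show ?thesis by (auto simp: P.stable_def stab_lie_def)
qed

text \<open>The condition on the first row says that a coordinate hyperplane is stable, so the
  argument for J can be repeated.\<close>

lemma row_fixing_ss:
  assumes A: "A \<in> row_fixing" shows "ss A \<in> row_fixing"
proof -
  let ?U = "{v :: complex ^ 'a option. v $ None = 0}"
  have row: "(B *v v) $ None = B $ None $ None * v $ None" if "B \<in> row_fixing"
    for v :: "complex ^ 'a option" and B
  proof -
    have "(B *v v) $ None = (\<Sum>k\<in>UNIV. if k = None then B $ None $ k * v $ k else 0)"
      unfolding matrix_vector_mult_def vec_lambda_beta
    proof (rule sum.cong)
      show "B $ None $ k * v $ k = (if k = None then B $ None $ k * v $ k else 0)" for k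
        using that by (cases k) (auto simp: row_fixing_def)
    qed simp
    then show ?thesis by simp
  qed
  have "V.stable ((*v) (ss A)) ?U"
  proof (rule V.semisimple_part_stable[OF linop_mv linop_mv])
    show "ss A *v ((A - ss A) *v v) = (A - ss A) *v (ss A *v v)" for v
      using bracket_ss_nilpotent_part[of A] by (simp only: matrix_vector_mul_assoc bracket_eq_0_iff)
    show "A *v v = ss A *v v + (A - ss A) *v v" for v
      by (simp flip: matrix_vector_mult_add_rdistrib)
    show "v \<in> vec.span (V.eigenvectors ((*v) (ss A)))" for v
      using ss_diagonalizable diagonalizable_iff by blast
    show "\<exists>k. ((*v) (A - ss A) ^^ k) v = 0" for v
      using ss_nilpotent nilpotent_iff by blast
    show "V.stable ((*v) A) ?U" by (auto simp: V.stable_def vec.subspace_def row[OF A])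
  qed
  then have "(ss A *v axis (Some j) 1) $ None = 0" for j
    unfolding V.stable_def by (auto simp: axis_def)
  then show ?thesis by (simp add: row_fixing_def matrix_mult_axis_column)
qed

section \<open>Splitting a Cartan subalgebra into diagonalizable and nilpotent elements\<close>

section \<open>The structure of a Cartan subalgebra\<close>

text \<open>An eigencomponent of B in C under ad (ss A) lies in C, where ad A is nilpotent; for an
  eigenvalue \<mu> \<noteq> 0 it is also killed by a power of ad A - \<mu>, so it is 0. Thus ad (ss
  A) vanishes on C, and self-normalization puts ss A into C.\<close>

lemma cartan_ss:
  assumes L: "lie_algebra L" and ssL: "\<And>A. A \<in> L \<Longrightarrow> ss A \<in> L"
    and C: "cartan_subalgebra C L" and A: "A \<in> C"
  shows "ss A \<in> C" "B \<in> C \<Longrightarrow> bracket (ss A) B = 0"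
proof -
  have CL: "C \<subseteq> L" and Cl: "lie_algebra C" using C by (auto simp: cartan_subalgebra_def lie_subalgebra_def)
  obtain m where m: "\<And>B. B \<in> C \<Longrightarrow> (bracket A ^^ m) B = 0"
    using C A unfolding cartan_subalgebra_def by blast
  have norm: "C = {A \<in> L. \<forall>B\<in>C. bracket A B \<in> C}" using C by (simp add: cartan_subalgebra_def)
  let ?S = "bracket (ss A)" and ?N = "bracket (A - ss A)"
  note comm = bracket_comm[OF bracket_ss_nilpotent_part]
  have zero: "?S B = 0" if B: "B \<in> C" for B
  proof -
    have "B \<in> cmat.span (M.eigenvectors ?S)" using ad_eigenvectors_span[OF ss_diagonalizable] by blast
    then obtain F u where F: "finite F" "\<forall>\<mu>. ?S (u \<mu>) = cscale \<mu> (u \<mu>)" "B = (\<Sum>\<mu>\<in>F. u \<mu>)"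
      using M.eigen_span_decompose[OF linop_bracket] by blast
    have z: "cscale \<mu> (u \<mu>) = 0" if \<mu>: "\<mu> \<in> F" for \<mu>
    proof (cases "\<mu> = 0")
      case False
      have "u \<mu> \<in> C"
        by (rule M.semisimple_components[OF linop_bracket linop_bracket comm bracket_split
              lie_algebraD(3)[OF Cl A] F(1) _ ad_nilpotent[OF ss_nilpotent] _ \<mu>])
          (use F B in auto)
      then have z1: "(M.shift (bracket A) 0 ^^ m) (u \<mu>) \<in> {0}"
        using m by (simp add: M.shift_def[abs_def])
      obtain k where "(?N ^^ k) (u \<mu>) = 0" using ad_nilpotent[OF ss_nilpotent] by blast
      then have z2: "(M.shift (bracket A) \<mu> ^^ k) (u \<mu>) = 0"
        using M.shift_funpow_eigen[OF linop_bracket linop_bracket comm bracket_split] F(2) by metis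
      have "u \<mu> \<in> {0}"
        by (rule M.gen_eigen_cancel[OF linop_bracket M.stable_zero[OF linop_bracket] False z2 z1])
      then show ?thesis by simp
    qed simp
    have "?S B = (\<Sum>\<mu>\<in>F. cscale \<mu> (u \<mu>))" using F(2) by (simp add: F(3) M.linop_sum[OF linop_bracket])
    also have "\<dots> = 0" using z by (rule sum.neutral[OF ballI])
    finally show ?thesis .
  qed
  then show "B \<in> C \<Longrightarrow> ?S B = 0" .
  have "ss A \<in> L" using ssL A CL by blast
  moreover have "0 \<in> C" using lie_algebraD(1)[OF Cl] by (simp add: cmat.subspace_0)
  ultimately show "ss A \<in> C" using zero by (subst norm) auto
qed

text \<open>Frames index functionals by the representatives themselves, so the index has to be
  recovered from the coordinate vector.\<close>

definition axis_coord :: "complex ^ 'm::finite \<Rightarrow> complex ^ 'm \<Rightarrow> complex"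
  where "axis_coord r v = v $ (THE i. r = axis i 1)"

lemma axis_coord_axis: "axis_coord (axis i 1) v = v $ i"
  by (simp add: axis_coord_def axis_eq_axis)

lemma inj_axis: "inj (\<lambda>i. axis i 1 :: complex ^ 'm::finite)"
  by (auto intro!: injI simp: axis_eq_axis)

lemma axis_frame: "V.frame {0} UNIV (range (\<lambda>i. axis i 1)) axis_coord"
proof -
  have "v - (\<Sum>r\<in>range (\<lambda>i. axis i 1). axis_coord r v *s r) = 0" for v :: "complex ^ 'a"
    by (simp add: sum.reindex[OF inj_axis] axis_coord_axis basis_expansion)
  moreover have "V.linfun (axis_coord (axis i 1))" for i :: 'a
    by (simp add: V.linfun_def axis_coord_axis)
  ultimately show ?thesis
    unfolding V.frame_def by (auto simp: axis_coord_axis axis_eq_axis vec.subspace_UNIV) (auto simp: axis_def)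
qed

lemma frame_trace_axis: "V.frame_trace (range (\<lambda>i. axis i 1)) axis_coord ((*v) A) = trace A"
  by (simp add: V.frame_trace_def sum.reindex[OF inj_axis] axis_coord_axis matrix_mult_axis_column trace_def)

lemma trace_nilpotent:
  assumes "nilpotent A" shows "trace A = 0"
proof -
  obtain k where "mat_pow A k = 0" using assms by (rule nilpotentE)
  then have "((*v) A ^^ k) v = 0" for v using mat_pow_mv[of A k v] by simp
  then have "V.frame_trace (range (\<lambda>i. axis i 1)) axis_coord ((*v) A) = 0"
    by (intro V.frame_trace_nilpotent[OF axis_frame linop_mv V.stable_zero[OF linop_mv] V.stable_UNIV, of k]) simp
  then show ?thesis by (simp add: frame_trace_axis)
qed

lemma mat_pow_mult_commute:
  assumes "A ** B = B ** A"
  shows "mat_pow (A ** B) k = mat_pow A k ** mat_pow B k"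
proof -
  have c: "B ** mat_pow A k = mat_pow A k ** B" for k
  proof (induction k)
    case (Suc k)
    have "B ** mat_pow A (Suc k) = A ** (B ** mat_pow A k)"
      using assms by (simp add: mat_pow_Suc matrix_mul_assoc)
    then show ?case by (simp add: Suc mat_pow_Suc matrix_mul_assoc)
  qed (simp add: mat_pow_0)
  show ?thesis
  proof (induction k)
    case (Suc k)
    have "mat_pow (A ** B) (Suc k) = A ** (B ** mat_pow A k) ** mat_pow B k"
      by (simp add: mat_pow_Suc Suc matrix_mul_assoc)
    then show ?case unfolding c by (simp add: mat_pow_Suc matrix_mul_assoc)
  qed (simp add: mat_pow_0)
qed

lemma nilpotent_mult_commute:
  assumes "nilpotent B" "A ** B = B ** A" shows "nilpotent (A ** B)"
proof -
  obtain k where "mat_pow B k = 0" using assms(1) by (rule nilpotentE)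
  then have "mat_pow (A ** B) k = 0" by (simp add: mat_pow_mult_commute[OF assms(2)])
  then show ?thesis by (auto simp: nilpotent_def mat_pow_def)
qed

lemma trace_cmat_diff: "trace (A - B) = trace A - trace (B :: 'm::finite cmatrix)"
  by (simp add: trace_def sum_subtractf)

lemma trace_cmat_add: "trace (A + B) = trace A + trace (B :: 'm::finite cmatrix)"
  by (simp add: trace_def sum.distrib)

text \<open>The eigenvalues of the semisimple part \<open>S\<close> of \<open>A + B\<close> are killed by pairing \<open>S\<close> with its
  complex conjugate \<open>Y\<close> (in an eigenbasis) under the trace form: \<open>trace (Y S) = \<Sum> |\<lambda>|\<^sup>2\<close>, while
  \<open>trace (Y A) = trace (Y B) = 0\<close> because \<open>Y\<close> commutes with the nilpotent matrices \<open>A\<close>, \<open>B\<close>.\<close>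

lemma nilpotent_add_commuting_ss:
  fixes A B :: "'m::finite cmatrix"
  assumes A: "nilpotent A" and B: "nilpotent B"
    and SA: "ss (A + B) ** A = A ** ss (A + B)" and SB: "ss (A + B) ** B = B ** ss (A + B)"
  shows "nilpotent (A + B)"
proof -
  let ?S = "ss (A + B)"
  obtain P R \<Lambda> :: "'m cmatrix" where PR: "P ** R = mat 1" "R ** P = mat 1" and \<Lambda>: "diagonal_matrix \<Lambda>"
    and D: "P ** ?S = \<Lambda> ** P" "?S ** R = R ** \<Lambda>" "?S = R ** \<Lambda> ** P"
    by (rule diagonalizableE[OF ss_diagonalizable]) (rule that)
  define \<Gamma> :: "'m cmatrix" where "\<Gamma> = (\<chi> i j. cnj (\<Lambda> $ i $ j))"
  define Y where "Y = R ** \<Gamma> ** P"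
  have \<Gamma>: "i \<noteq> j \<Longrightarrow> \<Gamma> $ i $ j = 0" for i j using \<Lambda> by (simp add: \<Gamma>_def diagonal_matrix_def)
  have dl: "(E ** Z) $ i $ j = E $ i $ i * Z $ i $ j" if "\<And>i j. i \<noteq> j \<Longrightarrow> E $ i $ j = 0" for E Z :: "'m cmatrix" and i j
  proof -
    have "(E ** Z) $ i $ j = (\<Sum>k\<in>UNIV. if k = i then E $ i $ i * Z $ i $ j else 0)"
      unfolding matrix_matrix_mult_def vec_lambda_beta using that by (intro sum.cong) auto
    then show ?thesis by simp
  qed
  have dr: "(Z ** E) $ i $ j = Z $ i $ j * E $ j $ j" if "\<And>i j. i \<noteq> j \<Longrightarrow> E $ i $ j = 0" for E Z :: "'m cmatrix" and i j
  proof -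
    have "(Z ** E) $ i $ j = (\<Sum>k\<in>UNIV. if k = j then Z $ i $ j * E $ j $ j else 0)"
      unfolding matrix_matrix_mult_def vec_lambda_beta using that by (intro sum.cong) auto
    then show ?thesis by simp
  qed
  have \<Lambda>0: "i \<noteq> j \<Longrightarrow> \<Lambda> $ i $ j = 0" for i j using \<Lambda> by (simp add: diagonal_matrix_def)
  \<comment> \<open>Y is a function of S: in the eigenbasis, a matrix commuting with S has nonzero
    entries only between equal eigenvalues, and these have equal conjugates.\<close>
  have comm: "Y ** Z = Z ** Y" if Z: "?S ** Z = Z ** ?S" for Z
  proof -
    let ?Z = "P ** Z ** R"
    have e1: "\<Lambda> ** ?Z = P ** (?S ** Z) ** R" by (simp add: matrix_mul_assoc D(1))
    have e2: "?Z ** \<Lambda> = P ** (Z ** ?S) ** R" by (simp add: matrix_mul_assoc[symmetric] D(2))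
    have c: "\<Lambda> ** ?Z = ?Z ** \<Lambda>" unfolding e1 e2 Z ..
    have "\<Lambda> $ i $ i * ?Z $ i $ j = ?Z $ i $ j * \<Lambda> $ j $ j" for i j
    proof -
      have "\<Lambda> $ i $ i * ?Z $ i $ j = (\<Lambda> ** ?Z) $ i $ j" by (rule dl[OF \<Lambda>0, symmetric])
      also have "\<dots> = ?Z $ i $ j * \<Lambda> $ j $ j" unfolding c by (rule dr[OF \<Lambda>0])
      finally show ?thesis .
    qed
    then have zero: "?Z $ i $ j = 0 \<or> \<Lambda> $ i $ i = \<Lambda> $ j $ j" for i j by (metis mult.commute mult_cancel_left)
    have "(\<Gamma> ** ?Z) $ i $ j = (?Z ** \<Gamma>) $ i $ j" for i j
    proof -
      have 1: "(\<Gamma> ** ?Z) $ i $ j = \<Gamma> $ i $ i * ?Z $ i $ j" by (rule dl[OF \<Gamma>])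
      have 2: "(?Z ** \<Gamma>) $ i $ j = ?Z $ i $ j * \<Gamma> $ j $ j" by (rule dr[OF \<Gamma>])
      from zero[of i j] show ?thesis
      proof
        assume "\<Lambda> $ i $ i = \<Lambda> $ j $ j"
        then have "\<Gamma> $ i $ i = \<Gamma> $ j $ j" by (simp add: \<Gamma>_def)
        then show ?thesis unfolding 1 2 by simp
      qed (simp only: 1 2 mult_zero_left mult_zero_right)
    qed
    then have G: "\<Gamma> ** ?Z = ?Z ** \<Gamma>" by (simp add: vec_eq_iff)
    have "Y ** Z = R ** \<Gamma> ** P ** Z ** (R ** P)" by (simp add: Y_def PR(2))
    also have "\<dots> = R ** (\<Gamma> ** ?Z) ** P" by (simp add: matrix_mul_assoc)
    also have "\<dots> = (R ** P) ** Z ** (R ** \<Gamma> ** P)" unfolding G by (simp add: matrix_mul_assoc)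
    also have "\<dots> = Z ** Y" by (simp add: Y_def PR(2))
    finally show ?thesis .
  qed
  have tr0: "trace (Y ** Z) = 0" if "nilpotent Z" "?S ** Z = Z ** ?S" for Z
    by (rule trace_nilpotent[OF nilpotent_mult_commute[OF that(1) comm[OF that(2)]]])
  have "bracket ?S (A + B - ?S) = 0" by (rule bracket_ss_nilpotent_part)
  then have "trace (Y ** (A + B - ?S)) = 0"
    by (intro tr0[OF ss_nilpotent]) (simp add: bracket_eq_0_iff)
  then have "trace (Y ** ?S) = trace (Y ** A) + trace (Y ** B)"
    by (simp add: matrix_diff_ldistrib matrix_add_ldistrib trace_cmat_diff trace_cmat_add)
  then have "trace (Y ** ?S) = 0" by (simp add: tr0 A B SA SB)
  moreover have "Y ** ?S = R ** (\<Gamma> ** \<Lambda> ** P)"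
  proof -
    have "Y ** ?S = R ** \<Gamma> ** (P ** ?S)" by (simp add: Y_def matrix_mul_assoc)
    then show ?thesis unfolding D(1) by (simp add: matrix_mul_assoc)
  qed
  ultimately have "trace (\<Gamma> ** \<Lambda> ** P ** R) = 0" using trace_mul_sym[of R "\<Gamma> ** \<Lambda> ** P"] by simp
  moreover have "\<Gamma> ** \<Lambda> ** P ** R = \<Gamma> ** \<Lambda>" by (simp add: matrix_mul_assoc[symmetric] PR(1))
  ultimately have "(\<Sum>i\<in>UNIV. cnj (\<Lambda> $ i $ i) * \<Lambda> $ i $ i) = 0"
    by (simp add: trace_def dl[of \<Gamma>, OF \<Gamma>]) (simp add: \<Gamma>_def)
  moreover have "(\<Sum>i\<in>UNIV. cnj (\<Lambda> $ i $ i) * \<Lambda> $ i $ i) = of_real (\<Sum>i\<in>UNIV. (cmod (\<Lambda> $ i $ i))\<^sup>2)"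
    by (simp add: mult.commute flip: complex_norm_square)
  ultimately have "(\<Sum>i\<in>UNIV. (cmod (\<Lambda> $ i $ i))\<^sup>2) = 0" by (metis of_real_eq_0_iff)
  then have "\<Lambda> $ i $ i = 0" for i by (simp add: sum_nonneg_eq_0_iff)
  then have "\<Lambda> $ i $ j = 0" for i j using \<Lambda>0[of i j] by (cases "i = j") auto
  then have "\<Lambda> = 0" by (simp add: vec_eq_iff)
  then have "?S = 0" using D(3) by simp
  then show ?thesis using ss_nilpotent[of "A + B"] by simp
qed

lemma nilpotent_cscale: "nilpotent A \<Longrightarrow> nilpotent (cscale c A)"
proof -
  assume A: "nilpotent A"
  have "cscale c A = cscale c (mat 1) ** A" by (simp add: cscale_mult_left)
  moreover have "cscale c (mat 1) ** A = A ** cscale c (mat 1)" by (simp add: cscale_mult_left cscale_mult_right)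
  ultimately show ?thesis using nilpotent_mult_commute[OF A, of "cscale c (mat 1)"] by simp
qed

lemma nilpotent_0: "nilpotent 0"
  unfolding nilpotent_def by (intro exI[of _ 1]) simp

text \<open>All semisimple parts of elements of C are central in C. This makes diagonalizable
  elements commute, hence closed under sums, and supplies the commutation that
  \<open>nilpotent_add_commuting_ss\<close> asks for.\<close>

lemma cartan_direct_sum:
  assumes L: "lie_algebra L" and ssL: "\<And>A. A \<in> L \<Longrightarrow> ss A \<in> L" and C: "cartan_subalgebra C L"
  shows "direct_sum C {A \<in> C. diagonalizable A} {A \<in> C. nilpotent A}"
proof -
  have Cs: "cmat.subspace C"
    using C by (auto simp: cartan_subalgebra_def lie_subalgebra_def lie_algebra_def)
  have C0: "0 \<in> C" by (rule cmat.subspace_0[OF Cs])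
  have cent: "ss A \<in> C" "B \<in> C \<Longrightarrow> bracket (ss A) B = 0" if "A \<in> C" for A B
    using cartan_ss[OF L _ C that] ssL by blast+
  have comm: "ss A ** B = B ** ss A" if "A \<in> C" "B \<in> C" for A B
    using cent(2) that by (simp add: bracket_eq_0_iff)
  have "cmat.subspace {A \<in> C. diagonalizable A}"
    unfolding cmat.subspace_def
  proof (intro conjI ballI allI)
    show "0 \<in> {A \<in> C. diagonalizable A}" using C0 diagonalizable_0 by simp
    fix A assume A: "A \<in> {A \<in> C. diagonalizable A}"
    show "cscale c A \<in> {A \<in> C. diagonalizable A}" for c
      using A by (auto intro: cmat.subspace_scale[OF Cs] diagonalizable_cscale)
    fix B assume B: "B \<in> {A \<in> C. diagonalizable A}"
    have "A ** B = B ** A" using comm[of A B] A B ss_of_diagonalizable[of A] by simp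
    then show "A + B \<in> {A \<in> C. diagonalizable A}"
      using A B by (auto intro: cmat.subspace_add[OF Cs] diagonalizable_add)
  qed
  moreover have "cmat.subspace {A \<in> C. nilpotent A}"
    unfolding cmat.subspace_def
  proof (intro conjI ballI allI)
    show "0 \<in> {A \<in> C. nilpotent A}" using C0 nilpotent_0 by simp
    fix A assume A: "A \<in> {A \<in> C. nilpotent A}"
    show "cscale c A \<in> {A \<in> C. nilpotent A}" for c
      using A by (auto intro: cmat.subspace_scale[OF Cs] nilpotent_cscale)
    fix B assume B: "B \<in> {A \<in> C. nilpotent A}"
    have "A + B \<in> C" using A B by (auto intro: cmat.subspace_add[OF Cs])
    then show "A + B \<in> {A \<in> C. nilpotent A}"
      using A B comm[of "A + B" A] comm[of "A + B" B] by (auto intro: nilpotent_add_commuting_ss)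
  qed
  moreover have "C = {A + B |A B. A \<in> {A \<in> C. diagonalizable A} \<and> B \<in> {A \<in> C. nilpotent A}}"
  proof (intro equalityI subsetI)
    fix A assume A: "A \<in> C"
    have "A - ss A \<in> C" using A cent(1) by (intro cmat.subspace_diff[OF Cs])
    then have "A = ss A + (A - ss A) \<and> ss A \<in> {A \<in> C. diagonalizable A} \<and> A - ss A \<in> {A \<in> C. nilpotent A}"
      using A cent(1) ss_diagonalizable ss_nilpotent by auto
    then show "A \<in> {A + B |A B. A \<in> {A \<in> C. diagonalizable A} \<and> B \<in> {A \<in> C. nilpotent A}}" by blast
  qed (auto intro: cmat.subspace_add[OF Cs])
  moreover have "{A \<in> C. diagonalizable A} \<inter> {A \<in> C. nilpotent A} = {0}"
    using C0 diagonalizable_0 nilpotent_0 diagonalizable_nilpotent_0 by auto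
  ultimately show ?thesis by (simp add: direct_sum_def)
qed

lemma matrix_inv_transpose:
  assumes "invertible (Q :: 'm::finite cmatrix)"
  shows "invertible (transpose Q)" "matrix_inv (transpose Q) = transpose (matrix_inv Q)"
  using matrix_inv_unique_cmatrix[of "transpose Q" "transpose (matrix_inv Q)"] matrix_inv_cmatrix[OF assms]
  by (simp_all add: matrix_transpose_mul[symmetric] transpose_mat)

lemma diagonal_matrix_transpose: "diagonal_matrix A \<Longrightarrow> diagonal_matrix (transpose A)"
  by (simp add: diagonal_matrix_def transpose_def)

lemma diagonalizable_transpose:
  assumes "diagonalizable (A :: 'm::finite cmatrix)" shows "diagonalizable (transpose A)"
proof -
  obtain P :: "'m cmatrix" where P: "invertible P" "diagonal_matrix (P ** A ** matrix_inv P)"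
    using assms unfolding diagonalizable_def by blast
  let ?Q = "transpose (matrix_inv P)"
  note i = matrix_inv_cmatrix[OF P(1)]
  have "invertible ?Q" "matrix_inv ?Q = transpose P"
    using matrix_inv_unique_cmatrix[of ?Q "transpose P"] i
    by (simp_all add: matrix_transpose_mul[symmetric] transpose_mat)
  moreover have "?Q ** transpose A ** transpose P = transpose (P ** A ** matrix_inv P)"
    by (simp add: matrix_transpose_mul matrix_mul_assoc)
  ultimately show ?thesis using diagonal_matrix_transpose[OF P(2)] unfolding diagonalizable_def by metis
qed

text \<open>The shape of the first row makes e_0 a joint eigenvector of the transposes. An
  eigenbasis with e_0 in place 0 becomes, transposed, a matrix with first row e_0.\<close>

lemma simultaneous_diagonalization_affine:
  fixes T :: "'n::finite option cmatrix set"
  assumes T: "\<And>A. A \<in> T \<Longrightarrow> diagonalizable A" "\<And>A B. A \<in> T \<Longrightarrow> B \<in> T \<Longrightarrow> A ** B = B ** A"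
    and row: "T \<subseteq> row_fixing"
  shows "\<exists>S\<in>affine_group. \<forall>A\<in>T. diagonal_matrix (S ** A ** matrix_inv S)"
proof -
  let ?E = "{v. \<forall>A\<in>transpose ` T. \<exists>c. A *v v = c *s v}"
  have "vec.span ?E = UNIV"
    by (rule joint_eigenvectors_span)
      (use T in \<open>auto intro: diagonalizable_transpose simp flip: matrix_transpose_mul\<close>)
  moreover have "axis None 1 \<in> ?E" using row row_fixing_eigen by blast
  moreover have "(axis None 1 :: complex ^ 'n option) \<noteq> 0" by (simp add: axis_eq_0_iff)
  ultimately obtain Q :: "'n option cmatrix" where Q: "invertible Q" "Q *v axis None 1 = axis None 1"
    "\<And>A. A \<in> transpose ` T \<Longrightarrow> diagonal_matrix (matrix_inv Q ** A ** Q)"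
    by (rule joint_eigenbasis[where ?i0.0 = None]) (rule that)
  let ?S = "transpose Q"
  note inv = matrix_inv_transpose[OF Q(1)]
  have "axis None 1 v* ?S = axis None 1" using Q(2) by simp
  then have "?S \<in> affine_group" using inv by (simp add: affine_group_def)
  moreover have "diagonal_matrix (?S ** A ** matrix_inv ?S)" if "A \<in> T" for A
  proof -
    have "?S ** A ** matrix_inv ?S = transpose (matrix_inv Q ** transpose A ** Q)"
      by (simp add: inv(2) matrix_transpose_mul matrix_mul_assoc)
    then show ?thesis using diagonal_matrix_transpose[OF Q(3)] that by simp
  qed
  ultimately show ?thesis by blast
qed

lemma output_exists:
  fixes I :: "'n::finite cpoly set"
  assumes C: "cartan_subalgebra C (affine_lie_algebra I)"
  shows "\<exists>r. can_output I C r"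
proof -
  let ?J = "homogenized_ideal I"
  have J: "P.subspace ?J"
    unfolding homogenized_ideal_def by (intro is_ideal_subspace is_ideal_genideal)
  have L: "lie_algebra (affine_lie_algebra I)" unfolding affine_lie_algebra_eq by (rule lie_algebra_affine[OF J])
  have ssL: "ss A \<in> affine_lie_algebra I" if "A \<in> affine_lie_algebra I" for A
    using that stab_lie_ss[OF J] row_fixing_ss unfolding affine_lie_algebra_eq by blast
  let ?T = "{A \<in> C. diagonalizable A}"
  have "\<exists>S\<in>affine_group. \<forall>A\<in>?T. diagonal_matrix (S ** A ** matrix_inv S)"
  proof (rule simultaneous_diagonalization_affine)
    show "diagonalizable A" if "A \<in> ?T" for A using that by blast
    show "A ** B = B ** A" if A: "A \<in> ?T" and B: "B \<in> ?T" for A B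
    proof -
      have "bracket (ss A) B = 0" by (rule cartan_ss(2)[OF L _ C]) (use ssL A B in auto)
      then show ?thesis using A by (simp add: ss_of_diagonalizable bracket_eq_0_iff)
    qed
    show "?T \<subseteq> row_fixing"
      using C by (auto simp: cartan_subalgebra_def lie_subalgebra_def affine_lie_algebra_eq)
  qed
  then show ?thesis
    unfolding can_output_def using cartan_direct_sum[OF L ssL C] by blast
qed

section \<open>Conjugates of C fill a neighbourhood of x in L\<close>

section \<open>Regular elements dominate the Lie algebra\<close>

text \<open>Fitting's decomposition L = C + [L, x]: the components of B with nonzero eigenvalue lie
  in the image of ad x. This is the surjectivity of the differential at x.\<close>

lemma ad_fitting:
  assumes L: "lie_algebra (L :: 'm::finite cmatrix set)" and x: "x \<in> L" and B: "B \<in> L"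
  shows "\<exists>c\<in>ad_kernel L x. \<exists>y\<in>L. B = c + bracket y x"
proof -
  let ?Z = "bracket x"
  note st = lie_algebraD(3)[OF L x]
  have Ls: "cmat.subspace L" by (rule lie_algebraD(1)[OF L])
  have "M.gen_eigen_decomposable ?Z B"
    by (rule M.gen_eigen_decomposable_finite_span[OF linop_bracket _ cmat_in_span_units]) simp
  then obtain F u where F: "finite F" "\<forall>\<mu>\<in>F. \<exists>k. (M.shift ?Z \<mu> ^^ k) (u \<mu>) = 0" "B = (\<Sum>\<mu>\<in>F. u \<mu>)"
    unfolding M.gen_eigen_decomposable_def by blast
  have uL: "u \<mu> \<in> L" if "\<mu> \<in> F" for \<mu>
    by (rule M.gen_eigen_components[OF linop_bracket st F(1) _ _ that]) (use F B in auto)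
  have sh0: "M.shift ?Z 0 = ?Z" by (simp add: M.shift_def[abs_def])
  have "\<exists>w\<in>L. ?Z w = u \<mu>" if "\<mu> \<in> F" "\<mu> \<noteq> 0" for \<mu>
  proof -
    from bspec[OF F(2) that(1)] obtain k where k: "(M.shift ?Z \<mu> ^^ k) (u \<mu>) = 0" by (rule exE)
    show ?thesis
      by (rule M.gen_eigen_solve[OF linop_bracket st not_sym[OF that(2)] k uL[OF that(1)], unfolded sh0])
  qed
  then obtain w where w: "\<And>\<mu>. \<mu> \<in> F - {0} \<Longrightarrow> w \<mu> \<in> L" "\<And>\<mu>. \<mu> \<in> F - {0} \<Longrightarrow> ?Z (w \<mu>) = u \<mu>"
    by (metis DiffE insertCI)
  let ?W = "\<Sum>\<mu>\<in>F - {0}. w \<mu>" and ?c = "if 0 \<in> F then u 0 else 0"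
  have WL: "?W \<in> L" using w(1) by (rule cmat.subspace_sum[OF Ls])
  have ZW: "?Z ?W = (\<Sum>\<mu>\<in>F - {0}. u \<mu>)"
    unfolding M.linop_sum[OF linop_bracket] by (rule sum.cong) (simp_all add: w(2))
  have "B = ?c + ?Z ?W" unfolding ZW F(3) using F(1) by (simp add: sum.remove)
  moreover have "?Z ?W = bracket (- ?W) x" using bracket_anti[of "- ?W" x] by (simp add: M.linop_minus[OF linop_bracket])
  moreover have "- ?W \<in> L" by (rule cmat.subspace_neg[OF Ls WL])
  moreover have "?c \<in> ad_kernel L x"
  proof (cases "0 \<in> F")
    case True
    then obtain k where "(?Z ^^ k) (u 0) = 0" using F(2) sh0 by metis
    then show ?thesis using ad_kernel_iff[OF L x] uL[OF True] True by auto
  next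
    case False
    then show ?thesis using lie_algebraD(1)[OF lie_algebra_ad_kernel[OF L x]] by (simp add: cmat.subspace_0)
  qed
  ultimately show ?thesis by (intro bexI[of _ ?c] bexI[of _ "- ?W"]) simp_all
qed

text \<open>Conjugation by such g preserves L (\<open>aff_stab_conj\<close>), and substitution by g
  preserves J and hence the traces modulo J. All conditions are imposed on the inverse too, so no
  finiteness argument is needed for it.\<close>

definition aff_stab :: "'n::finite option cpoly set \<Rightarrow> 'n option cmatrix set"
  where "aff_stab J = {g. invertible g \<and> g \<in> row_fixing \<and> matrix_inv g \<in> row_fixing \<and>
    (\<forall>f\<in>J. psub g f \<in> J) \<and> (\<forall>f\<in>J. psub (matrix_inv g) f \<in> J)}"

lemma mexp_row_fixing:
  assumes "A \<in> row_fixing" shows "mexp A t \<in> row_fixing"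
proof -
  have "mat_pow A k \<in> row_fixing" for k
  proof (induction k)
    case 0
    show ?case by (simp add: mat_pow_0 row_fixing_def mat_def)
  next
    case (Suc k)
    then show ?case unfolding mat_pow_Suc by (rule row_fixing_mult[OF assms])
  qed
  then show ?thesis by (simp add: mexp_def row_fixing_def)
qed

lemma mexp_aff_stab:
  assumes J: "P.subspace J" and A: "A \<in> stab_lie J \<inter> row_fixing"
  shows "mexp A t \<in> aff_stab J"
  unfolding aff_stab_def mem_Collect_eq mexp_inv(2)
  using A by (intro conjI ballI mexp_inv(1) mexp_row_fixing psub_mexp_stable[OF J]) (auto simp: stab_lie_def)

lemma matrix_inv_mult:
  fixes g h :: "'m::finite cmatrix"
  assumes "invertible g" "invertible h"
  shows "invertible (g ** h)" "matrix_inv (g ** h) = matrix_inv h ** matrix_inv g"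
proof -
  have "g ** h ** (matrix_inv h ** matrix_inv g) = g ** (h ** matrix_inv h) ** matrix_inv g"
    "matrix_inv h ** matrix_inv g ** (g ** h) = matrix_inv h ** (matrix_inv g ** g) ** h"
    by (simp_all add: matrix_mul_assoc)
  then have "g ** h ** (matrix_inv h ** matrix_inv g) = mat 1"
    "matrix_inv h ** matrix_inv g ** (g ** h) = mat 1"
    by (simp_all add: matrix_inv_cmatrix assms)
  from matrix_inv_unique_cmatrix[OF this]
  show "invertible (g ** h)" "matrix_inv (g ** h) = matrix_inv h ** matrix_inv g" by auto
qed

lemma aff_stab_mult:
  assumes g: "g \<in> aff_stab J" and h: "h \<in> aff_stab J" shows "g ** h \<in> aff_stab J"
proof -
  have "invertible g" "invertible h" using g h by (auto simp: aff_stab_def)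
  note i = matrix_inv_mult[OF this]
  show ?thesis
    using g h unfolding aff_stab_def mem_Collect_eq i(2)
    by (auto simp: i(1) row_fixing_mult psub_psub[symmetric])
qed

lemma mat_1_aff_stab: "mat 1 \<in> aff_stab J"
proof -
  have "matrix_inv (mat 1 :: 'a option cmatrix) = mat 1" "invertible (mat 1 :: 'a option cmatrix)"
    using matrix_inv_unique_cmatrix[of "mat 1" "mat 1"] by auto
  moreover have "(mat 1 :: 'a option cmatrix) \<in> row_fixing" by (simp add: row_fixing_def mat_def)
  ultimately show ?thesis by (simp add: aff_stab_def psub_mat_1)
qed

lemma pder_conj:
  assumes "invertible g"
  shows "pder (g ** B ** matrix_inv g) (psub (matrix_inv g) f) = psub (matrix_inv g) (pder B f)"
proof (rule psub_pder[symmetric])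
  have "matrix_inv g ** (g ** B ** matrix_inv g) = (matrix_inv g ** g) ** B ** matrix_inv g"
    by (simp add: matrix_mul_assoc)
  then show "matrix_inv g ** (g ** B ** matrix_inv g) = B ** matrix_inv g"
    by (simp add: matrix_inv_cmatrix(2)[OF assms])
qed

lemma aff_stab_conj:
  assumes g: "g \<in> aff_stab J" and B: "B \<in> stab_lie J \<inter> row_fixing"
  shows "g ** B ** matrix_inv g \<in> stab_lie J \<inter> row_fixing"
proof
  have inv: "invertible g" using g by (simp add: aff_stab_def)
  show "g ** B ** matrix_inv g \<in> row_fixing"
    using g B by (auto simp: aff_stab_def intro!: row_fixing_mult)
  have "pder (g ** B ** matrix_inv g) f \<in> J" if f: "f \<in> J" for f
  proof -
    have "psub (matrix_inv g) (pder B (psub g f)) \<in> J"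
      using g B f by (auto simp: aff_stab_def stab_lie_def)
    then show ?thesis
      using pder_conj[OF inv, of B "psub g f"] by (simp add: psub_matrix_inv(2)[OF inv])
  qed
  then show "g ** B ** matrix_inv g \<in> stab_lie J" by (simp add: stab_lie_def)
qed

subsection \<open>The local conjugation map\<close>

lemma bounded_bilinear_cmatrix_mult:
  "bounded_bilinear ((**) :: 'm::finite cmatrix \<Rightarrow> 'm cmatrix \<Rightarrow> 'm cmatrix)"
proof -
  have "(r *\<^sub>R A) ** B = r *\<^sub>R (A ** B)" "A ** (r *\<^sub>R B) = r *\<^sub>R (A ** B)" for r and A B :: "'m cmatrix"
    by (simp_all add: vec_eq_iff matrix_matrix_mult_def scaleR_sum_right)
  then have "bilinear ((**) :: 'm cmatrix \<Rightarrow> 'm cmatrix \<Rightarrow> 'm cmatrix)"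
    unfolding bilinear_def by (auto intro!: linearI simp: matrix_add_ldistrib matrix_add_rdistrib_cmatrix)
  then show ?thesis by (simp add: bilinear_conv_bounded_bilinear)
qed

lemma scaleR_cscale: "r *\<^sub>R A = cscale (complex_of_real r) A"
  by (simp add: vec_eq_iff cscale_def) (simp add: scaleR_conv_of_real)

lemma linop_bounded_linear: "M.linop q \<Longrightarrow> bounded_linear (q :: 'm::finite cmatrix \<Rightarrow> 'm cmatrix)"
  by (simp add: linear_conv_bounded_linear[symmetric] linear_iff scaleR_cscale M.linop_def)

lemma linfun_bounded_linear: "M.linfun s \<Longrightarrow> bounded_linear (s :: 'm::finite cmatrix \<Rightarrow> complex)"
  by (simp add: linear_conv_bounded_linear[symmetric] linear_iff scaleR_cscale M.linfun_def scaleR_conv_of_real)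

lemma bounded_linear_cscale: "bounded_linear (\<lambda>t. cscale t A)"
  by (simp add: linear_conv_bounded_linear[symmetric] linear_iff scaleR_cscale cmat.scale_left_distrib
      scaleR_conv_of_real)

lemma cmatrix_expand: "A = (\<Sum>i\<in>UNIV. \<Sum>j\<in>UNIV. cscale (A $ i $ j) (mat_unit i j :: 'm::finite cmatrix))"
proof -
  have "(\<Sum>i\<in>UNIV. \<Sum>j\<in>UNIV. cscale (A $ i $ j) (mat_unit i j :: 'm cmatrix)) $ k $ l = A $ k $ l" for k l
  proof -
    have "(\<Sum>i\<in>UNIV. \<Sum>j\<in>UNIV. cscale (A $ i $ j) (mat_unit i j :: 'm cmatrix)) $ k $ l =
      (\<Sum>i\<in>UNIV. \<Sum>j\<in>UNIV. if j = l then (if i = k then A $ k $ l else 0) else 0)"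
      unfolding sum_component by (intro sum.cong) (auto simp: cscale_def mat_unit_def)
    then show ?thesis by simp
  qed
  then show ?thesis by (simp add: vec_eq_iff)
qed

lemma mexp_has_derivative_0: "(mexp A has_derivative (\<lambda>t. cscale t A)) (at 0)"
proof -
  have e: "((\<lambda>t. mexp A t $ i $ j) has_derivative (\<lambda>t. t * A $ i $ j)) (at 0)" for i j
    using mexp_has_derivative(1)[of A i j 0]
    by (simp add: mexp_0 has_field_derivative_def mult.commute[of _ "A $ i $ j"])
  have "((\<lambda>t. \<Sum>i\<in>UNIV. \<Sum>j\<in>UNIV. cscale (mexp A t $ i $ j) (mat_unit i j)) has_derivative
    (\<lambda>t. \<Sum>i\<in>UNIV. \<Sum>j\<in>UNIV. cscale (t * A $ i $ j) (mat_unit i j))) (at 0)"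
    by (intro has_derivative_sum bounded_linear.has_derivative[OF bounded_linear_cscale] e)
  moreover have "(\<Sum>i\<in>UNIV. \<Sum>j\<in>UNIV. cscale (t * A $ i $ j) (mat_unit i j)) = cscale t A" for t
    by (subst (3) cmatrix_expand) (simp add: cmat.scale_sum_right)
  ultimately show ?thesis by (simp flip: cmatrix_expand)
qed

lemma continuous_mexp: "continuous_on UNIV (mexp A)"
proof -
  have e: "continuous_on UNIV (\<lambda>t. mexp A t $ i $ j)" for i j
    using mexp_has_derivative(1)[of A i j] by (intro DERIV_continuous_on[of UNIV]) (auto intro: has_field_derivative_at_within)
  have "continuous_on UNIV (\<lambda>t. \<Sum>i\<in>UNIV. \<Sum>j\<in>UNIV. cscale (mexp A t $ i $ j) (mat_unit i j))"
    by (intro continuous_on_sum bounded_linear.continuous_on[OF bounded_linear_cscale] e)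
  then show ?thesis by (simp flip: cmatrix_expand)
qed

lemma matrix_minus_right_cmatrix: "A ** (- B) = - (A ** (B :: 'm::finite cmatrix))"
  using matrix_diff_ldistrib[of A 0 B] by simp

text \<open>F conjugates x + q Y successively by the exponentials of s b Y times y b. Each factor
  adds its bracket with x to the differential at 0, while every value remains a conjugate of an
  element of C.\<close>

lemma conjugation_map:
  fixes L :: "'n::finite option cmatrix set"
  assumes J: "P.subspace J" and L: "L = stab_lie J \<inter> row_fixing" and x: "x \<in> C" and C: "cmat.subspace C"
    and q: "M.linop q" "\<And>Y. q Y \<in> C" and K: "finite K"
    and y: "\<And>b. b \<in> K \<Longrightarrow> y b \<in> L" and s: "\<And>b. b \<in> K \<Longrightarrow> M.linfun (s b)"
  shows "\<exists>F. continuous_on UNIV F \<and> F 0 = x \<and>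
    (F has_derivative (\<lambda>Y. q Y + (\<Sum>b\<in>K. cscale (s b Y) (bracket (y b) x)))) (at 0) \<and>
    (\<forall>Y. \<exists>g\<in>aff_stab J. \<exists>c\<in>C. F Y = g ** c ** matrix_inv g)"
  using K y s
proof (induction K rule: finite_induct)
  case empty
  have "matrix_inv (mat 1 :: 'n option cmatrix) = mat 1"
    using matrix_inv_unique_cmatrix[of "mat 1" "mat 1"] by auto
  then have "\<forall>Y. \<exists>g\<in>aff_stab J. \<exists>c\<in>C. x + q Y = g ** c ** matrix_inv g"
    using x q(2) C by (intro allI bexI[OF _ mat_1_aff_stab]) (auto intro: cmat.subspace_add)
  moreover have "((\<lambda>Y. x + q Y) has_derivative q) (at 0)"
    using has_derivative_add[OF has_derivative_const bounded_linear_imp_has_derivative[OF linop_bounded_linear[OF q(1)]]]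
    by simp
  moreover have "continuous_on UNIV (\<lambda>Y. x + q Y)"
    by (intro continuous_on_add continuous_on_const linear_continuous_on linop_bounded_linear q(1))
  ultimately show ?case
    by (intro exI[of _ "\<lambda>Y. x + q Y"]) (simp add: M.linop_zero[OF q(1)])
next
  case (insert b K)
  then obtain F where F: "continuous_on UNIV F" "F 0 = x"
    "(F has_derivative (\<lambda>Y. q Y + (\<Sum>b\<in>K. cscale (s b Y) (bracket (y b) x)))) (at 0)"
    "\<And>Y. \<exists>g\<in>aff_stab J. \<exists>c\<in>C. F Y = g ** c ** matrix_inv g" by auto
  let ?D = "\<lambda>Y. q Y + (\<Sum>b\<in>K. cscale (s b Y) (bracket (y b) x))"
  have sb: "bounded_linear (s b)" "M.linfun (s b)" using insert.prems by (auto intro: linfun_bounded_linear)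
  have s0: "s b 0 = 0" by (rule M.linfun_zero[OF sb(2)])
  let ?E = "\<lambda>Y. mexp (y b) (s b Y)" and ?E' = "\<lambda>Y. mexp (y b) (- s b Y)"
  let ?G = "\<lambda>Y. ?E Y ** F Y ** ?E' Y"
  have E: "(?E has_derivative (\<lambda>Y. cscale (s b Y) (y b))) (at 0)"
    using has_derivative_compose[OF bounded_linear_imp_has_derivative[OF sb(1)], of "mexp (y b)" "\<lambda>t. cscale t (y b)" 0 UNIV]
      mexp_has_derivative_0[of "y b"] by (simp add: s0)
  have E': "(?E' has_derivative (\<lambda>Y. cscale (- s b Y) (y b))) (at 0)"
    using has_derivative_compose[OF has_derivative_minus[OF bounded_linear_imp_has_derivative[OF sb(1)]], of "mexp (y b)" "\<lambda>t. cscale t (y b)" 0 UNIV]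
      mexp_has_derivative_0[of "y b"] by (simp add: s0)
  note mult = bounded_bilinear.FDERIV[OF bounded_bilinear_cmatrix_mult]
  have "(?G has_derivative (\<lambda>Y. (?E 0 ** F 0) ** cscale (- s b Y) (y b) +
    (?E 0 ** ?D Y + cscale (s b Y) (y b) ** F 0) ** ?E' 0)) (at 0)"
    by (rule mult[OF mult[OF E F(3)] E'])
  moreover have "(?E 0 ** F 0) ** cscale (- s b Y) (y b) + (?E 0 ** ?D Y + cscale (s b Y) (y b) ** F 0) ** ?E' 0
    = q Y + (\<Sum>b\<in>insert b K. cscale (s b Y) (bracket (y b) x))" for Y
    using insert.hyps
    by (simp add: s0 mexp_0 F(2) cscale_mult_left cscale_mult_right bracket_def
        cmat.scale_right_diff_distrib matrix_minus_right_cmatrix algebra_simps)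
  ultimately have "(?G has_derivative (\<lambda>Y. q Y + (\<Sum>b\<in>insert b K. cscale (s b Y) (bracket (y b) x)))) (at 0)"
    by simp
  moreover have "continuous_on UNIV ?G"
  proof -
    have c: "continuous_on UNIV (s b)" by (rule linear_continuous_on[OF sb(1)])
    have "continuous_on UNIV ?E"
      by (rule continuous_on_compose2[OF continuous_mexp c]) simp
    moreover have "continuous_on UNIV ?E'"
      by (rule continuous_on_compose2[OF continuous_mexp continuous_on_minus[OF c]]) simp
    ultimately show ?thesis
      using F(1) by (intro bounded_bilinear.continuous_on[OF bounded_bilinear_cmatrix_mult])
  qed
  moreover have "\<exists>g\<in>aff_stab J. \<exists>c\<in>C. ?G Y = g ** c ** matrix_inv g" for Y
  proof -
    obtain g c where g: "g \<in> aff_stab J" and c: "c \<in> C" and FY: "F Y = g ** c ** matrix_inv g" using F(4) by blast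
    have e: "?E Y \<in> aff_stab J" using insert.prems L by (intro mexp_aff_stab[OF J]) auto
    have "invertible g" using g by (simp add: aff_stab_def)
    then have "matrix_inv (?E Y ** g) = matrix_inv g ** ?E' Y"
      using matrix_inv_mult(2)[OF mexp_inv(1)] by (simp add: mexp_inv(2))
    then have "?G Y = (?E Y ** g) ** c ** matrix_inv (?E Y ** g)" by (simp add: FY matrix_mul_assoc)
    then show ?thesis using aff_stab_mult[OF e g] c by blast
  qed
  moreover have "?G 0 = x" by (simp add: s0 mexp_0 F(2))
  ultimately show ?case by (intro exI[of _ ?G]) blast
qed

text \<open>Writing each basis vector b of L as c b + [y b, x] makes the differential of the
  conjugation map equal to a projection pr onto L, and an open mapping theorem yields the
  neighbourhood.\<close>

lemma dominance:
  fixes L :: "'n::finite option cmatrix set"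
  assumes J: "P.subspace J" and L: "L = stab_lie J \<inter> row_fixing" and x: "x \<in> L" and a: "a \<in> L"
  shows "\<exists>\<epsilon>>0. \<forall>t::real. 0 < t \<and> t < \<epsilon> \<longrightarrow>
    (\<exists>g\<in>aff_stab J. \<exists>c\<in>ad_kernel L x. x + cscale (of_real t) (a - x) = g ** c ** matrix_inv g)"
proof -
  have Ll: "lie_algebra L" unfolding L by (rule lie_algebra_affine[OF J])
  have Ls: "cmat.subspace L" by (rule lie_algebraD(1)[OF Ll])
  let ?C = "ad_kernel L x"
  have Cs: "cmat.subspace ?C" by (rule lie_algebraD(1)[OF lie_algebra_ad_kernel[OF Ll x]])
  have CL: "?C \<subseteq> L" by (auto simp: ad_kernel_def)
  obtain pr where pr: "M.linop pr" "\<And>v. pr v \<in> L" "\<And>u. u \<in> L \<Longrightarrow> pr u = u"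
    by (rule M.subspace_projection[OF Ls]) (rule that)
  obtain B where B: "finite B" "cmat.span B = L" using subspace_basis[OF Ls] by metis
  have "B \<subseteq> L" using B(2) cmat.span_superset by blast
  moreover have "L \<subseteq> cmat.span ({0} \<union> B)" using B(2) cmat.span_mono[of B "{0} \<union> B"] by blast
  moreover have "M.indep_mod {0} {}" by (simp add: M.indep_mod_def)
  moreover have "{0} \<subseteq> L" using Ls by (simp add: cmat.subspace_0)
  ultimately obtain K l where K: "M.frame {0} L K l"
    using M.frame_exists[OF cmat.subspace_single_0 Ls _ B(1)] by (metis empty_subsetI)
  have fK: "finite K" "K \<subseteq> L" and lK: "\<And>b. b \<in> K \<Longrightarrow> M.linfun (l b)"
    using K by (auto simp: M.frame_def)
  have "\<forall>b\<in>K. \<exists>c y. c \<in> ?C \<and> y \<in> L \<and> b = c + bracket y x" using ad_fitting[OF Ll x] fK(2) by blast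
  then obtain c y where cy: "\<And>b. b \<in> K \<Longrightarrow> c b \<in> ?C \<and> y b \<in> L \<and> b = c b + bracket (y b) x" by metis
  define s where "s b Y = l b (pr Y)" for b Y
  have s: "M.linfun (s b)" if "b \<in> K" for b
    unfolding s_def using M.linfun_comp[OF lK[OF that] pr(1)] .
  define q where "q Y = (\<Sum>b\<in>K. cscale (s b Y) (c b))" for Y
  have qC: "q Y \<in> ?C" for Y
    unfolding q_def using cy by (intro cmat.subspace_sum[OF Cs] cmat.subspace_scale[OF Cs]) blast
  have q: "M.linop q"
    unfolding M.linop_def q_def
    by (auto simp: M.linfun_add[OF s] M.linfun_scale[OF s] cmat.scale_left_distrib cmat.scale_sum_right
        simp flip: sum.distrib intro!: sum.cong)
  obtain F where F: "continuous_on UNIV F" "F 0 = x"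
    "(F has_derivative (\<lambda>Y. q Y + (\<Sum>b\<in>K. cscale (s b Y) (bracket (y b) x)))) (at 0)"
    "\<And>Y. \<exists>g\<in>aff_stab J. \<exists>c\<in>?C. F Y = g ** c ** matrix_inv g"
    using conjugation_map[OF J L self_in_ad_kernel[OF Ll x] Cs q qC fK(1), of y s] cy s by blast
  have prY: "pr Y = q Y + (\<Sum>b\<in>K. cscale (s b Y) (bracket (y b) x))" for Y
  proof -
    have "pr Y = (\<Sum>b\<in>K. cscale (s b Y) b)" using K pr(2)[of Y] by (auto simp: M.frame_def s_def)
    also have "\<dots> = (\<Sum>b\<in>K. cscale (s b Y) (c b + bracket (y b) x))"
      using cy by (intro sum.cong) auto
    finally show ?thesis by (simp add: q_def cmat.scale_right_distrib sum.distrib)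
  qed
  have blpr: "bounded_linear pr" by (rule linop_bounded_linear[OF pr(1)])
  \<comment> \<open>The open mapping theorem is applied on the full matrix space. The correction Y -
    pr Y turns the differential into the identity and vanishes on L; values lying in L come only
    from Y in L, where ?f is F.\<close>
  let ?f = "\<lambda>Y. F Y + (Y - pr Y)"
  have "(?f has_derivative (\<lambda>Y. (q Y + (\<Sum>b\<in>K. cscale (s b Y) (bracket (y b) x))) + (Y - pr Y))) (at 0)"
    by (intro has_derivative_add F(3) has_derivative_diff has_derivative_ident bounded_linear_imp_has_derivative[OF blpr])
  then have "(?f has_derivative (\<lambda>Y. Y)) (at 0)" by (simp flip: prY)
  then have df: "(?f has_derivative id) (at 0)" by (simp add: id_def)
  have "continuous_on UNIV ?f"
    by (intro continuous_on_add F(1) continuous_on_diff continuous_on_id linear_continuous_on[OF blpr])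
  then have "?f 0 \<in> interior (?f ` UNIV)"
    using sussmann_open_mapping[OF open_UNIV _ UNIV_I df bounded_linear_ident[folded id_def], of UNIV]
    by (simp add: id_def comp_def)
  then have "x \<in> interior (range ?f)" by (simp add: F(2) M.linop_zero[OF pr(1)])
  then obtain e where e: "e > 0" "ball x e \<subseteq> range ?f"
    by (meson interior_subset open_contains_ball open_interior subset_trans)
  define \<epsilon> where "\<epsilon> = e / (norm (a - x) + 1)"
  have n1: "norm (a - x) + 1 > 0" by (simp add: add_nonneg_pos)
  have "\<epsilon> > 0" using e n1 by (simp add: \<epsilon>_def)
  moreover have "\<exists>g\<in>aff_stab J. \<exists>c\<in>?C. x + cscale (of_real t) (a - x) = g ** c ** matrix_inv g"
    if t: "0 < t" "t < \<epsilon>" for t :: real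
  proof -
    let ?A = "x + cscale (of_real t) (a - x)"
    have "dist x ?A = t * norm (a - x)" using t by (simp add: dist_norm flip: scaleR_cscale)
    also have "\<dots> \<le> t * (norm (a - x) + 1)" using t by simp
    also have "\<dots> < e" using t n1 by (simp add: \<epsilon>_def field_simps)
    finally have "?A \<in> range ?f" using e(2) by auto
    then obtain Y where Y: "?A = F Y + (Y - pr Y)" by blast
    obtain g c where gc: "g \<in> aff_stab J" "c \<in> ?C" "F Y = g ** c ** matrix_inv g" using F(4) by blast
    have "F Y \<in> L" unfolding gc(3) L using gc(1,2) CL L by (intro aff_stab_conj) auto
    moreover have "?A \<in> L" using x a Ls by (intro cmat.subspace_add cmat.subspace_scale cmat.subspace_diff)
    moreover have "Y = ?A - F Y + pr Y" unfolding Y by simp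
    ultimately have "Y \<in> L" using Ls pr(2) by (metis cmat.subspace_add cmat.subspace_diff)
    then have "?A = F Y" using Y pr(3) by simp
    then show ?thesis using gc by auto
  qed
  ultimately show ?thesis by blast
qed

section \<open>Counting eigenvalues on a quotient by Hankel matrices of power traces\<close>

section \<open>Hankel matrices of traces\<close>

interpretation Q: complex_space "Polynomial.smult :: complex \<Rightarrow> complex poly \<Rightarrow> complex poly"
  by unfold_locales (simp_all add: smult_add_right smult_add_left)

context complex_space
begin

lemma funpow_comp_commute:
  assumes "\<And>v. Y (Z v) = Z (Y v)"
  shows "((\<lambda>v. Y (Z v)) ^^ k) v = (Y ^^ k) ((Z ^^ k) v)"
proof (induction k)
  case (Suc k)
  have "Z ((Y ^^ k) ((Z ^^ k) v)) = (Y ^^ k) (Z ((Z ^^ k) v))" by (rule commute_funpow) (rule assms[symmetric])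
  then show ?case by (simp only: funpow.simps comp_apply Suc)
qed simp

lemma op_poly_commute: "linop Z \<Longrightarrow> op_poly p Z (Z v) = Z (op_poly p Z v)"
  by (simp add: op_poly_def linop_sum linop_scale funpow_swap1)

lemma stable_op_poly: "stable Z U \<Longrightarrow> stable (op_poly p Z) U"
  unfolding stable_def op_poly_def
  using stable_in[OF stable_funpow[of Z U]] by (auto simp: stable_def intro!: subspace_sum subspace_scale)

lemma frame_trace_op_poly:
  assumes F: "frame U W K l" and Z: "linop Z" and m: "Polynomial.degree p < m"
  shows "frame_trace K l (\<lambda>v. (Z ^^ i) (op_poly p Z v)) =
    (\<Sum>j<m. Polynomial.coeff p j * frame_trace K l (Z ^^ (i + j)))"
proof -
  have lin: "linfun (l r)" if "r \<in> K" for r using F that by (auto simp: frame_def)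
  obtain n where n: "m = Suc n" using m by (cases m) auto
  have "op_poly p Z v = (\<Sum>j<m. Polynomial.coeff p j \<triangleright> (Z ^^ j) v)" for v
    using op_poly_bound[of p n] m by (simp add: n lessThan_Suc_atMost)
  then have "(Z ^^ i) (op_poly p Z v) = (\<Sum>j<m. Polynomial.coeff p j \<triangleright> (Z ^^ (i + j)) v)" for v
    using linop_funpow[OF Z] by (simp add: linop_sum linop_scale funpow_add)
  then have "frame_trace K l (\<lambda>v. (Z ^^ i) (op_poly p Z v)) =
    (\<Sum>r\<in>K. \<Sum>j<m. Polynomial.coeff p j * l r ((Z ^^ (i + j)) r))"
    unfolding frame_trace_def by (intro sum.cong) (simp_all add: linfun_sum[OF lin] linfun_scale[OF lin])
  then show ?thesis by (subst (asm) sum.swap) (simp add: frame_trace_def sum_distrib_left)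
qed

text \<open>Let q have the eigenvalues as simple roots. Then Z^i q(Z) is nilpotent on W / U and has
  trace 0, so the coefficients of q form a kernel vector of every Hankel matrix of size m. Traces
  are taken in K, eigenvalues are read off in K'.\<close>

lemma hankel_singular:
  assumes F: "frame U W K l" and Z: "linop Z" "stable Z U" "stable Z W" and F': "frame U W K' l'"
    and gen: "\<And>r. r \<in> K' \<Longrightarrow> \<exists>k. (shift Z (\<beta> r) ^^ k) r = 0" and card: "card (\<beta> ` K') < m"
  obtains c where "\<exists>j<m. c j \<noteq> 0" "\<And>i. (\<Sum>j<m. c j * frame_trace K l (Z ^^ (i + j))) = 0"
proof -
  have fK: "finite K'" "K' \<subseteq> W" using F' by (auto simp: frame_def)
  define q where "q = (\<Prod>\<nu>\<in>\<beta> ` K'. [:- \<nu>, 1:])"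
  have deg: "Polynomial.degree q < m"
    using card fK(1) by (simp add: q_def degree_prod_eq_sum_degree)
  have q0: "q \<noteq> 0" using fK(1) by (simp add: q_def)
  have "frame_trace K l (\<lambda>v. (Z ^^ i) (op_poly q Z v)) = 0" for i
  proof -
    have oq: "linop (op_poly q Z)" by (rule linop_op_poly[OF Z(1)])
    have kill: "\<exists>k. (op_poly q Z ^^ k) r = 0" if r: "r \<in> K'" for r
    proof -
      obtain k where k: "(shift Z (\<beta> r) ^^ k) r = 0" using gen[OF r] by blast
      define p where "p = (\<Prod>\<nu>\<in>\<beta> ` K' - {\<beta> r}. [:- \<nu>, 1:])"
      have "q = p * [:- \<beta> r, 1:]"
        unfolding q_def p_def using fK(1) r by (simp add: prod.remove[of "\<beta> ` K'" "\<beta> r"] mult.commute del: mult_pCons_left mult_pCons_right)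
      then have e: "op_poly q Z = (\<lambda>v. op_poly p Z (shift Z (\<beta> r) v))"
        by (auto simp: op_poly_mult[OF Z(1)] op_poly_linear_factor[OF Z(1)] simp del: mult_pCons_right)
      have "op_poly p Z (shift Z (\<beta> r) v) = shift Z (\<beta> r) (op_poly p Z v)" for v
        by (rule commute_shift[OF linop_op_poly[OF Z(1)], symmetric]) (rule op_poly_commute[OF Z(1), symmetric])
      from funpow_comp_commute[of "op_poly p Z" "shift Z (\<beta> r)", OF this]
      have "(op_poly q Z ^^ k) r = (op_poly p Z ^^ k) ((shift Z (\<beta> r) ^^ k) r)" unfolding e .
      then have "(op_poly q Z ^^ k) r = 0" using k by (simp add: funpow_zero linop_op_poly[OF Z(1)])
      then show ?thesis by blast
    qed
    then obtain k where k: "\<And>r. r \<in> K' \<Longrightarrow> (op_poly q Z ^^ k r) r = 0" by metis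
    let ?n = "\<Sum>r\<in>K'. k r"
    have kn: "(op_poly q Z ^^ ?n) r = 0" if "r \<in> K'" for r
      by (rule funpow_eq_zero_mono[OF oq k[OF that]], rule member_le_sum) (use that fK in auto)
    have lq: "linop (op_poly q Z ^^ ?n)" by (rule linop_funpow[OF oq])
    have qW: "(op_poly q Z ^^ ?n) w \<in> U" if w: "w \<in> W" for w
    proof -
      let ?u = "w - (\<Sum>r\<in>K'. l' r w \<triangleright> r)"
      have u: "?u \<in> U" using F' w by (auto simp: frame_def)
      have "(op_poly q Z ^^ ?n) ?u = (op_poly q Z ^^ ?n) w"
        using kn by (simp add: linop_diff[OF lq] linop_sum[OF lq] linop_scale[OF lq])
      then show ?thesis using stable_in[OF stable_funpow[OF stable_op_poly[OF Z(2)]] u, of ?n q] by simp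
    qed
    let ?Y = "\<lambda>v. (Z ^^ i) (op_poly q Z v)"
    have Y: "linop ?Y" by (rule linop_comp[OF linop_funpow[OF Z(1)] oq])
    have YU: "stable ?Y U" "stable ?Y W"
      using stable_funpow[OF Z(2)] stable_funpow[OF Z(3)] stable_op_poly[OF Z(2)] stable_op_poly[OF Z(3)]
      by (auto simp: stable_def)
    have comm: "(Z ^^ i) (op_poly q Z v) = op_poly q Z ((Z ^^ i) v)" for v
      by (rule commute_funpow[symmetric]) (rule op_poly_commute[OF Z(1)])
    have "(?Y ^^ ?n) w \<in> U" if "w \<in> W" for w
      unfolding funpow_comp_commute[of "Z ^^ i" "op_poly q Z", OF comm]
      by (rule stable_in[OF stable_funpow[OF stable_funpow[OF Z(2)]] qW[OF that]])
    then show ?thesis by (rule frame_trace_nilpotent[OF F Y YU])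
  qed
  then have "(\<Sum>j<m. Polynomial.coeff q j * frame_trace K l (Z ^^ (i + j))) = 0" for i
    using frame_trace_op_poly[OF F Z(1) deg] by simp
  moreover have "\<exists>j<m. Polynomial.coeff q j \<noteq> 0" using deg q0 leading_coeff_neq_0 by blast
  ultimately show thesis using that[of "Polynomial.coeff q"] by blast
qed

text \<open>At t1 the representatives are eigenvectors with distinct eigenvalues, so the Hankel
  matrix is a Vandermonde matrix times its transpose and is regular; regularity persists for generic
  t.\<close>

lemma hankel_generic:
  assumes F: "frame U W K l" and poly: "\<And>k. (\<lambda>t. frame_trace K l (Z t ^^ k)) \<in> range poly"
    and eig: "\<And>r. r \<in> K \<Longrightarrow> Z t1 r = \<alpha> r \<triangleright> r" and lin: "linop (Z t1)" and inj: "inj_on \<alpha> K"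
  obtains q where "q \<noteq> 0" "\<And>t c. poly q t \<noteq> 0 \<Longrightarrow>
    (\<And>i. (\<Sum>j<card K. c j * frame_trace K l (Z t ^^ (i + j))) = 0) \<Longrightarrow> \<forall>j<card K. c j = 0"
proof -
  let ?m = "card K" and ?H = "\<lambda>t k. frame_trace K l (Z t ^^ k)"
  have fK: "finite K" using F by (auto simp: frame_def)
  \<comment> \<open>Column j of the Hankel matrix, encoded as a polynomial of degree less than m so
    that the columns live in a vector space.\<close>
  define u where "u j t = (\<Sum>i<?m. Polynomial.monom (?H t (i + j)) i)" for j t
  have cu: "Polynomial.coeff (\<Sum>j<?m. Polynomial.smult (c j) (u j t)) i =
    (if i < ?m then (\<Sum>j<?m. c j * ?H t (i + j)) else 0)" for c t i
    by (auto simp: u_def coeff_sum coeff_monom intro!: sum.neutral)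
  have "Q.fun_vector (range poly) (u j)" for j
    unfolding Q.fun_vector_def
  proof (intro allI impI)
    fix f :: "complex poly \<Rightarrow> complex" assume f: "Q.linfun f"
    have "Polynomial.monom (?H t (i + j)) i = Polynomial.smult (?H t (i + j)) (Polynomial.monom 1 i)" for t i
      by (simp add: smult_monom)
    then have "f (u j t) = (\<Sum>i<?m. ?H t (i + j) * f (Polynomial.monom 1 i))" for t
      by (simp add: u_def Q.linfun_sum[OF f] Q.linfun_scale[OF f])
    then show "(\<lambda>t. f (u j t)) \<in> range poly"
      by (auto intro!: fun_algebra_sum[OF fun_algebra_poly] fun_algebraD[OF fun_algebra_poly] poly)
  qed
  note vecs = this
  have H1: "?H t1 k = (\<Sum>r\<in>K. \<alpha> r ^ k)" for k
  proof -
    have "l r ((Z t1 ^^ k) r) = \<alpha> r ^ k" if "r \<in> K" for r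
      using eigenspace_nonneg_funpow[OF lin eig[OF that], of k] F that by (auto simp: frame_def linfun_scale)
    then show ?thesis by (simp add: frame_trace_def)
  qed
  have "Q.lin_indep {..<?m} (\<lambda>j. u j t1)"
    unfolding Q.lin_indep_def
  proof (intro allI impI)
    fix c assume c: "(\<Sum>j<?m. Polynomial.smult (c j) (u j t1)) = 0"
    \<comment> \<open>A kernel vector read as a polynomial of degree less than m. The rows say that
      f is orthogonal to all powers less than m on the m eigenvalues.\<close>
    define f where "f = (\<Sum>j<?m. Polynomial.monom (c j) j)"
    have pf: "poly f z = (\<Sum>j<?m. c j * z ^ j)" for z by (simp add: f_def poly_sum poly_monom)
    have cf: "Polynomial.coeff f j = (if j < ?m then c j else 0)" for j
      by (simp add: f_def coeff_sum coeff_monom)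
    have row: "(\<Sum>r\<in>K. \<alpha> r ^ i * poly f (\<alpha> r)) = 0" if i: "i < ?m" for i
    proof -
      have "(\<Sum>r\<in>K. \<alpha> r ^ i * poly f (\<alpha> r)) = (\<Sum>r\<in>K. \<Sum>j<?m. c j * \<alpha> r ^ (i + j))"
        by (simp add: pf sum_distrib_left power_add mult_ac)
      also have "\<dots> = (\<Sum>j<?m. c j * ?H t1 (i + j))"
        by (subst sum.swap) (simp add: H1 sum_distrib_left)
      also have "\<dots> = 0" using cu[of c t1 i] i by (simp add: c)
      finally show ?thesis .
    qed
    have root: "poly f (\<alpha> r) = 0" if r: "r \<in> K" for r
    proof -
      \<comment> \<open>The unnormalized Lagrange polynomial at \<alpha> r; its degree is less than
        m, so the rows combine to isolate f(\<alpha> r).\<close>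
      define g where "g = (\<Prod>s\<in>K - {r}. [:- \<alpha> s, 1:])"
      have "Polynomial.degree g = card (K - {r})" by (simp add: g_def degree_prod_eq_sum_degree)
      then have dg: "Polynomial.degree g < ?m" using card_Diff1_less[OF fK r] by metis
      have pg: "poly g z = (\<Prod>s\<in>K - {r}. z - \<alpha> s)" for z by (simp add: g_def poly_prod)
      have "(\<Sum>s\<in>K. poly g (\<alpha> s) * poly f (\<alpha> s)) =
        (\<Sum>s\<in>K. \<Sum>i\<le>Polynomial.degree g. Polynomial.coeff g i * (\<alpha> s ^ i * poly f (\<alpha> s)))"
        by (simp add: poly_altdef sum_distrib_right mult.assoc)
      also have "\<dots> = (\<Sum>i\<le>Polynomial.degree g. Polynomial.coeff g i * (\<Sum>s\<in>K. \<alpha> s ^ i * poly f (\<alpha> s)))"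
        by (subst sum.swap) (simp add: sum_distrib_left)
      also have "\<dots> = 0" using row dg by (intro sum.neutral) auto
      finally have "(\<Sum>s\<in>K. poly g (\<alpha> s) * poly f (\<alpha> s)) = 0" .
      moreover have "poly g (\<alpha> s) = 0" if "s \<in> K - {r}" for s
        using that fK by (auto simp: pg intro!: prod_zero)
      ultimately have "poly g (\<alpha> r) * poly f (\<alpha> r) = 0"
        using fK r by (simp add: sum.remove[of K r])
      moreover have "poly g (\<alpha> r) \<noteq> 0" using fK inj r by (auto simp: pg inj_on_def)
      ultimately show ?thesis by simp
    qed
    have "f = 0"
    proof (rule ccontr)
      assume f0: "f \<noteq> 0"
      have "\<alpha> ` K \<subseteq> {z. poly f z = 0}" using root by auto
      then have "card (\<alpha> ` K) \<le> card {z. poly f z = 0}" by (intro card_mono poly_roots_finite f0)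
      also have "\<dots> \<le> Polynomial.degree f" by (rule card_poly_roots_bound[OF f0])
      finally have "?m \<le> Polynomial.degree f" by (simp add: card_image[OF inj])
      then have "Polynomial.coeff f (Polynomial.degree f) = 0" by (simp add: cf)
      then show False using f0 by simp
    qed
    then show "\<forall>j\<in>{..<?m}. c j = 0" using cf by (metis coeff_0 lessThan_iff)
  qed
  note indep1 = this
  have fa: "Q.fun_algebra (range poly :: (complex \<Rightarrow> complex) set)"
    using fun_algebra_poly by (simp add: Q.fun_algebra_def P.fun_algebra_def)
  have "\<exists>p\<in>range poly. p t1 \<noteq> 0 \<and> (\<forall>t. p t \<noteq> 0 \<longrightarrow> Q.lin_indep {..<?m} (\<lambda>j. u j t))"
    by (rule Q.generic_lin_indep[where u = u, OF fa finite_lessThan vecs indep1])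
  then obtain q where q: "poly q t1 \<noteq> 0" "\<forall>t. poly q t \<noteq> 0 \<longrightarrow> Q.lin_indep {..<?m} (\<lambda>j. u j t)" by blast
  show thesis
  proof (rule that[of q])
    show "q \<noteq> 0" using q(1) by auto
    fix t c assume t: "poly q t \<noteq> 0" and c: "\<And>i. (\<Sum>j<?m. c j * ?H t (i + j)) = 0"
    have "(\<Sum>j<?m. Polynomial.smult (c j) (u j t)) = 0"
      by (rule poly_eqI) (simp only: cu c coeff_0 if_cancel)
    from Q.lin_indepD[OF q(2)[rule_format, OF t] this] show "\<forall>j<?m. c j = 0" by simp
  qed
qed

end

section \<open>Homogenization, affine coordinate changes, and the passage from weight spaces to
  binomials\<close>

section \<open>Homogenization and affine substitutions\<close>

definition expo_up :: "('n \<Rightarrow>\<^sub>0 nat) \<Rightarrow> ('n option \<Rightarrow>\<^sub>0 nat)"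
  where "expo_up a = (\<Sum>i\<in>Poly_Mapping.keys a. Poly_Mapping.single (Some i) (Poly_Mapping.lookup a i))"

definition expo_down :: "('n option \<Rightarrow>\<^sub>0 nat) \<Rightarrow> ('n \<Rightarrow>\<^sub>0 nat)"
  where "expo_down b = Poly_Mapping.map_key Some b"

lemma lookup_expo_down: "Poly_Mapping.lookup (expo_down b) i = Poly_Mapping.lookup b (Some i)"
  by (simp add: expo_down_def map_key.rep_eq)

lemma lookup_expo_up:
  "Poly_Mapping.lookup (expo_up a) (Some i) = Poly_Mapping.lookup a i"
  "Poly_Mapping.lookup (expo_up a) None = 0"
proof -
  have "Poly_Mapping.lookup (expo_up a) (Some i) =
    (\<Sum>j\<in>Poly_Mapping.keys a. if j = i then Poly_Mapping.lookup a j else 0)"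
    unfolding expo_up_def lookup_sum by (intro sum.cong) (auto simp: lookup_single when_def)
  then show "Poly_Mapping.lookup (expo_up a) (Some i) = Poly_Mapping.lookup a i"
    by (auto simp: in_keys_iff)
  show "Poly_Mapping.lookup (expo_up a) None = 0"
    unfolding expo_up_def lookup_sum by (simp add: lookup_single)
qed

lemma expo_eqI:
  assumes "Poly_Mapping.lookup a None = Poly_Mapping.lookup b None" "expo_down a = expo_down b"
  shows "a = b"
proof (rule poly_mapping_eqI)
  show "Poly_Mapping.lookup a k = Poly_Mapping.lookup b k" for k
    using assms(1) arg_cong[OF assms(2), of "\<lambda>c. Poly_Mapping.lookup c (the k)"]
    by (cases k) (simp_all add: lookup_expo_down)
qed

lemma sum_option: "(\<Sum>k\<in>UNIV. f k) = f None + (\<Sum>i\<in>(UNIV :: 'n::finite set). f (Some i))"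
  by (simp add: UNIV_option_conv sum.reindex)

lemma exp_degree_option:
  "exp_degree (b :: 'n::finite option \<Rightarrow>\<^sub>0 nat) = Poly_Mapping.lookup b None + exp_degree (expo_down b)"
  by (simp add: exp_degree_UNIV sum_option lookup_expo_down)

lemma expo_down_add: "expo_down (a + b) = expo_down a + expo_down b"
  by (intro poly_mapping_eqI) (simp add: lookup_expo_down lookup_add)

lemma expo_down_0: "expo_down 0 = 0"
  by (intro poly_mapping_eqI) (simp add: lookup_expo_down)

lemma expo_down_single: "expo_down (Poly_Mapping.single None k) = 0"
  "expo_down (Poly_Mapping.single (Some i) k) = Poly_Mapping.single i k"
  by (intro poly_mapping_eqI; simp add: lookup_expo_down lookup_single)+

lemma expo_down_up: "expo_down (expo_up a) = a"
  by (intro poly_mapping_eqI) (simp add: lookup_expo_down lookup_expo_up)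

text \<open>The exponent of x^a homogenized to degree d. Subtraction is truncated, so the result has
  degree d only if the degree of a is at most d.\<close>

definition hexpo :: "nat \<Rightarrow> ('n::finite \<Rightarrow>\<^sub>0 nat) \<Rightarrow> ('n option \<Rightarrow>\<^sub>0 nat)"
  where "hexpo d a = Poly_Mapping.single None (d - exp_degree a) + expo_up a"

lemma expo_down_hexpo: "expo_down (hexpo d a) = a"
  by (simp add: hexpo_def expo_down_add expo_down_single expo_down_up)

lemma lookup_hexpo: "Poly_Mapping.lookup (hexpo d a) None = d - exp_degree a"
  by (simp add: hexpo_def lookup_add lookup_expo_up)

lemma hexpo_down: "exp_degree b = d \<Longrightarrow> hexpo d (expo_down b) = b"
  by (rule expo_eqI) (simp_all add: expo_down_hexpo lookup_hexpo exp_degree_option)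

lemma pmon_single: "pmon (Poly_Mapping.single i k) = pvar i ^ k"
proof (induction k)
  case (Suc k)
  have "Poly_Mapping.single i (Suc k) = Poly_Mapping.single i 1 + Poly_Mapping.single i k"
    by (simp flip: single_add)
  then show ?case by (simp add: pmon_add Suc pvar_eq_pmon)
qed simp

lemma pmon_sum: "pmon (\<Sum>i\<in>K. a i) = (\<Prod>i\<in>K. pmon (a i))"
  by (induction K rule: infinite_finite_induct) (simp_all add: pmon_add)

lemma homogenize_pmon:
  "homogenize f = (\<Sum>a\<in>Poly_Mapping.keys f. pscale (Poly_Mapping.lookup f a) (pmon (hexpo (total_degree f) a)))"
  by (simp add: homogenize_def hexpo_def pmon_add pmon_single expo_up_def pmon_sum pscale_def mult.assoc)

lemma dehomogenize_pmon: "dehomogenize (pmon b) = pmon (expo_down b)"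
proof (induction b rule: expo_induct)
  case zero
  show ?case by (simp add: dehomogenize_def expo_down_0)
next
  case (step b i)
  have "dehomogenize (pvar i) = pmon (expo_down (Poly_Mapping.single i 1))"
    by (cases i) (simp_all add: dehomogenize_def psubst_pmon mon_eval_single expo_down_single pvar_eq_pmon)
  moreover have "dehomogenize (pmon b * pvar i) = dehomogenize (pmon b) * dehomogenize (pvar i)"
    by (simp add: dehomogenize_def psubst_mult)
  ultimately show ?case by (simp only: expo_down_add pmon_add step pvar_eq_pmon[symmetric])
qed


lemma dehomogenize_hom:
  "dehomogenize (f + g) = dehomogenize f + dehomogenize g"
  "dehomogenize (f - g) = dehomogenize f - dehomogenize g"
  "dehomogenize (f * g) = dehomogenize f * dehomogenize g"
  "dehomogenize (pscale c f) = pscale c (dehomogenize f)"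
  "dehomogenize 0 = 0" "dehomogenize 1 = 1"
  by (simp_all add: dehomogenize_def psubst_add psubst_mult psubst_pscale psubst_diff)

lemma dehomogenize_sum: "dehomogenize (\<Sum>i\<in>K. F i) = (\<Sum>i\<in>K. dehomogenize (F i))"
  by (simp add: dehomogenize_def psubst_sum)

lemma dehomogenize_homogenize: "dehomogenize (homogenize (f :: 'n::finite cpoly)) = f"
proof -
  have "dehomogenize (homogenize f) = (\<Sum>a\<in>Poly_Mapping.keys f. pscale (Poly_Mapping.lookup f a) (pmon a))"
    by (simp add: homogenize_pmon dehomogenize_sum dehomogenize_hom dehomogenize_pmon expo_down_hexpo)
  also have "\<dots> = f" by (rule cpoly_expand[symmetric])
  finally show ?thesis .
qed

text \<open>By Euler's formula, \<open>F\<close> is homogeneous of degree \<open>d\<close> iff it is an eigenvector of the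
  derivation of the identity matrix; this form is visibly invariant under linear substitutions.\<close>

definition homogeneous :: "nat \<Rightarrow> 'm::finite cpoly \<Rightarrow> bool"
  where "homogeneous d F \<longleftrightarrow> pder (mat 1) F = pscale (of_nat d) F"

lemma diagonal_mat_1: "diagonal_matrix (mat 1)"
  by (simp add: diagonal_matrix_def mat_def)

lemma weight_mat_1: "weight (mat 1) a = of_nat (exp_degree a)"
  by (simp add: weight_def mat_def exp_degree_UNIV)

lemma lookup_pder_diagonal:
  assumes "diagonal_matrix A"
  shows "Poly_Mapping.lookup (pder A F) b = weight A b * Poly_Mapping.lookup F b"
proof -
  have "pder A F = (\<Sum>a\<in>Poly_Mapping.keys F. pscale (Poly_Mapping.lookup F a) (pder A (pmon a)))"
    by (subst cpoly_expand) (simp add: P.linop_sum[OF linop_pder] P.linop_scale[OF linop_pder])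
  also have "\<dots> = (\<Sum>a\<in>Poly_Mapping.keys F. pscale (weight A a * Poly_Mapping.lookup F a) (pmon a))"
    by (simp add: pder_diagonal[OF assms] mult.commute)
  finally have "Poly_Mapping.lookup (pder A F) b =
    (\<Sum>a\<in>Poly_Mapping.keys F. if a = b then weight A b * Poly_Mapping.lookup F b else 0)"
    by (simp add: lookup_sum lookup_pmon if_distrib cong: if_cong)
  then show ?thesis by (auto simp: in_keys_iff)
qed

lemma homogeneous_iff: "homogeneous d F \<longleftrightarrow> (\<forall>b\<in>Poly_Mapping.keys F. exp_degree b = d)"
proof -
  have "homogeneous d F \<longleftrightarrow> (\<forall>b. of_nat (exp_degree b) * Poly_Mapping.lookup F b = of_nat d * Poly_Mapping.lookup F b)"
    unfolding homogeneous_def poly_mapping_eq_iff fun_eq_iff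
    by (simp add: lookup_pder_diagonal[OF diagonal_mat_1] weight_mat_1)
  then show ?thesis by (auto simp: in_keys_iff)
qed

lemma homogeneous_psub: "homogeneous d F \<Longrightarrow> homogeneous d (psub M F)"
  using psub_pder[of M "mat 1" "mat 1" F] by (simp add: homogeneous_def P.linop_scale[OF linop_psub])

lemma homogeneous_pmon: "homogeneous (exp_degree a) (pmon a)"
  by (simp add: homogeneous_iff)

lemma homogeneous_pscale_add:
  "homogeneous d F \<Longrightarrow> homogeneous d G \<Longrightarrow> homogeneous d (pscale c F + pscale e G)"
  by (simp add: homogeneous_def P.linop_add[OF linop_pder] P.linop_scale[OF linop_pder]
      P.scale_right_distrib mult.commute)

lemma exp_degree_le_total_degree: "a \<in> Poly_Mapping.keys f \<Longrightarrow> exp_degree a \<le> total_degree f"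
  by (simp add: total_degree_def)

lemma homogeneous_homogenize: "homogeneous (total_degree f) (homogenize f)"
proof -
  have "pder (mat 1) (pmon (hexpo (total_degree f) a)) = pscale (of_nat (total_degree f)) (pmon (hexpo (total_degree f) a))"
    if "a \<in> Poly_Mapping.keys f" for a
    using exp_degree_le_total_degree[OF that]
    by (simp add: pder_diagonal[OF diagonal_mat_1] weight_mat_1 exp_degree_option lookup_hexpo expo_down_hexpo)
  then show ?thesis
    by (simp add: homogeneous_def homogenize_pmon P.linop_sum[OF linop_pder] P.linop_scale[OF linop_pder]
        P.scale_sum_right mult.commute)
qed

text \<open>Monomials of one fixed degree remain distinct when x_0 is set to 1, so no coefficients
  merge and F is recovered up to a power of x_0.\<close>

lemma homogeneous_eq_homogenize:
  assumes F: "homogeneous d (F :: 'n::finite option cpoly)"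
  shows "F = pvar None ^ (d - total_degree (dehomogenize F)) * homogenize (dehomogenize F)"
proof -
  let ?f = "dehomogenize F" and ?K = "Poly_Mapping.keys F"
  let ?t = "total_degree ?f"
  have deg: "exp_degree b = d" if "b \<in> ?K" for b using F that by (simp add: homogeneous_iff)
  have inj: "inj_on expo_down ?K"
    using deg hexpo_down by (metis inj_onI)
  have f: "?f = (\<Sum>b\<in>?K. pscale (Poly_Mapping.lookup F b) (pmon (expo_down b)))"
    by (subst cpoly_expand[of F]) (simp add: dehomogenize_sum dehomogenize_hom dehomogenize_pmon)
  have lk: "Poly_Mapping.lookup ?f (expo_down b) = Poly_Mapping.lookup F b" if b: "b \<in> ?K" for b
  proof -
    have "Poly_Mapping.lookup ?f (expo_down b) =
      (\<Sum>c\<in>?K. if c = b then Poly_Mapping.lookup F b else 0)"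
      unfolding f lookup_sum using inj b
      by (intro sum.cong) (auto simp: lookup_pmon inj_on_def)
    then show ?thesis using b by simp
  qed
  have keys: "Poly_Mapping.keys ?f = expo_down ` ?K"
  proof
    show "expo_down ` ?K \<subseteq> Poly_Mapping.keys ?f" using lk by (auto simp: in_keys_iff)
    show "Poly_Mapping.keys ?f \<subseteq> expo_down ` ?K"
    proof
      fix a assume a: "a \<in> Poly_Mapping.keys ?f"
      show "a \<in> expo_down ` ?K"
      proof (rule ccontr)
        assume "a \<notin> expo_down ` ?K"
        then have "Poly_Mapping.lookup ?f a = 0"
          unfolding f lookup_sum by (intro sum.neutral) (auto simp: lookup_pmon)
        then show False using a by (simp add: in_keys_iff)
      qed
    qed
  qed
  have "pvar None ^ (d - ?t) * homogenize ?f =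
    (\<Sum>b\<in>?K. pscale (Poly_Mapping.lookup F b) (pmon (Poly_Mapping.single None (d - ?t) + hexpo ?t (expo_down b))))"
    by (simp add: homogenize_pmon keys sum.reindex[OF inj] lk sum_distrib_left pmon_add pmon_single pscale_mult_right)
  also have "\<dots> = (\<Sum>b\<in>?K. pscale (Poly_Mapping.lookup F b) (pmon b))"
  proof (rule sum.cong)
    fix b assume b: "b \<in> ?K"
    have "exp_degree (expo_down b) \<le> ?t" using keys b by (intro exp_degree_le_total_degree) auto
    moreover have "?t \<le> d"
    proof -
      have "exp_degree a \<le> d" if a: "a \<in> Poly_Mapping.keys ?f" for a
      proof -
        obtain b where "b \<in> ?K" "a = expo_down b" using a unfolding keys by blast
        then show ?thesis using deg[of b] exp_degree_option[of b] by simp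
      qed
      then show ?thesis by (auto simp: total_degree_def)
    qed
    ultimately have "Poly_Mapping.single None (d - ?t) + hexpo ?t (expo_down b) = b"
      using deg[OF b] by (intro expo_eqI)
        (auto simp: lookup_add lookup_hexpo expo_down_add expo_down_single expo_down_hexpo exp_degree_option)
    then show "pscale (Poly_Mapping.lookup F b) (pmon (Poly_Mapping.single None (d - ?t) + hexpo ?t (expo_down b)))
      = pscale (Poly_Mapping.lookup F b) (pmon b)" by simp
  qed simp
  finally show ?thesis by (simp flip: cpoly_expand)
qed

lemma is_ideal_homogenized: "is_ideal (homogenized_ideal I)"
  unfolding homogenized_ideal_def by (rule is_ideal_genideal)

lemma homogenized_homogeneous:
  fixes F :: "'n::finite option cpoly"
  assumes "homogeneous d F" "dehomogenize F \<in> I" shows "F \<in> homogenized_ideal I"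
proof -
  have "homogenize (dehomogenize F) \<in> homogenized_ideal I"
    unfolding homogenized_ideal_def using genideal_subset assms(2) by blast
  then show ?thesis
    by (subst homogeneous_eq_homogenize[OF assms(1)]) (rule is_idealD(3)[OF is_ideal_homogenized])
qed

lemma dehomogenize_homogenized:
  fixes I :: "'n::finite cpoly set"
  assumes I: "is_ideal I" and F: "F \<in> homogenized_ideal I" shows "dehomogenize F \<in> I"
proof -
  have "is_ideal {F. dehomogenize F \<in> I}"
    using is_idealD[OF I] by (auto simp: is_ideal_def dehomogenize_hom)
  moreover have "homogenize ` I \<subseteq> {F. dehomogenize F \<in> I}" by (auto simp: dehomogenize_homogenize)
  ultimately show ?thesis using F genideal_least unfolding homogenized_ideal_def by blast
qed

text \<open>The elements of J that the Euler derivation keeps in J form an ideal containing the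
  homogeneous generators. This expresses that J is graded.\<close>

lemma homogenized_euler: "mat 1 \<in> stab_lie (homogenized_ideal (I :: 'n::finite cpoly set))"
proof -
  let ?J = "homogenized_ideal I"
  note J = is_idealD[OF is_ideal_homogenized[of I]]
  have "is_ideal {F \<in> ?J. pder (mat 1) F \<in> ?J}"
    unfolding is_ideal_def using J by (auto simp: pder_plus pder_mult P.linop_zero[OF linop_pder])
  moreover have "homogenize ` I \<subseteq> {F \<in> ?J. pder (mat 1) F \<in> ?J}"
  proof
    fix F assume "F \<in> homogenize ` I"
    then obtain f where f: "F = homogenize f" and "F \<in> ?J"
      unfolding homogenized_ideal_def using genideal_subset by blast
    then show "F \<in> {F \<in> ?J. pder (mat 1) F \<in> ?J}"
      using homogeneous_homogenize[of f] J(5) by (simp add: homogeneous_def)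
  qed
  ultimately have "?J \<subseteq> {F \<in> ?J. pder (mat 1) F \<in> ?J}"
    unfolding homogenized_ideal_def by (rule genideal_least)
  then show ?thesis by (auto simp: stab_lie_def)
qed

subsection \<open>The action of the affine group\<close>

lemma affine_group_iff: "S \<in> affine_group \<longleftrightarrow> invertible S \<and> S \<in> row_fixing \<and> S $ None $ None = 1"
proof -
  have "(axis None 1 v* S) $ j = S $ None $ j" for j
  proof -
    have "(axis None 1 v* S) $ j = (\<Sum>i\<in>UNIV. if i = None then S $ i $ j else 0)"
      unfolding vector_matrix_mult_def vec_lambda_beta by (intro sum.cong) (auto simp: axis_def)
    then show ?thesis by simp
  qed
  then have "axis None 1 v* S = axis None 1 \<longleftrightarrow> (\<forall>j. S $ None $ j = (if j = None then 1 else 0))"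
    by (simp add: vec_eq_iff axis_def eq_commute)
  then show ?thesis by (auto simp: affine_group_def row_fixing_def split_option_all)
qed

lemma affine_group_inverse:
  assumes "S \<in> affine_group" shows "matrix_inv S \<in> affine_group" "matrix_inv (matrix_inv S) = S"
proof -
  have S: "invertible S" "S \<in> row_fixing" "S $ None $ None = 1" using assms by (auto simp: affine_group_iff)
  note i = matrix_inv_cmatrix[OF S(1)]
  show "matrix_inv (matrix_inv S) = S" by (rule matrix_inv_unique_cmatrix(2)[OF i(2,1)])
  have inv: "invertible (matrix_inv S)" by (rule matrix_inv_unique_cmatrix(1)[OF i(2,1)])
  have "(S ** matrix_inv S) $ None $ j = matrix_inv S $ None $ j" for j
    using row_fixing_mult_row[OF S(2)] S(3) by simp
  then have "matrix_inv S $ None $ j = (mat 1 :: 'a option cmatrix) $ None $ j" for j by (simp add: i(1))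
  then show "matrix_inv S \<in> affine_group" using inv by (simp add: affine_group_iff row_fixing_def mat_def)
qed

text \<open>The affine action as an evident ring homomorphism; \<open>affine_act\<close> passes
  through homogenization, which is not additive.\<close>

definition affine_hom :: "'n::finite option cmatrix \<Rightarrow> 'n cpoly \<Rightarrow> 'n cpoly"
  where "affine_hom S = psubst (\<lambda>i. dehomogenize (linform (matrix_inv S) (Some i)))"

text \<open>The inverse of S has first row e_0, so the substitution fixes x_0 and is compatible with
  setting x_0 = 1.\<close>

lemma dehomogenize_psub:
  assumes "S \<in> affine_group"
  shows "dehomogenize (psub (matrix_inv S) F) = affine_hom S (dehomogenize F)"
proof (rule cpoly_hom_unique[where h = "\<lambda>F. dehomogenize (psub (matrix_inv S) F)"])
  show "dehomogenize (psub (matrix_inv S) (pvar i)) = affine_hom S (dehomogenize (pvar i))" for i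
  proof (cases i)
    case None
    have "matrix_inv S \<in> affine_group" by (rule affine_group_inverse(1)[OF assms])
    then have "linform (matrix_inv S) None = (\<Sum>j\<in>UNIV. if j = None then pvar j else 0)"
      unfolding linform_def by (intro sum.cong) (auto simp: affine_group_iff row_fixing_def split: option.splits)
    then show ?thesis
      using None by (simp add: psub_def psubst_pvar affine_hom_def dehomogenize_def)
  next
    case (Some j)
    then show ?thesis by (simp add: psub_def psubst_pvar affine_hom_def dehomogenize_def)
  qed
qed (simp_all add: psub_def affine_hom_def dehomogenize_def psubst_add psubst_mult psubst_pconst)

lemma affine_act_eq: "S \<in> affine_group \<Longrightarrow> affine_act S f = affine_hom S f"
  by (simp add: affine_act_def gl_act_psub dehomogenize_psub dehomogenize_homogenize)

lemma affine_hom_inverse: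
  assumes "S \<in> affine_group" shows "affine_hom (matrix_inv S) (affine_hom S f) = f"
proof -
  have inv: "invertible S" using assms by (simp add: affine_group_iff)
  have "affine_hom (matrix_inv S) (affine_hom S f) =
    dehomogenize (psub (matrix_inv (matrix_inv S)) (psub (matrix_inv S) (homogenize f)))"
    by (simp only: dehomogenize_psub[OF affine_group_inverse(1)[OF assms]] dehomogenize_psub[OF assms]
        dehomogenize_homogenize)
  then show ?thesis
    by (simp add: affine_group_inverse(2)[OF assms] psub_matrix_inv(1)[OF inv] dehomogenize_homogenize)
qed

lemma affine_hom_inverse2:
  assumes "S \<in> affine_group" shows "affine_hom S (affine_hom (matrix_inv S) f) = f"
  using affine_hom_inverse[OF affine_group_inverse(1)[OF assms], of f]
  by (simp add: affine_group_inverse(2)[OF assms])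

lemma affine_hom_hom:
  "affine_hom S (f + g) = affine_hom S f + affine_hom S g" "affine_hom S (f * g) = affine_hom S f * affine_hom S g"
  "affine_hom S 0 = 0"
  by (simp_all add: affine_hom_def psubst_add psubst_mult)

lemma affine_image_mem:
  assumes S: "S \<in> affine_group"
  shows "f \<in> affine_hom S ` I \<longleftrightarrow> affine_hom (matrix_inv S) f \<in> I"
  using affine_hom_inverse[OF S] affine_hom_inverse2[OF S] by (metis image_iff)

lemma prime_affine_image:
  assumes S: "S \<in> affine_group" and S': "S' \<in> affine_group"
    and I: "primeideal (affine_hom S' ` I) cpoly_ring"
  shows "primeideal (affine_hom S ` I) cpoly_ring"
proof -
  have inI: "f \<in> I \<longleftrightarrow> affine_hom S' f \<in> affine_hom S' ` I" for f
    using affine_image_mem[OF S', of "affine_hom S' f" I] affine_hom_inverse[OF S'] by simp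
  have p: "is_ideal (affine_hom S' ` I)" "affine_hom S' ` I \<noteq> UNIV"
    "\<And>f g. f * g \<in> affine_hom S' ` I \<Longrightarrow> f \<in> affine_hom S' ` I \<or> g \<in> affine_hom S' ` I"
    using I by (auto simp: primeideal_cpoly_ring)
  have mem: "f \<in> affine_hom S ` I \<longleftrightarrow> affine_hom S' (affine_hom (matrix_inv S) f) \<in> affine_hom S' ` I" for f
    using affine_image_mem[OF S] inI by blast
  have "is_ideal (affine_hom S ` I)"
    unfolding is_ideal_def
    using is_idealD(1)[OF p(1)] is_idealD(2)[OF p(1)] is_idealD(3)[OF p(1)]
    by (simp add: mem affine_hom_hom)
  moreover have "affine_hom S ` I \<noteq> UNIV"
  proof
    assume "affine_hom S ` I = UNIV"
    then have "affine_hom S' (affine_hom (matrix_inv S) (affine_hom S (affine_hom (matrix_inv S') f))) \<in> affine_hom S' ` I" for f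
      by (simp flip: mem)
    then have "f \<in> affine_hom S' ` I" for f
      by (simp add: affine_hom_inverse[OF S] affine_hom_inverse2[OF S'])
    then show False using p(2) by blast
  qed
  moreover have "f \<in> affine_hom S ` I \<or> g \<in> affine_hom S ` I" if "f * g \<in> affine_hom S ` I" for f g
    using p(3)[of "affine_hom S' (affine_hom (matrix_inv S) f)" "affine_hom S' (affine_hom (matrix_inv S) g)"] that
    by (simp add: mem affine_hom_hom)
  ultimately show ?thesis by (simp add: primeideal_cpoly_ring)
qed

subsection \<open>Ideals with one-dimensional weight spaces\<close>

text \<open>Induction on the number of terms. If some D separates the terms, the weight components
  lie in K and are shorter. Otherwise all terms are multiples of one monomial modulo K, and if that
  monomial is not in K the total multiple is 0.\<close>

lemma weight_multiplicity_free_binomial: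
  fixes K :: "'m::finite cpoly set"
  assumes K: "is_ideal K" and T: "\<And>D. D \<in> T \<Longrightarrow> diagonal_matrix D" "T \<subseteq> stab_lie K"
    and mf: "\<And>a b. (\<And>D. D \<in> T \<Longrightarrow> weight D a = weight D b) \<Longrightarrow>
      pmon a \<in> K \<or> (\<exists>\<nu>. pmon b - pscale \<nu> (pmon a) \<in> K)"
    and F: "F \<in> K"
  shows "F \<in> P.span (binomials \<inter> K)"
  using F
proof (induction "card (Poly_Mapping.keys F)" arbitrary: F rule: less_induct)
  case less
  let ?S = "P.span (binomials \<inter> K)"
  have bin: "pmon b - pscale c (pmon a) \<in> binomials" for a b :: "'m \<Rightarrow>\<^sub>0 nat" and c
    unfolding binomials_def pmon_def[of b] single_eq_pscale[of a c, symmetric] by blast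
  \<comment> \<open>A monomial is a binomial with second coefficient 0.\<close>
  have mon: "pmon b \<in> ?S" if "pmon b \<in> K" for b
    using bin[of b 0 b] that by (intro P.span_base) simp
  show ?case
  proof (cases "\<forall>a\<in>Poly_Mapping.keys F. \<forall>b\<in>Poly_Mapping.keys F. \<forall>D\<in>T. weight D a = weight D b")
    case True
    show ?thesis
    proof (cases "\<forall>a\<in>Poly_Mapping.keys F. pmon a \<in> K")
      case True
      then show ?thesis by (subst cpoly_expand) (intro P.span_sum P.span_scale mon, blast)
    next
      case False
      then obtain a where a: "a \<in> Poly_Mapping.keys F" "pmon a \<notin> K" by blast
      have "\<exists>\<nu>. pmon b - pscale \<nu> (pmon a) \<in> K" if "b \<in> Poly_Mapping.keys F" for b
        using mf[of a b] True a that by blast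
      then obtain \<nu> where \<nu>: "\<And>b. b \<in> Poly_Mapping.keys F \<Longrightarrow> pmon b - pscale (\<nu> b) (pmon a) \<in> K" by metis
      let ?c = "Poly_Mapping.lookup F"
      let ?G = "\<Sum>b\<in>Poly_Mapping.keys F. pscale (?c b) (pmon b - pscale (\<nu> b) (pmon a))"
      have GS: "?G \<in> ?S" using \<nu> bin by (intro P.span_sum P.span_scale P.span_base) blast
      have GK: "?G \<in> K" using \<nu> by (intro P.subspace_sum P.subspace_scale is_ideal_subspace[OF K]) blast
      have FG: "F - ?G = pscale (\<Sum>b\<in>Poly_Mapping.keys F. ?c b * \<nu> b) (pmon a)"
      proof -
        have "?G = (\<Sum>b\<in>Poly_Mapping.keys F. pscale (?c b) (pmon b)) - pscale (\<Sum>b\<in>Poly_Mapping.keys F. ?c b * \<nu> b) (pmon a)"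
          by (simp add: P.scale_right_diff_distrib sum_subtractf P.scale_sum_left)
        then show ?thesis by (simp flip: cpoly_expand)
      qed
      have "F - ?G \<in> K" using is_idealD(7)[OF K less.prems GK] .
      then have sK: "pscale (\<Sum>b\<in>Poly_Mapping.keys F. ?c b * \<nu> b) (pmon a) \<in> K" unfolding FG .
      have "(\<Sum>b\<in>Poly_Mapping.keys F. ?c b * \<nu> b) = 0"
      proof (rule ccontr)
        assume s: "(\<Sum>b\<in>Poly_Mapping.keys F. ?c b * \<nu> b) \<noteq> 0" (is "?s \<noteq> 0")
        have "pscale (1 / ?s) (pscale ?s (pmon a)) \<in> K" by (rule is_idealD(5)[OF K sK])
        then show False using s a(2) by simp
      qed
      then have "F = ?G" using FG by simp
      then show ?thesis using GS by simp
    qed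
  next
    case False
    then obtain a b D where ab: "a \<in> Poly_Mapping.keys F" "b \<in> Poly_Mapping.keys F" "D \<in> T" "weight D a \<noteq> weight D b"
      by blast
    let ?W = "weight D ` Poly_Mapping.keys F"
    define G where "G \<mu> = (\<Sum>e\<in>{e \<in> Poly_Mapping.keys F. weight D e = \<mu>}. pscale (Poly_Mapping.lookup F e) (pmon e))" for \<mu>
    have FG: "F = (\<Sum>\<mu>\<in>?W. G \<mu>)"
    proof -
      have "(\<Sum>\<mu>\<in>?W. G \<mu>) = (\<Sum>e\<in>Poly_Mapping.keys F. pscale (Poly_Mapping.lookup F e) (pmon e))"
        unfolding G_def by (rule sum.image_gen[symmetric]) simp
      then show ?thesis by (simp flip: cpoly_expand)
    qed
    have D: "diagonal_matrix D" "P.stable (pder D) K"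
      using T ab(3) is_ideal_subspace[OF K] by (auto simp: P.stable_def stab_lie_def)
    have eig: "pder D (G \<mu>) = pscale \<mu> (G \<mu>)" for \<mu>
      unfolding G_def P.linop_sum[OF linop_pder] P.linop_scale[OF linop_pder] pder_diagonal[OF D(1)] P.scale_sum_right
      by (intro sum.cong) (auto simp: mult.commute)
    have lG: "Poly_Mapping.lookup (G \<mu>) e = (if e \<in> Poly_Mapping.keys F \<and> weight D e = \<mu> then Poly_Mapping.lookup F e else 0)" for \<mu> e
    proof -
      have "Poly_Mapping.lookup (G \<mu>) e =
        (\<Sum>e'\<in>{e \<in> Poly_Mapping.keys F. weight D e = \<mu>}. if e' = e then Poly_Mapping.lookup F e else 0)"
        unfolding G_def lookup_sum by (intro sum.cong) (auto simp: lookup_pmon)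
      then show ?thesis by simp
    qed
    have "G \<mu> \<in> ?S" if \<mu>: "\<mu> \<in> ?W" for \<mu>
    proof (rule less.hyps)
      have "(P.shift (pder D) \<mu> ^^ 1) (G \<mu>) = 0" for \<mu> by (simp add: P.shift_def eig)
      then have k: "\<exists>k. (P.shift (pder D) \<mu> ^^ k) (G \<mu>) = 0" for \<mu> by blast
      show "G \<mu> \<in> K"
        by (rule P.gen_eigen_components[OF linop_pder D(2) _ k _ \<mu>]) (use less.prems FG in auto)
      have "Poly_Mapping.keys (G \<mu>) \<subset> Poly_Mapping.keys F"
      proof (rule psubsetI)
        show "Poly_Mapping.keys (G \<mu>) \<subseteq> Poly_Mapping.keys F" by (auto simp: in_keys_iff lG)
        have "a \<notin> Poly_Mapping.keys (G \<mu>) \<or> b \<notin> Poly_Mapping.keys (G \<mu>)"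
          using ab(4) by (auto simp: in_keys_iff lG)
        then show "Poly_Mapping.keys (G \<mu>) \<noteq> Poly_Mapping.keys F" using ab by blast
      qed
      then show "card (Poly_Mapping.keys (G \<mu>)) < card (Poly_Mapping.keys F)" by (intro psubset_card_mono) auto
    qed
    then show ?thesis by (subst FG) (intro P.span_sum)
  qed
qed

text \<open>Dehomogenization is a surjective ring homomorphism, so it maps ideals to ideals, and it
  maps binomials to binomials.\<close>

lemma binomial_ideal_dehomogenize:
  fixes K :: "'n::finite option cpoly set"
  assumes K: "is_ideal K" and span: "\<And>F. F \<in> K \<Longrightarrow> F \<in> P.span (binomials \<inter> K)"
  shows "binomial_ideal (dehomogenize ` K)"
proof -
  let ?B = "dehomogenize ` (binomials \<inter> K)"
  have "?B \<subseteq> binomials"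
  proof
    fix g assume "g \<in> ?B"
    then obtain a b c where "g = dehomogenize (pmon a - pscale c (pmon b))"
      by (auto simp: binomials_def pmon_def[symmetric] single_eq_pscale)
    then have "g = Poly_Mapping.single (expo_down a) 1 - Poly_Mapping.single (expo_down b) c"
      by (simp add: dehomogenize_hom dehomogenize_pmon single_eq_pscale[of _ c]) (simp add: pmon_def)
    then show "g \<in> binomials" unfolding binomials_def by blast
  qed
  moreover have "dehomogenize ` K = genideal cpoly_ring ?B"
  proof
    have "is_ideal (dehomogenize ` K)"
      unfolding is_ideal_def
    proof (intro conjI ballI allI)
      show "0 \<in> dehomogenize ` K" using is_idealD(1)[OF K] by (metis dehomogenize_hom(5) imageI)
      fix f assume "f \<in> dehomogenize ` K"
      then obtain F where F: "F \<in> K" "f = dehomogenize F" by blast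
      show "h * f \<in> dehomogenize ` K" for h
        using is_idealD(3)[OF K F(1), of "homogenize h"] F(2)
        by (metis dehomogenize_hom(3) dehomogenize_homogenize imageI)
      fix g assume "g \<in> dehomogenize ` K"
      then obtain G where G: "G \<in> K" "g = dehomogenize G" by blast
      show "f + g \<in> dehomogenize ` K"
        using is_idealD(2)[OF K F(1) G(1)] F(2) G(2) by (metis dehomogenize_hom(1) imageI)
    qed
    then show "genideal cpoly_ring ?B \<subseteq> dehomogenize ` K" by (rule genideal_least) blast
    note gi = is_idealD[OF is_ideal_genideal[of ?B]]
    have g: "dehomogenize F \<in> genideal cpoly_ring ?B" if "F \<in> P.span (binomials \<inter> K)" for F
      using that
    proof (induction rule: P.span_induct_alt)
      case base
      then show ?case using gi(1) by (simp add: dehomogenize_hom)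
    next
      case (step c x y)
      have "dehomogenize x \<in> genideal cpoly_ring ?B"
        by (rule subsetD[OF genideal_subset]) (rule imageI[OF step(1)])
      then show ?case
        unfolding dehomogenize_hom by (intro gi(2,5) step(2))
    qed
    show "dehomogenize ` K \<subseteq> genideal cpoly_ring ?B" by (intro image_subsetI g span)
  qed
  ultimately show ?thesis unfolding binomial_ideal_def by blast
qed

section \<open>The exponent lattice of a prime binomial ideal\<close>

section \<open>Prime binomial ideals\<close>

locale prime_cpoly =
  fixes I :: "'n::finite cpoly set"
  assumes ideal: "is_ideal I" and proper: "1 \<notin> I" and prime: "f * g \<in> I \<Longrightarrow> f \<in> I \<or> g \<in> I"
begin

lemmas idl = is_idealD[OF ideal]

text \<open>The binary form of p in u and w splits into linear factors over the complex numbers, and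
  primeness of I selects one of them. A nonzero constant is excluded because I is proper.\<close>

lemma root_extraction_poly:
  assumes "p \<noteq> 0" "Polynomial.degree p = n"
    and "(\<Sum>i\<le>n. pscale (Polynomial.coeff p i) (u ^ i * w ^ (n - i))) \<in> I"
  shows "\<exists>\<zeta>. u - pscale \<zeta> w \<in> I"
  using assms
proof (induction n arbitrary: p)
  case 0
  then have c: "Polynomial.coeff p 0 \<noteq> 0" using leading_coeff_neq_0 by metis
  have "pscale (1 / Polynomial.coeff p 0) (pscale (Polynomial.coeff p 0) 1) \<in> I"
    by (rule idl(5)) (use 0(3) in simp)
  then have "1 \<in> I" using c by simp
  then show ?case using proper by simp
next
  case (Suc n)
  have "\<not> constant (poly p)" using Suc.prems(2) by (simp add: constant_degree)
  from Fundamental_Theorem_Algebra.fundamental_theorem_of_algebra[OF this] obtain \<zeta> where "poly p \<zeta> = 0" by (elim exE)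
  then have "[:- \<zeta>, 1:] dvd p" by (rule iffD1[OF poly_eq_0_iff_dvd])
  then obtain q where q: "p = [:- \<zeta>, 1:] * q" by (rule dvdE)
  have q0: "q \<noteq> 0" using Suc.prems(1) unfolding q by (intro notI) simp
  have "Polynomial.degree p = Polynomial.degree [:- \<zeta>, 1:] + Polynomial.degree q"
    unfolding q by (rule degree_mult_eq) (simp_all add: q0)
  then have dq: "Polynomial.degree q = n" using Suc.prems(2) by simp
  let ?t = "\<lambda>i. pscale (Polynomial.coeff q i) (u ^ i * w ^ (n - i))"
  have s1: "(\<Sum>i\<le>Suc n. pscale (Polynomial.coeff (pCons 0 q) i) (u ^ i * w ^ (Suc n - i))) = u * (\<Sum>i\<le>n. ?t i)"
    by (subst sum.atMost_Suc_shift) (simp add: sum_distrib_left pscale_mult_right mult.assoc)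
  have s2: "(\<Sum>i\<le>Suc n. pscale (Polynomial.coeff q i) (u ^ i * w ^ (Suc n - i))) = w * (\<Sum>i\<le>n. ?t i)"
  proof -
    have "Polynomial.coeff q (Suc n) = 0" using dq by (simp add: coeff_eq_0)
    then have "(\<Sum>i\<le>Suc n. pscale (Polynomial.coeff q i) (u ^ i * w ^ (Suc n - i)))
      = (\<Sum>i\<le>n. pscale (Polynomial.coeff q i) (u ^ i * w ^ (Suc n - i)))" by simp
    also have "\<dots> = (\<Sum>i\<le>n. w * ?t i)"
      by (intro sum.cong) (auto simp: Suc_diff_le pscale_mult_right mult_ac)
    finally show ?thesis by (simp add: sum_distrib_left)
  qed
  have "Polynomial.coeff p i = Polynomial.coeff (pCons 0 q) i - \<zeta> * Polynomial.coeff q i" for i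
    by (simp add: q)
  then have "(\<Sum>i\<le>Suc n. pscale (Polynomial.coeff p i) (u ^ i * w ^ (Suc n - i)))
    = (\<Sum>i\<le>Suc n. pscale (Polynomial.coeff (pCons 0 q) i) (u ^ i * w ^ (Suc n - i)))
      - pscale \<zeta> (\<Sum>i\<le>Suc n. pscale (Polynomial.coeff q i) (u ^ i * w ^ (Suc n - i)))"
    by (simp only: P.scale_left_diff_distrib sum_subtractf P.scale_sum_right P.scale_scale)
  also have "\<dots> = (u - pscale \<zeta> w) * (\<Sum>i\<le>n. ?t i)"
    unfolding s1 s2 by (simp add: left_diff_distrib pscale_mult_left)
  finally have "(u - pscale \<zeta> w) * (\<Sum>i\<le>n. ?t i) \<in> I" using Suc.prems(3) by simp
  from prime[OF this] show ?case
  proof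
    assume "u - pscale \<zeta> w \<in> I"
    then show ?thesis by (rule exI)
  next
    assume "(\<Sum>i\<le>n. ?t i) \<in> I"
    then show ?thesis by (rule Suc.IH[OF q0 dq])
  qed
qed

lemma root_extraction:
  assumes "u ^ n - pscale c (w ^ n) \<in> I" "0 < n"
  shows "\<exists>\<zeta>. u - pscale \<zeta> w \<in> I"
proof (rule root_extraction_poly)
  let ?p = "Polynomial.monom 1 n - [:c:]"
  have cf: "Polynomial.coeff ?p i = (if i = n then 1 else if i = 0 then - c else 0)" for i
    using assms(2) by (auto simp: coeff_pCons split: nat.splits)
  show "?p \<noteq> 0"
  proof
    assume "?p = 0"
    then have "Polynomial.coeff ?p n = 0" by (simp only: coeff_0)
    then show False unfolding cf by simp
  qed
  show "Polynomial.degree ?p = n"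
    by (rule order_antisym[OF degree_le le_degree]) (use assms(2) in \<open>simp_all only: cf split: if_splits\<close>, simp_all)
  have "(\<Sum>i\<le>n. pscale (Polynomial.coeff ?p i) (u ^ i * w ^ (n - i)))
    = (\<Sum>i\<in>{n, 0}. pscale (Polynomial.coeff ?p i) (u ^ i * w ^ (n - i)))"
    by (rule sum.mono_neutral_right) (auto simp add: cf simp del: coeff_diff)
  also have "\<dots> = u ^ n - pscale c (w ^ n)"
    unfolding cf using assms(2) by (simp add: P.scale_minus_left)
  finally show "(\<Sum>i\<le>n. pscale (Polynomial.coeff ?p i) (u ^ i * w ^ (n - i))) \<in> I" using assms(1) by simp
qed

definition expo_vec :: "('n \<Rightarrow>\<^sub>0 nat) \<Rightarrow> rat ^ 'n"
  where "expo_vec a = (\<chi> i. of_nat (Poly_Mapping.lookup a i))"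

lemma expo_vec_add: "expo_vec (a + b) = expo_vec a + expo_vec b"
  by (simp add: expo_vec_def vec_eq_iff lookup_add)

lemma expo_vec_0: "expo_vec 0 = 0"
  by (simp add: expo_vec_def vec_eq_iff)

lemma expo_vec_inj: "expo_vec a = expo_vec b \<Longrightarrow> a = b"
  by (simp add: expo_vec_def vec_eq_iff poly_mapping_eqI)

text \<open>Exponent differences of monomials that are nonzero and proportional modulo I. Primeness
  keeps products of such monomials nonzero, which makes this a group.\<close>

definition lattice :: "(rat ^ 'n) set"
  where "lattice = {expo_vec a - expo_vec b | a b. pmon a \<notin> I \<and> (\<exists>c. pmon a - pscale c (pmon b) \<in> I)}"

lemma lattice_swap:
  assumes "pmon a \<notin> I" "pmon a - pscale c (pmon b) \<in> I"
  shows "pmon b \<notin> I" "pmon b - pscale (1 / c) (pmon a) \<in> I"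
proof -
  show b: "pmon b \<notin> I"
  proof
    assume "pmon b \<in> I"
    then have "(pmon a - pscale c (pmon b)) + pscale c (pmon b) \<in> I" by (intro idl(2,5) assms(2))
    then show False using assms(1) by simp
  qed
  have c: "c \<noteq> 0" using assms by auto
  have "pscale (- (1 / c)) (pmon a - pscale c (pmon b)) \<in> I" by (rule idl(5)[OF assms(2)])
  then show "pmon b - pscale (1 / c) (pmon a) \<in> I"
    using c by (simp add: P.scale_right_diff_distrib P.scale_minus_left)
qed

lemma lattice_0: "0 \<in> lattice"
proof -
  have "pmon 0 \<notin> I" "pmon 0 - pscale 1 (pmon 0) \<in> I" using proper idl(1) by simp_all
  moreover have "0 = expo_vec 0 - expo_vec 0" by simp
  ultimately show ?thesis unfolding lattice_def by blast
qed

lemma lattice_uminus: "v \<in> lattice \<Longrightarrow> - v \<in> lattice"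
proof -
  assume "v \<in> lattice"
  then obtain a b c where v: "v = expo_vec a - expo_vec b" "pmon a \<notin> I" "pmon a - pscale c (pmon b) \<in> I"
    unfolding lattice_def by blast
  have "- v = expo_vec b - expo_vec a" using v(1) by simp
  then show ?thesis unfolding lattice_def using lattice_swap[OF v(2,3)] by blast
qed

lemma lattice_add: assumes "v \<in> lattice" "w \<in> lattice" shows "v + w \<in> lattice"
proof -
  obtain a b c where v: "v = expo_vec a - expo_vec b" "pmon a \<notin> I" "pmon a - pscale c (pmon b) \<in> I"
    using assms(1) unfolding lattice_def by blast
  obtain a' b' c' where w: "w = expo_vec a' - expo_vec b'" "pmon a' \<notin> I" "pmon a' - pscale c' (pmon b') \<in> I"
    using assms(2) unfolding lattice_def by blast
  have "pmon (a + a') - pscale (c * c') (pmon (b + b')) =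
    pmon a' * (pmon a - pscale c (pmon b)) + pscale c (pmon b) * (pmon a' - pscale c' (pmon b'))"
    by (simp add: pmon_add algebra_simps pscale_mult_left pscale_mult_right)
  moreover have "\<dots> \<in> I" by (intro idl(2,3) v(3) w(3))
  ultimately have "pmon (a + a') - pscale (c * c') (pmon (b + b')) \<in> I" by simp
  moreover have "pmon (a + a') \<notin> I" using prime v(2) w(2) unfolding pmon_add by blast
  moreover have "v + w = expo_vec (a + a') - expo_vec (b + b')" using v(1) w(1) by (simp add: expo_vec_add)
  ultimately show ?thesis unfolding lattice_def by blast
qed

lemma lattice_of_int: "v \<in> lattice \<Longrightarrow> of_int k *s v \<in> lattice"
proof -
  assume v: "v \<in> lattice"
  have n: "of_nat m *s v \<in> lattice" for m
    by (induction m) (auto simp: lattice_0 lattice_add[OF v] vec.scale_left_distrib)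
  show ?thesis
  proof (cases k rule: int_cases2)
    case (nonneg m) then show ?thesis using n by simp
  next
    case (nonpos m) then show ?thesis using lattice_uminus[OF n[of m]] by (simp add: vec.scale_minus_left)
  qed
qed

text \<open>The rational span of the lattice; a single denominator suffices because the lattice is a
  group.\<close>

definition rational_span :: "(rat ^ 'n) set"
  where "rational_span = {v. \<exists>k::nat. 0 < k \<and> of_nat k *s v \<in> lattice}"

lemma subspace_rational_span: "vec.subspace rational_span"
  unfolding vec.subspace_def
proof (intro conjI ballI allI)
  show "0 \<in> rational_span" unfolding rational_span_def using lattice_0 by (auto intro!: exI[of _ 1])
  fix v assume "v \<in> rational_span"
  then obtain k :: nat where k: "0 < k" "of_nat k *s v \<in> lattice" unfolding rational_span_def by blast
  {
    fix w assume "w \<in> rational_span"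
    then obtain l :: nat where l: "0 < l" "of_nat l *s w \<in> lattice" unfolding rational_span_def by blast
    have "of_int (int l) *s (of_nat k *s v) + of_int (int k) *s (of_nat l *s w) \<in> lattice"
      by (intro lattice_add lattice_of_int k l)
    moreover have "of_int (int l) *s (of_nat k *s v) + of_int (int k) *s (of_nat l *s w) = of_nat (k * l) *s (v + w)"
      by (simp add: vec_eq_iff algebra_simps)
    ultimately have "of_nat (k * l) *s (v + w) \<in> lattice" by (simp only:)
    then show "v + w \<in> rational_span"
      unfolding rational_span_def using k(1) l(1) by (intro CollectI exI[of _ "k * l"] conjI) simp_all
  }
  fix q :: rat
  obtain m n where q: "q = Rat.Fract m n" "n > 0" by (cases q) auto
  have "of_nat (k * nat n) *s (q *s v) = of_int m *s (of_nat k *s v)"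
    using q(2) by (simp add: vec_eq_iff q(1) Fract_of_int_quotient)
  moreover have "\<dots> \<in> lattice" by (rule lattice_of_int[OF k(2)])
  ultimately have "of_nat (k * nat n) *s (q *s v) \<in> lattice" by (simp only:)
  then show "q *s v \<in> rational_span" unfolding rational_span_def using k(1) q(2) by (intro CollectI exI[of _ "k * nat n"]) simp
qed

text \<open>The numbers t i become the entries of a diagonal matrix: its weights agree on
  proportional monomials but distinguish the pair whose difference is c.\<close>

lemma rational_functional:
  assumes "c \<notin> rational_span"
  obtains t :: "'n \<Rightarrow> rat" where "\<And>v. v \<in> lattice \<Longrightarrow> (\<Sum>i\<in>UNIV. v $ i * t i) = 0" "(\<Sum>i\<in>UNIV. c $ i * t i) \<noteq> 0"
proof -
  interpret vp: vector_space_pair "(*s) :: rat \<Rightarrow> rat ^ 'n \<Rightarrow> _" "(*) :: rat \<Rightarrow> rat \<Rightarrow> rat"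
    by unfold_locales (simp_all add: algebra_simps)
  obtain B where B: "B \<subseteq> rational_span" "vec.independent B" "rational_span \<subseteq> vec.span B"
    by (rule vec.basis_exists)
  have sp: "vec.span B \<subseteq> rational_span" by (rule vec.span_minimal[OF B(1) subspace_rational_span])
  then have c: "c \<notin> vec.span B" using assms by blast
  then have "vec.independent (insert c B)" using B(2) by (rule vec.independent_insertI)
  from vp.linear_independent_extend[OF this, of "\<lambda>x. if x = c then 1 else 0"]
  obtain f where f: "Vector_Spaces.linear (*s) (*) f" "\<forall>x\<in>insert c B. f x = (if x = c then 1 else 0)" by blast
  interpret f: Vector_Spaces.linear "(*s) :: rat \<Rightarrow> rat ^ 'n \<Rightarrow> _" "(*) :: rat \<Rightarrow> rat \<Rightarrow> rat" f by (rule f(1))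
  have fe: "f v = (\<Sum>i\<in>UNIV. v $ i * f (axis i 1))" for v
  proof -
    have "f v = f (\<Sum>i\<in>UNIV. v $ i *s axis i 1)" by (simp add: basis_expansion)
    then show ?thesis by (simp add: f.sum f.scale)
  qed
  have zB: "f x = 0" if "x \<in> B" for x using f(2) that c vec.span_base by auto
  have z: "f v = 0" if "v \<in> vec.span B" for v
    using that by (induction rule: vec.span_induct_alt) (simp_all add: f.zero f.add f.scale zB)
  show ?thesis
  proof (rule that[of "\<lambda>i. f (axis i 1)"])
    show "(\<Sum>i\<in>UNIV. v $ i * f (axis i 1)) = 0" if "v \<in> lattice" for v
    proof -
      have "v \<in> rational_span" unfolding rational_span_def using that by (auto intro!: exI[of _ 1])
      then have "f v = 0" by (intro z subsetD[OF B(3)])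
      then show ?thesis unfolding fe[of v] .
    qed
    show "(\<Sum>i\<in>UNIV. c $ i * f (axis i 1)) \<noteq> 0" 
    proof -
      have "f c \<noteq> 0" using f(2) by simp
      then show ?thesis unfolding fe[of c] .
    qed
  qed
qed

text \<open>If k (b - a) = e - f with x^e proportional to x^f, then x^(kb) x^f = x^(ka) x^e.
  Cancelling x^f, which is not in I, makes x^(kb) and x^(ka) proportional, and a k-th root can be
  extracted.\<close>

lemma binomial_in_ideal:
  assumes "expo_vec b - expo_vec a \<in> rational_span"
  shows "\<exists>\<zeta>. pmon b - pscale \<zeta> (pmon a) \<in> I"
proof -
  obtain k :: nat where k: "0 < k" "of_nat k *s (expo_vec b - expo_vec a) \<in> lattice"
    using assms unfolding rational_span_def by blast
  then obtain e f c where ef: "of_nat k *s (expo_vec b - expo_vec a) = expo_vec e - expo_vec f"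
    "pmon e \<notin> I" "pmon e - pscale c (pmon f) \<in> I"
    unfolding lattice_def by blast
  have mult: "pmon x ^ k = pmon (\<Sum>i<k. x)" "expo_vec (\<Sum>i<k. x) = of_nat k *s expo_vec x" for x
    by (induction k) (simp_all add: pmon_add expo_vec_add expo_vec_0 vec.scale_left_distrib add.commute mult.commute)
  have "expo_vec ((\<Sum>i<k. b) + f) = expo_vec ((\<Sum>i<k. a) + e)"
    unfolding expo_vec_add mult using ef(1) by (simp add: vec.scale_right_diff_distrib algebra_simps)
  then have "(\<Sum>i<k. b) + f = (\<Sum>i<k. a) + e" by (rule expo_vec_inj)
  then have eq: "pmon b ^ k * pmon f = pmon a ^ k * pmon e" unfolding mult by (simp flip: pmon_add)
  have "pmon f * (pmon b ^ k - pscale c (pmon a ^ k)) = pmon a ^ k * (pmon e - pscale c (pmon f))"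
    using eq by (simp add: right_diff_distrib pscale_mult_right pscale_mult_left mult.commute)
  also have "\<dots> \<in> I" by (rule idl(3)[OF ef(3)])
  finally have "pmon b ^ k - pscale c (pmon a ^ k) \<in> I" using prime lattice_swap(1)[OF ef(2,3)] by blast
  then show ?thesis using root_extraction k(1) by blast
qed

text \<open>Testing generators suffices. In a binomial of I either both terms lie in I or both have
  the same weight.\<close>

lemma lattice_weight_stable:
  assumes B: "I = genideal cpoly_ring B" "B \<subseteq> binomials" and E: "diagonal_matrix E"
    and w: "\<And>a b c. pmon a \<notin> I \<Longrightarrow> pmon a - pscale c (pmon b) \<in> I \<Longrightarrow> weight E a = weight E b"
    and f: "f \<in> I"
  shows "pder E f \<in> I"
proof -
  let ?K = "{f \<in> I. pder E f \<in> I}"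
  have "is_ideal ?K"
    unfolding is_ideal_def using idl by (auto simp: pder_plus pder_mult P.linop_zero[OF linop_pder])
  moreover have "B \<subseteq> ?K"
  proof
    fix g assume "g \<in> B"
    then have gI: "g \<in> I" using genideal_subset B(1) by blast
    obtain a b c where g: "g = pmon a - pscale c (pmon b)"
      using \<open>g \<in> B\<close> B(2) by (auto simp: binomials_def pmon_def[symmetric] single_eq_pscale)
    have pg: "pder E g = pscale (weight E a) (pmon a) - pscale (weight E b) (pscale c (pmon b))"
      by (simp add: g P.linop_diff[OF linop_pder] P.linop_scale[OF linop_pder] pder_diagonal[OF E] mult.commute)
    have "pder E g \<in> I"
    proof (cases "pmon a \<in> I")
      case True
      have "pmon a - g \<in> I" by (rule idl(7)[OF True gI])
      then have "pscale c (pmon b) \<in> I" by (simp add: g)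
      then show ?thesis unfolding pg by (intro idl(7) idl(5)[OF True] idl(5)[where f = "pscale c (pmon b)"])
    next
      case False
      then have "pder E g = pscale (weight E a) g"
        unfolding pg using w[OF False] gI by (simp add: g P.scale_right_diff_distrib)
      then show ?thesis using idl(5)[OF gI] by simp
    qed
    then show "g \<in> ?K" using gI by simp
  qed
  ultimately have "I \<subseteq> ?K" using genideal_least B(1) by metis
  then show ?thesis using f by blast
qed

definition option_diag :: "('n \<Rightarrow> complex) \<Rightarrow> 'n option cmatrix"
  where "option_diag t = (\<chi> i j. if i = j then case_option 0 t i else 0)"

lemma dehomogenize_pder_diagonal:
  assumes "diagonal_matrix D" "diagonal_matrix E" "\<And>b. weight D b = weight E (expo_down b)"
  shows "dehomogenize (pder D F) = pder E (dehomogenize F)"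
proof -
  have "dehomogenize (pder D F) = (\<Sum>b\<in>Poly_Mapping.keys F. dehomogenize (pder D (pscale (Poly_Mapping.lookup F b) (pmon b))))"
    by (subst cpoly_expand[of F]) (simp only: P.linop_sum[OF linop_pder] dehomogenize_sum)
  also have "\<dots> = (\<Sum>b\<in>Poly_Mapping.keys F. pder E (dehomogenize (pscale (Poly_Mapping.lookup F b) (pmon b))))"
    by (simp add: P.linop_scale[OF linop_pder] pder_diagonal assms dehomogenize_hom dehomogenize_pmon)
  also have "\<dots> = pder E (dehomogenize F)"
    by (subst (3) cpoly_expand[of F]) (simp only: P.linop_sum[OF linop_pder] dehomogenize_sum)
  finally show ?thesis .
qed

text \<open>Homogeneous components are eigencomponents of the Euler derivation, so they lie in J
  with F.\<close>

lemma homogeneous_components_in_span: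
  assumes J: "P.subspace J" "mat 1 \<in> stab_lie J" and F: "F \<in> J"
  shows "F \<in> P.span {G \<in> J. \<exists>d. homogeneous d G}"
proof -
  define G where "G \<mu> = (\<Sum>b\<in>{b \<in> Poly_Mapping.keys F. of_nat (exp_degree b) = \<mu>}. pscale (Poly_Mapping.lookup F b) (pmon b))"
    for \<mu> :: complex
  let ?W = "(\<lambda>b. of_nat (exp_degree b)) ` Poly_Mapping.keys F :: complex set"
  have FG: "F = (\<Sum>\<mu>\<in>?W. G \<mu>)"
  proof -
    have "(\<Sum>\<mu>\<in>?W. G \<mu>) = (\<Sum>b\<in>Poly_Mapping.keys F. pscale (Poly_Mapping.lookup F b) (pmon b))"
      unfolding G_def by (rule sum.image_gen[symmetric]) simp
    then show ?thesis by (simp flip: cpoly_expand)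
  qed
  have eig: "pder (mat 1) (G \<mu>) = pscale \<mu> (G \<mu>)" for \<mu>
    unfolding G_def P.linop_sum[OF linop_pder] P.linop_scale[OF linop_pder] pder_diagonal[OF diagonal_mat_1] P.scale_sum_right
    by (intro sum.cong) (auto simp: weight_mat_1 mult.commute)
  have st: "P.stable (pder (mat 1)) J" using J by (auto simp: P.stable_def stab_lie_def)
  have "(P.shift (pder (mat 1)) \<mu> ^^ 1) (G \<mu>) = 0" for \<mu> by (simp add: P.shift_def eig)
  then have k: "\<exists>k. (P.shift (pder (mat 1)) \<mu> ^^ k) (G \<mu>) = 0" for \<mu> by blast
  have "G \<mu> \<in> {G \<in> J. \<exists>d. homogeneous d G}" if \<mu>: "\<mu> \<in> ?W" for \<mu>
  proof -
    have "G \<mu> \<in> J"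
      by (rule P.gen_eigen_components[OF linop_pder st _ k _ \<mu>]) (use F FG in auto)
    moreover have "\<exists>d. homogeneous d (G \<mu>)" using \<mu> eig[of \<mu>] by (auto simp: homogeneous_def)
    ultimately show ?thesis by blast
  qed
  then show ?thesis by (subst FG) (intro P.span_sum P.span_base)
qed

lemma homogeneous_pder_diagonal:
  "diagonal_matrix D \<Longrightarrow> homogeneous d F \<Longrightarrow> homogeneous d (pder D F)"
  by (auto simp: homogeneous_iff in_keys_iff lookup_pder_diagonal)

text \<open>If the exponent difference were outside the rational span, a functional would give a
  diagonal matrix that stabilizes J and separates a from b. So the dehomogenized monomials are
  proportional modulo I; the identity matrix equates the degrees of a and b, and the binomial lifts
  to J. The ideal J enters through J1 and J2, which also hold for the transform of a
  homogenization.\<close>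

lemma weight_spaces_one_dimensional:
  assumes bin: "binomial_ideal I"
    and J: "P.subspace J" "mat 1 \<in> stab_lie J"
    and J1: "\<And>F d. homogeneous d F \<Longrightarrow> dehomogenize F \<in> I \<Longrightarrow> F \<in> J"
    and J2: "\<And>F. F \<in> J \<Longrightarrow> dehomogenize F \<in> I"
    and w: "\<And>D. diagonal_matrix D \<Longrightarrow> D \<in> stab_lie J \<Longrightarrow> weight D a = weight D b"
  shows "\<exists>\<nu>. pmon b - pscale \<nu> (pmon a) \<in> J"
proof -
  let ?a = "expo_down a" and ?b = "expo_down b"
  have "expo_vec ?b - expo_vec ?a \<in> rational_span"
  proof (rule ccontr)
    assume "\<not> ?thesis"
    from rational_functional[OF this] obtain t where t: "\<And>v. v \<in> lattice \<Longrightarrow> (\<Sum>i\<in>UNIV. v $ i * t i) = 0"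
      "(\<Sum>i\<in>UNIV. (expo_vec ?b - expo_vec ?a) $ i * t i) \<noteq> 0" by blast
    let ?D = "option_diag (\<lambda>i. of_rat (t i))" and ?E = "(\<chi> i j. if i = j then of_rat (t i) else 0) :: 'n cmatrix"
    have wE: "weight ?E x = of_rat (\<Sum>i\<in>UNIV. expo_vec x $ i * t i)" for x
      by (simp add: weight_def expo_vec_def of_rat_sum of_rat_mult mult.commute)
    have diff: "weight ?E x - weight ?E y = of_rat (\<Sum>i\<in>UNIV. (expo_vec x - expo_vec y) $ i * t i)" for x y
      unfolding wE by (simp add: left_diff_distrib sum_subtractf of_rat_diff)
    have wD: "weight ?D x = weight ?E (expo_down x)" for x
      by (simp add: weight_def sum_option option_diag_def lookup_expo_down)
    have D: "diagonal_matrix ?D" and E: "diagonal_matrix ?E" by (simp_all add: diagonal_matrix_def option_diag_def)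
    obtain B where B: "I = genideal cpoly_ring B" "B \<subseteq> binomials" using bin by (auto simp: binomial_ideal_def)
    have EI: "pder ?E f \<in> I" if "f \<in> I" for f
    proof (rule lattice_weight_stable[OF B E _ that])
      fix x y c assume "pmon x \<notin> I" "pmon x - pscale c (pmon y) \<in> I"
      then have "expo_vec x - expo_vec y \<in> lattice" unfolding lattice_def by blast
      then show "weight ?E x = weight ?E y" using t(1) diff[of x y]
        by (simp del: vector_minus_component)
    qed
    have "?D \<in> stab_lie J"
      unfolding stab_lie_def
    proof (intro CollectI ballI)
      fix F assume "F \<in> J"
      then have "F \<in> P.span {G \<in> J. \<exists>d. homogeneous d G}" by (rule homogeneous_components_in_span[OF J])
      then show "pder ?D F \<in> J"
      proof (induction rule: P.span_induct_alt)
        case base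
        then show ?case by (simp add: P.linop_zero[OF linop_pder] P.subspace_0[OF J(1)])
      next
        case (step c x y)
        then obtain d where d: "homogeneous d x" "x \<in> J" by blast
        have "pder ?D x \<in> J"
          by (rule J1[OF homogeneous_pder_diagonal[OF D d(1)]])
            (simp add: dehomogenize_pder_diagonal[OF D E wD] EI J2[OF d(2)])
        then show ?case
          unfolding P.linop_add[OF linop_pder] P.linop_scale[OF linop_pder]
          by (intro P.subspace_add P.subspace_scale J(1) step(2))
      qed
    qed
    then have "weight ?D a = weight ?D b" by (rule w[OF D])
    then have "weight ?E ?b - weight ?E ?a = 0" by (simp add: wD)
    then show False using t(2) unfolding diff by simp
  qed
  then obtain \<zeta> where z: "pmon ?b - pscale \<zeta> (pmon ?a) \<in> I" using binomial_in_ideal by blast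
  have "of_nat (exp_degree a) = (of_nat (exp_degree b) :: complex)"
    using w[OF diagonal_mat_1 J(2)] by (simp add: weight_mat_1)
  then have "homogeneous (exp_degree b) (pmon a)" using homogeneous_pmon[of a] by simp
  from homogeneous_pscale_add[OF homogeneous_pmon[of b] this, of 1 "- \<zeta>"]
  have "homogeneous (exp_degree b) (pmon b - pscale \<zeta> (pmon a))" by (simp add: P.scale_minus_left)
  then have "pmon b - pscale \<zeta> (pmon a) \<in> J"
    by (rule J1) (simp add: dehomogenize_hom dehomogenize_pmon z)
  then show ?thesis by blast
qed

end

section \<open>Comparison of the computed torus with the torus of a binomial form\<close>

section \<open>One-dimensional weight spaces of the computed torus\<close>

lemma psub_image_mem:
  fixes S :: "'m::finite cmatrix"
  assumes "invertible S" shows "f \<in> psub (matrix_inv S) ` J \<longleftrightarrow> psub S f \<in> J"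
proof
  show "f \<in> psub (matrix_inv S) ` J \<Longrightarrow> psub S f \<in> J" by (auto simp: psub_matrix_inv(1)[OF assms])
  assume "psub S f \<in> J"
  then have "psub (matrix_inv S) (psub S f) \<in> psub (matrix_inv S) ` J" by (rule imageI)
  then show "f \<in> psub (matrix_inv S) ` J" by (simp add: psub_matrix_inv(2)[OF assms])
qed

lemma stable_psub_image_pder:
  fixes S :: "'m::finite cmatrix"
  assumes S: "invertible S" and D: "D ** S = S ** A"
  shows "D \<in> stab_lie (psub (matrix_inv S) ` J) \<longleftrightarrow> A \<in> stab_lie J"
proof -
  note c = psub_pder[OF D[symmetric]] and m = psub_image_mem[OF S, of _ J]
  show ?thesis
  proof
    assume D: "D \<in> stab_lie (psub (matrix_inv S) ` J)"
    have "pder A f \<in> J" if f: "f \<in> J" for f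
    proof -
      have "psub S (pder D (psub (matrix_inv S) f)) \<in> J"
        using D imageI[OF f, of "psub (matrix_inv S)"] unfolding stab_lie_def m[symmetric] by blast
      then show ?thesis by (simp add: c psub_matrix_inv(1)[OF S])
    qed
    then show "A \<in> stab_lie J" by (simp add: stab_lie_def)
  next
    assume "A \<in> stab_lie J"
    then show "D \<in> stab_lie (psub (matrix_inv S) ` J)" by (simp add: stab_lie_def m c psub_matrix_inv(1)[OF S])
  qed
qed

lemma is_ideal_psub_image:
  fixes S :: "'m::finite cmatrix"
  assumes S: "invertible S" and J: "is_ideal J"
  shows "is_ideal (psub (matrix_inv S) ` J)"
  unfolding is_ideal_def
  using is_idealD(1)[OF J] is_idealD(2)[OF J] is_idealD(3)[OF J]
  by (simp add: psub_image_mem[OF S] P.linop_zero[OF linop_psub] P.linop_add[OF linop_psub] psub_mult)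

lemma indep_mod_pair:
  assumes "P.indep_mod U K" "finite K" "r \<in> K" "s \<in> K" "r \<noteq> s"
  shows "r - pscale \<nu> s \<notin> U"
proof
  assume "r - pscale \<nu> s \<in> U"
  let ?c = "\<lambda>x. if x = r then 1 else if x = s then - \<nu> else 0"
  have "(\<Sum>x\<in>K. pscale (?c x) x) = (\<Sum>x\<in>{r, s}. pscale (?c x) x)"
    using assms by (intro sum.mono_neutral_right) auto
  also have "\<dots> = r - pscale \<nu> s" using assms(5) by (simp add: P.scale_minus_left)
  finally have "(\<Sum>x\<in>K. pscale (?c x) x) \<in> U" using \<open>r - pscale \<nu> s \<in> U\<close> by simp
  from P.indep_modD[OF assms(1) this assms(3)] show False by simp
qed

lemma indep_mod_pairI:
  assumes U: "P.subspace U" and s: "s \<notin> U" and r: "\<And>\<nu>. r - pscale \<nu> s \<notin> U"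
  shows "P.indep_mod U {s, r}"
  unfolding P.indep_mod_def
proof (intro allI impI)
  fix c assume "(\<Sum>x\<in>{s, r}. pscale (c x) x) \<in> U"
  moreover have "s \<noteq> r" using r[of 1] P.subspace_0[OF U] by auto
  ultimately have sum: "pscale (c s) s + pscale (c r) r \<in> U" by simp
  have cr: "c r = 0"
  proof (rule ccontr)
    assume c: "c r \<noteq> 0"
    have "pscale (1 / c r) (pscale (c s) s + pscale (c r) r) \<in> U" by (rule P.subspace_scale[OF U sum])
    then have "r - pscale (- (c s / c r)) s \<in> U"
      using c by (simp add: P.scale_right_distrib P.scale_minus_left add.commute)
    then show False using r by blast
  qed
  have "c s = 0"
  proof (rule ccontr)
    assume c: "c s \<noteq> 0"
    have "pscale (1 / c s) (pscale (c s) s + pscale (c r) r) \<in> U" by (rule P.subspace_scale[OF U sum])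
    then show False using c cr s by simp
  qed
  with cr show "\<forall>x\<in>{s, r}. c x = 0" by simp
qed

text \<open>The transformed monomials span the polynomials of degree at most d, so a frame can be
  chosen among them. They are eigenvectors for every matrix that S diagonalizes.\<close>

lemma monomial_frame:
  fixes S :: "'m::finite cmatrix"
  assumes S: "invertible S" and U: "P.subspace U" "U \<subseteq> pdeg_le d"
    and E0: "\<And>e. e \<in> E0 \<Longrightarrow> exp_degree e \<le> d" "P.indep_mod U ((\<lambda>e. psub S (pmon e)) ` E0)"
  obtains K l where "(\<lambda>e. psub S (pmon e)) ` E0 \<subseteq> K" "K \<subseteq> range (\<lambda>e. psub S (pmon e))"
    "P.indep_mod U K" "P.frame U (pdeg_le d) K l"
proof -
  let ?g = "\<lambda>e. psub S (pmon e)"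
  let ?E = "?g ` {e. exp_degree e \<le> d}"
  have E: "finite ?E" "?E \<subseteq> pdeg_le d"
    using finite_exp_degree_le[of d] P.stable_in[OF psub_stable_pdeg_le, of _ d S] by (auto simp: pmon_pdeg_le)
  have "psub S f \<in> P.span ?E" if "f \<in> P.span (pmon ` {e. exp_degree e \<le> d})" for f
    using that
  proof (induction rule: P.span_induct_alt)
    case base
    then show ?case by (simp add: P.linop_zero[OF linop_psub] P.span_zero)
  next
    case (step c x y)
    have "psub S x \<in> P.span ?E" using step(1) by (intro P.span_base) blast
    then show ?case
      unfolding P.linop_add[OF linop_psub] P.linop_scale[OF linop_psub]
      by (intro P.span_add P.span_scale step(2))
  qed
  then have sp: "psub S f \<in> P.span ?E" if "f \<in> pdeg_le d" for f using that unfolding pdeg_le_span .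
  have WE: "pdeg_le d \<subseteq> P.span (U \<union> ?E)"
  proof
    fix f :: "'m cpoly" assume "f \<in> pdeg_le d"
    then have "psub S (psub (matrix_inv S) f) \<in> P.span ?E"
      by (intro sp P.stable_in[OF psub_stable_pdeg_le])
    then show "f \<in> P.span (U \<union> ?E)"
      unfolding psub_matrix_inv(1)[OF S] by (rule subsetD[OF P.span_mono, rotated]) blast
  qed
  have "?g ` E0 \<subseteq> ?E" using E0(1) by blast
  then show ?thesis
  proof (rule P.frame_exists[OF U(1) subspace_pdeg_le U(2) E WE _ E0(2)])
    fix K l assume K: "?g ` E0 \<subseteq> K" "K \<subseteq> ?E" "P.indep_mod U K" "P.frame U (pdeg_le d) K l"
    have "K \<subseteq> range ?g" using K(2) by blast
    then show ?thesis by (rule that[OF K(1) _ K(3,4)])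
  qed
qed

text \<open>On a line through a solution for Q and a point where the new function is nonzero, every
  function excludes at most one parameter t.\<close>

lemma exists_nonvanishing:
  assumes "finite Q" "cmat.subspace V"
    and "\<And>p D D' t. p \<in> Q \<Longrightarrow> \<phi> p (D + cscale t D') = \<phi> p D + t * (\<phi> p D' :: complex)"
    and "\<And>p. p \<in> Q \<Longrightarrow> \<exists>D\<in>V. \<phi> p D \<noteq> 0"
  shows "\<exists>D\<in>V. \<forall>p\<in>Q. \<phi> p D \<noteq> 0"
  using assms(1,3,4)
proof (induction Q rule: finite_induct)
  case empty
  then show ?case using cmat.subspace_0[OF assms(2)] by auto
next
  case (insert q Q)
  obtain D where D: "D \<in> V" "\<And>p. p \<in> Q \<Longrightarrow> \<phi> p D \<noteq> 0" using insert by blast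
  obtain D' where D': "D' \<in> V" "\<phi> q D' \<noteq> 0" using insert.prems(2)[of q] by blast
  have "finite (\<Union>p\<in>insert q Q. {t. \<phi> p D + t * \<phi> p D' = 0})"
  proof (rule finite_UN_I)
    fix p assume p: "p \<in> insert q Q"
    show "finite {t. \<phi> p D + t * \<phi> p D' = 0}"
    proof (cases "\<phi> p D' = 0")
      case True
      then have "\<phi> p D \<noteq> 0" using p D(2) D'(2) by auto
      then show ?thesis using True by simp
    next
      case False
      then have "{t. \<phi> p D + t * \<phi> p D' = 0} \<subseteq> {- \<phi> p D / \<phi> p D'}"
        by (auto simp: field_simps add_eq_0_iff)
      then show ?thesis by (rule finite_subset) simp
    qed
  qed (simp add: insert.hyps(1))
  then obtain t where "t \<notin> (\<Union>p\<in>insert q Q. {t. \<phi> p D + t * \<phi> p D' = 0})"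
    using ex_new_if_finite[OF infinite_UNIV_char_0] by blast
  then have "\<forall>p\<in>insert q Q. \<phi> p (D + cscale t D') \<noteq> 0" using insert.prems(1) by auto
  moreover have "D + cscale t D' \<in> V" by (intro cmat.subspace_add cmat.subspace_scale assms(2) D(1) D'(1))
  ultimately show ?case by blast
qed

lemma weight_linear: "weight (D + cscale t D') a = weight D a + t * weight D' a"
  by (simp add: weight_def cscale_def sum.distrib sum_distrib_left algebra_simps)

text \<open>Each pair of exponents excludes the zeros of a nonzero linear function on the
  stabilizing diagonal matrices, so one of them separates all pairs at once.\<close>

lemma separating_diagonal:
  fixes J :: "'m::finite cpoly set"
  assumes J: "P.subspace J" and XS: "finite XS"
    and sep: "\<And>a b. a \<in> XS \<Longrightarrow> b \<in> XS \<Longrightarrow> a \<noteq> b \<Longrightarrow>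
      \<exists>D. diagonal_matrix D \<and> D \<in> stab_lie J \<and> weight D a \<noteq> weight D b"
  obtains D where "diagonal_matrix D" "D \<in> stab_lie J" "inj_on (weight D) XS"
proof -
  let ?V = "{D. diagonal_matrix D \<and> D \<in> stab_lie J}"
  let ?Q = "{p \<in> XS \<times> XS. fst p \<noteq> snd p}"
  have "cmat.subspace ?V"
    unfolding cmat.subspace_def
    by (auto simp: diagonal_matrix_def cscale_def stab_lie_def pder_mat_0 pder_mat_add
        pder_mat_cscale[unfolded cscale_def] intro: P.subspace_0[OF J] P.subspace_add[OF J] P.subspace_scale[OF J])
  moreover have "finite ?Q" using XS by simp
  ultimately have "\<exists>D\<in>?V. \<forall>p\<in>?Q. weight D (fst p) - weight D (snd p) \<noteq> 0"
    using sep by (intro exists_nonvanishing) (auto simp: weight_linear algebra_simps)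
  then obtain D where D: "D \<in> ?V" "\<forall>p\<in>?Q. weight D (fst p) - weight D (snd p) \<noteq> 0" by blast
  have "inj_on (weight D) XS"
  proof (rule inj_onI, rule ccontr)
    fix a b assume "a \<in> XS" "b \<in> XS" "weight D a = weight D b" "a \<noteq> b"
    then show False using D(2)[rule_format, of "(a, b)"] by simp
  qed
  moreover have "diagonal_matrix D" "D \<in> stab_lie J" using D(1) by auto
  ultimately show ?thesis by (intro that)
qed

text \<open>Powers of the conjugated derivation are conjugates under \<open>psub g\<close>, and
  cyclicity of the trace moves the inverse substitution to the other side.\<close>

lemma frame_trace_conj:
  fixes g :: "'m::finite cmatrix"
  assumes F: "P.frame U W K l" and g: "invertible g" "P.stable (psub g) U" "P.stable (psub g) W"
    "P.stable (psub (matrix_inv g)) U" "P.stable (psub (matrix_inv g)) W"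
    and c: "P.stable (pder c) U" "P.stable (pder c) W"
  shows "P.frame_trace K l (pder (g ** c ** matrix_inv g) ^^ n) = P.frame_trace K l (pder c ^^ n)"
proof -
  have pw: "(pder (g ** c ** matrix_inv g) ^^ n) f = psub (matrix_inv g) ((pder c ^^ n) (psub g f))" for f
    by (induction n) (simp_all add: psub_matrix_inv[OF g(1)] pder_conj[OF g(1)])
  let ?Y = "\<lambda>f. (pder c ^^ n) (psub g f)"
  have Y: "P.linop ?Y" "P.stable ?Y U" "P.stable ?Y W"
    using P.linop_funpow[OF linop_pder, of n c] linop_psub[of g] g(2,3)
      P.stable_funpow[OF c(1), of n] P.stable_funpow[OF c(2), of n]
    by (auto simp: P.linop_def P.stable_def)
  have "P.frame_trace K l (pder (g ** c ** matrix_inv g) ^^ n) = P.frame_trace K l (\<lambda>f. psub (matrix_inv g) (?Y f))"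
    by (simp add: P.frame_trace_def pw)
  also have "\<dots> = P.frame_trace K l (\<lambda>f. ?Y (psub (matrix_inv g) f))"
    by (rule P.frame_trace_commute[OF F linop_psub g(4,5) Y])
  also have "\<dots> = P.frame_trace K l (pder c ^^ n)" by (simp add: psub_matrix_inv[OF g(1)] P.frame_trace_def)
  finally show ?thesis .
qed

lemma pder_stable_Int: "A \<in> stab_lie J \<Longrightarrow> P.subspace J \<Longrightarrow> P.stable (pder A) (J \<inter> pdeg_le d)"
  using P.stable_in[OF pder_stable_pdeg_le]
  by (auto simp: P.stable_def stab_lie_def intro!: P.subspace_inter subspace_pdeg_le)

lemma psub_stable_Int:
  "\<forall>f\<in>J. psub g f \<in> J \<Longrightarrow> P.subspace J \<Longrightarrow> P.stable (psub g) (J \<inter> pdeg_le d)"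
  using P.stable_in[OF psub_stable_pdeg_le]
  by (auto simp: P.stable_def intro!: P.subspace_inter subspace_pdeg_le)

text \<open>Suppose two independent weight vectors of \<open>T\<close> had the same weight. Then every \<open>c \<in> C\<close> has
  fewer eigenvalues than the dimension of \<open>pdeg_le d\<close> modulo \<open>J\<close>, so the Hankel matrix of the
  traces of its powers is singular, and this property is invariant under conjugation. But some
  \<open>a \<in> L\<close> conjugate to a diagonal matrix acts with simple spectrum, so the Hankel matrix is regular
  at generic points of the line from \<open>x\<close> to \<open>a\<close>; near \<open>x\<close>, the points of this line are conjugate
  into \<open>C\<close>.\<close>

lemma torus_weight_spaces:
  fixes J :: "'n::finite option cpoly set"
  assumes J: "P.subspace J" and L: "L = stab_lie J \<inter> row_fixing" and x: "x \<in> L"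
    and C: "C = ad_kernel L x" "cartan_subalgebra C L"
    and S: "invertible S" "\<And>A. A \<in> C \<Longrightarrow> diagonalizable A \<Longrightarrow> diagonal_matrix (S ** A ** matrix_inv S)"
    and S': "invertible S'" "S' \<in> row_fixing" "matrix_inv S' \<in> row_fixing"
    and one: "\<And>a b. (\<And>D. diagonal_matrix D \<Longrightarrow> D \<in> stab_lie (psub (matrix_inv S') ` J) \<Longrightarrow> weight D a = weight D b) \<Longrightarrow>
      \<exists>\<nu>. pmon b - pscale \<nu> (pmon a) \<in> psub (matrix_inv S') ` J"
    and w: "\<And>A. A \<in> C \<Longrightarrow> diagonalizable A \<Longrightarrow>
      weight (S ** A ** matrix_inv S) a = weight (S ** A ** matrix_inv S) b"
  shows "pmon a \<in> psub (matrix_inv S) ` J \<or> (\<exists>\<nu>. pmon b - pscale \<nu> (pmon a) \<in> psub (matrix_inv S) ` J)"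
proof (rule ccontr)
  assume neg: "\<not> ?thesis"
  \<comment> \<open>Just large enough for both monomials; linear substitutions do not raise the
    degree.\<close>
  define d where "d = max (exp_degree a) (exp_degree b)"
  define U where "U = J \<inter> pdeg_le d"
  let ?g = "\<lambda>e. psub S (pmon e)" and ?g' = "\<lambda>e. psub S' (pmon e)"
  have U: "P.subspace U" "U \<subseteq> pdeg_le d"
    unfolding U_def by (auto intro!: P.subspace_inter J subspace_pdeg_le)
  have na: "?g a \<notin> U" and nb: "?g b - pscale \<nu> (?g a) \<notin> U" for \<nu>
    using neg unfolding psub_image_mem[OF S(1)] P.linop_diff[OF linop_psub] P.linop_scale[OF linop_psub] U_def by auto
  have ab: "?g a \<noteq> ?g b" using nb[of 1] P.subspace_0[OF U(1)] by auto
  have "P.indep_mod U (?g ` {a, b})" using indep_mod_pairI[OF U(1) na nb] by simp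
  moreover have "exp_degree e \<le> d" if "e \<in> {a, b}" for e using that by (auto simp: d_def)
  ultimately obtain K l where K: "?g ` {a, b} \<subseteq> K" "K \<subseteq> range ?g" "P.frame U (pdeg_le d) K l"
    using monomial_frame[OF S(1) U, of "{a, b}"] by metis
  have "P.indep_mod U (?g' ` {})" by (simp add: P.indep_mod_def)
  then obtain K' l' where K': "K' \<subseteq> range ?g'" "P.indep_mod U K'" "P.frame U (pdeg_le d) K' l'"
    using monomial_frame[OF S'(1) U, of "{}"] by (metis empty_iff)
  have fin: "finite K" "finite K'" "K' \<subseteq> pdeg_le d" using K(3) K'(3) by (auto simp: P.frame_def)
  \<comment> \<open>The trace of the identity counts the representatives.\<close>
  have "of_nat (card K) = (of_nat (card K') :: complex)"
    using P.frame_trace_unique[OF K(3) K'(3), of "\<lambda>v. v"] U(1)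
    by (simp add: P.frame_trace_id[OF K(3)] P.frame_trace_id[OF K'(3)] P.linop_def P.stable_def subspace_pdeg_le)
  then have card: "card K = card K'" by simp
  have injg: "inj (\<lambda>e. psub M (pmon e))" if M: "invertible M" for M :: "'n option cmatrix"
  proof (rule injI)
    fix e e' assume "psub M (pmon e) = psub M (pmon e')"
    then have "pmon e = pmon e'" using psub_matrix_inv(2)[OF M] by metis
    then have "Poly_Mapping.keys (pmon e) = Poly_Mapping.keys (pmon e')" by (rule arg_cong)
    then show "e = e'" by simp
  qed
  note inj = injg[OF S(1)] and inj' = injg[OF S'(1)]
  have eig: "pder A (psub M (pmon e)) = pscale (weight D e) (psub M (pmon e))"
    if "diagonal_matrix D" "M ** A = D ** M" for A D M :: "'n option cmatrix" and e
    using psub_pder[OF that(2), of "pmon e"] by (simp add: pder_diagonal[OF that(1)] P.linop_scale[OF linop_psub])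
  have La: "lie_algebra L" unfolding L by (rule lie_algebra_affine[OF J])
  have ssL: "ss A \<in> L" if "A \<in> L" for A using that stab_lie_ss[OF J] row_fixing_ss unfolding L by blast
  have CL: "C \<subseteq> L" using C(2) by (simp add: cartan_subalgebra_def lie_subalgebra_def)

  \<comment> \<open>The exponents of the representatives adapted to S'. Two that no D separates
    would be proportional modulo J by \<open>one\<close>, against independence, so a single D
    separates them all.\<close>
  define XS where "XS = {e. ?g' e \<in> K'}"
  have finX: "finite XS" unfolding XS_def using finite_vimageI[OF fin(2) inj'] by (simp add: vimage_def)
  have sJ': "P.subspace (psub (matrix_inv S') ` J)"
    unfolding P.subspace_def
    using P.subspace_0[OF J] P.subspace_add[OF J] P.subspace_scale[OF J]
    by (simp add: psub_image_mem[OF S'(1)] P.linop_zero[OF linop_psub] P.linop_add[OF linop_psub] P.linop_scale[OF linop_psub])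
  obtain D where D: "diagonal_matrix D" "D \<in> stab_lie (psub (matrix_inv S') ` J)" "inj_on (weight D) XS"
  proof (rule separating_diagonal[OF sJ' finX])
    fix e e' assume e: "e \<in> XS" "e' \<in> XS" "e \<noteq> e'"
    show "\<exists>D. diagonal_matrix D \<and> D \<in> stab_lie (psub (matrix_inv S') ` J) \<and> weight D e \<noteq> weight D e'"
    proof (rule ccontr)
      assume "\<not> ?thesis"
      then obtain \<nu> where "pmon e' - pscale \<nu> (pmon e) \<in> psub (matrix_inv S') ` J" using one[of e e'] by blast
      then have "?g' e' - pscale \<nu> (?g' e) \<in> J"
        unfolding psub_image_mem[OF S'(1)] P.linop_diff[OF linop_psub] P.linop_scale[OF linop_psub] .
      moreover have "?g' e' - pscale \<nu> (?g' e) \<in> pdeg_le d"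
        using e fin(3) unfolding XS_def by (intro P.subspace_diff P.subspace_scale subspace_pdeg_le) auto
      moreover have "?g' e' \<noteq> ?g' e" using e(3) inj' by (auto simp: inj_def)
      ultimately show False
        using indep_mod_pair[OF K'(2) fin(2), of "?g' e'" "?g' e" \<nu>] e(1,2) by (simp add: U_def XS_def)
    qed
  qed
  \<comment> \<open>D in the original coordinates: y lies in L and acts on the frame K' with
    distinct eigenvalues.\<close>
  define y where "y = matrix_inv S' ** D ** S'"
  have Sy: "S' ** y = D ** S'"
    unfolding y_def by (simp add: matrix_mul_assoc matrix_inv_cmatrix(1)[OF S'(1)])
  have yL: "y \<in> L"
  proof -
    have "D \<in> row_fixing" using D(1) by (simp add: diagonal_matrix_def row_fixing_def)
    then have "y \<in> row_fixing" unfolding y_def by (intro row_fixing_mult S')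
    moreover have "y \<in> stab_lie J" using stable_psub_image_pder[OF S'(1) Sy[symmetric], of J] D(2) by blast
    ultimately show ?thesis by (simp add: L)
  qed
  define A where "A t = x + cscale t (y - x)" for t
  define \<alpha> where "\<alpha> r = weight D (inv_into UNIV ?g' r)" for r
  have eva: "pder (A 1) r = pscale (\<alpha> r) r" if r: "r \<in> K'" for r
  proof -
    obtain e where e: "r = ?g' e" using K'(1) r by blast
    have "A 1 = y" by (simp add: A_def cscale_def vec_eq_iff)
    then show ?thesis using eig[OF D(1) Sy] by (simp add: \<alpha>_def e inv_f_f[OF inj'])
  qed
  have inj\<alpha>: "inj_on \<alpha> K'"
  proof (rule inj_onI)
    fix r s assume rs: "r \<in> K'" "s \<in> K'" "\<alpha> r = \<alpha> s"
    obtain e e' where e: "r = ?g' e" "s = ?g' e'" using K'(1) rs by blast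
    have "weight D e = weight D e'" using rs(3) by (simp add: \<alpha>_def e inv_f_f[OF inj'])
    then have "e = e'" using D(3) rs(1,2) by (auto simp: inj_on_def XS_def e)
    then show "r = s" by (simp add: e)
  qed
  have poly: "(\<lambda>t. P.frame_trace K' l' (pder (A t) ^^ k)) \<in> range poly" for k
  proof -
    have "pcurve (range poly) (\<lambda>t. (pder (A t) ^^ k) r)" for r
    proof (induction k)
      case 0
      show ?case using pcurve_const[OF fun_algebra_poly, of r] by simp
    next
      case (Suc k)
      show ?case
        using pcurve_pder[OF fun_algebra_poly _ Suc, of A] line_in_poly[of x "y - x"] by (simp add: A_def)
    qed
    moreover have "P.linfun (l' r)" if "r \<in> K'" for r using K'(3) that by (simp add: P.frame_def)
    ultimately show ?thesis
      unfolding P.frame_trace_def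
      by (intro fun_algebra_sum[OF fun_algebra_poly] pcurve_linfun[OF fun_algebra_poly])
  qed
  have "\<exists>q. q \<noteq> 0 \<and> (\<forall>t c. poly q t \<noteq> 0 \<longrightarrow>
      (\<forall>i. (\<Sum>j<card K'. c j * P.frame_trace K' l' (pder (A t) ^^ (i + j))) = 0) \<longrightarrow> (\<forall>j<card K'. c j = 0))"
  proof (rule P.hankel_generic[where Z = "\<lambda>t. pder (A t)", OF K'(3) poly eva linop_pder inj\<alpha>])
    fix q assume q: "q \<noteq> 0" "\<And>t c. poly q t \<noteq> 0 \<Longrightarrow>
      (\<And>i. (\<Sum>j<card K'. c j * P.frame_trace K' l' (pder (A t) ^^ (i + j))) = 0) \<Longrightarrow> \<forall>j<card K'. c j = 0"
    have "poly q t \<noteq> 0 \<longrightarrow> (\<forall>i. (\<Sum>j<card K'. c j * P.frame_trace K' l' (pder (A t) ^^ (i + j))) = 0) \<longrightarrow>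
      (\<forall>j<card K'. c j = 0)" for t c
      by (intro impI, rule q(2), assumption, erule spec)
    then show ?thesis using q(1) by (intro exI[of _ q] conjI allI)
  qed
  then obtain q where q: "q \<noteq> 0" "\<forall>t c. poly q t \<noteq> 0 \<longrightarrow>
      (\<forall>i. (\<Sum>j<card K'. c j * P.frame_trace K' l' (pder (A t) ^^ (i + j))) = 0) \<longrightarrow> (\<forall>j<card K'. c j = 0)"
    by (elim exE conjE)

  have "\<exists>\<epsilon>>0. \<forall>t::real. 0 < t \<and> t < \<epsilon> \<longrightarrow>
      (\<exists>g\<in>aff_stab J. \<exists>c\<in>C. A (of_real t) = g ** c ** matrix_inv g)"
    unfolding A_def C(1) by (rule dominance[OF J L x yL])
  then obtain \<epsilon> where \<epsilon>: "\<epsilon> > 0" "\<forall>t::real. 0 < t \<and> t < \<epsilon> \<longrightarrow>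
      (\<exists>g\<in>aff_stab J. \<exists>c\<in>C. A (of_real t) = g ** c ** matrix_inv g)"
    by (elim exE conjE)
  \<comment> \<open>Since q has finitely many roots, some t below \<epsilon> avoids them while A t
    is still conjugate into C.\<close>
  have "finite {t::real. poly q (of_real t) = 0}"
  proof (rule finite_imageD)
    show "finite (complex_of_real ` {t. poly q (of_real t) = 0})"
      by (rule finite_subset[OF _ poly_roots_finite[OF q(1)]]) auto
  qed (simp add: inj_on_def)
  then have "infinite ({0<..<\<epsilon>} - {t::real. poly q (of_real t) = 0})"
    using \<epsilon>(1) by (simp add: infinite_Ioo)
  then have "{0<..<\<epsilon>} - {t::real. poly q (of_real t) = 0} \<noteq> {}" by (rule infinite_imp_nonempty)
  then obtain t :: real where "t \<in> {0<..<\<epsilon>} - {t. poly q (of_real t) = 0}" by (elim ex_in_conv[THEN iffD2, THEN exE])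
  then have t: "0 < t" "t < \<epsilon>" "poly q (of_real t) \<noteq> 0" by simp_all
  obtain g c where g: "g \<in> aff_stab J" and c: "c \<in> C" and At: "A (of_real t) = g ** c ** matrix_inv g"
    using \<epsilon>(2)[rule_format, OF conjI[OF t(1,2)]] by (elim bexE)
  have cJ: "c \<in> stab_lie J" using c CL L by blast
  note stc = pder_stable_Int[OF cJ J, of d, folded U_def]
  have tr: "P.frame_trace K' l' (pder (A (of_real t)) ^^ n) = P.frame_trace K' l' (pder c ^^ n)" for n
    unfolding At using g
    by (intro frame_trace_conj[OF K'(3)] stc pder_stable_pdeg_le psub_stable_pdeg_le)
      (auto simp: aff_stab_def U_def intro!: psub_stable_Int J)

  \<comment> \<open>S diagonalizes ss c. As c - ss c is nilpotent and commutes with ss c, the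
    representatives in K are generalized eigenvectors of c with the same eigenvalues.\<close>
  have sc: "ss c \<in> C" by (rule cartan_ss(1)[OF La _ C(2) c]) (rule ssL)
  define E where "E = S ** ss c ** matrix_inv S"
  have E: "diagonal_matrix E" unfolding E_def by (rule S(2)[OF sc ss_diagonalizable])
  have SE: "S ** ss c = E ** S"
    unfolding E_def by (simp add: matrix_mul_assoc[symmetric] matrix_inv_cmatrix(2)[OF S(1)])
  define \<beta> where "\<beta> r = weight E (inv_into UNIV ?g r)" for r
  have gen: "\<exists>k. (P.shift (pder c) (\<beta> r) ^^ k) r = 0" if r: "r \<in> K" for r
  proof -
    obtain e where e: "r = ?g e" using K(2) r by blast
    have "pder (ss c) r = pscale (\<beta> r) r" using eig[OF E SE] by (simp add: \<beta>_def e inv_f_f[OF inj])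
    from P.shift_funpow_eigen[OF linop_pder linop_pder pder_comm[OF bracket_ss_nilpotent_part] pder_split this]
    show ?thesis using pder_nilpotent[OF ss_nilpotent[of c], of r] by simp
  qed
  \<comment> \<open>Two different representatives share an eigenvalue, so c has fewer than card K of
    them.\<close>
  have "\<beta> (?g a) = \<beta> (?g b)"
    unfolding \<beta>_def inv_f_f[OF inj] E_def by (rule w[OF sc ss_diagonalizable])
  then have "\<not> inj_on \<beta> K" using K(1) ab by (auto simp: inj_on_def)
  then have "card (\<beta> ` K) \<noteq> card K" using eq_card_imp_inj_on[OF fin(1)] by blast
  then have less: "card (\<beta> ` K) < card K'" using card_image_le[OF fin(1), of \<beta>] card by linarith
  show False
  proof (rule P.hankel_singular[OF K'(3) linop_pder stc pder_stable_pdeg_le K(3) gen less])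
    fix h assume h: "\<exists>j<card K'. h j \<noteq> 0"
      "\<And>i. (\<Sum>j<card K'. h j * P.frame_trace K' l' (pder c ^^ (i + j))) = 0"
    have "\<forall>j<card K'. h j = 0" 
      by (rule q(2)[THEN spec, THEN spec, THEN mp, OF t(3), THEN mp]) (simp add: tr h(2))
    then show False using h(1) by blast
  qed
qed

section \<open>Termination of the random choice and correctness of every output\<close>

section \<open>Correctness\<close>

text \<open>Primeness is carried over by a ring automorphism. Binomiality is proved for the
  transformed homogenization, where weights see the degree, and is then dehomogenized.\<close>

lemma prime_binomial_after_computed:
  fixes I :: "'n::finite cpoly set"
  defines "L \<equiv> affine_lie_algebra I"
  assumes I: "is_ideal I" and x: "x \<in> L" and C: "C = ad_kernel L x" "cartan_subalgebra C L"
    and S: "S \<in> affine_group" "\<And>A. A \<in> C \<Longrightarrow> diagonalizable A \<Longrightarrow> diagonal_matrix (S ** A ** matrix_inv S)"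
    and S': "S' \<in> affine_group" "prime_binomial_after I S'"
  shows "prime_binomial_after I S"
proof -
  let ?J = "homogenized_ideal I"
  let ?K = "psub (matrix_inv S) ` ?J" and ?K' = "psub (matrix_inv S') ` ?J"
  have act: "affine_act R ` I = affine_hom R ` I" if "R \<in> affine_group" for R
    using affine_act_eq[OF that] by simp
  have S1: "invertible S" and S1': "invertible S'" "S' \<in> row_fixing" "matrix_inv S' \<in> row_fixing"
    using S(1) S'(1) affine_group_inverse(1)[OF S'(1)] by (simp_all add: affine_group_iff)
  note iJ = is_ideal_homogenized[of I]
  note sJ = is_ideal_subspace[OF iJ]
  have LJ: "L = stab_lie ?J \<inter> row_fixing" unfolding L_def by (rule affine_lie_algebra_eq)
  have pI: "primeideal (affine_hom S' ` I) cpoly_ring" and bin: "binomial_ideal (affine_hom S' ` I)"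
    using S'(2) unfolding prime_binomial_after_def act[OF S'(1)] by auto
  interpret prime_cpoly "affine_hom S' ` I"
  proof
    show iI: "is_ideal (affine_hom S' ` I)" using pI by (simp add: primeideal_cpoly_ring)
    show "1 \<notin> affine_hom S' ` I"
    proof
      assume "1 \<in> affine_hom S' ` I"
      then have "h \<in> affine_hom S' ` I" for h using is_idealD(3)[OF iI, of 1 h] by simp
      then show False using pI by (auto simp: primeideal_cpoly_ring)
    qed
    show "f * g \<in> affine_hom S' ` I \<Longrightarrow> f \<in> affine_hom S' ` I \<or> g \<in> affine_hom S' ` I" for f g
      using pI by (simp add: primeideal_cpoly_ring)
  qed
  have dh: "dehomogenize (psub S' F) = affine_hom (matrix_inv S') (dehomogenize F)" for F
    using dehomogenize_psub[OF affine_group_inverse(1)[OF S'(1)], of F] by (simp add: affine_group_inverse(2)[OF S'(1)])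
  have one: "\<exists>\<nu>. pmon b - pscale \<nu> (pmon a) \<in> ?K'"
    if "\<And>D. diagonal_matrix D \<Longrightarrow> D \<in> stab_lie ?K' \<Longrightarrow> weight D a = weight D b" for a b
  proof (rule weight_spaces_one_dimensional[OF bin])
    show "P.subspace ?K'" by (rule is_ideal_subspace[OF is_ideal_psub_image[OF S1'(1) iJ]])
    show "mat 1 \<in> stab_lie ?K'"
      using stable_psub_image_pder[OF S1'(1), of "mat 1" "mat 1"] homogenized_euler by simp
    show "F \<in> ?K'" if F: "homogeneous d F" "dehomogenize F \<in> affine_hom S' ` I" for F d
      unfolding psub_image_mem[OF S1'(1)]
      by (rule homogenized_homogeneous[OF homogeneous_psub[OF F(1)]])
        (use F(2) in \<open>simp add: dh flip: affine_image_mem[OF S'(1)]\<close>)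
    show "dehomogenize F \<in> affine_hom S' ` I" if "F \<in> ?K'" for F
      unfolding affine_image_mem[OF S'(1)] dh[symmetric]
      by (rule dehomogenize_homogenized[OF I]) (use that in \<open>simp add: psub_image_mem[OF S1'(1)]\<close>)
  qed (rule that)
  let ?T = "{S ** A ** matrix_inv S | A. A \<in> C \<and> diagonalizable A}"
  have iK: "is_ideal ?K" by (rule is_ideal_psub_image[OF S1 iJ])
  have TD: "D \<in> ?T \<Longrightarrow> diagonal_matrix D" for D using S(2) by blast
  have "?T \<subseteq> stab_lie ?K"
  proof
    fix D assume "D \<in> ?T"
    then obtain A where A: "D = S ** A ** matrix_inv S" "A \<in> C" by blast
    have "D ** S = S ** A" by (simp add: A(1) matrix_mul_assoc[symmetric] matrix_inv_cmatrix(2)[OF S1])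
    moreover have "A \<in> stab_lie ?J"
      using A(2) C(2) LJ by (auto simp: cartan_subalgebra_def lie_subalgebra_def)
    ultimately show "D \<in> stab_lie ?K" using stable_psub_image_pder[OF S1] by blast
  qed
  moreover have "pmon a \<in> ?K \<or> (\<exists>\<nu>. pmon b - pscale \<nu> (pmon a) \<in> ?K)"
    if "\<And>D. D \<in> ?T \<Longrightarrow> weight D a = weight D b" for a b
    by (rule torus_weight_spaces[OF sJ LJ x C S1 S(2) S1' one]) (use that in blast)+
  ultimately have "F \<in> P.span (binomials \<inter> ?K)" if "F \<in> ?K" for F
    using weight_multiplicity_free_binomial[OF iK TD] that by blast
  then have "binomial_ideal (dehomogenize ` ?K)" by (rule binomial_ideal_dehomogenize[OF iK])
  moreover have "dehomogenize ` ?K = affine_hom S ` I"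
  proof -
    have "dehomogenize ` ?J = I"
    proof
      show "dehomogenize ` ?J \<subseteq> I" using dehomogenize_homogenized[OF I] by blast
      show "I \<subseteq> dehomogenize ` ?J"
      proof
        fix f assume "f \<in> I"
        then have "homogenize f \<in> ?J" unfolding homogenized_ideal_def using genideal_subset by blast
        then show "f \<in> dehomogenize ` ?J" using dehomogenize_homogenize[of f] by (metis imageI)
      qed
    qed
    then show ?thesis using dehomogenize_psub[OF S(1)] by (metis (no_types, lifting) image_cong image_image)
  qed
  ultimately show ?thesis
    unfolding prime_binomial_after_def act[OF S(1)] using prime_affine_image[OF S(1) S'(1) pI] by simp
qed

text \<open>Almost surely the very first draw succeeds, because failures lie in the zero set of one
  polynomial that does not vanish on L. The loop index is then the least successful k.\<close>

lemma AE_loop_ends: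
  fixes I :: "'n::finite cpoly set"
  assumes D: "generic_distribution (affine_lie_algebra I) D"
  shows "AE xs in Pi\<^sub>M UNIV (\<lambda>_. D). \<exists>k. loop_ends_at I xs k"
proof -
  let ?L = "affine_lie_algebra I"
  let ?Q = "\<lambda>x. cartan_subalgebra (ad_kernel ?L x) ?L"
  have "lie_algebra ?L" using affine_lie_subalgebra[of I] by (simp add: lie_subalgebra_def)
  from generic_cartan[OF this] obtain p x0 where p: "x0 \<in> ?L" "mat_eval p x0 \<noteq> 0"
    "\<And>x. x \<in> ?L \<Longrightarrow> mat_eval p x \<noteq> 0 \<Longrightarrow> ?Q x" by metis
  let ?Z = "{A \<in> ?L. \<forall>p\<in>{p}. mat_eval p A = 0}"
  have "zariski_closed_in ?L ?Z" unfolding zariski_closed_in_def by blast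
  moreover have "?Z \<noteq> ?L" using p(1,2) by blast
  ultimately have "?Z \<in> null_sets D" using D unfolding generic_distribution_def by blast
  then have "AE x in D. x \<notin> ?Z" by (rule AE_not_in)
  moreover have "AE x in D. x \<in> ?L" using D AE_space[of D] by (simp add: generic_distribution_def)
  ultimately have "AE x in D. ?Q x" by eventually_elim (use p(3) in auto)
  then have "AE xs in Pi\<^sub>M UNIV (\<lambda>_. D). ?Q (xs (0::nat))"
    using D by (intro AE_PiM_component[where M = "\<lambda>_. D"]) (auto simp: generic_distribution_def)
  then show ?thesis
  proof eventually_elim
    fix xs assume "?Q (xs (0::nat))"
    then have "loop_ends_at I xs (LEAST k. ?Q (xs k))"
      unfolding loop_ends_at_def Let_def by (intro conjI allI impI) (rule LeastI, assumption, rule not_less_Least)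
    then show "\<exists>k. loop_ends_at I xs k" by blast
  qed
qed

theorem mainTheorem2:
  fixes I :: "'n::finite cpoly set"
  assumes "ideal I cpoly_ring"
  shows "lie_subalgebra (affine_lie_algebra I) (full_lie_algebra I) \<and>
    (\<forall>D. generic_distribution (affine_lie_algebra I) D \<longrightarrow>
      (AE xs in Pi\<^sub>M UNIV (\<lambda>_. D). \<exists>k. loop_ends_at I xs k)) \<and>
    (\<forall>xs k. range xs \<subseteq> affine_lie_algebra I \<and> loop_ends_at I xs k \<longrightarrow>
      (let C = ad_kernel (affine_lie_algebra I) (xs k) in
        (\<exists>r. can_output I C r) \<and> (\<forall>r. can_output I C r \<longrightarrow> correct_output I r)))"
proof -
  have I: "is_ideal I" using assms by (simp add: ideal_cpoly_ring)
  have out: "(\<exists>r. can_output I C r) \<and> (\<forall>r. can_output I C r \<longrightarrow> correct_output I r)"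
    if x: "x \<in> affine_lie_algebra I" and C: "C = ad_kernel (affine_lie_algebra I) x"
      "cartan_subalgebra C (affine_lie_algebra I)" for x C
  proof (intro conjI allI impI)
    show "\<exists>r. can_output I C r" by (rule output_exists[OF C(2)])
    fix r assume "can_output I C r"
    then obtain S where S: "S \<in> affine_group"
      "\<And>A. A \<in> C \<Longrightarrow> diagonalizable A \<Longrightarrow> diagonal_matrix (S ** A ** matrix_inv S)"
      "r = (if prime_binomial_after I S then Some S else None)"
      unfolding can_output_def by blast
    have "prime_binomial_after I S" if "S' \<in> affine_group" "prime_binomial_after I S'" for S'
      by (rule prime_binomial_after_computed[OF I x C S(1,2) that])
    then show "correct_output I r" unfolding correct_output_def S(3) using S(1) by (cases "prime_binomial_after I S") auto
  qed
  show ?thesis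
    unfolding Let_def
  proof (intro conjI[OF affine_lie_subalgebra] conjI[OF allI[OF impI[OF AE_loop_ends]]] allI impI)
    fix xs k assume xs: "range xs \<subseteq> affine_lie_algebra I \<and> loop_ends_at I xs k"
    show "(\<exists>r. can_output I (ad_kernel (affine_lie_algebra I) (xs k)) r) \<and>
      (\<forall>r. can_output I (ad_kernel (affine_lie_algebra I) (xs k)) r \<longrightarrow> correct_output I r)"
      by (rule out[OF _ refl]) (use xs in \<open>auto simp: loop_ends_at_def Let_def\<close>)
  qed
qed

end
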